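(* Let $(W,S)$ be a finite Coxeter group with $S=\{s_1,\dots,s_n\}$ (completely ordered), let $\Phi$ be a $W$-gluing data for abelian categories $(\mathcal{C}_w)_{w\in W}$, fix $s_i\in S$ and let $P_i=\{w\in W:\ell(ws_i)>\ell(w)\}$. For every object $A\in\mathcal{C}(\Phi_{P_i})$ the complex $C_{\cdot}(P_i,A)$ satisfies $H_0(C_{\cdot}(P_i,A))\simeq A$ and $H_j(C_{\cdot}(P_i,A))=0$ for $j\neq0$.
   Context: A $W$-gluing data $\Phi$ consists of right-exact functors $\Phi_w:\mathcal{C}_{w'}\to\mathcal{C}_{ww'}$ for all $w,w'\in W$ (same symbol for all $w'$), with $\Phi_1=\mathrm{Id}$, and morphisms of functors $\nu_{w,w'}:\Phi_w\Phi_{w'}\to\Phi_{ww'}$ (on each $\mathcal{C}_{w''}$) with $\nu_{1,w}=\nu_{w,1}=\mathrm{id}$, satisfying associativity $\nu_{ww',w''}\circ(\nu_{w,w'}\Phi_{w''})=\nu_{w,w'w''}\circ(\Phi_w\nu_{w',w''})$, and such that $\nu_{w,w'}$ is an isomorphism whenever $\ell(ww')=\ell(w)+\ell(w')$. For $P\subset W$, $\mathcal{C}(\Phi_P)$ is the abelian category of collections $(A_w,w\in P;\alpha_{w,w'})$ with $A_w\in\mathcal{C}_w$ and morphisms $\alpha_{w,w'}:\Phi_wA_{w'}\to A_{ww'}$ for $w',ww'\in P$, with $\alpha_{1,w'}=\mathrm{id}$ and $\alpha_{w_1,w_2w'}\circ\Phi_{w_1}(\alpha_{w_2,w'})=\alpha_{w_1w_2,w'}\circ\nu_{w_1,w_2}$;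 morphisms are componentwise and compatible with $\alpha$. For $J\subset S$ let $W_J$ be the subgroup generated by $J$. For $W_Jx\subset P\subset W$ the restriction functor $j^*_{W_Jx,P}:\mathcal{C}(\Phi_P)\to\mathcal{C}(\Phi_{W_Jx})$ has a left adjoint $j_{W_Jx,P;!}$; its $w$-component ($w\in P$) is $\Phi_{n(w)}A_{p(w)}$, where $p(w)\in W_Jx$ is the element for which $n(w)=wp(w)^{-1}$ has minimal length. For $J\subset K$ with $W_Kx\subset P$ there are canonical (adjunction) morphisms $j_{W_Jx,P;!}j^*_{W_Jx,P}\to j_{W_Kx,P;!}j^*_{W_Kx,P}$. The complex: identify $S$ with $[1,n]$ and put $W^{(j)}=W_{[1,n]-\{j\}}$. For nonempty $J\subset[1,n]$ let $A(J)=\bigoplus j_{W_{S-J}x,P_i;!}\,j^*_{W_{S-J}x,P_i}A$, the sum over all cosets $W_{S-J}x\in W_{S-J}\backslash W$ such that $W^{(j)}x\subset P_i$ for every $j\in J$. For $J\subset J'$ the canonical morphisms give $A(J')\to A(J)$; this is a homological coefficient system on the $(n-1)$-simplex, and $C_{\cdot}(P_i,A)$ is its chain complex (with the usual simplicial signs): $C_m=\bigoplus_{|J|=m+1}A(J)$, $0\le m\le n-1$. *)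

theory Defs
  imports "HOL-Algebra.Generated_Groups" "HOL-Algebra.FiniteProduct"
begin

section \<open>Coxeter systems\<close>

definition word_val :: "('w, 'z) monoid_scheme \<Rightarrow> 'w list \<Rightarrow> 'w" where
  "word_val W xs = foldr (\<lambda>x y. x \<otimes>\<^bsub>W\<^esub> y) xs \<one>\<^bsub>W\<^esub>"

text \<open>The entry \<open>0\<close> stands for \<open>\<infinity>\<close>, i.e. for the absence of a relation.\<close>

definition coxeter_matrix :: "'w set \<Rightarrow> ('w \<Rightarrow> 'w \<Rightarrow> nat) \<Rightarrow> bool" where
  "coxeter_matrix S m \<longleftrightarrow>
     (\<forall>s\<in>S. m s s = 1) \<and>
     (\<forall>s\<in>S. \<forall>t\<in>S. m s t = m t s) \<and>
     (\<forall>s\<in>S. \<forall>t\<in>S. s \<noteq> t \<longrightarrow> m s t \<noteq> 1)"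

text \<open>The congruence on words generated by the relations \<open>(s t)\<^bsup>m s t\<^esup> = 1\<close>. As \<open>m s s = 1\<close> makes every
  generator an involution, words without formal inverses suffice to present the group.\<close>

inductive coxeter_equiv :: "'w set \<Rightarrow> ('w \<Rightarrow> 'w \<Rightarrow> nat) \<Rightarrow> 'w list \<Rightarrow> 'w list \<Rightarrow> bool"
  for S m where
  relation: "\<lbrakk>s \<in> S; t \<in> S; u \<in> lists S; v \<in> lists S\<rbrakk>
      \<Longrightarrow> coxeter_equiv S m (u @ concat (replicate (m s t) [s, t]) @ v) (u @ v)"
| refl: "u \<in> lists S \<Longrightarrow> coxeter_equiv S m u u"
| sym: "coxeter_equiv S m u v \<Longrightarrow> coxeter_equiv S m v u"
| trans: "\<lbrakk>coxeter_equiv S m u v; coxeter_equiv S m v w\<rbrakk> \<Longrightarrow> coxeter_equiv S m u w"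

definition coxeter_system :: "('w, 'z) monoid_scheme \<Rightarrow> 'w set \<Rightarrow> bool" where
  "coxeter_system W S \<longleftrightarrow>
     group W \<and> S \<subseteq> carrier W \<and> generate W S = carrier W \<and>
     (\<exists>m. coxeter_matrix S m \<and>
        (\<forall>xs\<in>lists S. \<forall>ys\<in>lists S. word_val W xs = word_val W ys \<longleftrightarrow> coxeter_equiv S m xs ys))"

definition cox_length :: "('w, 'z) monoid_scheme \<Rightarrow> 'w set \<Rightarrow> 'w \<Rightarrow> nat" where
  "cox_length W S w = (LEAST k. \<exists>xs\<in>lists S. length xs = k \<and> word_val W xs = w)"


section \<open>Preadditive and abelian categories\<close>

text \<open>Hom sets of different pairs of objects need not be disjoint. Preadditive structure is part of
  the data.\<close>

record ('o, 'm) acat =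
  Obj :: "'o set"
  Hom :: "'o \<Rightarrow> 'o \<Rightarrow> 'm set"
  Ident :: "'o \<Rightarrow> 'm"
  Cmp :: "'m \<Rightarrow> 'm \<Rightarrow> 'm"  (* Cmp C g f is g after f *)
  Zero_hom :: "'o \<Rightarrow> 'o \<Rightarrow> 'm"
  Plus_hom :: "'m \<Rightarrow> 'm \<Rightarrow> 'm"

definition hom_group :: "('o, 'm) acat \<Rightarrow> 'o \<Rightarrow> 'o \<Rightarrow> 'm monoid" where
  "hom_group C a b = \<lparr>carrier = Hom C a b, monoid.mult = Plus_hom C, one = Zero_hom C a b\<rparr>"

definition hom_sum :: "('o, 'm) acat \<Rightarrow> 'o \<Rightarrow> 'o \<Rightarrow> ('i \<Rightarrow> 'm) \<Rightarrow> 'i set \<Rightarrow> 'm" where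
  "hom_sum C a b f I = finprod (hom_group C a b) f I"

definition hom_neg :: "('o, 'm) acat \<Rightarrow> 'o \<Rightarrow> 'o \<Rightarrow> 'm \<Rightarrow> 'm" where
  "hom_neg C a b f = inv\<^bsub>hom_group C a b\<^esub> f"

locale preadditive_category =
  fixes C :: "('o, 'm) acat"
  assumes ident_hom: "a \<in> Obj C \<Longrightarrow> Ident C a \<in> Hom C a a"
    and cmp_hom: "\<lbrakk>a \<in> Obj C; b \<in> Obj C; c \<in> Obj C; f \<in> Hom C a b; g \<in> Hom C b c\<rbrakk>
        \<Longrightarrow> Cmp C g f \<in> Hom C a c"
    and cmp_ident_right: "\<lbrakk>a \<in> Obj C; b \<in> Obj C; f \<in> Hom C a b\<rbrakk> \<Longrightarrow> Cmp C f (Ident C a) = f"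
    and cmp_ident_left: "\<lbrakk>a \<in> Obj C; b \<in> Obj C; f \<in> Hom C a b\<rbrakk> \<Longrightarrow> Cmp C (Ident C b) f = f"
    and cmp_assoc: "\<lbrakk>a \<in> Obj C; b \<in> Obj C; c \<in> Obj C; d \<in> Obj C;
        f \<in> Hom C a b; g \<in> Hom C b c; h \<in> Hom C c d\<rbrakk>
        \<Longrightarrow> Cmp C (Cmp C h g) f = Cmp C h (Cmp C g f)"
    and hom_abelian: "\<lbrakk>a \<in> Obj C; b \<in> Obj C\<rbrakk> \<Longrightarrow> comm_group (hom_group C a b)"
    and cmp_plus_right: "\<lbrakk>a \<in> Obj C; b \<in> Obj C; c \<in> Obj C;
        f \<in> Hom C a b; f' \<in> Hom C a b; g \<in> Hom C b c\<rbrakk>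
        \<Longrightarrow> Cmp C g (Plus_hom C f f') = Plus_hom C (Cmp C g f) (Cmp C g f')"
    and cmp_plus_left: "\<lbrakk>a \<in> Obj C; b \<in> Obj C; c \<in> Obj C;
        f \<in> Hom C a b; g \<in> Hom C b c; g' \<in> Hom C b c\<rbrakk>
        \<Longrightarrow> Cmp C (Plus_hom C g g') f = Plus_hom C (Cmp C g f) (Cmp C g' f)"

definition is_zero_object :: "('o, 'm) acat \<Rightarrow> 'o \<Rightarrow> bool" where
  "is_zero_object C z \<longleftrightarrow> z \<in> Obj C \<and>
     (\<forall>a\<in>Obj C. (\<exists>!f. f \<in> Hom C a z) \<and> (\<exists>!f. f \<in> Hom C z a))"

definition inverse_homs :: "('o, 'm) acat \<Rightarrow> 'o \<Rightarrow> 'o \<Rightarrow> 'm \<Rightarrow> 'm \<Rightarrow> bool" where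
  "inverse_homs C a b f g \<longleftrightarrow> f \<in> Hom C a b \<and> g \<in> Hom C b a \<and>
     Cmp C g f = Ident C a \<and> Cmp C f g = Ident C b"

definition is_iso :: "('o, 'm) acat \<Rightarrow> 'o \<Rightarrow> 'o \<Rightarrow> 'm \<Rightarrow> bool" where
  "is_iso C a b f \<longleftrightarrow> (\<exists>g. inverse_homs C a b f g)"

definition isomorphic :: "('o, 'm) acat \<Rightarrow> 'o \<Rightarrow> 'o \<Rightarrow> bool" where
  "isomorphic C a b \<longleftrightarrow> a \<in> Obj C \<and> b \<in> Obj C \<and> (\<exists>f. is_iso C a b f)"

definition is_mono :: "('o, 'm) acat \<Rightarrow> 'o \<Rightarrow> 'o \<Rightarrow> 'm \<Rightarrow> bool" where
  "is_mono C a b f \<longleftrightarrow> f \<in> Hom C a b \<and>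
     (\<forall>c\<in>Obj C. \<forall>g\<in>Hom C c a. \<forall>h\<in>Hom C c a. Cmp C f g = Cmp C f h \<longrightarrow> g = h)"

definition is_epi :: "('o, 'm) acat \<Rightarrow> 'o \<Rightarrow> 'o \<Rightarrow> 'm \<Rightarrow> bool" where
  "is_epi C a b f \<longleftrightarrow> f \<in> Hom C a b \<and>
     (\<forall>c\<in>Obj C. \<forall>g\<in>Hom C b c. \<forall>h\<in>Hom C b c. Cmp C g f = Cmp C h f \<longrightarrow> g = h)"

definition is_kernel :: "('o, 'm) acat \<Rightarrow> 'o \<Rightarrow> 'o \<Rightarrow> 'm \<Rightarrow> 'o \<Rightarrow> 'm \<Rightarrow> bool" where
  "is_kernel C a b f K k \<longleftrightarrow> K \<in> Obj C \<and> k \<in> Hom C K a \<and> Cmp C f k = Zero_hom C K b \<and>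
     (\<forall>X\<in>Obj C. \<forall>g\<in>Hom C X a. Cmp C f g = Zero_hom C X b \<longrightarrow>
        (\<exists>!h. h \<in> Hom C X K \<and> Cmp C k h = g))"

definition is_cokernel :: "('o, 'm) acat \<Rightarrow> 'o \<Rightarrow> 'o \<Rightarrow> 'm \<Rightarrow> 'o \<Rightarrow> 'm \<Rightarrow> bool" where
  "is_cokernel C a b f Q q \<longleftrightarrow> Q \<in> Obj C \<and> q \<in> Hom C b Q \<and> Cmp C q f = Zero_hom C a Q \<and>
     (\<forall>X\<in>Obj C. \<forall>g\<in>Hom C b X. Cmp C g f = Zero_hom C a X \<longrightarrow>
        (\<exists>!h. h \<in> Hom C Q X \<and> Cmp C h q = g))"

definition is_coproduct ::
  "('o, 'm) acat \<Rightarrow> 'i set \<Rightarrow> ('i \<Rightarrow> 'o) \<Rightarrow> 'o \<Rightarrow> ('i \<Rightarrow> 'm) \<Rightarrow> bool" where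
  "is_coproduct C I X U \<iota> \<longleftrightarrow> U \<in> Obj C \<and> (\<forall>i\<in>I. \<iota> i \<in> Hom C (X i) U) \<and>
     (\<forall>Y\<in>Obj C. \<forall>f. (\<forall>i\<in>I. f i \<in> Hom C (X i) Y) \<longrightarrow>
        (\<exists>!h. h \<in> Hom C U Y \<and> (\<forall>i\<in>I. Cmp C h (\<iota> i) = f i)))"

text \<open>In a preadditive category binary coproducts are automatically biproducts.\<close>

locale abelian_category = preadditive_category +
  assumes zero_object: "\<exists>z. is_zero_object C z"
    and binary_sums: "\<lbrakk>a \<in> Obj C; b \<in> Obj C\<rbrakk>
        \<Longrightarrow> \<exists>U \<iota>. is_coproduct C (UNIV :: bool set) (\<lambda>t. if t then a else b) U \<iota>"
    and kernels: "\<lbrakk>a \<in> Obj C; b \<in> Obj C; f \<in> Hom C a b\<rbrakk> \<Longrightarrow> \<exists>K k. is_kernel C a b f K k"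
    and cokernels: "\<lbrakk>a \<in> Obj C; b \<in> Obj C; f \<in> Hom C a b\<rbrakk> \<Longrightarrow> \<exists>Q q. is_cokernel C a b f Q q"
    and mono_normal: "\<lbrakk>a \<in> Obj C; b \<in> Obj C; is_mono C a b f\<rbrakk>
        \<Longrightarrow> \<exists>c\<in>Obj C. \<exists>g\<in>Hom C b c. is_kernel C b c g a f"
    and epi_normal: "\<lbrakk>a \<in> Obj C; b \<in> Obj C; is_epi C a b f\<rbrakk>
        \<Longrightarrow> \<exists>c\<in>Obj C. \<exists>g\<in>Hom C c a. is_cokernel C c a g b f"

text \<open>Direct sums are chosen together with their injections; \<open>copair\<close> is the morphism out of the
  chosen direct sum with prescribed restrictions to the summands.\<close>

definition dsum :: "('o, 'm) acat \<Rightarrow> 'i set \<Rightarrow> ('i \<Rightarrow> 'o) \<Rightarrow> 'o \<times> ('i \<Rightarrow> 'm)" where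
  "dsum C I X = (SOME (U, \<iota>). is_coproduct C I X U \<iota>)"

definition dsum_obj :: "('o, 'm) acat \<Rightarrow> 'i set \<Rightarrow> ('i \<Rightarrow> 'o) \<Rightarrow> 'o" where
  "dsum_obj C I X = fst (dsum C I X)"

definition dsum_inj :: "('o, 'm) acat \<Rightarrow> 'i set \<Rightarrow> ('i \<Rightarrow> 'o) \<Rightarrow> 'i \<Rightarrow> 'm" where
  "dsum_inj C I X = snd (dsum C I X)"

definition copair ::
  "('o, 'm) acat \<Rightarrow> 'i set \<Rightarrow> ('i \<Rightarrow> 'o) \<Rightarrow> 'o \<Rightarrow> ('i \<Rightarrow> 'm) \<Rightarrow> 'm" where
  "copair C I X Y f =
     (THE h. h \<in> Hom C (dsum_obj C I X) Y \<and> (\<forall>i\<in>I. Cmp C h (dsum_inj C I X i) = f i))"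


section \<open>Functors, natural transformations and adjoints\<close>

record ('o, 'm, 'p, 'q) funct =
  fobj :: "'o \<Rightarrow> 'p"
  fmap :: "'m \<Rightarrow> 'q"

definition funct_id :: "('o, 'm, 'o, 'm) funct" where
  "funct_id = \<lparr>fobj = (\<lambda>a. a), fmap = (\<lambda>f. f)\<rparr>"

definition funct_comp ::
  "('p, 'q, 'r, 's) funct \<Rightarrow> ('o, 'm, 'p, 'q) funct \<Rightarrow> ('o, 'm, 'r, 's) funct" where
  "funct_comp G F = \<lparr>fobj = (\<lambda>a. fobj G (fobj F a)), fmap = (\<lambda>f. fmap G (fmap F f))\<rparr>"

definition is_functor ::
  "('o, 'm) acat \<Rightarrow> ('p, 'q) acat \<Rightarrow> ('o, 'm, 'p, 'q) funct \<Rightarrow> bool" where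
  "is_functor C D F \<longleftrightarrow>
     (\<forall>a\<in>Obj C. fobj F a \<in> Obj D) \<and>
     (\<forall>a\<in>Obj C. \<forall>b\<in>Obj C. \<forall>f\<in>Hom C a b. fmap F f \<in> Hom D (fobj F a) (fobj F b)) \<and>
     (\<forall>a\<in>Obj C. fmap F (Ident C a) = Ident D (fobj F a)) \<and>
     (\<forall>a\<in>Obj C. \<forall>b\<in>Obj C. \<forall>c\<in>Obj C. \<forall>f\<in>Hom C a b. \<forall>g\<in>Hom C b c.
        fmap F (Cmp C g f) = Cmp D (fmap F g) (fmap F f))"

definition is_additive_functor ::
  "('o, 'm) acat \<Rightarrow> ('p, 'q) acat \<Rightarrow> ('o, 'm, 'p, 'q) funct \<Rightarrow> bool" where
  "is_additive_functor C D F \<longleftrightarrow> is_functor C D F \<and>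
     (\<forall>a\<in>Obj C. \<forall>b\<in>Obj C. \<forall>f\<in>Hom C a b. \<forall>g\<in>Hom C a b.
        fmap F (Plus_hom C f g) = Plus_hom D (fmap F f) (fmap F g))"

definition is_right_exact ::
  "('o, 'm) acat \<Rightarrow> ('p, 'q) acat \<Rightarrow> ('o, 'm, 'p, 'q) funct \<Rightarrow> bool" where
  "is_right_exact C D F \<longleftrightarrow> is_additive_functor C D F \<and>
     (\<forall>a\<in>Obj C. \<forall>b\<in>Obj C. \<forall>f\<in>Hom C a b. \<forall>Q q.
        is_cokernel C a b f Q q \<longrightarrow>
        is_cokernel D (fobj F a) (fobj F b) (fmap F f) (fobj F Q) (fmap F q))"

definition is_nat_trans ::
  "('o, 'm) acat \<Rightarrow> ('p, 'q) acat \<Rightarrow> ('o, 'm, 'p, 'q) funct \<Rightarrow> ('o, 'm, 'p, 'q) funct \<Rightarrow>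
   ('o \<Rightarrow> 'q) \<Rightarrow> bool" where
  "is_nat_trans C D F G \<tau> \<longleftrightarrow>
     (\<forall>a\<in>Obj C. \<tau> a \<in> Hom D (fobj F a) (fobj G a)) \<and>
     (\<forall>a\<in>Obj C. \<forall>b\<in>Obj C. \<forall>f\<in>Hom C a b. Cmp D (\<tau> b) (fmap F f) = Cmp D (fmap G f) (\<tau> a))"

text \<open>\<open>L : D \<rightarrow> C\<close> is left adjoint to \<open>R : C \<rightarrow> D\<close> with unit \<open>\<eta>\<close>.\<close>

definition is_left_adjoint ::
  "('o, 'm) acat \<Rightarrow> ('p, 'q) acat \<Rightarrow> ('o, 'm, 'p, 'q) funct \<Rightarrow>
   ('p, 'q, 'o, 'm) funct \<Rightarrow> ('p \<Rightarrow> 'q) \<Rightarrow> bool" where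
  "is_left_adjoint C D R L \<eta> \<longleftrightarrow>
     is_functor D C L \<and> is_nat_trans D D funct_id (funct_comp R L) \<eta> \<and>
     (\<forall>b\<in>Obj D. \<forall>a\<in>Obj C. \<forall>g\<in>Hom D b (fobj R a).
        \<exists>!f. f \<in> Hom C (fobj L b) a \<and> Cmp D (fmap R f) (\<eta> b) = g)"


section \<open>Complexes, homology and coefficient systems on a simplex\<close>

text \<open>\<open>cdiff X m\<close> is the differential from degree \<open>m\<close> to degree \<open>m - 1\<close>.\<close>

record ('o, 'm) complex_data =
  cobj :: "int \<Rightarrow> 'o"
  cdiff :: "int \<Rightarrow> 'm"

text \<open>For \<open>f : a \<rightarrow> b\<close> and \<open>g : b \<rightarrow> c\<close>, the homology at \<open>b\<close> is the cokernel of the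
  morphism from \<open>a\<close> to the kernel of \<open>g\<close> induced by \<open>f\<close>. Such a morphism exists only if \<open>g\<close> after
  \<open>f\<close> is zero.\<close>

definition is_homology :: "('o, 'm) acat \<Rightarrow> 'o \<Rightarrow> 'o \<Rightarrow> 'o \<Rightarrow> 'm \<Rightarrow> 'm \<Rightarrow> 'o \<Rightarrow> bool" where
  "is_homology C a b c f g H \<longleftrightarrow>
     (\<exists>K k f' q. is_kernel C b c g K k \<and> f' \<in> Hom C a K \<and> Cmp C k f' = f \<and>
        is_cokernel C a K f' H q)"

definition homology :: "('o, 'm) acat \<Rightarrow> ('o, 'm) complex_data \<Rightarrow> int \<Rightarrow> 'o" where
  "homology C X m =
     (SOME H. is_homology C (cobj X (m + 1)) (cobj X m) (cobj X (m - 1))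
                (cdiff X (m + 1)) (cdiff X m) H)"

definition faces :: "nat set \<Rightarrow> int \<Rightarrow> nat set set" where
  "faces V m = {J. J \<subseteq> V \<and> J \<noteq> {} \<and> int (card J) = m + 1}"

text \<open>The chain complex of a homological coefficient system on the simplex with ordered vertex set
  \<open>V\<close>: \<open>F J\<close> is the object at the face \<open>J\<close> and \<open>r J' J : F J' \<rightarrow> F J\<close> the map for
  \<open>J \<subseteq> J'\<close>. It is zero in degrees outside \<open>0, ..., card V - 1\<close>, as there are no such faces.\<close>

definition simplex_obj ::
  "('o, 'm) acat \<Rightarrow> nat set \<Rightarrow> (nat set \<Rightarrow> 'o) \<Rightarrow> int \<Rightarrow> 'o" where
  "simplex_obj C V F m = dsum_obj C (faces V m) F"

definition signed_hom :: "('o, 'm) acat \<Rightarrow> 'o \<Rightarrow> 'o \<Rightarrow> nat \<Rightarrow> 'm \<Rightarrow> 'm" where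
  "signed_hom C a b k f = (if even k then f else hom_neg C a b f)"

definition simplex_diff ::
  "('o, 'm) acat \<Rightarrow> nat set \<Rightarrow> (nat set \<Rightarrow> 'o) \<Rightarrow> (nat set \<Rightarrow> nat set \<Rightarrow> 'm) \<Rightarrow> int \<Rightarrow> 'm" where
  "simplex_diff C V F r m =
     copair C (faces V m) F (simplex_obj C V F (m - 1))
       (\<lambda>J. hom_sum C (F J) (simplex_obj C V F (m - 1))
          (\<lambda>j. signed_hom C (F J) (simplex_obj C V F (m - 1)) (card {i \<in> J. i < j})
             (Cmp C (dsum_inj C (faces V (m - 1)) F (J - {j})) (r J (J - {j}))))
          {j \<in> J. J - {j} \<noteq> {}})"

definition simplex_complex ::
  "('o, 'm) acat \<Rightarrow> nat set \<Rightarrow> (nat set \<Rightarrow> 'o) \<Rightarrow> (nat set \<Rightarrow> nat set \<Rightarrow> 'm) \<Rightarrow>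
   ('o, 'm) complex_data" where
  "simplex_complex C V F r = \<lparr>cobj = simplex_obj C V F, cdiff = simplex_diff C V F r\<rparr>"


section \<open>Gluing data\<close>

text \<open>\<open>GFun D w w'\<close> is the functor \<open>\<Phi>\<^sub>w\<close> on \<open>GCat D w'\<close>, and \<open>GNat D w w' w'' A\<close> is the component
  of \<open>\<nu>\<close> for \<open>(w, w')\<close> at the object \<open>A\<close> of \<open>GCat D w''\<close>.\<close>

record ('w, 'o, 'm) gluing =
  GCat :: "'w \<Rightarrow> ('o, 'm) acat"
  GFun :: "'w \<Rightarrow> 'w \<Rightarrow> ('o, 'm, 'o, 'm) funct"
  GNat :: "'w \<Rightarrow> 'w \<Rightarrow> 'w \<Rightarrow> 'o \<Rightarrow> 'm"

locale gluing_data =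
  fixes W :: "('w, 'z) monoid_scheme" (structure)
    and S :: "'w set"
    and D :: "('w, 'o, 'm) gluing"
  assumes right_exact: "\<lbrakk>w \<in> carrier W; w' \<in> carrier W\<rbrakk>
      \<Longrightarrow> is_right_exact (GCat D w') (GCat D (w \<otimes> w')) (GFun D w w')"
    and Phi_one_obj: "\<lbrakk>w \<in> carrier W; A \<in> Obj (GCat D w)\<rbrakk> \<Longrightarrow> fobj (GFun D \<one> w) A = A"
    and Phi_one_map: "\<lbrakk>w \<in> carrier W; A \<in> Obj (GCat D w); B \<in> Obj (GCat D w);
        f \<in> Hom (GCat D w) A B\<rbrakk> \<Longrightarrow> fmap (GFun D \<one> w) f = f"
    and nu_natural: "\<lbrakk>w \<in> carrier W; w' \<in> carrier W; w'' \<in> carrier W\<rbrakk>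
      \<Longrightarrow> is_nat_trans (GCat D w'') (GCat D (w \<otimes> w' \<otimes> w''))
            (funct_comp (GFun D w (w' \<otimes> w'')) (GFun D w' w'')) (GFun D (w \<otimes> w') w'')
            (GNat D w w' w'')"
    and nu_one_left: "\<lbrakk>w \<in> carrier W; w'' \<in> carrier W; A \<in> Obj (GCat D w'')\<rbrakk>
      \<Longrightarrow> GNat D \<one> w w'' A = Ident (GCat D (w \<otimes> w'')) (fobj (GFun D w w'') A)"
    and nu_one_right: "\<lbrakk>w \<in> carrier W; w'' \<in> carrier W; A \<in> Obj (GCat D w'')\<rbrakk>
      \<Longrightarrow> GNat D w \<one> w'' A = Ident (GCat D (w \<otimes> w'')) (fobj (GFun D w w'') A)"
    and nu_assoc: "\<lbrakk>w \<in> carrier W; w' \<in> carrier W; w'' \<in> carrier W; v \<in> carrier W;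
        A \<in> Obj (GCat D v)\<rbrakk>
      \<Longrightarrow> Cmp (GCat D (w \<otimes> w' \<otimes> w'' \<otimes> v))
            (GNat D (w \<otimes> w') w'' v A) (GNat D w w' (w'' \<otimes> v) (fobj (GFun D w'' v) A)) =
          Cmp (GCat D (w \<otimes> w' \<otimes> w'' \<otimes> v))
            (GNat D w (w' \<otimes> w'') v A) (fmap (GFun D w (w' \<otimes> w'' \<otimes> v)) (GNat D w' w'' v A))"
    and nu_iso: "\<lbrakk>w \<in> carrier W; w' \<in> carrier W; w'' \<in> carrier W; A \<in> Obj (GCat D w'');
        cox_length W S (w \<otimes> w') = cox_length W S w + cox_length W S w'\<rbrakk>
      \<Longrightarrow> is_iso (GCat D (w \<otimes> w' \<otimes> w''))
            (fobj (GFun D w (w' \<otimes> w'')) (fobj (GFun D w' w'') A)) (fobj (GFun D (w \<otimes> w') w'') A)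
            (GNat D w w' w'' A)"


section \<open>The glued categories\<close>

text \<open>Families indexed by \<open>w \<in> P\<close> (and by the pairs below) are extensional, i.e. \<open>undefined\<close> outside
  their index sets, so that equality of families is equality of their components.\<close>

definition glue_pairs :: "('w, 'z) monoid_scheme \<Rightarrow> 'w set \<Rightarrow> ('w \<times> 'w) set" where
  "glue_pairs W P = {(w, w'). w \<in> carrier W \<and> w' \<in> P \<and> w \<otimes>\<^bsub>W\<^esub> w' \<in> P}"

type_synonym ('w, 'o, 'm) glue_obj = "('w \<Rightarrow> 'o) \<times> ('w \<times> 'w \<Rightarrow> 'm)"

definition is_glue_obj ::
  "('w, 'z) monoid_scheme \<Rightarrow> ('w, 'o, 'm) gluing \<Rightarrow> 'w set \<Rightarrow> ('w \<Rightarrow> 'o) \<Rightarrow>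
   ('w \<times> 'w \<Rightarrow> 'm) \<Rightarrow> bool" where
  "is_glue_obj W D P A \<alpha> \<longleftrightarrow>
     A \<in> (\<Pi>\<^sub>E w\<in>P. Obj (GCat D w)) \<and>
     \<alpha> \<in> (\<Pi>\<^sub>E (w, w')\<in>glue_pairs W P.
            Hom (GCat D (w \<otimes>\<^bsub>W\<^esub> w')) (fobj (GFun D w w') (A w')) (A (w \<otimes>\<^bsub>W\<^esub> w'))) \<and>
     (\<forall>w'\<in>P. \<alpha> (\<one>\<^bsub>W\<^esub>, w') = Ident (GCat D w') (A w')) \<and>
     (\<forall>w\<^sub>1\<in>carrier W. \<forall>w\<^sub>2\<in>carrier W. \<forall>w'\<in>P.
        w\<^sub>2 \<otimes>\<^bsub>W\<^esub> w' \<in> P \<longrightarrow> w\<^sub>1 \<otimes>\<^bsub>W\<^esub> w\<^sub>2 \<otimes>\<^bsub>W\<^esub> w' \<in> P \<longrightarrow>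
        Cmp (GCat D (w\<^sub>1 \<otimes>\<^bsub>W\<^esub> w\<^sub>2 \<otimes>\<^bsub>W\<^esub> w'))
          (\<alpha> (w\<^sub>1, w\<^sub>2 \<otimes>\<^bsub>W\<^esub> w')) (fmap (GFun D w\<^sub>1 (w\<^sub>2 \<otimes>\<^bsub>W\<^esub> w')) (\<alpha> (w\<^sub>2, w'))) =
        Cmp (GCat D (w\<^sub>1 \<otimes>\<^bsub>W\<^esub> w\<^sub>2 \<otimes>\<^bsub>W\<^esub> w'))
          (\<alpha> (w\<^sub>1 \<otimes>\<^bsub>W\<^esub> w\<^sub>2, w')) (GNat D w\<^sub>1 w\<^sub>2 w' (A w')))"

definition glue_hom ::
  "('w, 'z) monoid_scheme \<Rightarrow> ('w, 'o, 'm) gluing \<Rightarrow> 'w set \<Rightarrow>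
   ('w, 'o, 'm) glue_obj \<Rightarrow> ('w, 'o, 'm) glue_obj \<Rightarrow> ('w \<Rightarrow> 'm) set" where
  "glue_hom W D P = (\<lambda>(A, \<alpha>) (B, \<beta>).
     {f \<in> (\<Pi>\<^sub>E w\<in>P. Hom (GCat D w) (A w) (B w)).
        \<forall>(w, w')\<in>glue_pairs W P.
          Cmp (GCat D (w \<otimes>\<^bsub>W\<^esub> w')) (f (w \<otimes>\<^bsub>W\<^esub> w')) (\<alpha> (w, w')) =
          Cmp (GCat D (w \<otimes>\<^bsub>W\<^esub> w')) (\<beta> (w, w')) (fmap (GFun D w w') (f w'))})"

definition glue ::
  "('w, 'z) monoid_scheme \<Rightarrow> ('w, 'o, 'm) gluing \<Rightarrow> 'w set \<Rightarrow>
   (('w, 'o, 'm) glue_obj, 'w \<Rightarrow> 'm) acat" where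
  "glue W D P =
     \<lparr>Obj = {(A, \<alpha>). is_glue_obj W D P A \<alpha>},
      Hom = glue_hom W D P,
      Ident = (\<lambda>A. \<lambda>w\<in>P. Ident (GCat D w) (fst A w)),
      Cmp = (\<lambda>g f. \<lambda>w\<in>P. Cmp (GCat D w) (g w) (f w)),
      Zero_hom = (\<lambda>A B. \<lambda>w\<in>P. Zero_hom (GCat D w) (fst A w) (fst B w)),
      Plus_hom = (\<lambda>f g. \<lambda>w\<in>P. Plus_hom (GCat D w) (f w) (g w))\<rparr>"

text \<open>The functor \<open>j\<^sup>*\<close> from \<open>glue W D P\<close> to \<open>glue W D Q\<close> for \<open>Q \<subseteq> P\<close>; its formula does not
  involve \<open>P\<close>, and \<open>D\<close> only fixes the types.\<close>

definition jstar ::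
  "('w, 'z) monoid_scheme \<Rightarrow> ('w, 'o, 'm) gluing \<Rightarrow> 'w set \<Rightarrow>
   (('w, 'o, 'm) glue_obj, 'w \<Rightarrow> 'm, ('w, 'o, 'm) glue_obj, 'w \<Rightarrow> 'm) funct" where
  "jstar W D Q =
     \<lparr>fobj = (\<lambda>(A, \<alpha>). (restrict A Q, restrict \<alpha> (glue_pairs W Q))),
      fmap = (\<lambda>f. restrict f Q)\<rparr>"

text \<open>The left adjoint \<open>j\<^sub>!\<close> of \<open>j\<^sup>*\<close>, together with the unit of the adjunction.\<close>

definition jshriek_adj ::
  "('w, 'z) monoid_scheme \<Rightarrow> ('w, 'o, 'm) gluing \<Rightarrow> 'w set \<Rightarrow> 'w set \<Rightarrow>
   (('w, 'o, 'm) glue_obj, 'w \<Rightarrow> 'm, ('w, 'o, 'm) glue_obj, 'w \<Rightarrow> 'm) funct \<times>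
   (('w, 'o, 'm) glue_obj \<Rightarrow> 'w \<Rightarrow> 'm)" where
  "jshriek_adj W D Q P =
     (SOME (L, \<eta>). is_left_adjoint (glue W D P) (glue W D Q) (jstar W D Q) L \<eta>)"

definition jshriek ::
  "('w, 'z) monoid_scheme \<Rightarrow> ('w, 'o, 'm) gluing \<Rightarrow> 'w set \<Rightarrow> 'w set \<Rightarrow>
   (('w, 'o, 'm) glue_obj, 'w \<Rightarrow> 'm, ('w, 'o, 'm) glue_obj, 'w \<Rightarrow> 'm) funct" where
  "jshriek W D Q P = fst (jshriek_adj W D Q P)"

definition junit ::
  "('w, 'z) monoid_scheme \<Rightarrow> ('w, 'o, 'm) gluing \<Rightarrow> 'w set \<Rightarrow> 'w set \<Rightarrow>
   ('w, 'o, 'm) glue_obj \<Rightarrow> 'w \<Rightarrow> 'm" where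
  "junit W D Q P = snd (jshriek_adj W D Q P)"

definition jj ::
  "('w, 'z) monoid_scheme \<Rightarrow> ('w, 'o, 'm) gluing \<Rightarrow> 'w set \<Rightarrow> 'w set \<Rightarrow>
   ('w, 'o, 'm) glue_obj \<Rightarrow> ('w, 'o, 'm) glue_obj" where
  "jj W D Q P A = fobj (jshriek W D Q P) (fobj (jstar W D Q) A)"

text \<open>For \<open>Q \<subseteq> Q' \<subseteq> P\<close>, the canonical morphism from \<open>j\<^sub>! j\<^sup>* A\<close> for \<open>Q\<close> to \<open>j\<^sub>! j\<^sup>* A\<close> for
  \<open>Q'\<close> is the composite of the isomorphism of left adjoints of \<open>j\<^sup>*\<close> from \<open>P\<close> to \<open>Q\<close> (directly, and
  through \<open>Q'\<close>) with the counit for \<open>Q \<subseteq> Q'\<close>. Under the adjunction for \<open>Q \<subseteq> P\<close> it corresponds to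
  the restriction to \<open>Q\<close> of the unit for \<open>Q' \<subseteq> P\<close>.\<close>

definition jj_map ::
  "('w, 'z) monoid_scheme \<Rightarrow> ('w, 'o, 'm) gluing \<Rightarrow> 'w set \<Rightarrow> ('w, 'o, 'm) glue_obj \<Rightarrow>
   'w set \<Rightarrow> 'w set \<Rightarrow> 'w \<Rightarrow> 'm" where
  "jj_map W D P A Q Q' =
     (THE f. f \<in> Hom (glue W D P) (jj W D Q P A) (jj W D Q' P A) \<and>
        Cmp (glue W D Q) (fmap (jstar W D Q) f) (junit W D Q P (fobj (jstar W D Q) A)) =
        fmap (jstar W D Q) (junit W D Q' P (fobj (jstar W D Q') A)))"


section \<open>The complex\<close>

text \<open>\<open>parab W s n J\<close> is the standard parabolic subgroup generated by the \<open>s j\<close> with \<open>j\<close> in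
  \<open>[1, n]\<close> outside \<open>J\<close>.\<close>

definition parab :: "('w, 'z) monoid_scheme \<Rightarrow> (nat \<Rightarrow> 'w) \<Rightarrow> nat \<Rightarrow> nat set \<Rightarrow> 'w set" where
  "parab W s n J = generate W (s ` ({1..n} - J))"

definition coset_index ::
  "('w, 'z) monoid_scheme \<Rightarrow> (nat \<Rightarrow> 'w) \<Rightarrow> nat \<Rightarrow> 'w set \<Rightarrow> nat set \<Rightarrow> 'w set set" where
  "coset_index W s n P J =
     {parab W s n J #>\<^bsub>W\<^esub> x | x. x \<in> carrier W \<and> (\<forall>j\<in>J. parab W s n {j} #>\<^bsub>W\<^esub> x \<subseteq> P)}"

definition coeff_obj ::
  "('w, 'z) monoid_scheme \<Rightarrow> (nat \<Rightarrow> 'w) \<Rightarrow> nat \<Rightarrow> ('w, 'o, 'm) gluing \<Rightarrow> 'w set \<Rightarrow>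
   ('w, 'o, 'm) glue_obj \<Rightarrow> nat set \<Rightarrow> ('w, 'o, 'm) glue_obj" where
  "coeff_obj W s n D P A J =
     dsum_obj (glue W D P) (coset_index W s n P J) (\<lambda>c. jj W D c P A)"

text \<open>For \<open>J \<subseteq> J'\<close> a coset \<open>c\<close> of \<open>parab W s n J'\<close> lies in the unique coset
  \<open>parab W s n J <#>\<^bsub>W\<^esub> c\<close> of the larger subgroup \<open>parab W s n J\<close>.\<close>

definition coeff_map ::
  "('w, 'z) monoid_scheme \<Rightarrow> (nat \<Rightarrow> 'w) \<Rightarrow> nat \<Rightarrow> ('w, 'o, 'm) gluing \<Rightarrow> 'w set \<Rightarrow>
   ('w, 'o, 'm) glue_obj \<Rightarrow> nat set \<Rightarrow> nat set \<Rightarrow> 'w \<Rightarrow> 'm" where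
  "coeff_map W s n D P A J' J =
     copair (glue W D P) (coset_index W s n P J') (\<lambda>c. jj W D c P A) (coeff_obj W s n D P A J)
       (\<lambda>c. Cmp (glue W D P)
          (dsum_inj (glue W D P) (coset_index W s n P J) (\<lambda>c. jj W D c P A)
             (parab W s n J <#>\<^bsub>W\<^esub> c))
          (jj_map W D P A c (parab W s n J <#>\<^bsub>W\<^esub> c)))"

definition coset_complex ::
  "('w, 'z) monoid_scheme \<Rightarrow> (nat \<Rightarrow> 'w) \<Rightarrow> nat \<Rightarrow> ('w, 'o, 'm) gluing \<Rightarrow> 'w set \<Rightarrow>
   ('w, 'o, 'm) glue_obj \<Rightarrow> (('w, 'o, 'm) glue_obj, 'w \<Rightarrow> 'm) complex_data" where
  "coset_complex W s n D P A =
     simplex_complex (glue W D P) {1..n} (coeff_obj W s n D P A) (coeff_map W s n D P A)"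

definition ascent_set :: "('w, 'z) monoid_scheme \<Rightarrow> 'w set \<Rightarrow> 'w \<Rightarrow> 'w set" where
  "ascent_set W S t = {w \<in> carrier W. cox_length W S (w \<otimes>\<^bsub>W\<^esub> t) > cox_length W S w}"

end

theory Submission
  imports Defs
begin

text \<open>
Fix \<open>w \<in> P\<close> and look at \<open>w\<close>-components. For a coset \<open>c\<close> let \<open>y\<close> be its element nearest to \<open>w\<close>, the one for which
\<open>w y\<^sup>-\<^sup>1\<close> is shortest. The \<open>w\<close>-component of \<open>j\<^sub>! j\<^sup>* A\<close> for \<open>c\<close> is \<open>\<Phi> A\<^sub>y\<close> with \<open>\<Phi>\<close> the functor of
\<open>w y\<^sup>-\<^sup>1\<close>, and the canonical morphism to a larger coset is an isomorphism at \<open>w\<close> whenever the nearest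
element stays the same; otherwise the length of \<open>w y\<^sup>-\<^sup>1\<close> drops. So, up to terms of smaller length, the
\<open>w\<close>-component of the complex splits into pieces indexed by \<open>y \<in> P\<close>, and the piece of \<open>y\<close> is spanned by
the nonempty sets \<open>J\<close> that contain all right descents of \<open>w y\<^sup>-\<^sup>1\<close> and are contained in the set
\<open>M\<close> of all \<open>j\<close> such that \<open>P\<close> contains the coset of \<open>y\<close> for the parabolic subgroup generated by the
\<open>s\<^sub>k\<close> with \<open>k \<noteq> j\<close>.

The one fact about Coxeter groups behind the theorem is that \<open>M\<close> always contains a vertex \<open>j\<close> for which
\<open>s\<^sub>j\<close> is not a descent of \<open>w y\<^sup>-\<^sup>1\<close> (\<open>ascent_coset_ex\<close>). Adding this vertex to \<open>J\<close> or removing it from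
\<open>J\<close> matches the cells of the complex in pairs, and the matrix coefficient of the differential on each pair
is plus or minus an isomorphism. The removal of the last vertex can only happen for \<open>y = w\<close>, and there the
partner is the augmentation to \<open>A\<close>, given by the counits. The length of \<open>w y\<^sup>-\<^sup>1\<close> is a rank that makes
the matching acyclic, so every cycle at \<open>w\<close> is a boundary (\<open>acyclic_matching_exact\<close>), for cycles with
any object of the \<open>w\<close>-th category as source. Hence the augmented complex is split exact at every \<open>w\<close>.

It remains to pass from components to the glued category. Kernels and finite biproducts of the glued
category are formed componentwise (\<open>glue_kernel\<close>, \<open>glue_biproduct\<close>), a morphism that is a split
epimorphism at every component is an epimorphism, and an augmentation that is split exact at every component
is a cokernel (\<open>glue_split_cokernel\<close>). The description of \<open>j\<^sub>!\<close> rests on an explicit left adjoint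
(\<open>ext_left_adjoint\<close>), from which it is transferred to an arbitrary one (\<open>jj_generated\<close>).
\<close>

section \<open>Coxeter groups and inversions\<close>

text \<open>The letter \<open>a\<close> in front of a suffix with value \<open>v\<close> contributes the reflection \<open>v\<^sup>-\<^sup>1 a v\<close>; multiplying
  the value of the word by it on the right deletes that letter.\<close>

primrec right_refls :: "('w, 'z) monoid_scheme \<Rightarrow> 'w list \<Rightarrow> 'w list" where
  "right_refls W [] = []"
| "right_refls W (a # xs) =
     (inv\<^bsub>W\<^esub> (word_val W xs) \<otimes>\<^bsub>W\<^esub> a \<otimes>\<^bsub>W\<^esub> word_val W xs) # right_refls W xs"

locale coxeter =
  fixes W :: "('w, 'z) monoid_scheme" (structure) and S :: "'w set"
  assumes cox: "coxeter_system W S"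
begin

lemma is_group: "group W" using cox unfolding coxeter_system_def by blast

sublocale group W by (rule is_group)

abbreviation val where "val \<equiv> word_val W"
abbreviation len where "len \<equiv> cox_length W S"

lemma S_carrier: "S \<subseteq> carrier W" using cox unfolding coxeter_system_def by blast

lemma S_in_carrier [simp, intro]: "s \<in> S \<Longrightarrow> s \<in> carrier W" using S_carrier by blast

lemma val_Nil [simp]: "val [] = \<one>" by (simp add: word_val_def)
lemma val_Cons [simp]: "val (a # xs) = a \<otimes> val xs" by (simp add: word_val_def)

lemma val_closed [simp, intro]: "xs \<in> lists S \<Longrightarrow> val xs \<in> carrier W"
  by (induction xs) auto

lemma val_append [simp]: "xs \<in> lists S \<Longrightarrow> ys \<in> lists S \<Longrightarrow> val (xs @ ys) = val xs \<otimes> val ys"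
  by (induction xs) (auto simp: m_assoc)

lemma cancel_left [simp]:
  "x \<in> carrier W \<Longrightarrow> y \<in> carrier W \<Longrightarrow> x \<otimes> (inv x \<otimes> y) = y"
  "x \<in> carrier W \<Longrightarrow> y \<in> carrier W \<Longrightarrow> inv x \<otimes> (x \<otimes> y) = y"
  by (simp_all add: m_assoc[symmetric])

lemma S_square: assumes "s \<in> S" shows "s \<otimes> s = \<one>"
proof -
  obtain m where m: "coxeter_matrix S m"
    and e: "\<And>xs ys. xs\<in>lists S \<Longrightarrow> ys\<in>lists S \<Longrightarrow> val xs = val ys \<longleftrightarrow> coxeter_equiv S m xs ys"
    using cox unfolding coxeter_system_def by blast
  have "coxeter_equiv S m ([] @ concat (replicate (m s s) [s, s]) @ []) ([] @ [])"
    using assms by (intro coxeter_equiv.relation) auto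
  moreover have "m s s = 1" using m assms unfolding coxeter_matrix_def by blast
  ultimately have "coxeter_equiv S m [s, s] []" by simp
  hence "val [s, s] = val []" using e[of "[s,s]" "[]"] assms by auto
  thus ?thesis using assms by simp
qed

lemma S_inv [simp]: "s \<in> S \<Longrightarrow> inv s = s"
  using S_square by (simp add: inv_equality)

lemma S_cancel [simp]: "s \<in> S \<Longrightarrow> x \<in> carrier W \<Longrightarrow> s \<otimes> (s \<otimes> x) = x"
  by (simp add: m_assoc[symmetric] S_square)

lemma generate_words:
  assumes K: "K \<subseteq> S"
  shows "w \<in> generate W K \<longleftrightarrow> (\<exists>xs\<in>lists K. val xs = w)"
proof
  assume "w \<in> generate W K"
  thus "\<exists>xs\<in>lists K. val xs = w"
  proof (induction rule: generate.induct)
    case one thus ?case by (intro bexI[of _ "[]"]) auto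
  next
    case (incl h) thus ?case using K by (intro bexI[of _ "[h]"]) auto
  next
    case (inv h) thus ?case using K by (intro bexI[of _ "[h]"]) (auto simp: subset_iff)
  next
    case (eng h1 h2)
    then obtain xs ys where "xs \<in> lists K" "ys \<in> lists K" "val xs = h1" "val ys = h2" by blast
    thus ?case using K by (intro bexI[of _ "xs @ ys"]) (auto simp: val_append lists_mono[THEN subsetD])
  qed
next
  assume "\<exists>xs\<in>lists K. val xs = w"
  then obtain xs where "xs \<in> lists K" "val xs = w" by blast
  thus "w \<in> generate W K"
    by (induction xs arbitrary: w) (auto intro: generate.intros)
qed

lemma word_ex: "w \<in> carrier W \<Longrightarrow> \<exists>xs\<in>lists S. val xs = w"
  using generate_words[of S w] cox unfolding coxeter_system_def by auto

lemma generate_closed: "K \<subseteq> S \<Longrightarrow> generate W K \<subseteq> carrier W"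
  using generate_incl S_carrier by (metis order_trans)

lemma right_refls_carrier: "xs \<in> lists S \<Longrightarrow> set (right_refls W xs) \<subseteq> carrier W"
  by (induction xs) auto

lemma right_refls_append:
  "xs \<in> lists S \<Longrightarrow> ys \<in> lists S \<Longrightarrow>
   right_refls W (xs @ ys) =
     map (\<lambda>t. inv (val ys) \<otimes> t \<otimes> val ys) (right_refls W xs) @ right_refls W ys"
  by (induction xs) (auto simp: m_assoc inv_mult_group)

lemma count_conj:
  assumes "g \<in> carrier W" "t \<in> carrier W" "set zs \<subseteq> carrier W"
  shows "count_list (map (\<lambda>t. inv g \<otimes> t \<otimes> g) zs) t = count_list zs (g \<otimes> t \<otimes> inv g)"
proof -
  have "\<And>z. z \<in> carrier W \<Longrightarrow> inv g \<otimes> z \<otimes> g = t \<longleftrightarrow> z = g \<otimes> t \<otimes> inv g"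
    using assms by (auto simp: m_assoc)
  thus ?thesis using assms(3) by (induction zs) auto
qed

text \<open>The reflections of the word \<open>(s t)\<^sup>m\<close> are \<open>(s t)\<^sup>-\<^sup>k t\<close> for \<open>0 \<le> k < 2 m\<close>; when \<open>(s t)\<^sup>m = 1\<close>
  they are periodic in \<open>k\<close> with period \<open>m\<close>, so each of them occurs an even number of times.\<close>

lemma right_refls_braid_even:
  assumes s: "s \<in> S" and t: "t \<in> S" and one: "val (concat (replicate m [s, t])) = \<one>"
  shows "even (count_list (right_refls W (concat (replicate m [s, t]))) r)"
proof -
  let ?w = "\<lambda>k. concat (replicate k [s, t])"
  let ?\<rho> = "t \<otimes> s"
  let ?e = "\<lambda>k. ?\<rho> [^] (k::nat) \<otimes> t"
  have w: "?w k \<in> lists S" for k using s t by (induction k) auto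
  have st: "s \<in> carrier W" "t \<in> carrier W" using s t by auto
  have v: "val (?w k) = inv (?\<rho> [^] k)" for k
  proof (induction k)
    case (Suc k)
    have "val (?w (Suc k)) = s \<otimes> (t \<otimes> inv (?\<rho> [^] k))" using Suc by simp
    also have "\<dots> = inv (?\<rho> [^] k \<otimes> ?\<rho>)" using s t st by (simp add: inv_mult_group m_assoc)
    finally show ?case by simp
  qed simp
  have sh: "?\<rho> [^] k \<otimes> t \<otimes> inv (?\<rho> [^] k) = ?e (2 * k)" for k :: nat
  proof -
    have c: "t \<otimes> inv (?\<rho> [^] k) = ?\<rho> [^] k \<otimes> t" for k :: nat
    proof (induction k)
      case (Suc k)
      have "t \<otimes> inv (?\<rho> [^] Suc k) = t \<otimes> (s \<otimes> t \<otimes> inv (?\<rho> [^] k))"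
        using s t st by (simp add: inv_mult_group m_assoc)
      also have "\<dots> = ?\<rho> \<otimes> (t \<otimes> inv (?\<rho> [^] k))" using st by (simp add: m_assoc)
      also have "\<dots> = ?\<rho> \<otimes> ?\<rho> [^] k \<otimes> t" using Suc st by (simp add: m_assoc)
      also have "\<dots> = ?\<rho> [^] Suc k \<otimes> t"
        using st by (metis nat_pow_Suc2 m_closed)
      finally show ?case .
    qed (use st in simp)
    have "?\<rho> [^] k \<otimes> t \<otimes> inv (?\<rho> [^] k) = ?\<rho> [^] k \<otimes> (?\<rho> [^] k \<otimes> t)" using c[of k] st by (simp add:
        m_assoc)
    thus ?thesis using st by (simp add: m_assoc[symmetric] nat_pow_mult mult_2)
  qed
  have refl: "right_refls W (?w k) = rev (map ?e [0..<2*k])" for k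
  proof (induction k)
    case (Suc k)
    have a1: "inv (val (?w k)) \<otimes> t \<otimes> val (?w k) = ?e (2 * k)"
      unfolding v using sh[of k] st by simp
    have "inv (t \<otimes> val (?w k)) \<otimes> s \<otimes> (t \<otimes> val (?w k))
        = ?\<rho> [^] k \<otimes> (?\<rho> \<otimes> t) \<otimes> inv (?\<rho> [^] k)"
      unfolding v using s t st by (simp add: inv_mult_group m_assoc)
    also have "\<dots> = (?\<rho> [^] k \<otimes> ?\<rho>) \<otimes> t \<otimes> inv (?\<rho> [^] k)" using st by (simp add: m_assoc)
    also have "?\<rho> [^] k \<otimes> ?\<rho> = ?\<rho> \<otimes> ?\<rho> [^] k" using st nat_pow_Suc2[of ?\<rho> k] by simp
    also have "?\<rho> \<otimes> ?\<rho> [^] k \<otimes> t \<otimes> inv (?\<rho> [^] k) = ?\<rho> \<otimes> (?\<rho> [^] k \<otimes> t \<otimes> inv (?\<rho> [^] k))"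
      using st by (simp add: m_assoc)
    also have "\<dots> = ?\<rho> \<otimes> ?\<rho> [^] (2*k) \<otimes> t" using sh[of k] st by (simp add: m_assoc)
    also have "\<dots> = ?e (Suc (2*k))" using st nat_pow_Suc2[of ?\<rho> "2*k"] by simp
    finally have a2: "inv (t \<otimes> val (?w k)) \<otimes> s \<otimes> (t \<otimes> val (?w k)) = ?e (Suc (2 * k))" .
    have "right_refls W (?w (Suc k)) = ?e (Suc (2*k)) # ?e (2*k) # right_refls W (?w k)"
      using a1 a2 by simp
    thus ?case using Suc.IH by simp
  qed simp
  have per: "?\<rho> [^] m = \<one>" using one v[of m] st by (metis inv_inv inv_one nat_pow_closed m_closed)
  have "map ?e [m..<2*m] = map ?e [0..<m]"
  proof (rule nth_equalityI)
    fix i assume "i < length (map ?e [m..<2 * m])"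
    hence i: "i < m" by simp
    have "?\<rho> [^] (m + i) = ?\<rho> [^] m \<otimes> ?\<rho> [^] i" using st by (simp add: nat_pow_mult)
    hence "?\<rho> [^] (m + i) = ?\<rho> [^] i" using per st by simp
    thus "map ?e [m..<2*m] ! i = map ?e [0..<m] ! i" using i by simp
  qed simp
  moreover have "[0..<2*m] = [0..<m] @ [m..<2*m]" by (simp add: upt_add_eq_append[symmetric] mult_2)
  ultimately have "count_list (map ?e [0..<2*m]) r = 2 * count_list (map ?e [0..<m]) r"
    by simp
  thus ?thesis unfolding refl by simp
qed

text \<open>Only the parity of the number of occurrences of a reflection depends on the value of the word alone, and it
  does so because the defining relations insert each reflection an even number of times.\<close>

lemma right_refls_parity:
  assumes xs: "xs \<in> lists S" and ys: "ys \<in> lists S" and eq: "val xs = val ys" and r: "r \<in> carrier W"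
  shows "odd (count_list (right_refls W xs) r) = odd (count_list (right_refls W ys) r)"
proof -
  obtain m where e: "\<And>xs ys. xs\<in>lists S \<Longrightarrow> ys\<in>lists S \<Longrightarrow> val xs = val ys \<longleftrightarrow> coxeter_equiv S m xs ys"
    using cox unfolding coxeter_system_def by blast
  have "coxeter_equiv S m xs ys" using e xs ys eq by blast
  thus ?thesis using r
  proof (induction rule: coxeter_equiv.induct)
    case (relation s t u v)
    let ?z = "concat (replicate (m s t) [s, t])"
    have z: "?z \<in> lists S" using relation(1,2) by (induction "m s t") auto
    have "coxeter_equiv S m ([] @ ?z @ []) ([] @ [])"
      using relation by (intro coxeter_equiv.relation) auto
    hence one: "val ?z = \<one>" using e[of ?z "[]"] z by auto
    let ?r = "val v \<otimes> r \<otimes> inv (val v)"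
    have "right_refls W (u @ ?z @ v) = map (\<lambda>t. inv (val v) \<otimes> t \<otimes> val v) (right_refls W u)
        @ map (\<lambda>t. inv (val v) \<otimes> t \<otimes> val v) (right_refls W ?z) @ right_refls W v"
      using relation z one by (simp add: right_refls_append append_in_lists_conv del: lists.simps)
    moreover have "right_refls W (u @ v) = map (\<lambda>t. inv (val v) \<otimes> t \<otimes> val v) (right_refls W u) @
        right_refls W v"
      using relation by (simp add: right_refls_append)
    moreover have "even (count_list (map (\<lambda>t. inv (val v) \<otimes> t \<otimes> val v) (right_refls W ?z)) r)"
      using relation z one by (subst count_conj) (auto simp: right_refls_carrier right_refls_braid_even)
    ultimately show ?case by simp
  qed auto
qed

text \<open>For a reflection \<open>t\<close> this says that \<open>w t\<close> is shorter than \<open>w\<close>. Defining it by parity makes the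
  cocycle identity immediate.\<close>

definition is_inversion :: "'w \<Rightarrow> 'w \<Rightarrow> bool" where
  "is_inversion w t \<longleftrightarrow> odd (count_list (right_refls W (SOME xs. xs \<in> lists S \<and> val xs = w)) t)"

lemma is_inversion_word:
  assumes "xs \<in> lists S" "t \<in> carrier W"
  shows "is_inversion (val xs) t \<longleftrightarrow> odd (count_list (right_refls W xs) t)"
proof -
  let ?ys = "SOME ys. ys \<in> lists S \<and> val ys = val xs"
  have "?ys \<in> lists S \<and> val ?ys = val xs" by (rule someI[of _ xs]) (use assms in simp)
  thus ?thesis unfolding is_inversion_def using right_refls_parity[of ?ys xs t] assms by blast
qed

text \<open>Concatenating words conjugates the reflections of the first one: the cocycle identity.\<close>

lemma is_inversion_mult:
  assumes "a \<in> carrier W" "b \<in> carrier W" "t \<in> carrier W"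
  shows "is_inversion (a \<otimes> b) t \<longleftrightarrow> is_inversion b t \<noteq> is_inversion a (b \<otimes> t \<otimes> inv b)"
proof -
  obtain xs ys where x: "xs \<in> lists S" "val xs = a" and y: "ys \<in> lists S" "val ys = b"
    using word_ex assms by metis
  have "is_inversion (a \<otimes> b) t \<longleftrightarrow> odd (count_list (right_refls W (xs @ ys)) t)"
    using is_inversion_word[of "xs @ ys" t] x y assms by simp
  also have "\<dots> \<longleftrightarrow> odd (count_list (right_refls W ys) t + count_list (right_refls W xs) (b \<otimes> t \<otimes> inv b))"
    using x y assms right_refls_carrier[OF x(1)]
    by (simp add: right_refls_append count_conj add.commute)
  finally show ?thesis using is_inversion_word[of xs "b \<otimes> t \<otimes> inv b"] is_inversion_word[of ys t] x y
      assms by auto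
qed

lemma is_inversion_one: "t \<in> carrier W \<Longrightarrow> \<not> is_inversion \<one> t"
  using is_inversion_word[of "[]" t] by simp

lemma is_inversion_gen: "s \<in> S \<Longrightarrow> t \<in> carrier W \<Longrightarrow> is_inversion s t \<longleftrightarrow> t = s"
  using is_inversion_word[of "[s]" t] by auto

text \<open>Both \<open>t = x s x\<^sup>-\<^sup>1\<close> and \<open>1 = x x\<^sup>-\<^sup>1\<close> are expanded by the cocycle identity; the two expansions differ
  exactly by the contribution of the middle letter \<open>s\<close>.\<close>

lemma is_inversion_self:
  assumes "x \<in> carrier W" "s \<in> S"
  shows "is_inversion (x \<otimes> s \<otimes> inv x) (x \<otimes> s \<otimes> inv x)"
proof -
  let ?t = "x \<otimes> s \<otimes> inv x"
  have t: "?t \<in> carrier W" using assms by auto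
  have c: "inv x \<otimes> ?t \<otimes> inv (inv x) = s" using assms by (simp add: m_assoc)
  have "is_inversion ?t ?t \<longleftrightarrow> is_inversion (inv x) ?t \<noteq> is_inversion (x \<otimes> s) s"
    using is_inversion_mult[of "x \<otimes> s" "inv x" ?t] assms t c by simp
  moreover have "is_inversion (x \<otimes> s) s \<longleftrightarrow> \<not> is_inversion x s"
    using is_inversion_mult[of x s s] assms by (simp add: is_inversion_gen m_assoc)
  moreover have "is_inversion (x \<otimes> inv x) ?t \<longleftrightarrow> is_inversion (inv x) ?t \<noteq> is_inversion x s"
    using is_inversion_mult[of x "inv x" ?t] assms t c by simp
  ultimately show ?thesis using assms t is_inversion_one by auto
qed

text \<open>Deleting the letter of a word that contributes the reflection \<open>t\<close> multiplies its value by \<open>t\<close>.\<close>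

lemma exchange:
  assumes "xs \<in> lists S" "t \<in> set (right_refls W xs)"
  shows "\<exists>ys. set ys \<subseteq> set xs \<and> length ys < length xs \<and> val ys = val xs \<otimes> t"
  using assms
proof (induction xs)
  case (Cons a xs)
  hence a: "a \<in> S" "xs \<in> lists S" by auto
  show ?case
  proof (cases "t = inv (val xs) \<otimes> a \<otimes> val xs")
    case True
    hence "val (a # xs) \<otimes> t = val xs" using a by (simp add: m_assoc)
    thus ?thesis by (intro exI[of _ xs]) auto
  next
    case False
    then obtain ys where y: "set ys \<subseteq> set xs" "length ys < length xs" "val ys = val xs \<otimes> t"
      using Cons a by auto
    have "t \<in> carrier W" using Cons.prems right_refls_carrier[of "a # xs"] a by auto
    thus ?thesis using y a by (intro exI[of _ "a # ys"]) (auto simp: m_assoc)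
  qed
qed simp

lemma inversion_exchange:
  assumes "xs \<in> lists S" "t \<in> carrier W" "is_inversion (val xs) t"
  shows "\<exists>ys. set ys \<subseteq> set xs \<and> length ys < length xs \<and> val ys = val xs \<otimes> t"
proof -
  have "t \<in> set (right_refls W xs)"
    using assms is_inversion_word[of xs t] count_notin[of t "right_refls W xs"] odd_pos by fastforce
  thus ?thesis using exchange assms by blast
qed

lemma len_le: "xs \<in> lists S \<Longrightarrow> len (val xs) \<le> length xs"
  unfolding cox_length_def by (rule Least_le) blast

lemma reduced_word:
  assumes "w \<in> carrier W"
  obtains xs where "xs \<in> lists S" "val xs = w" "length xs = len w"
proof -
  have "\<exists>k. \<exists>xs\<in>lists S. length xs = k \<and> val xs = w" using word_ex[OF assms] by auto
  from LeastI_ex[OF this] obtain xs where "xs \<in> lists S" "length xs = len w" "val xs = w"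
    unfolding cox_length_def by auto
  thus ?thesis using that by simp
qed

lemma len_one [simp]: "len \<one> = 0" using len_le[of "[]"] by simp

lemma len_eq_0: "w \<in> carrier W \<Longrightarrow> len w = 0 \<longleftrightarrow> w = \<one>"
  by (metis len_one length_0_conv reduced_word val_Nil)

lemma len_mult: assumes "a \<in> carrier W" "b \<in> carrier W" shows "len (a \<otimes> b) \<le> len a + len b"
proof -
  obtain xs where x: "xs \<in> lists S" "val xs = a" "length xs = len a" using reduced_word assms by blast
  obtain ys where y: "ys \<in> lists S" "val ys = b" "length ys = len b" using reduced_word assms by blast
  show ?thesis using len_le[of "xs @ ys"] x y by simp
qed

lemma len_gen: "s \<in> S \<Longrightarrow> len s \<le> 1" using len_le[of "[s]"] by simp

lemma inversion_len_less:
  assumes "w \<in> carrier W" "t \<in> carrier W" "is_inversion w t" shows "len (w \<otimes> t) < len w"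
proof -
  obtain xs where x: "xs \<in> lists S" "val xs = w" "length xs = len w" using reduced_word assms by blast
  obtain ys where "set ys \<subseteq> set xs" "length ys < length xs" "val ys = w \<otimes> t"
    using inversion_exchange[of xs t] x assms by auto
  moreover have "ys \<in> lists S" using x(1) calculation(1) by (auto simp: in_lists_conv_set)
  ultimately show ?thesis using len_le[of ys] x by simp
qed

text \<open>As \<open>t\<close> is an inversion of itself, it is an inversion of exactly one of \<open>w\<close> and \<open>w t\<close>.\<close>

lemma noninversion_len_greater:
  assumes w: "w \<in> carrier W" and x: "x \<in> carrier W" and s: "s \<in> S" and t: "t = x \<otimes> s \<otimes> inv x"
    and n: "\<not> is_inversion w t"
  shows "len w < len (w \<otimes> t)"
proof -
  have tc: "t \<in> carrier W" "t \<otimes> t = \<one>" "inv t = t" using x s t by (auto simp: m_assoc inv_mult_group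
      S_square)
  have "is_inversion (w \<otimes> t) t" using is_inversion_mult[of w t t] is_inversion_self[OF x s] w tc n
    by (simp add: t[symmetric])
  from inversion_len_less[OF _ _ this] show ?thesis using w tc by (simp add: m_assoc)
qed

lemma inversion_iff_len:
  assumes w: "w \<in> carrier W" and s: "s \<in> S"
  shows "is_inversion w s \<longleftrightarrow> len (w \<otimes> s) < len w"
    and "\<not> is_inversion w s \<longleftrightarrow> len (w \<otimes> s) > len w"
proof -
  have l: "is_inversion w s \<Longrightarrow> len (w \<otimes> s) < len w" using inversion_len_less[of w s] assms by auto
  have g: "\<not> is_inversion w s \<Longrightarrow> len w < len (w \<otimes> s)"
    using noninversion_len_greater[of w \<one> s s] assms by auto
  show "is_inversion w s \<longleftrightarrow> len (w \<otimes> s) < len w" using l g by fastforce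
  show "\<not> is_inversion w s \<longleftrightarrow> len (w \<otimes> s) > len w" using l g by fastforce
qed

lemma len_descent:
  assumes w: "w \<in> carrier W" and s: "s \<in> S"
  shows "is_inversion w s \<Longrightarrow> len w = len (w \<otimes> s) + 1"
    and "\<not> is_inversion w s \<Longrightarrow> len (w \<otimes> s) = len w + 1"
proof -
  have a: "len (w \<otimes> s) \<le> len w + 1" using len_mult[of w s] len_gen[OF s] assms by force
  have b: "len w \<le> len (w \<otimes> s) + 1" using len_mult[of "w \<otimes> s" s] len_gen[OF s] assms
    by (simp add: m_assoc S_square)
  show "is_inversion w s \<Longrightarrow> len w = len (w \<otimes> s) + 1"
    using b inversion_iff_len(1)[OF assms] by linarith
  show "\<not> is_inversion w s \<Longrightarrow> len (w \<otimes> s) = len w + 1"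
    using a inversion_iff_len(2)[OF assms] by linarith
qed

end

section \<open>Parabolic subgroups and their cosets\<close>

context coxeter
begin

lemma parabolic_subgroup: "K \<subseteq> S \<Longrightarrow> subgroup (generate W K) W"
  using generate_is_subgroup S_carrier by blast

lemma parabolic_carrier: "K \<subseteq> S \<Longrightarrow> z \<in> generate W K \<Longrightarrow> z \<in> carrier W"
  using subgroup.mem_carrier[OF parabolic_subgroup] by blast

text \<open>The exchange condition only deletes letters, so it stays inside a parabolic subgroup.\<close>

lemma inversion_in_parabolic:
  assumes K: "K \<subseteq> S" and u: "u \<in> generate W K" and t: "t \<in> carrier W" "is_inversion u t"
  shows "t \<in> generate W K"
proof -
  obtain xs where x: "xs \<in> lists K" "val xs = u" using generate_words[OF K] u by blast
  have "xs \<in> lists S" using x K by (auto simp: in_lists_conv_set)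
  then obtain ys where y: "set ys \<subseteq> set xs" "val ys = u \<otimes> t" using inversion_exchange[of xs t] x t
      by blast
  have "ys \<in> lists K" using y x by (auto simp: in_lists_conv_set)
  hence "u \<otimes> t \<in> generate W K" using generate_words[OF K] y by blast
  hence "inv u \<otimes> (u \<otimes> t) \<in> generate W K"
    using u parabolic_subgroup[OF K] by (simp add: subgroup.m_closed subgroup.m_inv_closed)
  thus ?thesis using u t parabolic_carrier[OF K] by simp
qed

text \<open>The last letter of a shortest word in \<open>K\<close> is a descent.\<close>

lemma parabolic_descent_ex:
  assumes K: "K \<subseteq> S" and z: "z \<in> generate W K" "z \<noteq> \<one>"
  shows "\<exists>r\<in>K. is_inversion z r"
proof -
  define k where "k = (LEAST k. \<exists>xs\<in>lists K. length xs = k \<and> val xs = z)"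
  have "\<exists>k. \<exists>xs\<in>lists K. length xs = k \<and> val xs = z" using z generate_words[OF K] by auto
  from LeastI_ex[OF this] obtain xs where x: "xs \<in> lists K" "length xs = k" "val xs = z"
    unfolding k_def by blast
  have min: "k \<le> length ys" if "ys \<in> lists K" "val ys = z" for ys
    unfolding k_def by (rule Least_le) (use that in blast)
  have "xs \<noteq> []" using x z by auto
  then obtain ys r where xs: "xs = ys @ [r]" by (metis rev_exhaust)
  have r: "r \<in> K" "r \<in> S" and ysK: "ys \<in> lists K" using x(1) K unfolding xs by auto
  have ys: "ys \<in> lists S" using ysK K by (auto simp: in_lists_conv_set)
  have v: "val ys \<otimes> r = z" using x(3) val_append[of ys "[r]"] ys r unfolding xs by simp
  have "\<not> is_inversion (val ys) r"
  proof
    \<comment> \<open>otherwise a letter of the shorter word can be deleted instead of appending \<open>r\<close>\<close>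
    assume "is_inversion (val ys) r"
    then obtain us where "set us \<subseteq> set ys" "length us < length ys" "val us = val ys \<otimes> r"
      using inversion_exchange[of ys r] ys r by auto
    moreover have "us \<in> lists K" using calculation ysK by (auto simp: in_lists_conv_set)
    ultimately show False using min[of us] v x(2) xs by auto
  qed
  hence "is_inversion (val ys \<otimes> r) r"
    using is_inversion_mult[of "val ys" r r] ys r by (simp add: is_inversion_gen m_assoc)
  thus ?thesis using v r by auto
qed

lemma generator_in_parabolic:
  assumes "K \<subseteq> S" "r \<in> S" "r \<in> generate W K" shows "r \<in> K"
proof (cases "r = \<one>")
  case True
  have "is_inversion r r" "\<not> is_inversion \<one> r"
    using is_inversion_gen[of r r] is_inversion_one[of r] assms by auto
  thus ?thesis using True by simp
next
  case False
  then obtain r' where "r' \<in> K" "is_inversion r r'" using parabolic_descent_ex assms by blast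
  thus ?thesis using is_inversion_gen[of r r'] assms by auto
qed

lemma parabolic_induct [consumes 2, case_names one step]:
  assumes K: "K \<subseteq> S" and z: "z \<in> generate W K"
    and one: "P \<one>"
    and step: "\<And>z r. z \<in> generate W K \<Longrightarrow> r \<in> K \<Longrightarrow> \<not> is_inversion z r \<Longrightarrow>
      len (z \<otimes> r) = len z + 1 \<Longrightarrow> P z \<Longrightarrow> P (z \<otimes> r)"
  shows "P z"
  using z
proof (induction "len z" arbitrary: z rule: less_induct)
  case less
  show ?case
  proof (cases "z = \<one>")
    case False
    then obtain r where r: "r \<in> K" "is_inversion z r" using parabolic_descent_ex[OF K] less by blast
    have rS: "r \<in> S" using r K by blast
    have zc: "z \<in> carrier W" using less parabolic_carrier[OF K] by blast
    have zr: "z \<otimes> r \<in> generate W K" using less r by (simp add: generate.incl generate.eng)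
    have zrr: "z \<otimes> r \<otimes> r = z" using zc rS by (simp add: m_assoc S_square)
    have l: "len z = len (z \<otimes> r) + 1" using len_descent zc rS r by blast
    have n: "\<not> is_inversion (z \<otimes> r) r"
      using is_inversion_mult[of z r r] zc rS r by (simp add: is_inversion_gen m_assoc)
    show ?thesis using step[of "z \<otimes> r" r] less.hyps[of "z \<otimes> r"] zr r n l zrr by auto
  qed (use one in simp)
qed

text \<open>A word in \<open>K\<close> for \<open>z\<close> is appended to \<open>g\<close> letter by letter. A descent at some stage would come, by the
  cocycle identity, from a reflection in the parabolic subgroup that shortens \<open>g\<close>.\<close>

lemma reduced_coset_len:
  assumes K: "K \<subseteq> S" and g: "g \<in> carrier W"
    and min: "\<And>z. z \<in> generate W K \<Longrightarrow> len g \<le> len (g \<otimes> z)" and z: "z \<in> generate W K"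
  shows "len (g \<otimes> z) = len g + len z"
  using K z
proof (induction rule: parabolic_induct)
  case one thus ?case using g by simp
next
  case (step z r)
  have c: "z \<in> carrier W" "r \<in> S" using step K parabolic_carrier by auto
  let ?t = "z \<otimes> r \<otimes> inv z"
  have "?t \<in> generate W K" using step parabolic_subgroup[OF K]
    by (simp add: generate.incl subgroup.m_closed subgroup.m_inv_closed)
  from min[OF this] have "\<not> is_inversion g ?t" using inversion_len_less[of g ?t] g c by auto
  hence "\<not> is_inversion (g \<otimes> z) r" using is_inversion_mult[of g z r] step g c by simp
  hence "len (g \<otimes> z \<otimes> r) = len (g \<otimes> z) + 1" using len_descent(2)[of "g \<otimes> z" r] g c by simp
  thus ?case using step g c by (simp add: m_assoc)
qed

text \<open>If every generator in \<open>K\<close> is a right descent of \<open>v\<close> then \<open>v\<close> is longest in its coset: for \<open>u = r z\<close>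
  reduced, write \<open>v = x z\<^sup>-\<^sup>1\<close> with lengths adding up; the descent \<open>r\<close> of \<open>v\<close> cannot come from \<open>z\<^sup>-\<^sup>1\<close>, so it
  shortens \<open>x\<close>.\<close>

lemma longest_coset_len:
  assumes K: "K \<subseteq> S" and v: "v \<in> carrier W" and desc: "\<And>r. r \<in> K \<Longrightarrow> is_inversion v r"
    and u: "u \<in> generate W K"
  shows "len (v \<otimes> inv u) + len u = len v"
  using K u
proof (induction rule: parabolic_induct)
  case one thus ?case using v by simp
next
  case (step z r)
  have c: "z \<in> carrier W" "r \<in> S" "r \<in> carrier W" using step K parabolic_carrier by auto
  let ?x = "v \<otimes> inv z" and ?t = "z \<otimes> r \<otimes> inv z"
  have "\<not> is_inversion z r" by (rule step)
  hence "is_inversion (?x \<otimes> z) r \<longleftrightarrow> is_inversion ?x ?t"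
    using is_inversion_mult[of ?x z r] v c by simp
  moreover have "?x \<otimes> z = v" using v c by (simp add: m_assoc)
  ultimately have "is_inversion ?x ?t" using desc step by simp
  hence "len (?x \<otimes> ?t) < len ?x" using inversion_len_less v c by simp
  moreover have "?x \<otimes> ?t = v \<otimes> inv (z \<otimes> r)" using v c by (simp add: m_assoc inv_mult_group)
  ultimately have a: "len (v \<otimes> inv (z \<otimes> r)) < len ?x" by simp
  have "v = (v \<otimes> inv (z \<otimes> r)) \<otimes> (z \<otimes> r)" using v c by (simp add: m_assoc)
  hence "len v \<le> len (v \<otimes> inv (z \<otimes> r)) + len (z \<otimes> r)" using len_mult v c by (metis inv_closed m_closed)
  thus ?case using a step by linarith
qed

text \<open>Every descent of an element of a parabolic subgroup lies in that subgroup and hence in its set of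
  generators, so the descents of \<open>t\<close> lie in \<open>M\<close> and can be split off one after another.\<close>

lemma parabolic_Inter:
  assumes M: "M \<subseteq> S" and t: "t \<in> carrier W" and all: "\<And>r. r \<in> S - M \<Longrightarrow> t \<in> generate W (S - {r})"
  shows "t \<in> generate W M"
  using t all
proof (induction "len t" arbitrary: t rule: less_induct)
  case less
  show ?case
  proof (cases "t = \<one>")
    case False
    have "t \<in> generate W S" using less cox unfolding coxeter_system_def by blast
    then obtain a where a: "a \<in> S" "is_inversion t a" using parabolic_descent_ex[of S t] False by blast
    have aK: "a \<in> generate W (S - {r})" "a \<noteq> r" if "r \<in> S - M" for r
      using inversion_in_parabolic[of "S - {r}" t a] generator_in_parabolic[of "S - {r}" a] a less
          that by auto
    have aM: "a \<in> M" using aK(2)[of a] a by blast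
    have "t \<otimes> a \<in> generate W M"
    proof (rule less.hyps)
      show "len (t \<otimes> a) < len t" using len_descent[of t a] a less by simp
      show "t \<otimes> a \<in> generate W (S - {r})" if "r \<in> S - M" for r
        using less.prems(2)[OF that] aK(1)[OF that] by (rule generate.eng)
    qed (use less a in auto)
    hence "t \<otimes> a \<otimes> a \<in> generate W M" using aM by (simp add: generate.incl generate.eng)
    thus ?thesis using less a by (simp add: m_assoc S_square)
  qed (simp add: generate.one)
qed

definition coset_of :: "'w set \<Rightarrow> 'w set \<Rightarrow> bool" where
  "coset_of K Q \<longleftrightarrow> K \<subseteq> S \<and> (\<exists>x\<in>carrier W. Q = generate W K #> x)"

text \<open>The projection of \<open>w\<close> to the coset \<open>Q\<close>. It is uniquely determined (\<open>nearest_unique\<close>), and \<open>w\<close> is reached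
  from any \<open>y \<in> Q\<close> by passing through it with lengths adding up (\<open>nearest_len\<close>).\<close>

definition nearest :: "'w set \<Rightarrow> 'w \<Rightarrow> 'w" where
  "nearest Q w = (ARG_MIN (\<lambda>y. len (w \<otimes> inv y)) y. y \<in> Q)"

lemma coset_subset: "coset_of K Q \<Longrightarrow> Q \<subseteq> carrier W"
  unfolding coset_of_def using r_coset_subset_G generate_closed by blast

lemma coset_mem_carrier: "coset_of K Q \<Longrightarrow> y \<in> Q \<Longrightarrow> y \<in> carrier W"
  using coset_subset by blast

lemma coset_eq: assumes "coset_of K Q" "y \<in> Q" shows "Q = generate W K #> y"
  using assms repr_independence[OF _ _ parabolic_subgroup] unfolding coset_of_def by blast

lemma coset_mult: assumes "coset_of K Q" "y \<in> Q" "z \<in> generate W K" shows "z \<otimes> y \<in> Q"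
  using coset_eq[OF assms(1,2)] assms(3) unfolding r_coset_def by blast

lemma coset_diff:
  assumes Q: "coset_of K Q" and y: "y \<in> Q" "y' \<in> Q" shows "y' \<otimes> inv y \<in> generate W K"
proof -
  obtain z where z: "z \<in> generate W K" "y' = z \<otimes> y"
    using coset_eq[OF Q y(1)] y(2) unfolding r_coset_def by blast
  moreover have "z \<in> carrier W" using z Q parabolic_carrier unfolding coset_of_def by blast
  ultimately show ?thesis using coset_mem_carrier[OF Q y(1)] by (simp add: m_assoc)
qed

lemma coset_nonempty: "coset_of K Q \<Longrightarrow> Q \<noteq> {}"
  unfolding coset_of_def r_coset_def using generate.one by blast

lemma nearest_arg_min: assumes "coset_of K Q" shows "is_arg_min (\<lambda>y. len (w \<otimes> inv y)) (\<lambda>y. y \<in> Q)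
    (nearest Q w)"
  unfolding nearest_def using coset_nonempty[OF assms] by (metis arg_min_nat_lemma ex_in_conv
      is_arg_min_linorder)

lemma nearest_mem: "coset_of K Q \<Longrightarrow> nearest Q w \<in> Q"
  using nearest_arg_min unfolding is_arg_min_def by blast

lemma nearest_le: "coset_of K Q \<Longrightarrow> y \<in> Q \<Longrightarrow> len (w \<otimes> inv (nearest Q w)) \<le> len (w \<otimes> inv y)"
  using nearest_arg_min[of K Q w] unfolding is_arg_min_linorder by blast

lemma nearest_len:
  assumes Q: "coset_of K Q" and w: "w \<in> carrier W" and z: "z \<in> generate W K"
  shows "len (w \<otimes> inv (nearest Q w) \<otimes> z) = len (w \<otimes> inv (nearest Q w)) + len z"
proof (rule reduced_coset_len[of K])
  let ?p = "nearest Q w"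
  have p: "?p \<in> Q" "?p \<in> carrier W" using nearest_mem[OF Q] coset_mem_carrier[OF Q] by auto
  show K: "K \<subseteq> S" using Q unfolding coset_of_def by blast
  show "w \<otimes> inv ?p \<in> carrier W" using p w by simp
  show "len (w \<otimes> inv ?p) \<le> len (w \<otimes> inv ?p \<otimes> z)" if z: "z \<in> generate W K" for z
  proof -
    have zc: "z \<in> carrier W" using parabolic_carrier[OF K z] .
    have "inv z \<otimes> ?p \<in> Q" using coset_mult[OF Q p(1)] z parabolic_subgroup[OF K] by (simp add:
        subgroup.m_inv_closed)
    from nearest_le[OF Q this, of w] show ?thesis using p w zc by (simp add: inv_mult_group m_assoc)
  qed
qed (rule z)

lemma nearest_unique:
  assumes Q: "coset_of K Q" and w: "w \<in> carrier W" and y: "y \<in> Q"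
    and le: "len (w \<otimes> inv y) \<le> len (w \<otimes> inv (nearest Q w))"
  shows "nearest Q w = y"
proof -
  let ?p = "nearest Q w"
  have p: "?p \<in> Q" "?p \<in> carrier W" "y \<in> carrier W" using nearest_mem[OF Q] coset_mem_carrier[OF Q]
      y by auto
  have "w \<otimes> inv ?p \<otimes> (?p \<otimes> inv y) = w \<otimes> inv y" using p w by (simp add: m_assoc)
  hence "len (?p \<otimes> inv y) = 0" using nearest_len[OF Q w coset_diff[OF Q y p(1)]] le by simp
  hence "?p \<otimes> inv y = \<one>" using len_eq_0 p by simp
  thus ?thesis using p by (metis inv_inv inv_equality inv_closed)
qed

lemma nearest_self: assumes "coset_of K Q" "w \<in> Q" shows "nearest Q w = w"
  using nearest_unique[OF assms(1) _ assms(2)] coset_mem_carrier[OF assms] by simp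

lemma nearest_no_descent:
  assumes Q: "coset_of K Q" and w: "w \<in> carrier W" and y: "y \<in> Q"
    and nd: "\<And>r. r \<in> K \<Longrightarrow> \<not> is_inversion (w \<otimes> inv y) r"
  shows "nearest Q w = y"
proof (rule ccontr)
  assume ne: "nearest Q w \<noteq> y"
  let ?p = "nearest Q w"
  have p: "?p \<in> Q" "?p \<in> carrier W" "y \<in> carrier W" using nearest_mem[OF Q] coset_mem_carrier[OF Q]
      y by auto
  have K: "K \<subseteq> S" using Q unfolding coset_of_def by blast
  let ?z = "?p \<otimes> inv y"
  have z: "?z \<in> generate W K" using coset_diff[OF Q y p(1)] .
  have "?z \<noteq> \<one>" using p ne by (metis inv_inv inv_equality inv_closed)
  then obtain r where r: "r \<in> K" "is_inversion ?z r" using parabolic_descent_ex[OF K z] by blast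
  have rS: "r \<in> S" using r K by blast
  have zr: "?z \<otimes> r \<in> generate W K" using z r by (simp add: generate.incl generate.eng)
  have e: "w \<otimes> inv ?p \<otimes> ?z = w \<otimes> inv y" "w \<otimes> inv ?p \<otimes> (?z \<otimes> r) = w \<otimes> inv y \<otimes> r"
    using p w rS by (simp_all add: m_assoc)
  have "len (?z \<otimes> r) < len ?z" using len_descent(1)[of ?z r] r rS p by simp
  hence "len (w \<otimes> inv y \<otimes> r) < len (w \<otimes> inv y)"
    using nearest_len[OF Q w z] nearest_len[OF Q w zr] unfolding e by simp
  thus False using nd[OF r(1)] inversion_iff_len(1)[of "w \<otimes> inv y" r] p w rS by simp
qed

lemma nearest_mono:
  assumes Q: "coset_of K Q" and Q': "coset_of K' Q'" and sub: "Q \<subseteq> Q'" and w: "w \<in> carrier W"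
  shows "len (w \<otimes> inv (nearest Q' w)) \<le> len (w \<otimes> inv (nearest Q w))"
  using nearest_le[OF Q', of "nearest Q w" w] nearest_mem[OF Q, of w] sub by blast

lemma nearest_subset:
  assumes Q: "coset_of K Q" and Q': "coset_of K' Q'" and sub: "Q \<subseteq> Q'" and w: "w \<in> carrier W"
    and m: "nearest Q' w \<in> Q"
  shows "nearest Q w = nearest Q' w"
  using nearest_unique[OF Q w m] nearest_mono[OF Q Q' sub w] nearest_le[OF Q'] nearest_mem[OF Q] sub
      by blast

text \<open>The reflection \<open>t = y a y\<^sup>-\<^sup>1\<close> is not an inversion of \<open>v = w y\<^sup>-\<^sup>1\<close>, by the cocycle identity.
  A generator \<open>r\<close> whose coset leaves the ascent set has \<open>t\<close> in the parabolic subgroup without \<open>r\<close>.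
  If all other generators were descents of \<open>v\<close>, then \<open>v\<close> would be longest in its coset for the parabolic
  subgroup that they generate; this subgroup contains \<open>t\<close>, so \<open>t\<close> would be an inversion of \<open>v\<close>.\<close>

lemma ascent_coset_ex:
  assumes a: "a \<in> S" and y: "y \<in> carrier W" "\<not> is_inversion y a" and w: "w \<in> carrier W" "\<not>
      is_inversion w a"
  shows "\<exists>r\<in>S. (\<forall>x\<in>generate W (S - {r}) #> y. \<not> is_inversion x a) \<and> \<not> is_inversion (w \<otimes> inv y) r"
proof (rule ccontr)
  assume neg: "\<not> ?thesis"
  define M where "M = {r\<in>S. \<forall>x\<in>generate W (S - {r}) #> y. \<not> is_inversion x a}"
  let ?t = "y \<otimes> a \<otimes> inv y" and ?v = "w \<otimes> inv y"
  have t: "?t \<in> carrier W" and v: "?v \<in> carrier W" using a y w by auto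
  have M: "M \<subseteq> S" unfolding M_def by blast
  have tK: "?t \<in> generate W (S - {r})" if r: "r \<in> S - M" for r
  proof -
    obtain u where u: "u \<in> generate W (S - {r})" "is_inversion (u \<otimes> y) a"
      using r unfolding M_def r_coset_def by blast
    have uc: "u \<in> carrier W" using u(1) parabolic_carrier[of "S - {r}" u] by blast
    have "is_inversion u ?t" using is_inversion_mult[of u y a] u y a uc by simp
    thus ?thesis using inversion_in_parabolic[of "S - {r}" u ?t] u t by blast
  qed
  have tM: "?t \<in> generate W M" by (rule parabolic_Inter[OF M t tK])
  have desc: "is_inversion ?v r" if "r \<in> M" for r using that neg unfolding M_def by blast
  have tt: "inv ?t = ?t" using a y by (simp add: inv_mult_group m_assoc)
  have len: "len (?v \<otimes> ?t) + len ?t = len ?v" using longest_coset_len[OF M v desc tM] tt by simp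
  have "?v \<otimes> y = w" using w y by (simp add: m_assoc)
  hence "\<not> is_inversion ?v ?t" using is_inversion_mult[of ?v y a] v y w a by auto
  hence "len ?v < len (?v \<otimes> ?t)" using noninversion_len_greater[OF v y(1) a] by simp
  thus False using len by simp
qed

end

section \<open>Preadditive categories\<close>

definition is_biproduct ::
  "('o, 'm) acat \<Rightarrow> 'i set \<Rightarrow> ('i \<Rightarrow> 'o) \<Rightarrow> 'o \<Rightarrow> ('i \<Rightarrow> 'm) \<Rightarrow> ('i \<Rightarrow> 'm) \<Rightarrow> bool" where
  "is_biproduct C I X U \<iota> \<pi> \<longleftrightarrow> finite I \<and> U \<in> Obj C \<and>
     (\<forall>i\<in>I. X i \<in> Obj C \<and> \<iota> i \<in> Hom C (X i) U \<and> \<pi> i \<in> Hom C U (X i)) \<and>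
     (\<forall>i\<in>I. \<forall>j\<in>I. Cmp C (\<pi> i) (\<iota> j) = (if i = j then Ident C (X i) else Zero_hom C (X j) (X i))) \<and>
     hom_sum C U U (\<lambda>i. Cmp C (\<iota> i) (\<pi> i)) I = Ident C U"

lemma ex1_eq: "\<exists>!x. P x \<Longrightarrow> P a \<Longrightarrow> P b \<Longrightarrow> a = b" by blast

lemma hom_group_simps [simp]:
  "carrier (hom_group C a b) = Hom C a b"
  "monoid.mult (hom_group C a b) = Plus_hom C"
  "one (hom_group C a b) = Zero_hom C a b"
  by (simp_all add: hom_group_def)

context preadditive_category
begin

lemma zero_closed [simp, intro]: assumes "a \<in> Obj C" "b \<in> Obj C" shows "Zero_hom C a b \<in> Hom C a b"
proof -
  interpret comm_group "hom_group C a b" by (rule hom_abelian[OF assms])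
  show ?thesis using one_closed by simp
qed

lemma plus_closed:
  assumes "a \<in> Obj C" "b \<in> Obj C" "f \<in> Hom C a b" "g \<in> Hom C a b" shows "Plus_hom C f g \<in> Hom C a b"
proof -
  interpret comm_group "hom_group C a b" by (rule hom_abelian[OF assms(1,2)])
  show ?thesis using m_closed[of f g] assms by simp
qed

lemma neg_closed:
  assumes "a \<in> Obj C" "b \<in> Obj C" "f \<in> Hom C a b" shows "hom_neg C a b f \<in> Hom C a b"
proof -
  interpret comm_group "hom_group C a b" by (rule hom_abelian[OF assms(1,2)])
  show ?thesis using inv_closed[of f] assms by (simp add: hom_neg_def)
qed

lemma plus_zero:
  assumes "a \<in> Obj C" "b \<in> Obj C" "f \<in> Hom C a b"
  shows "Plus_hom C f (Zero_hom C a b) = f" "Plus_hom C (Zero_hom C a b) f = f"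
proof -
  interpret comm_group "hom_group C a b" by (rule hom_abelian[OF assms(1,2)])
  show "Plus_hom C f (Zero_hom C a b) = f" "Plus_hom C (Zero_hom C a b) f = f"
    using r_one[of f] l_one[of f] assms by auto
qed

lemma plus_neg:
  assumes "a \<in> Obj C" "b \<in> Obj C" "f \<in> Hom C a b"
  shows "Plus_hom C f (hom_neg C a b f) = Zero_hom C a b" "Plus_hom C (hom_neg C a b f) f = Zero_hom
      C a b"
proof -
  interpret comm_group "hom_group C a b" by (rule hom_abelian[OF assms(1,2)])
  show "Plus_hom C f (hom_neg C a b f) = Zero_hom C a b" "Plus_hom C (hom_neg C a b f) f = Zero_hom
      C a b"
    using r_inv[of f] l_inv[of f] assms by (auto simp: hom_neg_def)
qed

lemma plus_cancel:
  assumes "a \<in> Obj C" "b \<in> Obj C" "f \<in> Hom C a b" "g \<in> Hom C a b" "h \<in> Hom C a b"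
  shows "Plus_hom C f g = Plus_hom C f h \<longleftrightarrow> g = h"
proof -
  interpret comm_group "hom_group C a b" by (rule hom_abelian[OF assms(1,2)])
  show ?thesis using right_cancel[of f g h] m_comm[of f g] m_comm[of f h] assms by simp
qed

lemma plus_eq_zero_neg:
  assumes "a \<in> Obj C" "b \<in> Obj C" "f \<in> Hom C a b" "g \<in> Hom C a b" "Plus_hom C f g = Zero_hom C a b"
  shows "g = hom_neg C a b f"
  using plus_cancel[of a b f g "hom_neg C a b f"] plus_neg[of a b f] neg_closed[of a b f] assms by simp

lemma neg_neg:
  assumes "a \<in> Obj C" "b \<in> Obj C" "f \<in> Hom C a b" shows "hom_neg C a b (hom_neg C a b f) = f"
  using plus_eq_zero_neg[of a b "hom_neg C a b f" f] plus_neg[of a b f] neg_closed[of a b f] assms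
      by simp

lemma minus_eq_zero:
  assumes "a \<in> Obj C" "b \<in> Obj C" "f \<in> Hom C a b" "g \<in> Hom C a b"
    "Plus_hom C f (hom_neg C a b g) = Zero_hom C a b"
  shows "f = g"
  using plus_eq_zero_neg[of a b f "hom_neg C a b g"] neg_neg[of a b f] neg_neg[of a b g]
      neg_closed[of a b g] assms
  by metis

lemma cmp_zero_right:
  assumes "a \<in> Obj C" "b \<in> Obj C" "c \<in> Obj C" "g \<in> Hom C b c"
  shows "Cmp C g (Zero_hom C a b) = Zero_hom C a c"
proof -
  let ?z = "Zero_hom C a b"
  have "Cmp C g ?z = Plus_hom C (Cmp C g ?z) (Cmp C g ?z)"
    using cmp_plus_right[of a b c ?z ?z g] plus_zero[of a b ?z] assms by simp
  hence "Plus_hom C (Cmp C g ?z) (Zero_hom C a c) = Plus_hom C (Cmp C g ?z) (Cmp C g ?z)"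
    using plus_zero[of a c "Cmp C g ?z"] cmp_hom[of a b c ?z g] assms by simp
  thus ?thesis using plus_cancel[of a c "Cmp C g ?z" "Zero_hom C a c" "Cmp C g ?z"] cmp_hom[of a b c
      ?z g] assms by simp
qed

lemma cmp_zero_left:
  assumes "a \<in> Obj C" "b \<in> Obj C" "c \<in> Obj C" "f \<in> Hom C a b"
  shows "Cmp C (Zero_hom C b c) f = Zero_hom C a c"
proof -
  let ?z = "Zero_hom C b c"
  have "Cmp C ?z f = Plus_hom C (Cmp C ?z f) (Cmp C ?z f)"
    using cmp_plus_left[of a b c f ?z ?z] plus_zero[of b c ?z] assms by simp
  hence "Plus_hom C (Cmp C ?z f) (Zero_hom C a c) = Plus_hom C (Cmp C ?z f) (Cmp C ?z f)"
    using plus_zero[of a c "Cmp C ?z f"] cmp_hom[of a b c f ?z] assms by simp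
  thus ?thesis using plus_cancel[of a c "Cmp C ?z f" "Zero_hom C a c" "Cmp C ?z f"] cmp_hom[of a b c
      f ?z] assms by simp
qed

lemma cmp_neg_right:
  assumes "a \<in> Obj C" "b \<in> Obj C" "c \<in> Obj C" "f \<in> Hom C a b" "g \<in> Hom C b c"
  shows "Cmp C g (hom_neg C a b f) = hom_neg C a c (Cmp C g f)"
proof (rule plus_eq_zero_neg)
  show "Plus_hom C (Cmp C g f) (Cmp C g (hom_neg C a b f)) = Zero_hom C a c"
    using cmp_plus_right[of a b c f "hom_neg C a b f" g] plus_neg[of a b f] neg_closed[of a b f]
      cmp_zero_right[of a b c g] assms by simp
qed (use assms cmp_hom neg_closed in auto)

lemma cmp_neg_left:
  assumes "a \<in> Obj C" "b \<in> Obj C" "c \<in> Obj C" "f \<in> Hom C a b" "g \<in> Hom C b c"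
  shows "Cmp C (hom_neg C b c g) f = hom_neg C a c (Cmp C g f)"
proof (rule plus_eq_zero_neg)
  show "Plus_hom C (Cmp C g f) (Cmp C (hom_neg C b c g) f) = Zero_hom C a c"
    using cmp_plus_left[of a b c f g "hom_neg C b c g"] plus_neg[of b c g] neg_closed[of b c g]
      cmp_zero_left[of a b c f] assms by simp
qed (use assms cmp_hom neg_closed in auto)

subsection \<open>Finite sums of morphisms\<close>

lemma hom_sum_closed:
  assumes "a \<in> Obj C" "b \<in> Obj C" "\<And>i. i \<in> I \<Longrightarrow> f i \<in> Hom C a b"
  shows "hom_sum C a b f I \<in> Hom C a b"
proof -
  interpret comm_group "hom_group C a b" by (rule hom_abelian[OF assms(1,2)])
  show ?thesis using finprod_closed[of f I] assms(3) by (auto simp: hom_sum_def)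
qed

lemma hom_sum_empty [simp]: assumes "a \<in> Obj C" "b \<in> Obj C" shows "hom_sum C a b f {} = Zero_hom C a b"
proof -
  interpret comm_group "hom_group C a b" by (rule hom_abelian[OF assms(1,2)])
  show ?thesis by (simp add: hom_sum_def)
qed

lemma hom_sum_insert:
  assumes "a \<in> Obj C" "b \<in> Obj C" "finite I" "i \<notin> I" "f i \<in> Hom C a b" "\<And>i. i \<in> I \<Longrightarrow> f i \<in> Hom C a b"
  shows "hom_sum C a b f (insert i I) = Plus_hom C (f i) (hom_sum C a b f I)"
proof -
  interpret comm_group "hom_group C a b" by (rule hom_abelian[OF assms(1,2)])
  show ?thesis using finprod_insert[of I i f] assms(3-6) by (auto simp: hom_sum_def)
qed

lemma hom_sum_cong:
  assumes "a \<in> Obj C" "b \<in> Obj C" "I = J" "\<And>i. i \<in> J \<Longrightarrow> g i \<in> Hom C a b" "\<And>i. i \<in> J \<Longrightarrow> f i = g i"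
  shows "hom_sum C a b f I = hom_sum C a b g J"
proof -
  interpret comm_group "hom_group C a b" by (rule hom_abelian[OF assms(1,2)])
  show ?thesis unfolding hom_sum_def by (rule finprod_cong') (use assms in auto)
qed

lemma hom_sum_plus:
  assumes "a \<in> Obj C" "b \<in> Obj C" "\<And>i. i \<in> I \<Longrightarrow> f i \<in> Hom C a b" "\<And>i. i \<in> I \<Longrightarrow> g i \<in> Hom C a b"
  shows "hom_sum C a b (\<lambda>i. Plus_hom C (f i) (g i)) I = Plus_hom C (hom_sum C a b f I) (hom_sum C a
      b g I)"
proof -
  interpret comm_group "hom_group C a b" by (rule hom_abelian[OF assms(1,2)])
  show ?thesis using finprod_multf[of f I g] assms(3,4) by (auto simp: hom_sum_def)
qed

lemma hom_sum_zero:
  assumes "a \<in> Obj C" "b \<in> Obj C" "\<And>i. i \<in> I \<Longrightarrow> f i = Zero_hom C a b"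
  shows "hom_sum C a b f I = Zero_hom C a b"
proof -
  interpret comm_group "hom_group C a b" by (rule hom_abelian[OF assms(1,2)])
  show ?thesis using finprod_one_eqI[of I f] assms(3) by (simp add: hom_sum_def)
qed

lemma hom_sum_single:
  assumes ab: "a \<in> Obj C" "b \<in> Obj C" and I: "finite I" "j \<in> I" and f: "f j \<in> Hom C a b"
    and z: "\<And>i. i \<in> I \<Longrightarrow> i \<noteq> j \<Longrightarrow> f i = Zero_hom C a b"
  shows "hom_sum C a b f I = f j"
proof -
  have "hom_sum C a b f (insert j (I - {j})) = Plus_hom C (f j) (hom_sum C a b f (I - {j}))"
    by (rule hom_sum_insert) (use assms in auto)
  moreover have "hom_sum C a b f (I - {j}) = Zero_hom C a b" by (rule hom_sum_zero) (use assms in auto)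
  ultimately show ?thesis using I ab f by (simp add: insert_absorb plus_zero)
qed

lemma cmp_hom_sum_right:
  assumes abc: "a \<in> Obj C" "b \<in> Obj C" "c \<in> Obj C" and g: "g \<in> Hom C b c"
    and I: "finite I" and f: "\<And>i. i \<in> I \<Longrightarrow> f i \<in> Hom C a b"
  shows "Cmp C g (hom_sum C a b f I) = hom_sum C a c (\<lambda>i. Cmp C g (f i)) I"
  using I f
proof (induction I)
  case empty thus ?case using abc g by (simp add: cmp_zero_right)
next
  case (insert i I)
  have c: "\<And>k. k \<in> insert i I \<Longrightarrow> Cmp C g (f k) \<in> Hom C a c"
    using insert abc g by (auto intro: cmp_hom)
  have "Cmp C g (hom_sum C a b f (insert i I)) = Cmp C g (Plus_hom C (f i) (hom_sum C a b f I))"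
    using insert abc by (subst hom_sum_insert) auto
  also have "\<dots> = Plus_hom C (Cmp C g (f i)) (Cmp C g (hom_sum C a b f I))"
    using insert abc g by (intro cmp_plus_right[of a b c]) (auto intro: hom_sum_closed)
  also have "\<dots> = hom_sum C a c (\<lambda>i. Cmp C g (f i)) (insert i I)"
    using insert abc c by (subst hom_sum_insert) auto
  finally show ?case .
qed

lemma cmp_hom_sum_left:
  assumes abc: "a \<in> Obj C" "b \<in> Obj C" "c \<in> Obj C" and g: "g \<in> Hom C a b"
    and I: "finite I" and f: "\<And>i. i \<in> I \<Longrightarrow> f i \<in> Hom C b c"
  shows "Cmp C (hom_sum C b c f I) g = hom_sum C a c (\<lambda>i. Cmp C (f i) g) I"
  using I f
proof (induction I)
  case empty thus ?case using abc g by (simp add: cmp_zero_left)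
next
  case (insert i I)
  have c: "\<And>k. k \<in> insert i I \<Longrightarrow> Cmp C (f k) g \<in> Hom C a c"
    using insert abc g by (auto intro: cmp_hom)
  have "Cmp C (hom_sum C b c f (insert i I)) g = Cmp C (Plus_hom C (f i) (hom_sum C b c f I)) g"
    using insert abc by (subst hom_sum_insert) auto
  also have "\<dots> = Plus_hom C (Cmp C (f i) g) (Cmp C (hom_sum C b c f I) g)"
    using insert abc g by (intro cmp_plus_left[of a b c]) (auto intro: hom_sum_closed)
  also have "\<dots> = hom_sum C a c (\<lambda>i. Cmp C (f i) g) (insert i I)"
    using insert abc c by (subst hom_sum_insert) auto
  finally show ?case .
qed

text \<open>The terms for \<open>(j, k)\<close> and \<open>(k, j)\<close> cancel; this is the form in which the square of a simplicial
  differential appears.\<close>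

lemma hom_sum_antisym:
  assumes ab: "a \<in> Obj C" "b \<in> Obj C" and A: "finite A"
    and f: "\<And>j k. j \<in> A \<Longrightarrow> k \<in> A \<Longrightarrow> j \<noteq> k \<Longrightarrow> f j k \<in> Hom C a b"
    and anti: "\<And>j k. j \<in> A \<Longrightarrow> k \<in> A \<Longrightarrow> j \<noteq> k \<Longrightarrow> Plus_hom C (f j k) (f k j) = Zero_hom C a b"
  shows "hom_sum C a b (\<lambda>j. hom_sum C a b (f j) (A - {j})) A = Zero_hom C a b"
  using A f anti
proof (induction A)
  case empty thus ?case using ab by simp
next
  case (insert x A)
  let ?s = "\<lambda>j. hom_sum C a b (f j)"
  have cl: "\<And>j B. j \<in> insert x A \<Longrightarrow> B \<subseteq> insert x A - {j} \<Longrightarrow> ?s j B \<in> Hom C a b"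
    using insert.prems ab by (intro hom_sum_closed) auto
  have r: "?s j (insert x A - {j}) = Plus_hom C (f j x) (?s j (A - {j}))" if "j \<in> A" for j
  proof -
    have "insert x A - {j} = insert x (A - {j})" using that insert.hyps by auto
    thus ?thesis using hom_sum_insert[of a b "A - {j}" x "f j"] insert that ab by auto
  qed
  have x: "insert x A - {x} = A" using insert.hyps by auto
  have "hom_sum C a b (\<lambda>j. ?s j (insert x A - {j})) (insert x A)
      = Plus_hom C (?s x A) (hom_sum C a b (\<lambda>j. ?s j (insert x A - {j})) A)"
    using hom_sum_insert[of a b A x "\<lambda>j. ?s j (insert x A - {j})"] insert.hyps ab cl x by auto
  also have "hom_sum C a b (\<lambda>j. ?s j (insert x A - {j})) A = hom_sum C a b (\<lambda>j. Plus_hom C (f j x)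
      (?s j (A - {j}))) A"
  proof (intro hom_sum_cong ab plus_closed)
    show "?s i (A - {i}) \<in> Hom C a b" if "i \<in> A" for i by (rule cl) (use that in auto)
  qed (use insert r in auto)
  also have "\<dots> = Plus_hom C (hom_sum C a b (\<lambda>j. f j x) A) (hom_sum C a b (\<lambda>j. ?s j (A - {j})) A)"
  proof (intro hom_sum_plus ab)
    show "?s i (A - {i}) \<in> Hom C a b" if "i \<in> A" for i by (rule cl) (use that in auto)
  qed (use insert in auto)
  also have "hom_sum C a b (\<lambda>j. ?s j (A - {j})) A = Zero_hom C a b"
    using insert by auto
  also have "Plus_hom C (hom_sum C a b (\<lambda>j. f j x) A) (Zero_hom C a b) = hom_sum C a b (\<lambda>j. f j x) A"
    using insert ab by (intro plus_zero hom_sum_closed) auto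
  also have "Plus_hom C (?s x A) (hom_sum C a b (\<lambda>j. f j x) A) = hom_sum C a b (\<lambda>j. Plus_hom C (f x
      j) (f j x)) A"
    using insert ab by (intro hom_sum_plus[symmetric]) auto
  also have "\<dots> = Zero_hom C a b" using insert ab by (intro hom_sum_zero) auto
  finally show ?case .
qed

subsection \<open>Isomorphisms\<close>

lemma is_iso_E:
  assumes "is_iso C a b f"
  obtains g where "f \<in> Hom C a b" "g \<in> Hom C b a" "Cmp C g f = Ident C a" "Cmp C f g = Ident C b"
  using assms unfolding is_iso_def inverse_homs_def by blast

lemma is_isoI:
  "f \<in> Hom C a b \<Longrightarrow> g \<in> Hom C b a \<Longrightarrow> Cmp C g f = Ident C a \<Longrightarrow> Cmp C f g = Ident C b \<Longrightarrow> is_iso C a b f"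
  unfolding is_iso_def inverse_homs_def by blast

lemma is_iso_ident: "a \<in> Obj C \<Longrightarrow> is_iso C a a (Ident C a)"
  by (rule is_isoI[where g = "Ident C a"]) (auto simp: ident_hom cmp_ident_left[of a a])

lemma is_iso_cancel_right:
  assumes o: "a \<in> Obj C" "b \<in> Obj C" "c \<in> Obj C" and f: "is_iso C a b f"
    and g: "g \<in> Hom C b c" "h \<in> Hom C b c" and e: "Cmp C g f = Cmp C h f"
  shows "g = h"
proof -
  obtain f' where f': "f \<in> Hom C a b" "f' \<in> Hom C b a" "Cmp C f f' = Ident C b" using is_iso_E[OF f]
      by blast
  have "Cmp C (Cmp C g f) f' = g" "Cmp C (Cmp C h f) f' = h"
    using f' g o by (simp_all add: cmp_assoc[of b a b c] cmp_ident_right)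
  thus ?thesis using e by metis
qed

lemma is_iso_cancel_left:
  assumes o: "a \<in> Obj C" "b \<in> Obj C" "c \<in> Obj C" and f: "is_iso C b c f"
    and g: "g \<in> Hom C a b" "h \<in> Hom C a b" and e: "Cmp C f g = Cmp C f h"
  shows "g = h"
proof -
  obtain f' where f': "f \<in> Hom C b c" "f' \<in> Hom C c b" "Cmp C f' f = Ident C b" using is_iso_E[OF f]
      by blast
  have "Cmp C f' (Cmp C f g) = g" "Cmp C f' (Cmp C f h) = h"
    using f' g o by (simp_all add: cmp_assoc[of a b c b, symmetric] cmp_ident_left)
  thus ?thesis using e by metis
qed

text \<open>If \<open>f\<close> carries one isomorphism from \<open>x\<close> to another, then it is itself an isomorphism.\<close>

lemma is_iso_factor:
  assumes o: "x \<in> Obj C" "a \<in> Obj C" "b \<in> Obj C" and p: "is_iso C x a p" and q: "is_iso C x b q"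
    and f: "f \<in> Hom C a b" and e: "Cmp C f p = q"
  shows "is_iso C a b f"
proof -
  obtain p' where p': "p \<in> Hom C x a" "p' \<in> Hom C a x" "Cmp C p' p = Ident C x" "Cmp C p p' = Ident C a"
    using is_iso_E[OF p] by blast
  obtain q' where q': "q \<in> Hom C x b" "q' \<in> Hom C b x" "Cmp C q' q = Ident C x" "Cmp C q q' = Ident C b"
    using is_iso_E[OF q] by blast
  have f2: "f = Cmp C q p'" unfolding e[symmetric] using o p' f by (simp add: cmp_assoc[of a x a b]
      cmp_ident_right)
  show ?thesis
  proof (rule is_isoI[OF f])
    show "Cmp C p q' \<in> Hom C b a" using o p' q' cmp_hom[of b x a q' p] by simp
    have "Cmp C (Cmp C p q') f = Cmp C p (Cmp C q' (Cmp C q p'))"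
      unfolding f2 using o p' q' cmp_hom[of a x b p' q] by (intro cmp_assoc) auto
    also have "Cmp C q' (Cmp C q p') = p'"
      using o p' q' by (simp add: cmp_assoc[of a x b x, symmetric] cmp_ident_left)
    finally show "Cmp C (Cmp C p q') f = Ident C a" using p' by simp
    have "Cmp C f (Cmp C p q') = Cmp C (Cmp C f p) q'" using o p' q' f by (intro cmp_assoc[of b x a
        b, symmetric]) auto
    thus "Cmp C f (Cmp C p q') = Ident C b" using e q' by simp
  qed
qed

lemma is_iso_neg:
  assumes "a \<in> Obj C" "b \<in> Obj C" "is_iso C a b f" shows "is_iso C a b (hom_neg C a b f)"
proof -
  obtain g where g: "f \<in> Hom C a b" "g \<in> Hom C b a" "Cmp C g f = Ident C a" "Cmp C f g = Ident C b"
    using is_iso_E[OF assms(3)] by blast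
  show ?thesis
    by (rule is_isoI[where g = "hom_neg C b a g"])
      (use g assms in \<open>simp_all add: neg_closed cmp_neg_left[of a b a] cmp_neg_right[of a b a]
        cmp_neg_left[of b a b] cmp_neg_right[of b a b] neg_neg ident_hom\<close>)
qed

subsection \<open>Biproducts\<close>

lemma biproductD:
  assumes "is_biproduct C I X U \<iota> \<pi>"
  shows "finite I" "U \<in> Obj C" "i \<in> I \<Longrightarrow> X i \<in> Obj C" "i \<in> I \<Longrightarrow> \<iota> i \<in> Hom C (X i) U"
    "i \<in> I \<Longrightarrow> \<pi> i \<in> Hom C U (X i)" "i \<in> I \<Longrightarrow> Cmp C (\<pi> i) (\<iota> i) = Ident C (X i)"
    "i \<in> I \<Longrightarrow> j \<in> I \<Longrightarrow> i \<noteq> j \<Longrightarrow> Cmp C (\<pi> i) (\<iota> j) = Zero_hom C (X j) (X i)"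
    "hom_sum C U U (\<lambda>i. Cmp C (\<iota> i) (\<pi> i)) I = Ident C U"
  using assms unfolding is_biproduct_def by auto

text \<open>Matrix multiplication.\<close>

lemma biproduct_cmp:
  assumes b: "is_biproduct C I X U \<iota> \<pi>" and YZ: "Y \<in> Obj C" "Z \<in> Obj C"
    and q: "q \<in> Hom C U Y" and f: "f \<in> Hom C Z U"
  shows "Cmp C q f = hom_sum C Z Y (\<lambda>i. Cmp C (Cmp C q (\<iota> i)) (Cmp C (\<pi> i) f)) I"
proof -
  note B = biproductD[OF b]
  have ip: "Cmp C (\<iota> i) (\<pi> i) \<in> Hom C U U" if "i \<in> I" for i
    using B that cmp_hom[of U "X i" U "\<pi> i" "\<iota> i"] by auto
  have "Cmp C q f = Cmp C q (Cmp C (hom_sum C U U (\<lambda>i. Cmp C (\<iota> i) (\<pi> i)) I) f)"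
    using B f YZ by (simp add: cmp_ident_left)
  also have "Cmp C (hom_sum C U U (\<lambda>i. Cmp C (\<iota> i) (\<pi> i)) I) f = hom_sum C Z U (\<lambda>i. Cmp C (Cmp C (\<iota>
      i) (\<pi> i)) f) I"
    using B ip f YZ by (intro cmp_hom_sum_left) auto
  also have "Cmp C q \<dots> = hom_sum C Z Y (\<lambda>i. Cmp C q (Cmp C (Cmp C (\<iota> i) (\<pi> i)) f)) I"
    using B ip f YZ q by (intro cmp_hom_sum_right) (auto intro: cmp_hom)
  also have "\<dots> = hom_sum C Z Y (\<lambda>i. Cmp C (Cmp C q (\<iota> i)) (Cmp C (\<pi> i) f)) I"
  proof (rule hom_sum_cong)
    fix i assume i: "i \<in> I"
    have t: "X i \<in> Obj C" "\<iota> i \<in> Hom C (X i) U" "\<pi> i \<in> Hom C U (X i)" "U \<in> Obj C" using B i by auto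
    have pf: "Cmp C (\<pi> i) f \<in> Hom C Z (X i)" using t f YZ cmp_hom[of Z U "X i"] by auto
    have qi: "Cmp C q (\<iota> i) \<in> Hom C (X i) Y" using t q YZ cmp_hom[of "X i" U Y] by auto
    show "Cmp C (Cmp C q (\<iota> i)) (Cmp C (\<pi> i) f) \<in> Hom C Z Y" using pf qi t YZ cmp_hom[of Z "X i" Y]
        by auto
    have "Cmp C (Cmp C (\<iota> i) (\<pi> i)) f = Cmp C (\<iota> i) (Cmp C (\<pi> i) f)" using t f YZ by (intro
        cmp_assoc[of Z U "X i" U]) auto
    moreover have "Cmp C (Cmp C q (\<iota> i)) (Cmp C (\<pi> i) f) = Cmp C q (Cmp C (\<iota> i) (Cmp C (\<pi> i) f))"
      using t q pf YZ by (intro cmp_assoc[of Z "X i" U Y]) auto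
    ultimately show "Cmp C q (Cmp C (Cmp C (\<iota> i) (\<pi> i)) f) = Cmp C (Cmp C q (\<iota> i)) (Cmp C (\<pi> i) f)"
        by simp
  qed (use YZ in auto)
  finally show ?thesis .
qed

lemma biproduct_eqI_proj:
  assumes b: "is_biproduct C I X U \<iota> \<pi>" and Z: "Z \<in> Obj C"
    and f: "f \<in> Hom C Z U" and z: "\<And>i. i \<in> I \<Longrightarrow> Cmp C (\<pi> i) f = Zero_hom C Z (X i)"
  shows "f = Zero_hom C Z U"
proof -
  note B = biproductD[OF b]
  have "Cmp C (Ident C U) f = hom_sum C Z U (\<lambda>i. Cmp C (Cmp C (Ident C U) (\<iota> i)) (Cmp C (\<pi> i) f)) I"
    using B Z f by (intro biproduct_cmp[OF b]) (auto simp: ident_hom)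
  also have "\<dots> = Zero_hom C Z U"
  proof (rule hom_sum_zero)
    show "Cmp C (Cmp C (Ident C U) (\<iota> i)) (Cmp C (\<pi> i) f) = Zero_hom C Z U" if i: "i \<in> I" for i
      using B i Z cmp_ident_left[of "X i" U "\<iota> i"] cmp_zero_right[of Z "X i" U "\<iota> i"] by (simp add:
          z[OF i])
  qed (use B Z in auto)
  finally show ?thesis using B Z f by (simp add: cmp_ident_left)
qed

lemma biproduct_coproduct:
  assumes b: "is_biproduct C I X U \<iota> \<pi>" shows "is_coproduct C I X U \<iota>"
proof -
  note B = biproductD[OF b]
  have "\<exists>!h. h \<in> Hom C U Y \<and> (\<forall>i\<in>I. Cmp C h (\<iota> i) = f i)"
    if Y: "Y \<in> Obj C" and f: "\<And>i. i \<in> I \<Longrightarrow> f i \<in> Hom C (X i) Y" for Y f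
  proof (rule ex1I)
    let ?h = "hom_sum C U Y (\<lambda>i. Cmp C (f i) (\<pi> i)) I"
    have fp: "Cmp C (f i) (\<pi> i) \<in> Hom C U Y" if "i \<in> I" for i
      using B f Y that cmp_hom[of U "X i" Y "\<pi> i" "f i"] by auto
    show "?h \<in> Hom C U Y \<and> (\<forall>i\<in>I. Cmp C ?h (\<iota> i) = f i)"
    proof (intro conjI ballI)
      show "?h \<in> Hom C U Y" using B fp Y by (intro hom_sum_closed) auto
      fix j assume j: "j \<in> I"
      have a: "Cmp C (Cmp C (f i) (\<pi> i)) (\<iota> j) = Cmp C (f i) (Cmp C (\<pi> i) (\<iota> j))" if "i \<in> I" for i
        using B f Y j that by (intro cmp_assoc[of "X j" U "X i" Y]) auto
      have "Cmp C ?h (\<iota> j) = hom_sum C (X j) Y (\<lambda>i. Cmp C (Cmp C (f i) (\<pi> i)) (\<iota> j)) I"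
        using B fp Y j by (intro cmp_hom_sum_left) auto
      also have "\<dots> = Cmp C (Cmp C (f j) (\<pi> j)) (\<iota> j)"
      proof (rule hom_sum_single)
        show "Cmp C (Cmp C (f j) (\<pi> j)) (\<iota> j) \<in> Hom C (X j) Y" using B(2-4) fp Y j cmp_hom[of "X j"
            U Y] by auto
        fix i assume i: "i \<in> I" "i \<noteq> j"
        show "Cmp C (Cmp C (f i) (\<pi> i)) (\<iota> j) = Zero_hom C (X j) Y"
          unfolding a[OF i(1)] using B f Y i j by (simp add: cmp_zero_right[of "X j" "X i" Y])
      qed (use B Y j in auto)
      also have "\<dots> = f j" unfolding a[OF j] using B f Y j by (simp add: cmp_ident_right[of "X j" Y])
      finally show "Cmp C ?h (\<iota> j) = f j" .
    qed
    fix h assume h: "h \<in> Hom C U Y \<and> (\<forall>i\<in>I. Cmp C h (\<iota> i) = f i)"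
    have "Cmp C h (Ident C U) = hom_sum C U Y (\<lambda>i. Cmp C (Cmp C h (\<iota> i)) (Cmp C (\<pi> i) (Ident C U))) I"
      using B Y h by (intro biproduct_cmp[OF b]) (auto simp: ident_hom)
    also have "\<dots> = ?h"
    proof (rule hom_sum_cong)
      show "Cmp C (Cmp C h (\<iota> i)) (Cmp C (\<pi> i) (Ident C U)) = Cmp C (f i) (\<pi> i)" if i: "i \<in> I" for i
        using B i h cmp_ident_right[of U "X i" "\<pi> i"] by simp
    qed (use B Y fp in auto)
    finally show "h = ?h" using B h Y by (simp add: cmp_ident_right)
  qed
  thus ?thesis unfolding is_coproduct_def using B(2,4) by simp
qed

lemma coproductD:
  assumes "is_coproduct C I X U \<iota>"
  shows "U \<in> Obj C" "i \<in> I \<Longrightarrow> \<iota> i \<in> Hom C (X i) U"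
  using assms unfolding is_coproduct_def by auto

lemma coproduct_ex:
  assumes "is_coproduct C I X U \<iota>" "Y \<in> Obj C" "\<And>i. i \<in> I \<Longrightarrow> f i \<in> Hom C (X i) Y"
  shows "\<exists>h. h \<in> Hom C U Y \<and> (\<forall>i\<in>I. Cmp C h (\<iota> i) = f i)"
proof -
  have "\<forall>i\<in>I. f i \<in> Hom C (X i) Y" using assms(3) by blast
  hence "\<exists>!h. h \<in> Hom C U Y \<and> (\<forall>i\<in>I. Cmp C h (\<iota> i) = f i)"
    using assms(1,2) unfolding is_coproduct_def by simp
  thus ?thesis by (rule ex1_implies_ex)
qed

lemma coproduct_eqI:
  assumes "is_coproduct C I X U \<iota>" "Y \<in> Obj C" "h \<in> Hom C U Y" "h' \<in> Hom C U Y"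
    "\<And>i. i \<in> I \<Longrightarrow> X i \<in> Obj C" "\<And>i. i \<in> I \<Longrightarrow> Cmp C h (\<iota> i) = Cmp C h' (\<iota> i)"
  shows "h = h'"
proof -
  have "\<forall>i\<in>I. Cmp C h' (\<iota> i) \<in> Hom C (X i) Y"
    using assms cmp_hom[of "X _" U Y "\<iota> _" h'] unfolding is_coproduct_def by auto
  hence "\<exists>!k. k \<in> Hom C U Y \<and> (\<forall>i\<in>I. Cmp C k (\<iota> i) = Cmp C h' (\<iota> i))"
    using assms(1,2) unfolding is_coproduct_def by simp
  moreover have "h \<in> Hom C U Y \<and> (\<forall>i\<in>I. Cmp C h (\<iota> i) = Cmp C h' (\<iota> i))" using assms(3,6) by simp
  moreover have "h' \<in> Hom C U Y \<and> (\<forall>i\<in>I. Cmp C h' (\<iota> i) = Cmp C h' (\<iota> i))" using assms(4) by simp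
  ultimately show ?thesis by (rule ex1_eq)
qed

text \<open>The projections are the morphisms out of the coproduct with the entries of the identity matrix; that the
  sum of injection after projection is the identity may be tested on the injections.\<close>

lemma coproduct_biproduct:
  assumes c: "is_coproduct C I X U \<iota>" and I: "finite I" and X: "\<And>i. i \<in> I \<Longrightarrow> X i \<in> Obj C"
  shows "\<exists>\<pi>. is_biproduct C I X U \<iota> \<pi>"
proof -
  have U: "U \<in> Obj C" and \<iota>: "\<And>i. i \<in> I \<Longrightarrow> \<iota> i \<in> Hom C (X i) U" using coproductD[OF c] by auto
  let ?d = "\<lambda>i j. if i = j then Ident C (X i) else Zero_hom C (X j) (X i)"
  have "\<exists>h. h \<in> Hom C U (X i) \<and> (\<forall>j\<in>I. Cmp C h (\<iota> j) = ?d i j)" if i: "i \<in> I" for i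
  proof -
    have "?d i j \<in> Hom C (X j) (X i)" if "j \<in> I" for j using X i that by (auto simp: ident_hom)
    from coproduct_ex[OF c X[OF i], of "?d i", OF this] show ?thesis .
  qed
  then obtain \<pi> where \<pi>: "\<And>i. i \<in> I \<Longrightarrow> \<pi> i \<in> Hom C U (X i) \<and> (\<forall>j\<in>I. Cmp C (\<pi> i) (\<iota> j) = ?d i j)"
    by metis
  let ?s = "hom_sum C U U (\<lambda>i. Cmp C (\<iota> i) (\<pi> i)) I"
  have ip: "Cmp C (\<iota> i) (\<pi> i) \<in> Hom C U U" if "i \<in> I" for i
    using U X \<iota> \<pi> that cmp_hom[of U "X i" U "\<pi> i" "\<iota> i"] by auto
  have "?s = Ident C U"
  proof (rule coproduct_eqI[OF c U _ _ X])
    show "?s \<in> Hom C U U" using U ip by (intro hom_sum_closed) auto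
    fix j assume j: "j \<in> I"
    have a: "Cmp C (Cmp C (\<iota> i) (\<pi> i)) (\<iota> j) = Cmp C (\<iota> i) (?d i j)" if "i \<in> I" for i
      using U X \<iota> \<pi> j that cmp_assoc[of "X j" U "X i" U "\<iota> j" "\<pi> i" "\<iota> i"] by auto
    have "Cmp C ?s (\<iota> j) = hom_sum C (X j) U (\<lambda>i. Cmp C (Cmp C (\<iota> i) (\<pi> i)) (\<iota> j)) I"
      using U X \<iota> ip j I by (intro cmp_hom_sum_left) auto
    also have "\<dots> = Cmp C (Cmp C (\<iota> j) (\<pi> j)) (\<iota> j)"
    proof (rule hom_sum_single)
      show "Cmp C (Cmp C (\<iota> j) (\<pi> j)) (\<iota> j) \<in> Hom C (X j) U" using U X \<iota> ip j cmp_hom[of "X j" U U]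
          by auto
      fix i assume i: "i \<in> I" "i \<noteq> j"
      show "Cmp C (Cmp C (\<iota> i) (\<pi> i)) (\<iota> j) = Zero_hom C (X j) U"
        unfolding a[OF i(1)] using U X \<iota> i j by (simp add: cmp_zero_right[of "X j" "X i" U])
    qed (use U X j I in auto)
    also have "\<dots> = Cmp C (Ident C U) (\<iota> j)" unfolding a[OF j] using U X \<iota> j by (simp add:
        cmp_ident_right[of "X j" U] cmp_ident_left[of "X j" U])
    finally show "Cmp C ?s (\<iota> j) = Cmp C (Ident C U) (\<iota> j)" .
  qed (use U in \<open>simp add: ident_hom\<close>)
  hence "is_biproduct C I X U \<iota> \<pi>" unfolding is_biproduct_def using I U X \<iota> \<pi> by simp
  thus ?thesis by blast
qed

lemma coproduct_Sigma:
  assumes c: "is_coproduct C I F U \<iota>" and F: "\<And>i. i \<in> I \<Longrightarrow> is_coproduct C (K i) (X i) (F i) (\<kappa> i)"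
    and X: "\<And>i k. i \<in> I \<Longrightarrow> k \<in> K i \<Longrightarrow> X i k \<in> Obj C"
  shows "is_coproduct C (Sigma I K) (\<lambda>(i, k). X i k) U (\<lambda>(i, k). Cmp C (\<iota> i) (\<kappa> i k))"
proof -
  have U: "U \<in> Obj C" and \<iota>: "\<And>i. i \<in> I \<Longrightarrow> \<iota> i \<in> Hom C (F i) U" using coproductD[OF c] by auto
  have FO: "\<And>i. i \<in> I \<Longrightarrow> F i \<in> Obj C" and \<kappa>: "\<And>i k. i \<in> I \<Longrightarrow> k \<in> K i \<Longrightarrow> \<kappa> i k \<in> Hom C (X i k) (F i)"
    using coproductD[OF F] by auto
  have as: "Cmp C h (Cmp C (\<iota> i) (\<kappa> i k)) = Cmp C (Cmp C h (\<iota> i)) (\<kappa> i k)"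
    if "h \<in> Hom C U Y" "Y \<in> Obj C" "i \<in> I" "k \<in> K i" for h Y i k
    using that U \<iota> FO \<kappa> X by (intro cmp_assoc[of "X i k" "F i" U Y, symmetric]) auto
  have uni: "\<exists>!h. h \<in> Hom C U Y \<and> (\<forall>p\<in>Sigma I K. Cmp C h (case p of (i, k) \<Rightarrow> Cmp C (\<iota> i) (\<kappa> i k)) =
      f p)"
    if Y: "Y \<in> Obj C" and f: "\<And>p. p \<in> Sigma I K \<Longrightarrow> f p \<in> Hom C (case p of (i, k) \<Rightarrow> X i k) Y" for Y f
  proof -
    have "\<exists>g. g \<in> Hom C (F i) Y \<and> (\<forall>k\<in>K i. Cmp C g (\<kappa> i k) = f (i, k))" if i: "i \<in> I" for i
    proof -
      have "f (i, k) \<in> Hom C (X i k) Y" if "k \<in> K i" for k using f[of "(i, k)"] i that by simp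
      from coproduct_ex[OF F[OF i] Y, of "\<lambda>k. f (i, k)", OF this] show ?thesis .
    qed
    then obtain g where g: "\<And>i. i \<in> I \<Longrightarrow> g i \<in> Hom C (F i) Y \<and> (\<forall>k\<in>K i. Cmp C (g i) (\<kappa> i k) = f (i, k))"
      by metis
    then obtain h where h: "h \<in> Hom C U Y" "\<And>i. i \<in> I \<Longrightarrow> Cmp C h (\<iota> i) = g i"
      using coproduct_ex[OF c Y, of g] by auto
    show ?thesis
    proof (rule ex1I[of _ h])
      show "h \<in> Hom C U Y \<and> (\<forall>p\<in>Sigma I K. Cmp C h (case p of (i, k) \<Rightarrow> Cmp C (\<iota> i) (\<kappa> i k)) = f p)"
        using h g as[OF h(1) Y] by auto
      fix h' assume h': "h' \<in> Hom C U Y \<and> (\<forall>p\<in>Sigma I K. Cmp C h' (case p of (i, k) \<Rightarrow> Cmp C (\<iota> i) (\<kappa>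
          i k)) = f p)"
      show "h' = h"
      proof (rule coproduct_eqI[OF c Y _ h(1) FO])
        fix i assume i: "i \<in> I"
        show "Cmp C h' (\<iota> i) = Cmp C h (\<iota> i)"
        proof (rule coproduct_eqI[OF F[OF i] Y _ _ X[OF i]])
          fix k assume k: "k \<in> K i"
          show "Cmp C (Cmp C h' (\<iota> i)) (\<kappa> i k) = Cmp C (Cmp C h (\<iota> i)) (\<kappa> i k)"
            using h' as[of h' Y i k] g[OF i] h(2)[OF i] i k Y by force
        qed (use h' h(1) i U FO \<iota> Y cmp_hom[of "F i" U Y] in auto)
      qed (use h' in auto)
    qed
  qed
  show ?thesis unfolding is_coproduct_def
  proof (intro conjI allI impI)
    show "\<forall>p\<in>Sigma I K. (case p of (i, k) \<Rightarrow> Cmp C (\<iota> i) (\<kappa> i k)) \<in> Hom C (case p of (i, k) \<Rightarrow> X i k) U"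
    proof
      fix p assume "p \<in> Sigma I K"
      then obtain i k where p: "p = (i, k)" "i \<in> I" "k \<in> K i" by blast
      show "(case p of (i, k) \<Rightarrow> Cmp C (\<iota> i) (\<kappa> i k)) \<in> Hom C (case p of (i, k) \<Rightarrow> X i k) U"
        using p U \<iota> FO \<kappa> X cmp_hom[of "X i k" "F i" U "\<kappa> i k" "\<iota> i"] by auto
    qed
  qed (use U uni in blast)+
qed

lemma dsum_coproduct:
  assumes "\<exists>U \<iota>. is_coproduct C I X U \<iota>"
  shows "is_coproduct C I X (dsum_obj C I X) (dsum_inj C I X)"
proof -
  have "\<exists>p. case p of (U, \<iota>) \<Rightarrow> is_coproduct C I X U \<iota>" using assms by auto
  hence "case dsum C I X of (U, \<iota>) \<Rightarrow> is_coproduct C I X U \<iota>" unfolding dsum_def by (rule someI_ex)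
  thus ?thesis unfolding dsum_obj_def dsum_inj_def by (simp add: case_prod_beta)
qed

lemma copair_props:
  assumes "is_coproduct C I X (dsum_obj C I X) (dsum_inj C I X)" "Y \<in> Obj C"
    "\<And>i. i \<in> I \<Longrightarrow> f i \<in> Hom C (X i) Y"
  shows "copair C I X Y f \<in> Hom C (dsum_obj C I X) Y"
    "i \<in> I \<Longrightarrow> Cmp C (copair C I X Y f) (dsum_inj C I X i) = f i"
proof -
  have "\<forall>i\<in>I. f i \<in> Hom C (X i) Y" using assms(3) by blast
  hence "\<exists>!h. h \<in> Hom C (dsum_obj C I X) Y \<and> (\<forall>i\<in>I. Cmp C h (dsum_inj C I X i) = f i)"
    using assms(1,2) unfolding is_coproduct_def by simp
  from theI'[OF this] show "copair C I X Y f \<in> Hom C (dsum_obj C I X) Y"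
    "i \<in> I \<Longrightarrow> Cmp C (copair C I X Y f) (dsum_inj C I X i) = f i" unfolding copair_def by auto
qed

end

lemma (in abelian_category) finite_coproducts:
  assumes "finite I" "\<And>i. i \<in> I \<Longrightarrow> X i \<in> Obj C"
  shows "\<exists>U \<iota>. is_coproduct C I X U \<iota>"
  using assms
proof (induction I)
  case empty
  obtain z where "is_zero_object C z" using zero_object by blast
  hence "is_coproduct C {} X z (\<lambda>_. undefined)" unfolding is_zero_object_def is_coproduct_def by simp
  thus ?case by blast
next
  case (insert i I)
  then obtain V \<kappa> where V: "is_coproduct C I X V \<kappa>" by blast
  have VO: "V \<in> Obj C" and \<kappa>: "\<And>k. k \<in> I \<Longrightarrow> \<kappa> k \<in> Hom C (X k) V" using coproductD[OF V] by auto
  obtain U \<mu> where U: "is_coproduct C (UNIV :: bool set) (\<lambda>t. if t then X i else V) U \<mu>"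
    using binary_sums[of "X i" V] insert VO by blast
  have UO: "U \<in> Obj C" and \<mu>: "\<mu> True \<in> Hom C (X i) U" "\<mu> False \<in> Hom C V U"
    using coproductD[OF U] coproductD(2)[OF U, of True] coproductD(2)[OF U, of False] by auto
  let ?\<iota> = "\<lambda>k. if k = i then \<mu> True else Cmp C (\<mu> False) (\<kappa> k)"
  have as: "Cmp C h (Cmp C (\<mu> False) (\<kappa> k)) = Cmp C (Cmp C h (\<mu> False)) (\<kappa> k)"
    if "h \<in> Hom C U Y" "Y \<in> Obj C" "k \<in> I" for h Y k
    using that UO VO \<mu> \<kappa> insert by (intro cmp_assoc[of "X k" V U Y, symmetric]) auto
  have "is_coproduct C (insert i I) X U ?\<iota>"
    unfolding is_coproduct_def
  proof (intro conjI ballI allI impI)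
    show "U \<in> Obj C" by (rule UO)
    show "?\<iota> k \<in> Hom C (X k) U" if "k \<in> insert i I" for k
      using that UO VO \<mu> \<kappa> insert by (auto intro: cmp_hom[of _ V])
    fix Y f assume Y: "Y \<in> Obj C" and f: "\<forall>k\<in>insert i I. f k \<in> Hom C (X k) Y"
    then obtain g where g: "g \<in> Hom C V Y" "\<And>k. k \<in> I \<Longrightarrow> Cmp C g (\<kappa> k) = f k"
      using coproduct_ex[OF V Y, of f] f by auto
    have "(if t then f i else g) \<in> Hom C (if t then X i else V) Y" for t using f g by auto
    then obtain h where h': "h \<in> Hom C U Y" "\<And>t. Cmp C h (\<mu> t) = (if t then f i else g)"
      using coproduct_ex[OF U Y, of "\<lambda>t. if t then f i else g"] by auto
    hence h: "h \<in> Hom C U Y" "Cmp C h (\<mu> True) = f i" "Cmp C h (\<mu> False) = g" by auto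
    show "\<exists>!h. h \<in> Hom C U Y \<and> (\<forall>k\<in>insert i I. Cmp C h (?\<iota> k) = f k)"
    proof (rule ex1I[of _ h])
      show "h \<in> Hom C U Y \<and> (\<forall>k\<in>insert i I. Cmp C h (?\<iota> k) = f k)"
        using h g as[OF h(1) Y] insert.hyps by auto
      fix h' assume h': "h' \<in> Hom C U Y \<and> (\<forall>k\<in>insert i I. Cmp C h' (?\<iota> k) = f k)"
      have 1: "Cmp C h' (\<mu> True) = f i" using h' by auto
      have 2: "Cmp C h' (\<mu> False) = g"
      proof (rule coproduct_eqI[OF V Y])
        show "Cmp C h' (\<mu> False) \<in> Hom C V Y" using h' \<mu> UO VO Y cmp_hom[of V U Y] by auto
        fix k assume k: "k \<in> I"
        have "Cmp C h' (?\<iota> k) = f k" "k \<noteq> i" using h' k insert.hyps by auto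
        thus "Cmp C (Cmp C h' (\<mu> False)) (\<kappa> k) = Cmp C g (\<kappa> k)" using as[of h' Y k] h' Y k g by auto
      qed (use g insert in auto)
      show "h' = h"
      proof (rule coproduct_eqI[OF U Y])
        fix t :: bool
        show "Cmp C h' (\<mu> t) = Cmp C h (\<mu> t)" using 1 2 h by (cases t) auto
      qed (use h' h insert VO in \<open>auto split: if_splits\<close>)
    qed
  qed
  thus ?case by blast
qed

lemma (in abelian_category) finite_biproducts:
  assumes "finite I" "\<And>i. i \<in> I \<Longrightarrow> X i \<in> Obj C"
  shows "\<exists>U \<iota> \<pi>. is_biproduct C I X U \<iota> \<pi>"
proof -
  obtain U \<iota> where "is_coproduct C I X U \<iota>" using finite_coproducts[of I X] assms by auto
  from coproduct_biproduct[OF this assms] show ?thesis by blast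
qed

section \<open>Homology\<close>

lemma finite_max_rank:
  assumes "finite N" "N \<noteq> {}" shows "\<exists>m\<in>N. \<forall>l\<in>N. \<rho> l \<le> (\<rho> m :: nat)"
proof -
  have "Max (\<rho> ` N) \<in> \<rho> ` N" using assms by (intro Max_in) auto
  then obtain m where "m \<in> N" "Max (\<rho> ` N) = \<rho> m" by blast
  thus ?thesis using Max_ge[of "\<rho> ` N"] assms(1) by (intro bexI[of _ m]) auto
qed

context preadditive_category
begin

lemma kernelD:
  assumes "is_kernel C a b f K k"
  shows "K \<in> Obj C" "k \<in> Hom C K a" "Cmp C f k = Zero_hom C K b"
  using assms unfolding is_kernel_def by auto

lemma kernel_factor:
  assumes "is_kernel C a b f K k" "X \<in> Obj C" "g \<in> Hom C X a" "Cmp C f g = Zero_hom C X b"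
  shows "\<exists>!h. h \<in> Hom C X K \<and> Cmp C k h = g"
  using assms unfolding is_kernel_def by simp

lemma kernel_cancel:
  assumes k: "is_kernel C a b f K k" and o: "a \<in> Obj C" "b \<in> Obj C" "X \<in> Obj C" and f: "f \<in> Hom C a b"
    and g: "g \<in> Hom C X K" "h \<in> Hom C X K" and e: "Cmp C k g = Cmp C k h"
  shows "g = h"
proof -
  note K = kernelD[OF k]
  have "Cmp C f (Cmp C k g) = Zero_hom C X b"
    using K o f g by (simp add: cmp_assoc[of X K a b, symmetric] cmp_zero_left)
  moreover have "Cmp C k g \<in> Hom C X a" using K o g cmp_hom by blast
  ultimately have "\<exists>!x. x \<in> Hom C X K \<and> Cmp C k x = Cmp C k g" using kernel_factor[OF k o(3)] by simp
  thus ?thesis by (rule ex1_eq) (use g e in simp_all)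
qed

lemma cokernelD:
  assumes "is_cokernel C a b f Q q"
  shows "Q \<in> Obj C" "q \<in> Hom C b Q" "Cmp C q f = Zero_hom C a Q"
  using assms unfolding is_cokernel_def by auto

lemma cokernel_factor:
  assumes "is_cokernel C a b f Q q" "X \<in> Obj C" "g \<in> Hom C b X" "Cmp C g f = Zero_hom C a X"
  shows "\<exists>!h. h \<in> Hom C Q X \<and> Cmp C h q = g"
  using assms unfolding is_cokernel_def by simp

lemma cokernel_cancel:
  assumes q: "is_cokernel C a b f Q q" and o: "a \<in> Obj C" "b \<in> Obj C" "X \<in> Obj C" and f: "f \<in> Hom C a b"
    and g: "g \<in> Hom C Q X" "h \<in> Hom C Q X" and e: "Cmp C g q = Cmp C h q"
  shows "g = h"
proof -
  note Q = cokernelD[OF q]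
  have "Cmp C (Cmp C g q) f = Zero_hom C a X"
    using Q o f g by (simp add: cmp_assoc[of a b Q X] cmp_zero_right)
  moreover have "Cmp C g q \<in> Hom C b X" using Q o g cmp_hom by blast
  ultimately have "\<exists>!x. x \<in> Hom C Q X \<and> Cmp C x q = Cmp C g q" using cokernel_factor[OF q o(3)] by simp
  thus ?thesis by (rule ex1_eq) (use g e in simp_all)
qed

lemma homology_comparison:
  assumes o: "a \<in> Obj C" "b \<in> Obj C" "c \<in> Obj C" and f: "f \<in> Hom C a b" and g: "g \<in> Hom C b c"
    and k: "is_kernel C b c g K k" "f1 \<in> Hom C a K" "Cmp C k f1 = f" "is_cokernel C a K f1 H q"
    and k': "is_kernel C b c g K' k'" "f2 \<in> Hom C a K'" "Cmp C k' f2 = f" "is_cokernel C a K' f2 H' q'"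
  shows "\<exists>i h. i \<in> Hom C K K' \<and> Cmp C k' i = k \<and> h \<in> Hom C H H' \<and> Cmp C h q = Cmp C q' i"
proof -
  note K = kernelD[OF k(1)] and K' = kernelD[OF k'(1)] and Q = cokernelD[OF k(4)] and Q' =
      cokernelD[OF k'(4)]
  obtain i where i: "i \<in> Hom C K K'" "Cmp C k' i = k"
    using kernel_factor[OF k'(1) K(1,2,3)] by blast
  have "Cmp C i f1 = f2"
  proof (rule kernel_cancel[OF k'(1) o(2,3,1) g _ k'(2)])
    show "Cmp C i f1 \<in> Hom C a K'" using i k K K' o cmp_hom[of a K K'] by simp
    show "Cmp C k' (Cmp C i f1) = Cmp C k' f2"
      using i k k' K K' o by (simp add: cmp_assoc[of a K K' b, symmetric])
  qed
  hence "Cmp C (Cmp C q' i) f1 = Zero_hom C a H'"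
    using i k K K' Q' o by (simp add: cmp_assoc[of a K K' H'])
  moreover have "Cmp C q' i \<in> Hom C K H'" using i K K' Q' cmp_hom[of K K' H'] by simp
  ultimately obtain h where "h \<in> Hom C H H'" "Cmp C h q = Cmp C q' i"
    using cokernel_factor[OF k(4) Q'(1)] by blast
  thus ?thesis using i by blast
qed

text \<open>The comparison morphisms in both directions are mutually inverse, because morphisms into a kernel and out
  of a cokernel are determined by their composites with the structure maps.\<close>

lemma homology_unique:
  assumes o: "a \<in> Obj C" "b \<in> Obj C" "c \<in> Obj C" and f: "f \<in> Hom C a b" and g: "g \<in> Hom C b c"
    and H: "is_homology C a b c f g H" and H': "is_homology C a b c f g H'"
  shows "isomorphic C H H'"
proof -
  obtain K k f1 q where k: "is_kernel C b c g K k" "f1 \<in> Hom C a K" "Cmp C k f1 = f" "is_cokernel C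
      a K f1 H q"
    using H unfolding is_homology_def by blast
  obtain K' k' f2 q' where k': "is_kernel C b c g K' k'" "f2 \<in> Hom C a K'" "Cmp C k' f2 = f"
      "is_cokernel C a K' f2 H' q'"
    using H' unfolding is_homology_def by blast
  have inv: "Cmp C h' h = Ident C H"
    if k: "is_kernel C b c g K k" "f1 \<in> Hom C a K" "is_cokernel C a K f1 H q"
      and k': "is_kernel C b c g K' k'" "is_cokernel C a K' f2 H' q'"
      and i: "i \<in> Hom C K K'" "Cmp C k' i = k" "h \<in> Hom C H H'" "Cmp C h q = Cmp C q' i"
      and i': "i' \<in> Hom C K' K" "Cmp C k i' = k'" "h' \<in> Hom C H' H" "Cmp C h' q' = Cmp C q i'"
    for K k f1 H q K' k' f2 H' q' i h i' h'
  proof -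
    note K = kernelD[OF k(1)] and K' = kernelD[OF k'(1)] and Q = cokernelD[OF k(3)] and Q' =
        cokernelD[OF k'(2)]
    have "Cmp C i' i = Ident C K"
    proof (rule kernel_cancel[OF k(1) o(2,3) K(1) g])
      show "Cmp C i' i \<in> Hom C K K" "Ident C K \<in> Hom C K K" using i i' K K' cmp_hom[of K K' K]
          ident_hom by auto
      show "Cmp C k (Cmp C i' i) = Cmp C k (Ident C K)"
        using i i' K K' o by (simp add: cmp_assoc[of K K' K b, symmetric] cmp_ident_right[of K b])
    qed
    note ii = this
    show ?thesis
    proof (rule cokernel_cancel[OF k(3) o(1) K(1) Q(1) k(2)])
      show "Cmp C h' h \<in> Hom C H H" "Ident C H \<in> Hom C H H" using i i' Q Q' cmp_hom[of H H' H]
          ident_hom by auto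
      have "Cmp C (Cmp C h' h) q = Cmp C h' (Cmp C q' i)" using i i' K Q Q' by (simp add:
          cmp_assoc[of K H H' H])
      also have "\<dots> = Cmp C (Cmp C q i') i" using i i' K K' Q Q' by (simp add: cmp_assoc[of K K' H'
          H, symmetric])
      also have "\<dots> = Cmp C q (Cmp C i' i)" using i i' K K' Q by (simp add: cmp_assoc[of K K' K H])
      also have "\<dots> = Cmp C (Ident C H) q" using ii K Q by (simp add: cmp_ident_right[of K H]
          cmp_ident_left[of K H])
      finally show "Cmp C (Cmp C h' h) q = Cmp C (Ident C H) q" .
    qed
  qed
  obtain i h where i: "i \<in> Hom C K K'" "Cmp C k' i = k" "h \<in> Hom C H H'" "Cmp C h q = Cmp C q' i"
    using homology_comparison[OF o f g k k'] by blast
  obtain i' h' where i': "i' \<in> Hom C K' K" "Cmp C k i' = k'" "h' \<in> Hom C H' H" "Cmp C h' q' = Cmp C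
      q i'"
    using homology_comparison[OF o f g k' k] by blast
  have "is_iso C H H' h"
    using inv[OF k(1,2,4) k'(1,4) i i'] inv[OF k'(1,2,4) k(1,4) i' i] i(3) i'(3) by (intro is_isoI)
  thus ?thesis unfolding isomorphic_def using cokernelD(1)[OF k(4)] cokernelD(1)[OF k'(4)] by blast
qed

lemma zero_objectD:
  assumes "is_zero_object C z"
  shows "z \<in> Obj C" "a \<in> Obj C \<Longrightarrow> f \<in> Hom C a z \<Longrightarrow> f = Zero_hom C a z"
    "a \<in> Obj C \<Longrightarrow> f \<in> Hom C z a \<Longrightarrow> f = Zero_hom C z a"
  using assms zero_closed unfolding is_zero_object_def by blast+

lemma zero_objectI:
  assumes z: "z \<in> Obj C" and i: "Ident C z = Zero_hom C z z" shows "is_zero_object C z"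
proof -
  have "f = Zero_hom C a z" if "a \<in> Obj C" "f \<in> Hom C a z" for a f
    using cmp_ident_left[of a z f] cmp_zero_left[of a z z f] that z i by simp
  moreover have "f = Zero_hom C z a" if "a \<in> Obj C" "f \<in> Hom C z a" for a f
    using cmp_ident_right[of z a f] cmp_zero_right[of z z a f] that z i by simp
  ultimately show ?thesis unfolding is_zero_object_def using z by (metis zero_closed)
qed

lemma zero_object_isomorphic:
  assumes "isomorphic C a z" "is_zero_object C z" shows "is_zero_object C a"
proof -
  obtain f g where f: "a \<in> Obj C" "z \<in> Obj C" "f \<in> Hom C a z" "g \<in> Hom C z a" "Cmp C g f = Ident C a"
    using assms(1) unfolding isomorphic_def is_iso_def inverse_homs_def by blast
  have "f = Zero_hom C a z" using zero_objectD(2)[OF assms(2)] f by simp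
  hence "Ident C a = Zero_hom C a a" using f cmp_zero_right[of a z a g] by simp
  thus ?thesis using f(1) by (intro zero_objectI)
qed

lemma homology_zero_if_epi:
  assumes o: "a \<in> Obj C" and k: "is_kernel C b c g K k" "f' \<in> Hom C a K" "Cmp C k f' = f"
    and epi: "\<And>X x y. X \<in> Obj C \<Longrightarrow> x \<in> Hom C K X \<Longrightarrow> y \<in> Hom C K X \<Longrightarrow> Cmp C x f' = Cmp C y f' \<Longrightarrow> x = y"
    and z: "is_zero_object C z"
  shows "is_homology C a b c f g z"
proof -
  note K = kernelD[OF k(1)] and Z = zero_objectD[OF z]
  have "is_cokernel C a K f' z (Zero_hom C K z)"
    unfolding is_cokernel_def
  proof (intro conjI ballI impI)
    show "Cmp C (Zero_hom C K z) f' = Zero_hom C a z" using o k K Z cmp_zero_left by blast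
    fix X x assume X: "X \<in> Obj C" and x: "x \<in> Hom C K X" "Cmp C x f' = Zero_hom C a X"
    have x0: "x = Zero_hom C K X"
      using epi[OF X x(1), of "Zero_hom C K X"] X x K o k cmp_zero_left[of a K X f'] by simp
    show "\<exists>!h. h \<in> Hom C z X \<and> Cmp C h (Zero_hom C K z) = x"
    proof (rule ex1I[of _ "Zero_hom C z X"])
      show "Zero_hom C z X \<in> Hom C z X \<and> Cmp C (Zero_hom C z X) (Zero_hom C K z) = x"
        using x0 X K Z(1) cmp_zero_left[of K z X "Zero_hom C K z"] by simp
    qed (use X Z(3) in blast)
  qed (use K Z(1) in auto)
  thus ?thesis unfolding is_homology_def using k by blast
qed

lemma minus_cmp_right:
  assumes "a \<in> Obj C" "b \<in> Obj C" "c \<in> Obj C" "f \<in> Hom C a b" "f' \<in> Hom C a b" "g \<in> Hom C b c"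
  shows "Cmp C g (Plus_hom C f (hom_neg C a b f')) = Plus_hom C (Cmp C g f) (hom_neg C a c (Cmp C g
      f'))"
  using cmp_plus_right[of a b c f "hom_neg C a b f'" g] cmp_neg_right[of a b c f' g] neg_closed[of a
      b f'] assms
  by simp

subsection \<open>Acyclic matchings\<close>

text \<open>A cycle without components at lower cells vanishes: take an upper cell \<open>u\<close> of largest rank in its support.
  Among the cells of the support only \<open>u\<close> itself has \<open>\<delta> u\<close> in its boundary, and it does so through an
  isomorphism.\<close>

lemma matched_cycle_zero:
  assumes b1: "is_biproduct C I1 E1 U1 \<iota>1 \<pi>1" and b0: "is_biproduct C I0 E0 U0 \<iota>0 \<pi>0"
    and d: "d \<in> Hom C U1 U0"
    and down: "\<And>u. u \<in> I1 - L \<Longrightarrow> \<delta> u \<in> I0 \<and> is_iso C (E1 u) (E0 (\<delta> u)) (Cmp C (\<pi>0 (\<delta> u)) (Cmp C d (\<iota>1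
        u)))"
    and rank: "\<And>u v. u \<in> I1 - L \<Longrightarrow> v \<in> I1 - L \<Longrightarrow> u \<noteq> v \<Longrightarrow> \<not> \<rho> u < (\<rho> v :: nat) \<Longrightarrow>
        Cmp C (\<pi>0 (\<delta> u)) (Cmp C d (\<iota>1 v)) = Zero_hom C (E1 v) (E0 (\<delta> u))"
    and X: "X \<in> Obj C" and f: "f \<in> Hom C X U1" "Cmp C d f = Zero_hom C X U0"
    and low: "\<And>i. i \<in> I1 \<inter> L \<Longrightarrow> Cmp C (\<pi>1 i) f = Zero_hom C X (E1 i)"
  shows "f = Zero_hom C X U1"
proof (rule biproduct_eqI_proj[OF b1 X f(1)])
  note B1 = biproductD[OF b1] and B0 = biproductD[OF b0]
  let ?T = "{u \<in> I1 - L. Cmp C (\<pi>1 u) f \<noteq> Zero_hom C X (E1 u)}"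
  have "?T = {}"
  proof (rule ccontr)
    assume "?T \<noteq> {}"
    moreover have "finite ?T" using B1(1) by auto
    ultimately obtain u where u: "u \<in> ?T" and max: "\<And>v. v \<in> ?T \<Longrightarrow> \<rho> v \<le> \<rho> u"
      using finite_max_rank[of ?T \<rho>] by meson
    have uI: "u \<in> I1" "u \<in> I1 - L" using u by auto
    let ?p = "\<pi>0 (\<delta> u)" and ?F = "E0 (\<delta> u)"
    have D: "\<delta> u \<in> I0" "is_iso C (E1 u) ?F (Cmp C ?p (Cmp C d (\<iota>1 u)))" using down uI by auto
    have p: "?p \<in> Hom C U0 ?F" "?F \<in> Obj C" using B0 D by auto
    have pd: "Cmp C ?p d \<in> Hom C U1 ?F" using p d B1 B0 cmp_hom[of U1 U0 ?F] by simp
    have co: "Cmp C (Cmp C ?p d) (\<iota>1 v) = Cmp C ?p (Cmp C d (\<iota>1 v))" if "v \<in> I1" for v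
      using p d B1 B0 that by (intro cmp_assoc[of "E1 v" U1 U0 ?F]) auto
    have pf: "Cmp C (\<pi>1 v) f \<in> Hom C X (E1 v)" if "v \<in> I1" for v
      using B1 X f that cmp_hom[of X U1 "E1 v"] by simp
    have "Cmp C (Cmp C ?p d) f = Cmp C ?p (Cmp C d f)" using p d B1 B0 X f by (intro cmp_assoc[of X
        U1 U0 ?F]) auto
    also have "\<dots> = Zero_hom C X ?F" using f X p B0 by (simp add: cmp_zero_right)
    finally have "hom_sum C X ?F (\<lambda>v. Cmp C (Cmp C (Cmp C ?p d) (\<iota>1 v)) (Cmp C (\<pi>1 v) f)) I1 =
        Zero_hom C X ?F"
      using biproduct_cmp[OF b1 p(2) X pd f(1)] by simp
    also have "hom_sum C X ?F (\<lambda>v. Cmp C (Cmp C (Cmp C ?p d) (\<iota>1 v)) (Cmp C (\<pi>1 v) f)) I1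
        = Cmp C (Cmp C (Cmp C ?p d) (\<iota>1 u)) (Cmp C (\<pi>1 u) f)"
    proof (rule hom_sum_single)
      have "Cmp C (Cmp C ?p d) (\<iota>1 u) \<in> Hom C (E1 u) ?F" using pd p B1 uI cmp_hom[of "E1 u" U1 ?F]
          by simp
      thus "Cmp C (Cmp C (Cmp C ?p d) (\<iota>1 u)) (Cmp C (\<pi>1 u) f) \<in> Hom C X ?F"
        using X pf[OF uI(1)] p B1 uI cmp_hom[of X "E1 u" ?F] by simp
      fix v assume v: "v \<in> I1" "v \<noteq> u"
      have cl: "Cmp C (Cmp C ?p d) (\<iota>1 v) \<in> Hom C (E1 v) ?F" using pd p B1 v cmp_hom[of "E1 v" U1
          ?F] by simp
      show "Cmp C (Cmp C (Cmp C ?p d) (\<iota>1 v)) (Cmp C (\<pi>1 v) f) = Zero_hom C X ?F"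
      proof (cases "v \<in> ?T")
        case True
        hence "Cmp C (Cmp C ?p d) (\<iota>1 v) = Zero_hom C (E1 v) ?F"
          using rank[of u v] max[of v] uI v co[of v] by auto
        thus ?thesis using pf[OF v(1)] B1 v X p cmp_zero_left[of X "E1 v" ?F] by simp
      next
        case False
        hence "Cmp C (\<pi>1 v) f = Zero_hom C X (E1 v)" using v low by auto
        thus ?thesis using cl B1 v X p cmp_zero_right[of X "E1 v" ?F] by simp
      qed
    qed (use X p B1 uI in auto)
    also have "\<dots> = Cmp C (Cmp C ?p (Cmp C d (\<iota>1 u))) (Cmp C (\<pi>1 u) f)" using co[OF uI(1)] by simp
    finally have e: "Cmp C (Cmp C ?p (Cmp C d (\<iota>1 u))) (Cmp C (\<pi>1 u) f) = Zero_hom C X ?F" .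
    have "Cmp C (\<pi>1 u) f = Zero_hom C X (E1 u)"
    proof (rule is_iso_cancel_left[OF X B1(3)[OF uI(1)] p(2) D(2) pf[OF uI(1)]])
      have "Cmp C ?p (Cmp C d (\<iota>1 u)) \<in> Hom C (E1 u) ?F" using D(2) is_iso_E by blast
      thus "Cmp C (Cmp C ?p (Cmp C d (\<iota>1 u))) (Cmp C (\<pi>1 u) f) = Cmp C (Cmp C ?p (Cmp C d (\<iota>1 u)))
          (Zero_hom C X (E1 u))"
        unfolding e using X B1 uI p cmp_zero_right[of X "E1 u" ?F] by simp
    qed (use X B1 uI in auto)
    thus False using u by simp
  qed
  thus "\<And>i. i \<in> I1 \<Longrightarrow> Cmp C (\<pi>1 i) f = Zero_hom C X (E1 i)" using low by auto
qed

text \<open>Cells are matched in pairs with an isomorphism as matrix coefficient: a lower cell \<open>l\<close> with the cell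
  \<open>\<mu> l\<close> one degree up, an upper cell \<open>u\<close> with the cell \<open>\<delta> u\<close> one degree down. The rank excludes closed
  paths. A cycle is first pushed off the lower cells by subtracting boundaries, in order of decreasing
  rank: removing the component at a lower cell only changes components at lower cells of smaller rank.
  What remains is a cycle supported on upper cells, which vanishes.\<close>

lemma acyclic_matching_exact:
  assumes b2: "is_biproduct C I2 E2 U2 \<iota>2 \<pi>2" and b1: "is_biproduct C I1 E1 U1 \<iota>1 \<pi>1"
    and b0: "is_biproduct C I0 E0 U0 \<iota>0 \<pi>0"
    and d: "d \<in> Hom C U1 U0" and e: "e \<in> Hom C U2 U1" and de: "Cmp C d e = Zero_hom C U2 U0"
    and down: "\<And>u. u \<in> I1 - L \<Longrightarrow> \<delta> u \<in> I0 \<and> is_iso C (E1 u) (E0 (\<delta> u)) (Cmp C (\<pi>0 (\<delta> u)) (Cmp C d (\<iota>1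
        u)))"
    and drank: "\<And>u v. u \<in> I1 - L \<Longrightarrow> v \<in> I1 - L \<Longrightarrow> u \<noteq> v \<Longrightarrow> \<not> \<rho> u < (\<rho> v :: nat) \<Longrightarrow>
        Cmp C (\<pi>0 (\<delta> u)) (Cmp C d (\<iota>1 v)) = Zero_hom C (E1 v) (E0 (\<delta> u))"
    and up: "\<And>l. l \<in> I1 \<inter> L \<Longrightarrow> \<mu> l \<in> I2 \<and> is_iso C (E2 (\<mu> l)) (E1 l) (Cmp C (\<pi>1 l) (Cmp C e (\<iota>2 (\<mu> l))))"
    and urank: "\<And>l m. l \<in> I1 \<inter> L \<Longrightarrow> m \<in> I1 \<inter> L \<Longrightarrow> l \<noteq> m \<Longrightarrow> \<not> \<rho> l < \<rho> m \<Longrightarrow>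
        Cmp C (\<pi>1 l) (Cmp C e (\<iota>2 (\<mu> m))) = Zero_hom C (E2 (\<mu> m)) (E1 l)"
    and X: "X \<in> Obj C" and f: "f \<in> Hom C X U1" "Cmp C d f = Zero_hom C X U0"
  shows "\<exists>g. g \<in> Hom C X U2 \<and> Cmp C e g = f"
proof -
  note B2 = biproductD[OF b2] and B1 = biproductD[OF b1] and B0 = biproductD[OF b0]
  \<comment> \<open>\<open>N\<close> is the set of lower cells still to be cleared; it is closed under passing to smaller rank\<close>
  have "\<exists>g. g \<in> Hom C X U2 \<and> Cmp C e g = f"
    if "finite N" "N \<subseteq> I1 \<inter> L" "\<And>l m. l \<in> N \<Longrightarrow> m \<in> I1 \<inter> L \<Longrightarrow> \<rho> m < \<rho> l \<Longrightarrow> m \<in> N"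
      "f \<in> Hom C X U1" "Cmp C d f = Zero_hom C X U0"
      "\<And>l. l \<in> I1 \<inter> L \<Longrightarrow> l \<notin> N \<Longrightarrow> Cmp C (\<pi>1 l) f = Zero_hom C X (E1 l)" for N f
    using that
  proof (induction "card N" arbitrary: N f)
    case 0
    hence "f = Zero_hom C X U1"
      by (intro matched_cycle_zero[OF b1 b0 d down drank X]) auto
    thus ?case using X B2(2) B1(2) e cmp_zero_right[of X U2 U1 e] by (intro exI[of _ "Zero_hom C X
        U2"]) simp
  next
    case (Suc c)
    have "N \<noteq> {}" using Suc.hyps(2) by auto
    then obtain m where m: "m \<in> N" and max: "\<And>l. l \<in> N \<Longrightarrow> \<rho> l \<le> \<rho> m"
      using finite_max_rank[of N \<rho>] Suc.prems(1) by meson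
    have mI: "m \<in> I1" "m \<in> I1 \<inter> L" using m Suc.prems(2) by auto
    let ?c = "\<lambda>l. Cmp C (\<pi>1 l) (Cmp C e (\<iota>2 (\<mu> m)))"
    have M: "\<mu> m \<in> I2" "is_iso C (E2 (\<mu> m)) (E1 m) (?c m)" using up[OF mI(2)] by auto
    \<comment> \<open>the boundary of \<open>?h\<close> has the same component at \<open>m\<close> as \<open>f\<close>\<close>
    obtain c' where c': "c' \<in> Hom C (E1 m) (E2 (\<mu> m))" "Cmp C (?c m) c' = Ident C (E1 m)"
      using is_iso_E[OF M(2)] by blast
    have o: "E1 m \<in> Obj C" "E2 (\<mu> m) \<in> Obj C" "U1 \<in> Obj C" "U2 \<in> Obj C" "U0 \<in> Obj C" using B2 B1 B0
        M mI by auto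
    have pf: "Cmp C (\<pi>1 m) f \<in> Hom C X (E1 m)" using B1 X Suc.prems mI cmp_hom[of X U1 "E1 m"] by simp
    let ?x = "Cmp C c' (Cmp C (\<pi>1 m) f)"
    have x: "?x \<in> Hom C X (E2 (\<mu> m))" using pf c' o X cmp_hom[of X "E1 m" "E2 (\<mu> m)"] by simp
    have im: "\<iota>2 (\<mu> m) \<in> Hom C (E2 (\<mu> m)) U2" using B2 M by simp
    let ?h = "Cmp C (\<iota>2 (\<mu> m)) ?x"
    have h: "?h \<in> Hom C X U2" using x im o X cmp_hom[of X "E2 (\<mu> m)" U2] by simp
    have eh: "Cmp C e ?h \<in> Hom C X U1" using h e o X cmp_hom[of X U2 U1] by simp
    have ei: "Cmp C e (\<iota>2 (\<mu> m)) \<in> Hom C (E2 (\<mu> m)) U1" using im e o cmp_hom[of "E2 (\<mu> m)" U2 U1] by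
        simp
    let ?f = "Plus_hom C f (hom_neg C X U1 (Cmp C e ?h))"
    have f': "?f \<in> Hom C X U1" using eh Suc.prems X o plus_closed neg_closed by simp
    have coef: "Cmp C (\<pi>1 l) (Cmp C e ?h) = Cmp C (?c l) ?x" if l: "l \<in> I1" for l
    proof -
      have "Cmp C e ?h = Cmp C (Cmp C e (\<iota>2 (\<mu> m))) ?x"
        using x im e o X by (intro cmp_assoc[of X "E2 (\<mu> m)" U2 U1, symmetric]) auto
      moreover have "Cmp C (\<pi>1 l) (Cmp C (Cmp C e (\<iota>2 (\<mu> m))) ?x) = Cmp C (?c l) ?x"
        using x ei o X B1 l by (intro cmp_assoc[of X "E2 (\<mu> m)" U1 "E1 l", symmetric]) auto
      ultimately show ?thesis by simp
    qed
    have "Cmp C d (Cmp C e ?h) = Zero_hom C X U0"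
      using cmp_assoc[of X U2 U1 U0 ?h e d] de h e d o X cmp_zero_left[of X U2 U0 ?h] by simp
    hence df: "Cmp C d ?f = Zero_hom C X U0"
      using minus_cmp_right[of X U1 U0 f "Cmp C e ?h" d] Suc.prems(4,5) eh o X d
        plus_neg(1)[of X U0 "Zero_hom C X U0"] by simp
    have "\<exists>g. g \<in> Hom C X U2 \<and> Cmp C e g = ?f"
    proof (rule Suc.hyps(1)[of "N - {m}"])
      show "c = card (N - {m})" using Suc.hyps(2) Suc.prems(1) m by simp
      show "k \<in> N - {m}" if "l \<in> N - {m}" "k \<in> I1 \<inter> L" "\<rho> k < \<rho> l" for l k
        using Suc.prems(3)[of l k] that max[of l] by auto
      show "Cmp C (\<pi>1 l) ?f = Zero_hom C X (E1 l)" if l: "l \<in> I1 \<inter> L" "l \<notin> N - {m}" for l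
      proof -
        have o': "E1 l \<in> Obj C" "\<pi>1 l \<in> Hom C U1 (E1 l)" using B1 l by auto
        have s: "Cmp C (\<pi>1 l) ?f = Plus_hom C (Cmp C (\<pi>1 l) f) (hom_neg C X (E1 l) (Cmp C (?c l) ?x))"
          using minus_cmp_right[of X U1 "E1 l" f "Cmp C e ?h" "\<pi>1 l"] coef[of l] Suc.prems(4) eh o
              o' X l by simp
        show ?thesis
        proof (cases "l = m")
          case True
          have cm: "?c m \<in> Hom C (E2 (\<mu> m)) (E1 m)" using M(2) is_iso_E by blast
          have "Cmp C (?c m) ?x = Cmp C (Cmp C (?c m) c') (Cmp C (\<pi>1 m) f)"
            using cm pf c' o X by (intro cmp_assoc[of X "E1 m" "E2 (\<mu> m)" "E1 m", symmetric]) auto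
          also have "\<dots> = Cmp C (\<pi>1 m) f" using c' pf o X cmp_ident_left[of X "E1 m"] by simp
          finally show ?thesis using s plus_neg(1)[of X "E1 m"] pf o X unfolding True by simp
        next
          case False
          hence "Cmp C (\<pi>1 l) f = Zero_hom C X (E1 l)" using Suc.prems(6)[of l] l by auto
          moreover have "\<not> \<rho> l < \<rho> m" using Suc.prems(3)[of m l] m l False by auto
          hence "?c l = Zero_hom C (E2 (\<mu> m)) (E1 l)" using urank[of l m] l mI False by simp
          hence "Cmp C (?c l) ?x = Zero_hom C X (E1 l)" using x o o' X cmp_zero_left[of X "E2 (\<mu> m)"
              "E1 l"] by simp
          ultimately show ?thesis unfolding s using plus_neg(1)[of X "E1 l" "Zero_hom C X (E1 l)"]
              o' X by simp
        qed
      qed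
    qed (use Suc.prems f' df in auto)
    then obtain g where g: "g \<in> Hom C X U2" "Cmp C e g = ?f" by blast
    have "Cmp C e (Plus_hom C g ?h) = Plus_hom C ?f (Cmp C e ?h)" using cmp_plus_right[of X U2 U1 g
        ?h e] g h e o X by simp
    also have "\<dots> = f"
    proof -
      interpret comm_group "hom_group C X U1" by (rule hom_abelian) (use X o in auto)
      show ?thesis using m_assoc[of f "hom_neg C X U1 (Cmp C e ?h)" "Cmp C e ?h"]
          plus_neg(2)[of X U1 "Cmp C e ?h"] plus_zero(1)[of X U1 f] neg_closed[of X U1 "Cmp C e ?h"]
              Suc.prems(4) eh X o by simp
    qed
    finally show ?case using plus_closed[of X U2 g ?h] g h o X by (intro exI[of _ "Plus_hom C g
        ?h"]) simp
  qed
  from this[of "I1 \<inter> L" f] show ?thesis using B1(1) f by auto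
qed

end

section \<open>Gluing data and the glued categories\<close>

locale coxeter_gluing = coxeter W S + gluing_data W S D
  for W :: "('w, 'z) monoid_scheme" (structure) and S and D :: "('w, 'o, 'm) gluing" +
  assumes abelian: "w \<in> carrier W \<Longrightarrow> abelian_category (GCat D w)"
begin

abbreviation cat where "cat \<equiv> GCat D"
abbreviation Phi where "Phi u w \<equiv> fobj (GFun D u w)"
abbreviation PhiM where "PhiM u w \<equiv> fmap (GFun D u w)"
abbreviation nu where "nu \<equiv> GNat D"

lemma preadd: "w \<in> carrier W \<Longrightarrow> preadditive_category (cat w)"
  using abelian abelian_category.axioms(1) by blast

lemma Phi_functor: "u \<in> carrier W \<Longrightarrow> w \<in> carrier W \<Longrightarrow> is_functor (cat w) (cat (u \<otimes> w)) (GFun D u w)"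
  using right_exact unfolding is_right_exact_def is_additive_functor_def by blast

lemma Phi_obj:
  "u \<in> carrier W \<Longrightarrow> w \<in> carrier W \<Longrightarrow> u \<otimes> w = v \<Longrightarrow> a \<in> Obj (cat w) \<Longrightarrow> Phi u w a \<in> Obj (cat v)"
  using Phi_functor[of u w] unfolding is_functor_def by blast

lemma Phi_hom:
  "u \<in> carrier W \<Longrightarrow> w \<in> carrier W \<Longrightarrow> u \<otimes> w = v \<Longrightarrow> a \<in> Obj (cat w) \<Longrightarrow> b \<in> Obj (cat w) \<Longrightarrow>
   f \<in> Hom (cat w) a b \<Longrightarrow> PhiM u w f \<in> Hom (cat v) (Phi u w a) (Phi u w b)"
  using Phi_functor[of u w] unfolding is_functor_def by blast

lemma Phi_ident:
  "u \<in> carrier W \<Longrightarrow> w \<in> carrier W \<Longrightarrow> u \<otimes> w = v \<Longrightarrow> a \<in> Obj (cat w) \<Longrightarrow>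
   PhiM u w (Ident (cat w) a) = Ident (cat v) (Phi u w a)"
  using Phi_functor[of u w] unfolding is_functor_def by blast

lemma Phi_cmp:
  "u \<in> carrier W \<Longrightarrow> w \<in> carrier W \<Longrightarrow> u \<otimes> w = v \<Longrightarrow> a \<in> Obj (cat w) \<Longrightarrow> b \<in> Obj (cat w) \<Longrightarrow>
   c \<in> Obj (cat w) \<Longrightarrow> f \<in> Hom (cat w) a b \<Longrightarrow> g \<in> Hom (cat w) b c \<Longrightarrow>
   PhiM u w (Cmp (cat w) g f) = Cmp (cat v) (PhiM u w g) (PhiM u w f)"
  using Phi_functor[of u w] unfolding is_functor_def by blast

lemma Phi_plus:
  "u \<in> carrier W \<Longrightarrow> w \<in> carrier W \<Longrightarrow> u \<otimes> w = v \<Longrightarrow> a \<in> Obj (cat w) \<Longrightarrow> b \<in> Obj (cat w) \<Longrightarrow>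
   f \<in> Hom (cat w) a b \<Longrightarrow> g \<in> Hom (cat w) a b \<Longrightarrow>
   PhiM u w (Plus_hom (cat w) f g) = Plus_hom (cat v) (PhiM u w f) (PhiM u w g)"
  using right_exact[of u w] unfolding is_right_exact_def is_additive_functor_def by blast

lemma Phi_zero:
  assumes "u \<in> carrier W" "w \<in> carrier W" "u \<otimes> w = v" "a \<in> Obj (cat w)" "b \<in> Obj (cat w)"
  shows "PhiM u w (Zero_hom (cat w) a b) = Zero_hom (cat v) (Phi u w a) (Phi u w b)"
proof -
  interpret C: preadditive_category "cat w" by (rule preadd) fact
  interpret V: preadditive_category "cat v" by (rule preadd) (use assms in auto)
  let ?z = "PhiM u w (Zero_hom (cat w) a b)" and ?o = "Zero_hom (cat v) (Phi u w a) (Phi u w b)"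
  have o: "Phi u w a \<in> Obj (cat v)" "Phi u w b \<in> Obj (cat v)" using Phi_obj assms by auto
  have z: "?z \<in> Hom (cat v) (Phi u w a) (Phi u w b)" using Phi_hom assms by auto
  have "Plus_hom (cat v) ?z ?z = ?z"
    using Phi_plus[OF assms, of "Zero_hom (cat w) a b" "Zero_hom (cat w) a b"] assms C.plus_zero by auto
  hence "Plus_hom (cat v) ?z ?z = Plus_hom (cat v) ?z ?o" using V.plus_zero(1)[OF o z] by simp
  thus ?thesis using V.plus_cancel[OF o z z] o by auto
qed

lemma Phi_hom_sum:
  assumes "u \<in> carrier W" "w \<in> carrier W" "u \<otimes> w = v" "a \<in> Obj (cat w)" "b \<in> Obj (cat w)"
    and "finite I" and "\<And>i. i \<in> I \<Longrightarrow> f i \<in> Hom (cat w) a b"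
  shows "PhiM u w (hom_sum (cat w) a b f I) = hom_sum (cat v) (Phi u w a) (Phi u w b) (\<lambda>i. PhiM u w
      (f i)) I"
proof -
  interpret C: preadditive_category "cat w" by (rule preadd) fact
  interpret V: preadditive_category "cat v" by (rule preadd) (use assms in auto)
  have o: "Phi u w a \<in> Obj (cat v)" "Phi u w b \<in> Obj (cat v)" using Phi_obj assms by auto
  show ?thesis using assms(6,7)
  proof (induction I)
    case empty thus ?case using Phi_zero[OF assms(1-5)] assms o by simp
  next
    case (insert i I)
    have h: "PhiM u w (f k) \<in> Hom (cat v) (Phi u w a) (Phi u w b)" if "k \<in> insert i I" for k
      using Phi_hom[OF assms(1-5)] insert.prems that by blast
    show ?case
      using insert Phi_plus[OF assms(1-5), of "f i" "hom_sum (cat w) a b f I"] assms(4,5)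
        C.hom_sum_closed[of a b I f] C.hom_sum_insert[of a b I i f]
        V.hom_sum_insert[OF o, of I i "\<lambda>i. PhiM u w (f i)"] h by simp
  qed
qed

lemma Phi_iso:
  assumes "u \<in> carrier W" "w \<in> carrier W" "u \<otimes> w = v" "a \<in> Obj (cat w)" "b \<in> Obj (cat w)"
    and "is_iso (cat w) a b f"
  shows "is_iso (cat v) (Phi u w a) (Phi u w b) (PhiM u w f)"
proof -
  interpret C: preadditive_category "cat w" by (rule preadd) fact
  interpret V: preadditive_category "cat v" by (rule preadd) (use assms in auto)
  obtain g where g: "f \<in> Hom (cat w) a b" "g \<in> Hom (cat w) b a"
    "Cmp (cat w) g f = Ident (cat w) a" "Cmp (cat w) f g = Ident (cat w) b"
    using C.is_iso_E[OF assms(6)] by blast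
  show ?thesis
  proof (rule V.is_isoI[where g = "PhiM u w g"])
    show "Cmp (cat v) (PhiM u w g) (PhiM u w f) = Ident (cat v) (Phi u w a)"
      using Phi_cmp[OF assms(1-5,4) g(1,2)] Phi_ident[OF assms(1-4)] g by simp
    show "Cmp (cat v) (PhiM u w f) (PhiM u w g) = Ident (cat v) (Phi u w b)"
      using Phi_cmp[OF assms(1-3,5,4,5) g(2,1)] Phi_ident[OF assms(1-3,5)] g by simp
  qed (use Phi_hom assms g in auto)
qed

lemma Phi_biproduct:
  assumes "u \<in> carrier W" "w \<in> carrier W" "u \<otimes> w = v" and b: "is_biproduct (cat w) I X U \<iota> \<pi>"
  shows "is_biproduct (cat v) I (\<lambda>i. Phi u w (X i)) (Phi u w U) (\<lambda>i. PhiM u w (\<iota> i)) (\<lambda>i. PhiM u w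
      (\<pi> i))"
proof -
  interpret C: preadditive_category "cat w" by (rule preadd) fact
  interpret V: preadditive_category "cat v" by (rule preadd) (use assms in auto)
  note B = C.biproductD[OF b]
  note a = assms(1-3)
  have ip: "Cmp (cat w) (\<iota> i) (\<pi> i) \<in> Hom (cat w) U U" if "i \<in> I" for i
    using B that C.cmp_hom[of U "X i" U] by auto
  have "hom_sum (cat v) (Phi u w U) (Phi u w U) (\<lambda>i. Cmp (cat v) (PhiM u w (\<iota> i)) (PhiM u w (\<pi> i))) I
      = hom_sum (cat v) (Phi u w U) (Phi u w U) (\<lambda>i. PhiM u w (Cmp (cat w) (\<iota> i) (\<pi> i))) I"
  proof (rule V.hom_sum_cong)
    show "Cmp (cat v) (PhiM u w (\<iota> i)) (PhiM u w (\<pi> i)) = PhiM u w (Cmp (cat w) (\<iota> i) (\<pi> i))" if "i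
        \<in> I" for i
      using Phi_cmp[OF a, of U "X i" U "\<pi> i" "\<iota> i"] B that by simp
    show "PhiM u w (Cmp (cat w) (\<iota> i) (\<pi> i)) \<in> Hom (cat v) (Phi u w U) (Phi u w U)" if "i \<in> I" for i
      using Phi_hom[OF a B(2) B(2) ip[OF that]] .
  qed (use Phi_obj[OF a B(2)] in auto)
  also have "\<dots> = PhiM u w (Ident (cat w) U)"
    using Phi_hom_sum[OF a B(2) B(2) B(1), of "\<lambda>i. Cmp (cat w) (\<iota> i) (\<pi> i)"] ip B(8) by simp
  also have "\<dots> = Ident (cat v) (Phi u w U)" by (rule Phi_ident[OF a B(2)])
  finally have s: "hom_sum (cat v) (Phi u w U) (Phi u w U) (\<lambda>i. Cmp (cat v) (PhiM u w (\<iota> i)) (PhiM u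
      w (\<pi> i))) I
      = Ident (cat v) (Phi u w U)" .
  have "Cmp (cat v) (PhiM u w (\<pi> i)) (PhiM u w (\<iota> j)) =
     (if i = j then Ident (cat v) (Phi u w (X i)) else Zero_hom (cat v) (Phi u w (X j)) (Phi u w (X
         i)))"
    if "i \<in> I" "j \<in> I" for i j
    using Phi_cmp[OF a, of "X j" U "X i" "\<iota> j" "\<pi> i", symmetric] B that Phi_ident[OF a, of "X i"]
      Phi_zero[OF a, of "X j" "X i"] by auto
  thus ?thesis unfolding is_biproduct_def using s B Phi_obj[OF a] Phi_hom[OF a] by simp
qed

lemma nu_hom:
  assumes "u \<in> carrier W" "u' \<in> carrier W" "w \<in> carrier W" "u' \<otimes> w = v'" "u \<otimes> u' = x" "u \<otimes> v' = v"
    "A \<in> Obj (cat w)"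
  shows "nu u u' w A \<in> Hom (cat v) (Phi u v' (Phi u' w A)) (Phi x w A)"
proof -
  have "v = u \<otimes> u' \<otimes> w" using assms by (auto simp: m_assoc)
  thus ?thesis using nu_natural[of u u' w] assms unfolding is_nat_trans_def funct_comp_def by auto
qed

lemma nu_nat:
  assumes "u \<in> carrier W" "u' \<in> carrier W" "w \<in> carrier W" "u' \<otimes> w = v'" "u \<otimes> u' = x" "u \<otimes> v' = v"
    "A \<in> Obj (cat w)" "B \<in> Obj (cat w)" "f \<in> Hom (cat w) A B"
  shows "Cmp (cat v) (nu u u' w B) (PhiM u v' (PhiM u' w f)) = Cmp (cat v) (PhiM x w f) (nu u u' w A)"
proof -
  have "v = u \<otimes> u' \<otimes> w" using assms by (auto simp: m_assoc)
  thus ?thesis using nu_natural[of u u' w] assms unfolding is_nat_trans_def funct_comp_def by auto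
qed

lemma nu_associative:
  assumes "a \<in> carrier W" "b \<in> carrier W" "c \<in> carrier W" "w \<in> carrier W"
    "c \<otimes> w = cw" "b \<otimes> cw = bcw" "a \<otimes> bcw = v" "a \<otimes> b = ab" "b \<otimes> c = bc" "A \<in> Obj (cat w)"
  shows "Cmp (cat v) (nu ab c w A) (nu a b cw (Phi c w A)) = Cmp (cat v) (nu a bc w A) (PhiM a bcw
      (nu b c w A))"
proof -
  have "v = a \<otimes> b \<otimes> c \<otimes> w" "bcw = b \<otimes> c \<otimes> w" using assms by (auto simp: m_assoc)
  thus ?thesis using nu_assoc[of a b c w A] assms by simp
qed

lemma nu_is_iso:
  assumes "u \<in> carrier W" "u' \<in> carrier W" "w \<in> carrier W" "u' \<otimes> w = v'" "u \<otimes> u' = x" "u \<otimes> v' = v"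
    "A \<in> Obj (cat w)" "len x = len u + len u'"
  shows "is_iso (cat v) (Phi u v' (Phi u' w A)) (Phi x w A) (nu u u' w A)"
proof -
  have "v = u \<otimes> u' \<otimes> w" using assms by (auto simp: m_assoc)
  thus ?thesis using nu_iso[of u u' w A] assms by auto
qed

subsection \<open>Objects and morphisms\<close>

lemma glue_simps:
  "Obj (glue W D P) = {(A, \<alpha>). is_glue_obj W D P A \<alpha>}"
  "Hom (glue W D P) = glue_hom W D P"
  "Ident (glue W D P) X = (\<lambda>w\<in>P. Ident (cat w) (fst X w))"
  "Cmp (glue W D P) g f = (\<lambda>w\<in>P. Cmp (cat w) (g w) (f w))"
  "Zero_hom (glue W D P) X Y = (\<lambda>w\<in>P. Zero_hom (cat w) (fst X w) (fst Y w))"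
  "Plus_hom (glue W D P) f g = (\<lambda>w\<in>P. Plus_hom (cat w) (f w) (g w))"
  unfolding glue_def by simp_all

lemma glue_obj_component: "X \<in> Obj (glue W D P) \<Longrightarrow> w \<in> P \<Longrightarrow> fst X w \<in> Obj (cat w)"
  unfolding glue_simps is_glue_obj_def by auto

lemma glue_obj_map:
  "X \<in> Obj (glue W D P) \<Longrightarrow> u \<in> carrier W \<Longrightarrow> w \<in> P \<Longrightarrow> u \<otimes> w = v \<Longrightarrow> v \<in> P \<Longrightarrow>
   snd X (u, w) \<in> Hom (cat v) (Phi u w (fst X w)) (fst X v)"
  unfolding glue_simps is_glue_obj_def glue_pairs_def by fastforce

lemma glue_obj_one: "X \<in> Obj (glue W D P) \<Longrightarrow> w \<in> P \<Longrightarrow> snd X (\<one>, w) = Ident (cat w) (fst X w)"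
  unfolding glue_simps is_glue_obj_def by auto

lemma glue_obj_assoc:
  assumes P: "P \<subseteq> carrier W" and X: "X \<in> Obj (glue W D P)" and u: "u \<in> carrier W" "u' \<in> carrier W"
      "w \<in> P"
    and v: "u' \<otimes> w = v'" "v' \<in> P" "u \<otimes> v' = v" "v \<in> P" "u \<otimes> u' = x"
  shows "Cmp (cat v) (snd X (u, v')) (PhiM u v' (snd X (u', w))) = Cmp (cat v) (snd X (x, w)) (nu u
      u' w (fst X w))"
proof -
  obtain A \<alpha> where XA: "X = (A, \<alpha>)" by (cases X)
  have e: "v = u \<otimes> u' \<otimes> w" using assms by (auto simp: m_assoc)
  have "is_glue_obj W D P A \<alpha>" using X unfolding glue_simps XA by simp
  hence "\<forall>w\<^sub>1\<in>carrier W. \<forall>w\<^sub>2\<in>carrier W. \<forall>w'\<in>P.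
        w\<^sub>2 \<otimes> w' \<in> P \<longrightarrow> w\<^sub>1 \<otimes> w\<^sub>2 \<otimes> w' \<in> P \<longrightarrow>
        Cmp (GCat D (w\<^sub>1 \<otimes> w\<^sub>2 \<otimes> w'))
          (\<alpha> (w\<^sub>1, w\<^sub>2 \<otimes> w')) (fmap (GFun D w\<^sub>1 (w\<^sub>2 \<otimes> w')) (\<alpha> (w\<^sub>2, w'))) =
        Cmp (GCat D (w\<^sub>1 \<otimes> w\<^sub>2 \<otimes> w'))
          (\<alpha> (w\<^sub>1 \<otimes> w\<^sub>2, w')) (GNat D w\<^sub>1 w\<^sub>2 w' (A w'))" unfolding is_glue_obj_def by blast
  from this[rule_format, of u u' w] show ?thesis using assms e XA by simp
qed

lemma glue_objI:
  assumes "P \<subseteq> carrier W"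
    and "\<And>w. w \<in> P \<Longrightarrow> A w \<in> Obj (cat w)"
    and "\<And>u w v. u \<in> carrier W \<Longrightarrow> w \<in> P \<Longrightarrow> u \<otimes> w = v \<Longrightarrow> v \<in> P \<Longrightarrow> \<alpha> u w \<in> Hom (cat v) (Phi u w (A w)) (A v)"
    and "\<And>w. w \<in> P \<Longrightarrow> \<alpha> \<one> w = Ident (cat w) (A w)"
    and "\<And>u u' w v' v x. u \<in> carrier W \<Longrightarrow> u' \<in> carrier W \<Longrightarrow> w \<in> P \<Longrightarrow> u' \<otimes> w = v' \<Longrightarrow> v' \<in> P \<Longrightarrow>
      u \<otimes> v' = v \<Longrightarrow> v \<in> P \<Longrightarrow> u \<otimes> u' = x \<Longrightarrow>
      Cmp (cat v) (\<alpha> u v') (PhiM u v' (\<alpha> u' w)) = Cmp (cat v) (\<alpha> x w) (nu u u' w (A w))"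
  shows "(restrict A P, restrict (\<lambda>(u, w). \<alpha> u w) (glue_pairs W P)) \<in> Obj (glue W D P)"
  unfolding glue_simps is_glue_obj_def mem_Collect_eq case_prod_conv
proof (intro conjI ballI impI)
  show "restrict A P \<in> (\<Pi>\<^sub>E w\<in>P. Obj (cat w))" using assms(2) by simp
  show "restrict (\<lambda>(u, w). \<alpha> u w) (glue_pairs W P)
      \<in> (\<Pi>\<^sub>E (w, w')\<in>glue_pairs W P. Hom (cat (w \<otimes> w')) (Phi w w' (restrict A P w')) (restrict A P
          (w \<otimes> w')))"
    using assms(3) unfolding restrict_PiE_iff by (auto simp: glue_pairs_def)
  show "restrict (\<lambda>(u, w). \<alpha> u w) (glue_pairs W P) (\<one>, w') = Ident (cat w') (restrict A P w')" if
      "w' \<in> P" for w'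
    using that assms(1,4) by (auto simp: glue_pairs_def subset_iff)
  fix w1 w2 w' assume a: "w1 \<in> carrier W" "w2 \<in> carrier W" "w' \<in> P" "w2 \<otimes> w' \<in> P" "w1 \<otimes> w2 \<otimes> w' \<in> P"
  have c: "w' \<in> carrier W" using a assms(1) by blast
  hence m: "w1 \<otimes> (w2 \<otimes> w') = w1 \<otimes> w2 \<otimes> w'" using a by (simp add: m_assoc)
  have g: "(w1, w2 \<otimes> w') \<in> glue_pairs W P" "(w2, w') \<in> glue_pairs W P" "(w1 \<otimes> w2, w') \<in> glue_pairs W P"
    using a m by (auto simp: glue_pairs_def)
  show "Cmp (cat (w1 \<otimes> w2 \<otimes> w')) (restrict (\<lambda>(u, w). \<alpha> u w) (glue_pairs W P) (w1, w2 \<otimes> w'))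
      (PhiM w1 (w2 \<otimes> w') (restrict (\<lambda>(u, w). \<alpha> u w) (glue_pairs W P) (w2, w'))) =
     Cmp (cat (w1 \<otimes> w2 \<otimes> w')) (restrict (\<lambda>(u, w). \<alpha> u w) (glue_pairs W P) (w1 \<otimes> w2, w'))
      (nu w1 w2 w' (restrict A P w'))"
    using assms(5)[OF a(1,2,3) HOL.refl a(4) m a(5) HOL.refl] g a by simp
qed

lemma glue_hom_component: "f \<in> Hom (glue W D P) X Y \<Longrightarrow> w \<in> P \<Longrightarrow> f w \<in> Hom (cat w) (fst X w) (fst Y w)"
  unfolding glue_simps glue_hom_def by (auto split: prod.splits)

lemma glue_hom_natural:
  "f \<in> Hom (glue W D P) X Y \<Longrightarrow> u \<in> carrier W \<Longrightarrow> w \<in> P \<Longrightarrow> u \<otimes> w = v \<Longrightarrow> v \<in> P \<Longrightarrow>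
   Cmp (cat v) (f v) (snd X (u, w)) = Cmp (cat v) (snd Y (u, w)) (PhiM u w (f w))"
  unfolding glue_simps glue_hom_def glue_pairs_def by (auto split: prod.splits)

lemma glue_hom_ext: "f \<in> Hom (glue W D P) X Y \<Longrightarrow> f \<in> extensional P"
  unfolding glue_simps glue_hom_def by (auto split: prod.splits simp: PiE_def)

lemma glue_homI:
  assumes "f \<in> extensional P" "\<And>w. w \<in> P \<Longrightarrow> f w \<in> Hom (cat w) (fst X w) (fst Y w)"
    "\<And>u w v. u \<in> carrier W \<Longrightarrow> w \<in> P \<Longrightarrow> u \<otimes> w = v \<Longrightarrow> v \<in> P \<Longrightarrow>
      Cmp (cat v) (f v) (snd X (u, w)) = Cmp (cat v) (snd Y (u, w)) (PhiM u w (f w))"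
  shows "f \<in> Hom (glue W D P) X Y"
  using assms unfolding glue_simps glue_hom_def by (auto split: prod.splits simp: PiE_def
      glue_pairs_def)

lemma glue_hom_eqI:
  assumes "f \<in> Hom (glue W D P) X Y" "g \<in> Hom (glue W D P) X' Y'" "\<And>w. w \<in> P \<Longrightarrow> f w = g w"
  shows "f = g"
  using assms glue_hom_ext by (metis extensionalityI)

lemma glue_cmp [simp]: "w \<in> P \<Longrightarrow> Cmp (glue W D P) g f w = Cmp (cat w) (g w) (f w)"
  and glue_ident [simp]: "w \<in> P \<Longrightarrow> Ident (glue W D P) X w = Ident (cat w) (fst X w)"
  and glue_zero [simp]: "w \<in> P \<Longrightarrow> Zero_hom (glue W D P) X Y w = Zero_hom (cat w) (fst X w) (fst Y w)"
  and glue_plus [simp]: "w \<in> P \<Longrightarrow> Plus_hom (glue W D P) f g w = Plus_hom (cat w) (f w) (g w)"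
  unfolding glue_simps by simp_all

end

context coxeter_gluing
begin

lemma Phi_neg:
  assumes "u \<in> carrier W" "w \<in> carrier W" "u \<otimes> w = v" "a \<in> Obj (cat w)" "b \<in> Obj (cat w)" "f \<in> Hom
      (cat w) a b"
  shows "PhiM u w (hom_neg (cat w) a b f) = hom_neg (cat v) (Phi u w a) (Phi u w b) (PhiM u w f)"
proof -
  interpret C: preadditive_category "cat w" by (rule preadd) fact
  interpret V: preadditive_category "cat v" by (rule preadd) (use assms in auto)
  show ?thesis
  proof (rule V.plus_eq_zero_neg)
    show "Plus_hom (cat v) (PhiM u w f) (PhiM u w (hom_neg (cat w) a b f)) = Zero_hom (cat v) (Phi u
        w a) (Phi u w b)"
      using Phi_plus[OF assms C.neg_closed[OF assms(4-6)]] C.plus_neg(1)[OF assms(4-6)] Phi_zero[OF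
          assms(1-5)] by simp
  qed (use assms Phi_obj Phi_hom C.neg_closed in auto)
qed

lemma glue_plus_hom:
  assumes P: "P \<subseteq> carrier W" and o: "X \<in> Obj (glue W D P)" "Y \<in> Obj (glue W D P)"
    and f: "f \<in> Hom (glue W D P) X Y" and g: "g \<in> Hom (glue W D P) X Y"
  shows "Plus_hom (glue W D P) f g \<in> Hom (glue W D P) X Y"
proof (rule glue_homI)
  show "Plus_hom (glue W D P) f g \<in> extensional P" unfolding glue_simps by simp
  show "Plus_hom (glue W D P) f g w \<in> Hom (cat w) (fst X w) (fst Y w)" if w: "w \<in> P" for w
    using w preadditive_category.plus_closed[OF preadd] P o f g glue_hom_component
        glue_obj_component by (simp add: subset_iff)
  fix u w v assume a: "u \<in> carrier W" "w \<in> P" "u \<otimes> w = v" "v \<in> P"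
  have c: "w \<in> carrier W" "v \<in> carrier W" using a P by auto
  interpret V: preadditive_category "cat v" by (rule preadd) fact
  note oX = glue_obj_component[OF o(1)] and oY = glue_obj_component[OF o(2)]
  note hf = glue_hom_component[OF f] and hg = glue_hom_component[OF g]
  note m = glue_obj_map[OF o(1) a] glue_obj_map[OF o(2) a]
  note pX = Phi_obj[OF a(1) c(1) a(3) oX[OF a(2)]] and pY = Phi_obj[OF a(1) c(1) a(3) oY[OF a(2)]]
  note ph = Phi_hom[OF a(1) c(1) a(3) oX[OF a(2)] oY[OF a(2)]]
  have "Cmp (cat v) (Plus_hom (cat v) (f v) (g v)) (snd X (u, w))
      = Plus_hom (cat v) (Cmp (cat v) (f v) (snd X (u, w))) (Cmp (cat v) (g v) (snd X (u, w)))"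
    by (rule V.cmp_plus_left[OF pX oX[OF a(4)] oY[OF a(4)] m(1) hf[OF a(4)] hg[OF a(4)]])
  also have "\<dots> = Plus_hom (cat v) (Cmp (cat v) (snd Y (u, w)) (PhiM u w (f w))) (Cmp (cat v) (snd Y
      (u, w)) (PhiM u w (g w)))"
    using glue_hom_natural[OF f a] glue_hom_natural[OF g a] by simp
  also have "\<dots> = Cmp (cat v) (snd Y (u, w)) (Plus_hom (cat v) (PhiM u w (f w)) (PhiM u w (g w)))"
    by (rule V.cmp_plus_right[OF pX pY oY[OF a(4)] ph[OF hf[OF a(2)]] ph[OF hg[OF a(2)]] m(2),
        symmetric])
  also have "\<dots> = Cmp (cat v) (snd Y (u, w)) (PhiM u w (Plus_hom (cat w) (f w) (g w)))"
    using Phi_plus[OF a(1) c(1) a(3) oX[OF a(2)] oY[OF a(2)] hf[OF a(2)] hg[OF a(2)]] by simp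
  finally show "Cmp (cat v) (Plus_hom (glue W D P) f g v) (snd X (u, w)) =
      Cmp (cat v) (snd Y (u, w)) (PhiM u w (Plus_hom (glue W D P) f g w))" using a by simp
qed

lemma glue_neg_hom:
  assumes P: "P \<subseteq> carrier W" and o: "X \<in> Obj (glue W D P)" "Y \<in> Obj (glue W D P)"
    and f: "f \<in> Hom (glue W D P) X Y"
  shows "(\<lambda>w\<in>P. hom_neg (cat w) (fst X w) (fst Y w) (f w)) \<in> Hom (glue W D P) X Y"
proof (rule glue_homI)
  fix u w v assume a: "u \<in> carrier W" "w \<in> P" "u \<otimes> w = v" "v \<in> P"
  have c: "w \<in> carrier W" "v \<in> carrier W" using a P by auto
  interpret V: preadditive_category "cat v" by (rule preadd) fact
  note oX = glue_obj_component[OF o(1)] and oY = glue_obj_component[OF o(2)]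
  note hf = glue_hom_component[OF f]
  note m = glue_obj_map[OF o(1) a] glue_obj_map[OF o(2) a]
  note pX = Phi_obj[OF a(1) c(1) a(3) oX[OF a(2)]] and pY = Phi_obj[OF a(1) c(1) a(3) oY[OF a(2)]]
  note ph = Phi_hom[OF a(1) c(1) a(3) oX[OF a(2)] oY[OF a(2)]]
  show "Cmp (cat v) ((\<lambda>w\<in>P. hom_neg (cat w) (fst X w) (fst Y w) (f w)) v) (snd X (u, w)) =
      Cmp (cat v) (snd Y (u, w)) (PhiM u w ((\<lambda>w\<in>P. hom_neg (cat w) (fst X w) (fst Y w) (f w)) w))"
    using a V.cmp_neg_left[OF pX oX[OF a(4)] oY[OF a(4)] m(1) hf[OF a(4)]]
      V.cmp_neg_right[OF pX pY oY[OF a(4)] ph[OF hf[OF a(2)]] m(2)] glue_hom_natural[OF f a]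
      Phi_neg[OF a(1) c(1) a(3) oX[OF a(2)] oY[OF a(2)] hf[OF a(2)]] by simp
qed (use P o f preadditive_category.neg_closed[OF preadd] glue_hom_component glue_obj_component in
    \<open>simp_all add: subset_iff\<close>)

lemma glue_zero_hom:
  assumes P: "P \<subseteq> carrier W" and o: "X \<in> Obj (glue W D P)" "Y \<in> Obj (glue W D P)"
  shows "Zero_hom (glue W D P) X Y \<in> Hom (glue W D P) X Y"
proof (rule glue_homI)
  show "Zero_hom (glue W D P) X Y \<in> extensional P" unfolding glue_simps by simp
  show "Zero_hom (glue W D P) X Y w \<in> Hom (cat w) (fst X w) (fst Y w)" if "w \<in> P" for w
    using that preadditive_category.zero_closed[OF preadd] P o glue_obj_component by (simp add:
        subset_iff)
  fix u w v assume a: "u \<in> carrier W" "w \<in> P" "u \<otimes> w = v" "v \<in> P"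
  have c: "w \<in> carrier W" "v \<in> carrier W" using a P by auto
  interpret V: preadditive_category "cat v" by (rule preadd) fact
  note oX = glue_obj_component[OF o(1)] and oY = glue_obj_component[OF o(2)]
  note m = glue_obj_map[OF o(1) a] glue_obj_map[OF o(2) a]
  note pX = Phi_obj[OF a(1) c(1) a(3) oX[OF a(2)]] and pY = Phi_obj[OF a(1) c(1) a(3) oY[OF a(2)]]
  show "Cmp (cat v) (Zero_hom (glue W D P) X Y v) (snd X (u, w)) =
      Cmp (cat v) (snd Y (u, w)) (PhiM u w (Zero_hom (glue W D P) X Y w))"
    using a V.cmp_zero_left[OF pX oX[OF a(4)] oY[OF a(4)] m(1)] V.cmp_zero_right[OF pX pY oY[OF
        a(4)] m(2)]
      Phi_zero[OF a(1) c(1) a(3) oX[OF a(2)] oY[OF a(2)]] by simp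
qed

lemma glue_ident_hom:
  assumes P: "P \<subseteq> carrier W" and o: "X \<in> Obj (glue W D P)"
  shows "Ident (glue W D P) X \<in> Hom (glue W D P) X X"
proof (rule glue_homI)
  show "Ident (glue W D P) X \<in> extensional P" unfolding glue_simps by simp
  show "Ident (glue W D P) X w \<in> Hom (cat w) (fst X w) (fst X w)" if "w \<in> P" for w
    using that preadditive_category.ident_hom[OF preadd] P o glue_obj_component by (simp add:
        subset_iff)
  fix u w v assume a: "u \<in> carrier W" "w \<in> P" "u \<otimes> w = v" "v \<in> P"
  have c: "w \<in> carrier W" "v \<in> carrier W" using a P by auto
  interpret V: preadditive_category "cat v" by (rule preadd) fact
  note oX = glue_obj_component[OF o]
  note m = glue_obj_map[OF o a]
  note pX = Phi_obj[OF a(1) c(1) a(3) oX[OF a(2)]]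
  show "Cmp (cat v) (Ident (glue W D P) X v) (snd X (u, w)) = Cmp (cat v) (snd X (u, w)) (PhiM u w
      (Ident (glue W D P) X w))"
    using a V.cmp_ident_left[OF pX oX[OF a(4)] m] V.cmp_ident_right[OF pX oX[OF a(4)] m]
      Phi_ident[OF a(1) c(1) a(3) oX[OF a(2)]] by simp
qed

lemma glue_cmp_hom:
  assumes P: "P \<subseteq> carrier W" and o: "X \<in> Obj (glue W D P)" "Y \<in> Obj (glue W D P)" "Z \<in> Obj (glue W D P)"
    and f: "f \<in> Hom (glue W D P) X Y" and g: "g \<in> Hom (glue W D P) Y Z"
  shows "Cmp (glue W D P) g f \<in> Hom (glue W D P) X Z"
proof (rule glue_homI)
  show "Cmp (glue W D P) g f \<in> extensional P" unfolding glue_simps by simp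
  note oX = glue_obj_component[OF o(1)] and oY = glue_obj_component[OF o(2)] and oZ =
      glue_obj_component[OF o(3)]
  note hf = glue_hom_component[OF f] and hg = glue_hom_component[OF g]
  show "Cmp (glue W D P) g f w \<in> Hom (cat w) (fst X w) (fst Z w)" if w: "w \<in> P" for w
    using w preadditive_category.cmp_hom[OF preadd[OF subsetD[OF P w]] oX[OF w] oY[OF w] oZ[OF w]
        hf[OF w] hg[OF w]] by simp
  fix u w v assume a: "u \<in> carrier W" "w \<in> P" "u \<otimes> w = v" "v \<in> P"
  have c: "w \<in> carrier W" "v \<in> carrier W" using a P by auto
  interpret V: preadditive_category "cat v" by (rule preadd) fact
  note m = glue_obj_map[OF o(1) a] glue_obj_map[OF o(2) a] glue_obj_map[OF o(3) a]
  note pX = Phi_obj[OF a(1) c(1) a(3) oX[OF a(2)]] and pY = Phi_obj[OF a(1) c(1) a(3) oY[OF a(2)]]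
    and pZ = Phi_obj[OF a(1) c(1) a(3) oZ[OF a(2)]]
  note phf = Phi_hom[OF a(1) c(1) a(3) oX[OF a(2)] oY[OF a(2)] hf[OF a(2)]]
    and phg = Phi_hom[OF a(1) c(1) a(3) oY[OF a(2)] oZ[OF a(2)] hg[OF a(2)]]
  have "Cmp (cat v) (Cmp (cat v) (g v) (f v)) (snd X (u, w)) = Cmp (cat v) (g v) (Cmp (cat v) (f v)
      (snd X (u, w)))"
    by (rule V.cmp_assoc[OF pX oX[OF a(4)] oY[OF a(4)] oZ[OF a(4)] m(1) hf[OF a(4)] hg[OF a(4)]])
  also have "\<dots> = Cmp (cat v) (g v) (Cmp (cat v) (snd Y (u, w)) (PhiM u w (f w)))"
    using glue_hom_natural[OF f a] by simp
  also have "\<dots> = Cmp (cat v) (Cmp (cat v) (g v) (snd Y (u, w))) (PhiM u w (f w))"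
    by (rule V.cmp_assoc[OF pX pY oY[OF a(4)] oZ[OF a(4)] phf m(2) hg[OF a(4)], symmetric])
  also have "\<dots> = Cmp (cat v) (Cmp (cat v) (snd Z (u, w)) (PhiM u w (g w))) (PhiM u w (f w))"
    using glue_hom_natural[OF g a] by simp
  also have "\<dots> = Cmp (cat v) (snd Z (u, w)) (Cmp (cat v) (PhiM u w (g w)) (PhiM u w (f w)))"
    by (rule V.cmp_assoc[OF pX pY pZ oZ[OF a(4)] phf phg m(3)])
  also have "Cmp (cat v) (PhiM u w (g w)) (PhiM u w (f w)) = PhiM u w (Cmp (cat w) (g w) (f w))"
    by (rule Phi_cmp[OF a(1) c(1) a(3) oX[OF a(2)] oY[OF a(2)] oZ[OF a(2)] hf[OF a(2)] hg[OF a(2)],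
        symmetric])
  finally show "Cmp (cat v) (Cmp (glue W D P) g f v) (snd X (u, w)) = Cmp (cat v) (snd Z (u, w))
      (PhiM u w (Cmp (glue W D P) g f w))"
    using a by simp
qed

lemma glue_preadditive:
  assumes P: "P \<subseteq> carrier W"
  shows "preadditive_category (glue W D P)"
proof (rule preadditive_category.intro)
  let ?G = "glue W D P"
  have pre: "preadditive_category (cat w)" if "w \<in> P" for w using preadd that P by blast
  note oc = glue_obj_component and hc = glue_hom_component and ext = glue_hom_ext
  note eqI = glue_hom_eqI
  fix a b c d f g h f' g'
  show "a \<in> Obj ?G \<Longrightarrow> Ident ?G a \<in> Hom ?G a a" using glue_ident_hom[OF P] .
  have cmp: "a \<in> Obj ?G \<Longrightarrow> b \<in> Obj ?G \<Longrightarrow> c \<in> Obj ?G \<Longrightarrow> f \<in> Hom ?G a b \<Longrightarrow> g \<in> Hom ?G b c \<Longrightarrow> Cmp ?G g f \<in>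
      Hom ?G a c"
    for a b c f g using glue_cmp_hom[OF P] .
  show "a \<in> Obj ?G \<Longrightarrow> b \<in> Obj ?G \<Longrightarrow> c \<in> Obj ?G \<Longrightarrow> f \<in> Hom ?G a b \<Longrightarrow> g \<in> Hom ?G b c \<Longrightarrow> Cmp ?G g f \<in> Hom ?G
      a c"
    by (rule cmp)
  show "Cmp ?G f (Ident ?G a) = f" if h: "a \<in> Obj ?G" "b \<in> Obj ?G" "f \<in> Hom ?G a b"
    by (rule eqI[OF cmp[OF h(1,1,2) glue_ident_hom[OF P h(1)] h(3)] h(3)])
      (use preadditive_category.cmp_ident_right[OF pre oc oc hc] h in auto)
  show "Cmp ?G (Ident ?G b) f = f" if h: "a \<in> Obj ?G" "b \<in> Obj ?G" "f \<in> Hom ?G a b"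
    by (rule eqI[OF cmp[OF h(1,2,2) h(3) glue_ident_hom[OF P h(2)]] h(3)])
      (use preadditive_category.cmp_ident_left[OF pre oc oc hc] h in auto)
  show "Cmp ?G (Cmp ?G h g) f = Cmp ?G h (Cmp ?G g f)"
    if h: "a \<in> Obj ?G" "b \<in> Obj ?G" "c \<in> Obj ?G" "d \<in> Obj ?G" "f \<in> Hom ?G a b" "g \<in> Hom ?G b c" "h \<in>
        Hom ?G c d"
  proof (rule eqI[OF cmp[OF h(1,2,4,5) cmp[OF h(2,3,4,6,7)]] cmp[OF h(1,3,4) cmp[OF h(1,2,3,5,6)]
      h(7)]])
    fix w assume w: "w \<in> P"
    show "Cmp ?G (Cmp ?G h g) f w = Cmp ?G h (Cmp ?G g f) w"
      using preadditive_category.cmp_assoc[OF pre[OF w] oc[OF h(1) w] oc[OF h(2) w] oc[OF h(3) w]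
          oc[OF h(4) w]
          hc[OF h(5) w] hc[OF h(6) w] hc[OF h(7) w]] w by simp
  qed
  show "Cmp ?G g (Plus_hom ?G f f') = Plus_hom ?G (Cmp ?G g f) (Cmp ?G g f')"
    if h: "a \<in> Obj ?G" "b \<in> Obj ?G" "c \<in> Obj ?G" "f \<in> Hom ?G a b" "f' \<in> Hom ?G a b" "g \<in> Hom ?G b c"
  proof (rule eqI[OF cmp[OF h(1-3) glue_plus_hom[OF P h(1,2,4,5)] h(6)]
        glue_plus_hom[OF P h(1,3) cmp[OF h(1-4,6)] cmp[OF h(1-3,5,6)]]])
    fix w assume w: "w \<in> P"
    show "Cmp ?G g (Plus_hom ?G f f') w = Plus_hom ?G (Cmp ?G g f) (Cmp ?G g f') w"
      using preadditive_category.cmp_plus_right[OF pre[OF w] oc[OF h(1) w] oc[OF h(2) w] oc[OF h(3) w]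
          hc[OF h(4) w] hc[OF h(5) w] hc[OF h(6) w]] w by simp
  qed
  show "Cmp ?G (Plus_hom ?G g g') f = Plus_hom ?G (Cmp ?G g f) (Cmp ?G g' f)"
    if h: "a \<in> Obj ?G" "b \<in> Obj ?G" "c \<in> Obj ?G" "f \<in> Hom ?G a b" "g \<in> Hom ?G b c" "g' \<in> Hom ?G b c"
  proof (rule eqI[OF cmp[OF h(1-4) glue_plus_hom[OF P h(2,3,5,6)]]
        glue_plus_hom[OF P h(1,3) cmp[OF h(1-5)] cmp[OF h(1-4,6)]]])
    fix w assume w: "w \<in> P"
    show "Cmp ?G (Plus_hom ?G g g') f w = Plus_hom ?G (Cmp ?G g f) (Cmp ?G g' f) w"
      using preadditive_category.cmp_plus_left[OF pre[OF w] oc[OF h(1) w] oc[OF h(2) w] oc[OF h(3) w]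
          hc[OF h(4) w] hc[OF h(5) w] hc[OF h(6) w]] w by simp
  qed
  show "comm_group (hom_group ?G a b)" if o: "a \<in> Obj ?G" "b \<in> Obj ?G"
  proof (rule comm_groupI)
    have grp: "comm_group (hom_group (cat w) (fst a w) (fst b w))" if "w \<in> P" for w
      using preadditive_category.hom_abelian[OF pre oc oc] that o by blast
    note pl = glue_plus_hom[OF P o]
    fix x y z
    assume "x \<in> carrier (hom_group ?G a b)" "y \<in> carrier (hom_group ?G a b)"
    hence x: "x \<in> Hom ?G a b" and y: "y \<in> Hom ?G a b" by auto
    show "x \<otimes>\<^bsub>hom_group ?G a b\<^esub> y \<in> carrier (hom_group ?G a b)" using pl[OF x y] by simp
    show "x \<otimes>\<^bsub>hom_group ?G a b\<^esub> y = y \<otimes>\<^bsub>hom_group ?G a b\<^esub> x"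
      unfolding hom_group_simps
    proof (rule eqI[OF pl[OF x y] pl[OF y x]])
      fix w assume w: "w \<in> P"
      interpret comm_group "hom_group (cat w) (fst a w) (fst b w)" by (rule grp[OF w])
      show "Plus_hom ?G x y w = Plus_hom ?G y x w" using m_comm[of "x w" "y w"] hc[OF x w] hc[OF y
          w] w by simp
    qed
    assume "z \<in> carrier (hom_group ?G a b)"
    hence z: "z \<in> Hom ?G a b" by simp
    show "x \<otimes>\<^bsub>hom_group ?G a b\<^esub> y \<otimes>\<^bsub>hom_group ?G a b\<^esub> z = x \<otimes>\<^bsub>hom_group ?G a b\<^esub> (y \<otimes>\<^bsub>hom_group ?G a
        b\<^esub> z)"
      unfolding hom_group_simps
    proof (rule eqI[OF pl[OF pl[OF x y] z] pl[OF x pl[OF y z]]])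
      fix w assume w: "w \<in> P"
      interpret comm_group "hom_group (cat w) (fst a w) (fst b w)" by (rule grp[OF w])
      show "Plus_hom ?G (Plus_hom ?G x y) z w = Plus_hom ?G x (Plus_hom ?G y z) w"
        using m_assoc[of "x w" "y w" "z w"] hc[OF x w] hc[OF y w] hc[OF z w] w by simp
    qed
  next
    show "\<one>\<^bsub>hom_group ?G a b\<^esub> \<in> carrier (hom_group ?G a b)" using glue_zero_hom[OF P o] by simp
    fix x assume "x \<in> carrier (hom_group ?G a b)"
    hence x: "x \<in> Hom ?G a b" by simp
    show "\<one>\<^bsub>hom_group ?G a b\<^esub> \<otimes>\<^bsub>hom_group ?G a b\<^esub> x = x" unfolding hom_group_simps
    proof (rule eqI[OF glue_plus_hom[OF P o glue_zero_hom[OF P o] x] x])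
      show "Plus_hom ?G (Zero_hom ?G a b) x w = x w" if "w \<in> P" for w
        using preadditive_category.plus_zero(2)[OF pre oc oc hc] that o x by simp
    qed
    let ?n = "\<lambda>w\<in>P. hom_neg (cat w) (fst a w) (fst b w) (x w)"
    have n: "?n \<in> Hom ?G a b" by (rule glue_neg_hom[OF P o x])
    have "Plus_hom ?G ?n x = Zero_hom ?G a b"
    proof (rule eqI[OF glue_plus_hom[OF P o n x] glue_zero_hom[OF P o]])
      show "Plus_hom ?G ?n x w = Zero_hom ?G a b w" if "w \<in> P" for w
        using preadditive_category.plus_neg(2)[OF pre oc oc hc] that o x by simp
    qed
    thus "\<exists>y\<in>carrier (hom_group ?G a b). y \<otimes>\<^bsub>hom_group ?G a b\<^esub> x = \<one>\<^bsub>hom_group ?G a b\<^esub>"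
      using n by (intro bexI[of _ ?n]) auto
  qed
qed

lemma glue_hom_sum_component:
  assumes P: "P \<subseteq> carrier W" and o: "X \<in> Obj (glue W D P)" "Y \<in> Obj (glue W D P)" and w: "w \<in> P"
    and I: "finite I" and f: "\<And>i. i \<in> I \<Longrightarrow> f i \<in> Hom (glue W D P) X Y"
  shows "hom_sum (glue W D P) X Y f I w = hom_sum (cat w) (fst X w) (fst Y w) (\<lambda>i. f i w) I"
proof -
  interpret G: preadditive_category "glue W D P" by (rule glue_preadditive[OF P])
  interpret C: preadditive_category "cat w" by (rule preadd) (use w P in blast)
  note oc = glue_obj_component[OF o(1) w] glue_obj_component[OF o(2) w]
  show ?thesis using I f
  proof (induction I)
    case empty thus ?case using o oc w by simp
  next
    case (insert i I)
    thus ?case using G.hom_sum_insert[OF o insert.hyps, of f] C.hom_sum_insert[OF oc insert.hyps, of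
        "\<lambda>i. f i w"]
        glue_hom_component[OF _ w] w by simp
  qed
qed

lemma glue_neg_component:
  assumes P: "P \<subseteq> carrier W" and o: "X \<in> Obj (glue W D P)" "Y \<in> Obj (glue W D P)" and w: "w \<in> P"
    and f: "f \<in> Hom (glue W D P) X Y"
  shows "hom_neg (glue W D P) X Y f w = hom_neg (cat w) (fst X w) (fst Y w) (f w)"
proof -
  interpret G: preadditive_category "glue W D P" by (rule glue_preadditive[OF P])
  interpret C: preadditive_category "cat w" by (rule preadd) (use w P in blast)
  note oc = glue_obj_component[OF o(1) w] glue_obj_component[OF o(2) w]
  have "Plus_hom (cat w) (f w) (hom_neg (glue W D P) X Y f w) = Zero_hom (cat w) (fst X w) (fst Y w)"
    using arg_cong[OF G.plus_neg(1)[OF o f], of "\<lambda>h. h w"] w by simp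
  thus ?thesis using C.plus_eq_zero_neg[OF oc] glue_hom_component[OF f w] glue_hom_component[OF
      G.neg_closed[OF o f] w] by blast
qed

lemma glue_biproduct_component:
  assumes P: "P \<subseteq> carrier W" and w: "w \<in> P" and X: "\<And>i. i \<in> I \<Longrightarrow> X i \<in> Obj (glue W D P)"
    and b: "is_biproduct (glue W D P) I X U \<iota> \<pi>"
  shows "is_biproduct (cat w) I (\<lambda>i. fst (X i) w) (fst U w) (\<lambda>i. \<iota> i w) (\<lambda>i. \<pi> i w)"
proof -
  interpret G: preadditive_category "glue W D P" by (rule glue_preadditive[OF P])
  note B = G.biproductD[OF b]
  have ip: "Cmp (glue W D P) (\<iota> i) (\<pi> i) \<in> Hom (glue W D P) U U" if "i \<in> I" for i
    using B that G.cmp_hom[of U "X i" U] by auto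
  have "hom_sum (cat w) (fst U w) (fst U w) (\<lambda>i. Cmp (cat w) (\<iota> i w) (\<pi> i w)) I = Ident (cat w) (fst
      U w)"
    using glue_hom_sum_component[OF P B(2) B(2) w B(1), of "\<lambda>i. Cmp (glue W D P) (\<iota> i) (\<pi> i)", OF
        ip] B(8) w by simp
  moreover have "Cmp (cat w) (\<pi> i w) (\<iota> j w) =
      (if i = j then Ident (cat w) (fst (X i) w) else Zero_hom (cat w) (fst (X j) w) (fst (X i) w))"
    if "i \<in> I" "j \<in> I" for i j
  proof -
    have "Cmp (glue W D P) (\<pi> i) (\<iota> j) = (if i = j then Ident (glue W D P) (X i) else Zero_hom (glue
        W D P) (X j) (X i))"
      using that B(6)[of i] B(7)[of i j] by auto
    from arg_cong[OF this, of "\<lambda>h. h w"] show ?thesis using w by (simp split: if_splits)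
  qed
  ultimately show ?thesis unfolding is_biproduct_def
    using B glue_obj_component[OF _ w] glue_hom_component[OF _ w] by simp
qed

end

subsection \<open>Kernels and biproducts\<close>

context coxeter_gluing
begin

text \<open>Kernels are formed componentwise; the structure maps are the unique ones compatible with the inclusions.\<close>

lemma glue_kernel:
  assumes P: "P \<subseteq> carrier W" and o: "X \<in> Obj (glue W D P)" "Y \<in> Obj (glue W D P)"
    and f: "f \<in> Hom (glue W D P) X Y"
  shows "\<exists>K k. is_kernel (glue W D P) X Y f K k \<and>
    (\<forall>w\<in>P. is_kernel (cat w) (fst X w) (fst Y w) (f w) (fst K w) (k w))"
proof -
  let ?G = "glue W D P"
  have pre: "preadditive_category (cat w)" if "w \<in> P" for w using preadd that P by blast
  note oX = glue_obj_component[OF o(1)] and oY = glue_obj_component[OF o(2)] and hf =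
      glue_hom_component[OF f]
  have "\<exists>K k. is_kernel (cat w) (fst X w) (fst Y w) (f w) K k" if w: "w \<in> P" for w
    using abelian_category.kernels[OF abelian oX[OF w] oY[OF w] hf[OF w]] P w by blast
  then obtain K0 k0 where ker: "\<And>w. w \<in> P \<Longrightarrow> is_kernel (cat w) (fst X w) (fst Y w) (f w) (K0 w) (k0
      w)" by metis
  note KD = preadditive_category.kernelD[OF pre ker]
  have ex: "\<exists>h. h \<in> Hom (cat v) (Phi u w (K0 w)) (K0 v) \<and> Cmp (cat v) (k0 v) h = Cmp (cat v) (snd X
      (u, w)) (PhiM u w (k0 w))"
    if a: "u \<in> carrier W" "w \<in> P" "u \<otimes> w = v" "v \<in> P" for u w v
  proof -
    have c: "w \<in> carrier W" "v \<in> carrier W" using a P by auto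
    interpret V: preadditive_category "cat v" by (rule preadd) fact
    note m = glue_obj_map[OF o(1) a] glue_obj_map[OF o(2) a]
    note K = KD[OF a(2) a(2)]
    note pX = Phi_obj[OF a(1) c(1) a(3) oX[OF a(2)]] and pY = Phi_obj[OF a(1) c(1) a(3) oY[OF a(2)]]
      and pK = Phi_obj[OF a(1) c(1) a(3) K(1)]
    note phk = Phi_hom[OF a(1) c(1) a(3) K(1) oX[OF a(2)] K(2)]
    note phf = Phi_hom[OF a(1) c(1) a(3) oX[OF a(2)] oY[OF a(2)] hf[OF a(2)]]
    let ?g = "Cmp (cat v) (snd X (u, w)) (PhiM u w (k0 w))"
    have g: "?g \<in> Hom (cat v) (Phi u w (K0 w)) (fst X v)" by (rule V.cmp_hom[OF pK pX oX[OF a(4)]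
        phk m(1)])
    have "Cmp (cat v) (f v) ?g = Cmp (cat v) (Cmp (cat v) (f v) (snd X (u, w))) (PhiM u w (k0 w))"
      by (rule V.cmp_assoc[OF pK pX oX[OF a(4)] oY[OF a(4)] phk m(1) hf[OF a(4)], symmetric])
    also have "\<dots> = Cmp (cat v) (Cmp (cat v) (snd Y (u, w)) (PhiM u w (f w))) (PhiM u w (k0 w))"
      using glue_hom_natural[OF f a] by simp
    also have "\<dots> = Cmp (cat v) (snd Y (u, w)) (Cmp (cat v) (PhiM u w (f w)) (PhiM u w (k0 w)))"
      by (rule V.cmp_assoc[OF pK pX pY oY[OF a(4)] phk phf m(2)])
    also have "Cmp (cat v) (PhiM u w (f w)) (PhiM u w (k0 w)) = PhiM u w (Cmp (cat w) (f w) (k0 w))"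
      by (rule Phi_cmp[OF a(1) c(1) a(3) K(1) oX[OF a(2)] oY[OF a(2)] K(2) hf[OF a(2)], symmetric])
    also have "\<dots> = Zero_hom (cat v) (Phi u w (K0 w)) (Phi u w (fst Y w))"
      using K(3) Phi_zero[OF a(1) c(1) a(3) K(1) oY[OF a(2)]] by simp
    also have "Cmp (cat v) (snd Y (u, w)) \<dots> = Zero_hom (cat v) (Phi u w (K0 w)) (fst Y v)"
      by (rule V.cmp_zero_right[OF pK pY oY[OF a(4)] m(2)])
    finally show ?thesis using V.kernel_factor[OF ker[OF a(4)] pK g] by blast
  qed
  define \<kappa> where "\<kappa> u w = (SOME h. h \<in> Hom (cat (u \<otimes> w)) (Phi u w (K0 w)) (K0 (u \<otimes> w)) \<and>
      Cmp (cat (u \<otimes> w)) (k0 (u \<otimes> w)) h = Cmp (cat (u \<otimes> w)) (snd X (u, w)) (PhiM u w (k0 w)))" for u w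
  have \<kappa>: "\<kappa> u w \<in> Hom (cat v) (Phi u w (K0 w)) (K0 v)"
    "Cmp (cat v) (k0 v) (\<kappa> u w) = Cmp (cat v) (snd X (u, w)) (PhiM u w (k0 w))"
    if a: "u \<in> carrier W" "w \<in> P" "u \<otimes> w = v" "v \<in> P" for u w v
    using someI_ex[OF ex[OF a(1,2) HOL.refl]] a unfolding \<kappa>_def by auto
  let ?K = "(restrict K0 P, restrict (\<lambda>(u, w). \<kappa> u w) (glue_pairs W P))" and ?k = "restrict k0 P"
  have KO: "?K \<in> Obj ?G"
  proof (rule glue_objI[OF P])
    show "K0 w \<in> Obj (cat w)" if "w \<in> P" for w using KD(1)[OF that that] .
    show "\<kappa> u w \<in> Hom (cat v) (Phi u w (K0 w)) (K0 v)" if a: "u \<in> carrier W" "w \<in> P" "u \<otimes> w = v" "v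
        \<in> P" for u w v
      using \<kappa>(1)[OF a] .
    show "\<kappa> \<one> w = Ident (cat w) (K0 w)" if w: "w \<in> P" for w
    proof -
      have c: "w \<in> carrier W" "\<one> \<otimes> w = w" using w P by auto
      interpret C: preadditive_category "cat w" by (rule preadd) fact
      note K = KD[OF w w]
      have e: "Phi \<one> w (K0 w) = K0 w" using Phi_one_obj[OF c(1) K(1)] .
      note h = \<kappa>[OF one_closed w c(2) w]
      show ?thesis
      proof (rule C.kernel_cancel[OF ker[OF w] oX[OF w] oY[OF w] K(1) hf[OF w]])
        show "\<kappa> \<one> w \<in> Hom (cat w) (K0 w) (K0 w)" using h(1) e by simp
        show "Ident (cat w) (K0 w) \<in> Hom (cat w) (K0 w) (K0 w)" by (rule C.ident_hom[OF K(1)])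
        show "Cmp (cat w) (k0 w) (\<kappa> \<one> w) = Cmp (cat w) (k0 w) (Ident (cat w) (K0 w))"
          using h(2) glue_obj_one[OF o(1) w] Phi_one_map[OF c(1) K(1) oX[OF w] K(2)]
            C.cmp_ident_left[OF K(1) oX[OF w] K(2)] C.cmp_ident_right[OF K(1) oX[OF w] K(2)] by simp
      qed
    qed
    fix u u' w v' v x
    assume a: "u \<in> carrier W" "u' \<in> carrier W" "w \<in> P" "u' \<otimes> w = v'" "v' \<in> P" "u \<otimes> v' = v" "v \<in> P"
        "u \<otimes> u' = x"
    have c: "w \<in> carrier W" "v' \<in> carrier W" "v \<in> carrier W" "x \<in> carrier W" using a P by auto
    have xw: "x \<otimes> w = v" using a c by (auto simp: m_assoc)
    interpret V: preadditive_category "cat v" by (rule preadd) fact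
    interpret V': preadditive_category "cat v'" by (rule preadd) fact
    note K = KD[OF a(3) a(3)] and K' = KD[OF a(5) a(5)] and Kv = KD[OF a(7) a(7)]
    note b1 = a(2,3,4,5) and b2 = a(1,5,6,7)
    have b3: "x \<in> carrier W" "w \<in> P" "x \<otimes> w = v" "v \<in> P" using a c xw by auto
    note k1 = \<kappa>[OF b1] and k2 = \<kappa>[OF b2] and k3 = \<kappa>[OF b3]
    note m1 = glue_obj_map[OF o(1) b1] and m2 = glue_obj_map[OF o(1) b2] and m3 = glue_obj_map[OF
        o(1) b3]
    note p1K = Phi_obj[OF a(2) c(1) a(4) K(1)] and p1X = Phi_obj[OF a(2) c(1) a(4) oX[OF a(3)]]
    note p2 = Phi_obj[OF a(1) c(2) a(6)]
    note p3K = Phi_obj[OF c(4) c(1) xw K(1)] and p3X = Phi_obj[OF c(4) c(1) xw oX[OF a(3)]]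
    note h1 = Phi_hom[OF a(2) c(1) a(4) K(1) oX[OF a(3)] K(2)]
    note h2 = Phi_hom[OF a(1) c(2) a(6)]
    note h3 = Phi_hom[OF c(4) c(1) xw K(1) oX[OF a(3)] K(2)]
    note nK = nu_hom[OF a(1,2) c(1) a(4,8,6) K(1)] and nX = nu_hom[OF a(1,2) c(1) a(4,8,6) oX[OF a(3)]]
    have q1: "PhiM u v' (\<kappa> u' w) \<in> Hom (cat v) (Phi u v' (Phi u' w (K0 w))) (Phi u v' (K0 v'))"
      by (rule h2[OF p1K K'(1) k1(1)])
    have q2: "PhiM u v' (k0 v') \<in> Hom (cat v) (Phi u v' (K0 v')) (Phi u v' (fst X v'))"
      by (rule h2[OF K'(1) oX[OF a(5)] K'(2)])
    have q3: "PhiM u v' (PhiM u' w (k0 w)) \<in> Hom (cat v) (Phi u v' (Phi u' w (K0 w))) (Phi u v' (Phi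
        u' w (fst X w)))"
      by (rule h2[OF p1K p1X h1])
    have q4: "PhiM u v' (snd X (u', w)) \<in> Hom (cat v) (Phi u v' (Phi u' w (fst X w))) (Phi u v' (fst
        X v'))"
      by (rule h2[OF p1X oX[OF a(5)] m1])
    show "Cmp (cat v) (\<kappa> u v') (PhiM u v' (\<kappa> u' w)) = Cmp (cat v) (\<kappa> x w) (nu u u' w (K0 w))"
    proof (rule V.kernel_cancel[OF ker[OF a(7)] oX[OF a(7)] oY[OF a(7)] p2[OF p1K] hf[OF a(7)]])
      show "Cmp (cat v) (\<kappa> u v') (PhiM u v' (\<kappa> u' w)) \<in> Hom (cat v) (Phi u v' (Phi u' w (K0 w))) (K0 v)"
        by (rule V.cmp_hom[OF p2[OF p1K] p2[OF K'(1)] Kv(1) q1 k2(1)])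
      show "Cmp (cat v) (\<kappa> x w) (nu u u' w (K0 w)) \<in> Hom (cat v) (Phi u v' (Phi u' w (K0 w))) (K0 v)"
        by (rule V.cmp_hom[OF p2[OF p1K] p3K Kv(1) nK k3(1)])
      have "Cmp (cat v) (k0 v) (Cmp (cat v) (\<kappa> u v') (PhiM u v' (\<kappa> u' w)))
          = Cmp (cat v) (Cmp (cat v) (snd X (u, v')) (PhiM u v' (k0 v'))) (PhiM u v' (\<kappa> u' w))"
        using V.cmp_assoc[OF p2[OF p1K] p2[OF K'(1)] Kv(1) oX[OF a(7)] q1 k2(1) Kv(2)] k2(2) by simp
      also have "\<dots> = Cmp (cat v) (snd X (u, v')) (Cmp (cat v) (PhiM u v' (k0 v')) (PhiM u v' (\<kappa> u' w)))"
        by (rule V.cmp_assoc[OF p2[OF p1K] p2[OF K'(1)] p2[OF oX[OF a(5)]] oX[OF a(7)] q1 q2 m2])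
      also have "Cmp (cat v) (PhiM u v' (k0 v')) (PhiM u v' (\<kappa> u' w)) = PhiM u v' (Cmp (cat v') (snd
          X (u', w)) (PhiM u' w (k0 w)))"
        using Phi_cmp[OF a(1) c(2) a(6) p1K K'(1) oX[OF a(5)] k1(1) K'(2)] k1(2) by simp
      also have "\<dots> = Cmp (cat v) (PhiM u v' (snd X (u', w))) (PhiM u v' (PhiM u' w (k0 w)))"
        by (rule Phi_cmp[OF a(1) c(2) a(6) p1K p1X oX[OF a(5)] h1 m1])
      also have "Cmp (cat v) (snd X (u, v')) \<dots> = Cmp (cat v) (Cmp (cat v) (snd X (u, v')) (PhiM u v'
          (snd X (u', w)))) (PhiM u v' (PhiM u' w (k0 w)))"
        by (rule V.cmp_assoc[OF p2[OF p1K] p2[OF p1X] p2[OF oX[OF a(5)]] oX[OF a(7)] q3 q4 m2,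
            symmetric])
      also have "\<dots> = Cmp (cat v) (Cmp (cat v) (snd X (x, w)) (nu u u' w (fst X w))) (PhiM u v' (PhiM
          u' w (k0 w)))"
        using glue_obj_assoc[OF P o(1) a] by simp
      also have "\<dots> = Cmp (cat v) (snd X (x, w)) (Cmp (cat v) (nu u u' w (fst X w)) (PhiM u v' (PhiM
          u' w (k0 w))))"
        by (rule V.cmp_assoc[OF p2[OF p1K] p2[OF p1X] p3X oX[OF a(7)] q3 nX m3])
      also have "Cmp (cat v) (nu u u' w (fst X w)) (PhiM u v' (PhiM u' w (k0 w))) = Cmp (cat v)
          (PhiM x w (k0 w)) (nu u u' w (K0 w))"
        by (rule nu_nat[OF a(1,2) c(1) a(4,8,6) K(1) oX[OF a(3)] K(2)])
      also have "Cmp (cat v) (snd X (x, w)) \<dots> = Cmp (cat v) (Cmp (cat v) (snd X (x, w)) (PhiM x w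
          (k0 w))) (nu u u' w (K0 w))"
        by (rule V.cmp_assoc[OF p2[OF p1K] p3K p3X oX[OF a(7)] nK h3 m3, symmetric])
      also have "\<dots> = Cmp (cat v) (Cmp (cat v) (k0 v) (\<kappa> x w)) (nu u u' w (K0 w))" using k3(2) by simp
      also have "\<dots> = Cmp (cat v) (k0 v) (Cmp (cat v) (\<kappa> x w) (nu u u' w (K0 w)))"
        by (rule V.cmp_assoc[OF p2[OF p1K] p3K Kv(1) oX[OF a(7)] nK k3(1) Kv(2)])
      finally show "Cmp (cat v) (k0 v) (Cmp (cat v) (\<kappa> u v') (PhiM u v' (\<kappa> u' w)))
          = Cmp (cat v) (k0 v) (Cmp (cat v) (\<kappa> x w) (nu u u' w (K0 w)))" .
    qed
  qed
  have sK: "snd ?K (u, w) = \<kappa> u w" if "u \<in> carrier W" "w \<in> P" "u \<otimes> w = v" "v \<in> P" for u w v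
    using that by (simp add: glue_pairs_def)
  have kH: "?k \<in> Hom ?G ?K X"
    by (rule glue_homI) (use KD sK \<kappa>(2) in simp_all)
  have "is_kernel ?G X Y f ?K ?k"
    unfolding is_kernel_def
  proof (intro conjI ballI impI)
    interpret G: preadditive_category ?G by (rule glue_preadditive[OF P])
    show "?K \<in> Obj ?G" "?k \<in> Hom ?G ?K X" by fact+
    show "Cmp ?G f ?k = Zero_hom ?G ?K Y"
      by (rule glue_hom_eqI[OF G.cmp_hom[OF KO o kH f] G.zero_closed[OF KO o(2)]]) (simp add: KD(3))
    fix Z g assume Z: "Z \<in> Obj ?G" and g: "g \<in> Hom ?G Z X" "Cmp ?G f g = Zero_hom ?G Z Y"
    note oZ = glue_obj_component[OF Z] and hg = glue_hom_component[OF g(1)]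
    have z: "Cmp (cat w) (f w) (g w) = Zero_hom (cat w) (fst Z w) (fst Y w)" if "w \<in> P" for w
      using arg_cong[OF g(2), of "\<lambda>h. h w"] that by simp
    have "\<exists>h. h \<in> Hom (cat w) (fst Z w) (K0 w) \<and> Cmp (cat w) (k0 w) h = g w" if w: "w \<in> P" for w
      using preadditive_category.kernel_factor[OF pre[OF w] ker[OF w] oZ[OF w] hg[OF w] z[OF w]] by
          blast
    then obtain h0 where h0: "\<And>w. w \<in> P \<Longrightarrow> h0 w \<in> Hom (cat w) (fst Z w) (K0 w)"
        "\<And>w. w \<in> P \<Longrightarrow> Cmp (cat w) (k0 w) (h0 w) = g w" by metis
    have h: "restrict h0 P \<in> Hom ?G Z ?K"
    proof (rule glue_homI)
      fix u w v assume a: "u \<in> carrier W" "w \<in> P" "u \<otimes> w = v" "v \<in> P"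
      have c: "w \<in> carrier W" "v \<in> carrier W" using a P by auto
      interpret V: preadditive_category "cat v" by (rule preadd) fact
      note K = KD[OF a(2) a(2)] and Kv = KD[OF a(4) a(4)] and k = \<kappa>[OF a]
      note mZ = glue_obj_map[OF Z a] and mX = glue_obj_map[OF o(1) a]
      note pZ = Phi_obj[OF a(1) c(1) a(3) oZ[OF a(2)]] and pK = Phi_obj[OF a(1) c(1) a(3) K(1)]
        and pX = Phi_obj[OF a(1) c(1) a(3) oX[OF a(2)]]
      note phh = Phi_hom[OF a(1) c(1) a(3) oZ[OF a(2)] K(1) h0(1)[OF a(2)]]
        and phk = Phi_hom[OF a(1) c(1) a(3) K(1) oX[OF a(2)] K(2)]
      have "Cmp (cat v) (h0 v) (snd Z (u, w)) = Cmp (cat v) (\<kappa> u w) (PhiM u w (h0 w))"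
      proof (rule V.kernel_cancel[OF ker[OF a(4)] oX[OF a(4)] oY[OF a(4)] pZ hf[OF a(4)]])
        show "Cmp (cat v) (h0 v) (snd Z (u, w)) \<in> Hom (cat v) (Phi u w (fst Z w)) (K0 v)"
          by (rule V.cmp_hom[OF pZ oZ[OF a(4)] Kv(1) mZ h0(1)[OF a(4)]])
        show "Cmp (cat v) (\<kappa> u w) (PhiM u w (h0 w)) \<in> Hom (cat v) (Phi u w (fst Z w)) (K0 v)"
          by (rule V.cmp_hom[OF pZ pK Kv(1) phh k(1)])
        have "Cmp (cat v) (k0 v) (Cmp (cat v) (h0 v) (snd Z (u, w))) = Cmp (cat v) (g v) (snd Z (u, w))"
          using V.cmp_assoc[OF pZ oZ[OF a(4)] Kv(1) oX[OF a(4)] mZ h0(1)[OF a(4)] Kv(2)] h0(2)[OF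
              a(4)] by simp
        also have "\<dots> = Cmp (cat v) (snd X (u, w)) (PhiM u w (g w))" by (rule glue_hom_natural[OF
            g(1) a])
        also have "PhiM u w (g w) = Cmp (cat v) (PhiM u w (k0 w)) (PhiM u w (h0 w))"
          using Phi_cmp[OF a(1) c(1) a(3) oZ[OF a(2)] K(1) oX[OF a(2)] h0(1)[OF a(2)] K(2)] h0(2)[OF
              a(2)] by simp
        also have "Cmp (cat v) (snd X (u, w)) \<dots> = Cmp (cat v) (Cmp (cat v) (snd X (u, w)) (PhiM u w
            (k0 w))) (PhiM u w (h0 w))"
          by (rule V.cmp_assoc[OF pZ pK pX oX[OF a(4)] phh phk mX, symmetric])
        also have "\<dots> = Cmp (cat v) (Cmp (cat v) (k0 v) (\<kappa> u w)) (PhiM u w (h0 w))" using k(2) by simp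
        also have "\<dots> = Cmp (cat v) (k0 v) (Cmp (cat v) (\<kappa> u w) (PhiM u w (h0 w)))"
          by (rule V.cmp_assoc[OF pZ pK Kv(1) oX[OF a(4)] phh k(1) Kv(2)])
        finally show "Cmp (cat v) (k0 v) (Cmp (cat v) (h0 v) (snd Z (u, w))) = Cmp (cat v) (k0 v)
            (Cmp (cat v) (\<kappa> u w) (PhiM u w (h0 w)))" .
      qed
      thus "Cmp (cat v) (restrict h0 P v) (snd Z (u, w)) = Cmp (cat v) (snd ?K (u, w)) (PhiM u w
          (restrict h0 P w))"
        using a sK[OF a] by simp
    qed (use h0(1) in simp_all)
    show "\<exists>!h. h \<in> Hom ?G Z ?K \<and> Cmp ?G ?k h = g"
    proof (rule ex1I[of _ "restrict h0 P"])
      show "restrict h0 P \<in> Hom ?G Z ?K \<and> Cmp ?G ?k (restrict h0 P) = g"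
        using h by (intro conjI glue_hom_eqI[OF G.cmp_hom[OF Z KO o(1) h kH] g(1)]) (simp_all add:
            h0(2))
      fix h' assume h': "h' \<in> Hom ?G Z ?K \<and> Cmp ?G ?k h' = g"
      show "h' = restrict h0 P"
      proof (rule glue_hom_eqI[OF conjunct1[OF h'] h])
        fix w assume w: "w \<in> P"
        have "Cmp (cat w) (k0 w) (h' w) = g w" using arg_cong[OF conjunct2[OF h'], of "\<lambda>h. h w"] w
            by simp
        moreover have "h' w \<in> Hom (cat w) (fst Z w) (K0 w)" using glue_hom_component[OF conjunct1[OF
            h'] w] w by simp
        ultimately show "h' w = restrict h0 P w"
          using preadditive_category.kernel_cancel[OF pre[OF w] ker[OF w] oX[OF w] oY[OF w] oZ[OF w]
              hf[OF w], of "h' w" "h0 w"]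
            h0[OF w] w by simp
      qed
    qed
  qed
  moreover have "is_kernel (cat w) (fst X w) (fst Y w) (f w) (fst ?K w) (?k w)" if "w \<in> P" for w
    using ker[OF that] that by simp
  ultimately show ?thesis by blast
qed

text \<open>An additive functor preserves biproducts, so a structure map on the componentwise sum is determined by its
  composites with the images of the injections. This defines it, and all identities are tested in the same
  way.\<close>

lemma glue_biproduct:
  assumes P: "P \<subseteq> carrier W" and I: "finite I" and X: "\<And>i. i \<in> I \<Longrightarrow> X i \<in> Obj (glue W D P)"
  shows "\<exists>U \<iota> \<pi>. is_biproduct (glue W D P) I X U \<iota> \<pi>"
proof -
  let ?G = "glue W D P"
  interpret G: preadditive_category ?G by (rule glue_preadditive[OF P])
  have pre: "preadditive_category (cat w)" if "w \<in> P" for w using preadd that P by blast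
  have oX: "fst (X i) w \<in> Obj (cat w)" if "i \<in> I" "w \<in> P" for i w using glue_obj_component[OF X[OF
      that(1)] that(2)] .
  have "\<exists>U \<iota> \<pi>. is_biproduct (cat w) I (\<lambda>i. fst (X i) w) U \<iota> \<pi>" if w: "w \<in> P" for w
    using abelian_category.finite_biproducts[OF abelian[OF subsetD[OF P w]] I, of "\<lambda>i. fst (X i) w"]
        oX w by blast
  then obtain U \<iota> \<pi> where bip: "\<And>w. w \<in> P \<Longrightarrow> is_biproduct (cat w) I (\<lambda>i. fst (X i) w) (U w) (\<iota> w) (\<pi>
      w)" by metis
  note B = preadditive_category.biproductD[OF pre bip]
  define \<alpha> where "\<alpha> u w = (SOME h. h \<in> Hom (cat (u \<otimes> w)) (Phi u w (U w)) (U (u \<otimes> w)) \<and>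
     (\<forall>i\<in>I. Cmp (cat (u \<otimes> w)) h (PhiM u w (\<iota> w i)) = Cmp (cat (u \<otimes> w)) (\<iota> (u \<otimes> w) i) (snd (X i) (u,
         w))))" for u w
  have cop: "is_coproduct (cat v) I (\<lambda>i. Phi u w (fst (X i) w)) (Phi u w (U w)) (\<lambda>i. PhiM u w (\<iota> w i))"
    if a: "u \<in> carrier W" "w \<in> P" "u \<otimes> w = v" "v \<in> P" for u w v
    using preadditive_category.biproduct_coproduct[OF pre[OF a(4)] Phi_biproduct[OF a(1) subsetD[OF
        P a(2)] a(3) bip[OF a(2)]]] .
  have im: "Cmp (cat v) (\<iota> v i) (snd (X i) (u, w)) \<in> Hom (cat v) (Phi u w (fst (X i) w)) (U v)"
    if a: "u \<in> carrier W" "w \<in> P" "u \<otimes> w = v" "v \<in> P" and i: "i \<in> I" for u w v i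
    by (rule preadditive_category.cmp_hom[OF pre[OF a(4)] Phi_obj[OF a(1) subsetD[OF P a(2)] a(3)
        oX[OF i a(2)]]
      oX[OF i a(4)] B(2)[OF a(4) a(4)] glue_obj_map[OF X[OF i] a] B(4)[OF a(4) a(4) i]])
  have \<alpha>: "\<alpha> u w \<in> Hom (cat v) (Phi u w (U w)) (U v)"
    "\<And>i. i \<in> I \<Longrightarrow> Cmp (cat v) (\<alpha> u w) (PhiM u w (\<iota> w i)) = Cmp (cat v) (\<iota> v i) (snd (X i) (u, w))"
    if a: "u \<in> carrier W" "w \<in> P" "u \<otimes> w = v" "v \<in> P" for u w v
    using someI_ex[OF preadditive_category.coproduct_ex[OF pre[OF a(4)] cop[OF a] B(2)[OF a(4) a(4)],
          of "\<lambda>i. Cmp (cat v) (\<iota> v i) (snd (X i) (u, w))", OF im[OF a]]] a(3) unfolding \<alpha>_def by auto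
  let ?U = "(restrict U P, restrict (\<lambda>(u, w). \<alpha> u w) (glue_pairs W P))"
  let ?\<iota> = "\<lambda>i. \<lambda>w\<in>P. \<iota> w i" and ?\<pi> = "\<lambda>i. \<lambda>w\<in>P. \<pi> w i"
  have UO: "?U \<in> Obj ?G"
  proof (rule glue_objI[OF P])
    show "U w \<in> Obj (cat w)" if "w \<in> P" for w using B(2)[OF that that] .
    show "\<alpha> u w \<in> Hom (cat v) (Phi u w (U w)) (U v)" if a: "u \<in> carrier W" "w \<in> P" "u \<otimes> w = v" "v \<in>
        P" for u w v
      using \<alpha>(1)[OF a] .
    show "\<alpha> \<one> w = Ident (cat w) (U w)" if w: "w \<in> P" for w
    proof -
      have c: "w \<in> carrier W" "\<one> \<otimes> w = w" using w P by auto
      interpret C: preadditive_category "cat w" by (rule preadd) fact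
      note h = \<alpha>[OF one_closed w c(2) w] and b = B[OF w w]
      have e: "Phi \<one> w (U w) = U w" using Phi_one_obj[OF c(1) b(2)] .
      show ?thesis
      proof (rule C.coproduct_eqI[OF C.biproduct_coproduct[OF bip[OF w]] b(2)])
        show "\<alpha> \<one> w \<in> Hom (cat w) (U w) (U w)" using h(1) e by simp
        show "Ident (cat w) (U w) \<in> Hom (cat w) (U w) (U w)" by (rule C.ident_hom[OF b(2)])
        fix i assume i: "i \<in> I"
        show "fst (X i) w \<in> Obj (cat w)" by (rule oX[OF i w])
        show "Cmp (cat w) (\<alpha> \<one> w) (\<iota> w i) = Cmp (cat w) (Ident (cat w) (U w)) (\<iota> w i)"
          using h(2)[OF i] glue_obj_one[OF X[OF i] w] Phi_one_map[OF c(1) oX[OF i w] b(2) b(4)[OF i]]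
            C.cmp_ident_left[OF oX[OF i w] b(2) b(4)[OF i]] C.cmp_ident_right[OF oX[OF i w] b(2)
                b(4)[OF i]] by simp
      qed
    qed
    fix u u' w v' v x
    assume a: "u \<in> carrier W" "u' \<in> carrier W" "w \<in> P" "u' \<otimes> w = v'" "v' \<in> P" "u \<otimes> v' = v" "v \<in> P"
        "u \<otimes> u' = x"
    have c: "w \<in> carrier W" "v' \<in> carrier W" "v \<in> carrier W" "x \<in> carrier W" using a P by auto
    have xw: "x \<otimes> w = v" using a c by (auto simp: m_assoc)
    interpret V: preadditive_category "cat v" by (rule preadd) fact
    interpret V': preadditive_category "cat v'" by (rule preadd) fact
    note K = B[OF a(3) a(3)] and K' = B[OF a(5) a(5)] and Kv = B[OF a(7) a(7)]
    note b1 = a(2,3,4,5) and b2 = a(1,5,6,7)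
    have b3: "x \<in> carrier W" "w \<in> P" "x \<otimes> w = v" "v \<in> P" using a c xw by auto
    note k1 = \<alpha>[OF b1] and k2 = \<alpha>[OF b2] and k3 = \<alpha>[OF b3]
    note p1U = Phi_obj[OF a(2) c(1) a(4) K(2)]
    note p2 = Phi_obj[OF a(1) c(2) a(6)]
    note p3U = Phi_obj[OF c(4) c(1) xw K(2)]
    note h2 = Phi_hom[OF a(1) c(2) a(6)]
    note nU = nu_hom[OF a(1,2) c(1) a(4,8,6) K(2)]
    have q1: "PhiM u v' (\<alpha> u' w) \<in> Hom (cat v) (Phi u v' (Phi u' w (U w))) (Phi u v' (U v'))"
      by (rule h2[OF p1U K'(2) k1(1)])
    have bip2: "is_biproduct (cat v) I (\<lambda>i. Phi u v' (Phi u' w (fst (X i) w))) (Phi u v' (Phi u' w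
        (U w)))
        (\<lambda>i. PhiM u v' (PhiM u' w (\<iota> w i))) (\<lambda>i. PhiM u v' (PhiM u' w (\<pi> w i)))"
      by (rule Phi_biproduct[OF a(1) c(2) a(6) Phi_biproduct[OF a(2) c(1) a(4) bip[OF a(3)]]])
    show "Cmp (cat v) (\<alpha> u v') (PhiM u v' (\<alpha> u' w)) = Cmp (cat v) (\<alpha> x w) (nu u u' w (U w))"
    proof (rule V.coproduct_eqI[OF V.biproduct_coproduct[OF bip2] Kv(2)])
      show "Cmp (cat v) (\<alpha> u v') (PhiM u v' (\<alpha> u' w)) \<in> Hom (cat v) (Phi u v' (Phi u' w (U w))) (U v)"
        by (rule V.cmp_hom[OF p2[OF p1U] p2[OF K'(2)] Kv(2) q1 k2(1)])
      show "Cmp (cat v) (\<alpha> x w) (nu u u' w (U w)) \<in> Hom (cat v) (Phi u v' (Phi u' w (U w))) (U v)"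
        by (rule V.cmp_hom[OF p2[OF p1U] p3U Kv(2) nU k3(1)])
      fix i assume i: "i \<in> I"
      note oi = oX[OF i a(3)] and oi' = oX[OF i a(5)] and oiv = oX[OF i a(7)]
      note p1 = Phi_obj[OF a(2) c(1) a(4) oi]
      note h1 = Phi_hom[OF a(2) c(1) a(4) oi K(2) K(4)[OF i]]
      note p3 = Phi_obj[OF c(4) c(1) xw oi] and h3 = Phi_hom[OF c(4) c(1) xw oi K(2) K(4)[OF i]]
      note m1 = glue_obj_map[OF X[OF i] b1] and m2 = glue_obj_map[OF X[OF i] b2] and m3 =
          glue_obj_map[OF X[OF i] b3]
      note ni = nu_hom[OF a(1,2) c(1) a(4,8,6) oi]
      show "Phi u v' (Phi u' w (fst (X i) w)) \<in> Obj (cat v)" by (rule p2[OF p1])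
      note q3 = h2[OF p1 p1U h1] and q4 = h2[OF p1 oi' m1] and q5 = h2[OF oi' K'(2) K'(4)[OF i]]
      have "Cmp (cat v) (Cmp (cat v) (\<alpha> u v') (PhiM u v' (\<alpha> u' w))) (PhiM u v' (PhiM u' w (\<iota> w i)))
          = Cmp (cat v) (\<alpha> u v') (Cmp (cat v) (PhiM u v' (\<alpha> u' w)) (PhiM u v' (PhiM u' w (\<iota> w i))))"
        by (rule V.cmp_assoc[OF p2[OF p1] p2[OF p1U] p2[OF K'(2)] Kv(2) q3 q1 k2(1)])
      also have "Cmp (cat v) (PhiM u v' (\<alpha> u' w)) (PhiM u v' (PhiM u' w (\<iota> w i))) = PhiM u v' (Cmp
          (cat v') (\<iota> v' i) (snd (X i) (u', w)))"
        using Phi_cmp[OF a(1) c(2) a(6) p1 p1U K'(2) h1 k1(1)] k1(2)[OF i] by simp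
      also have "\<dots> = Cmp (cat v) (PhiM u v' (\<iota> v' i)) (PhiM u v' (snd (X i) (u', w)))"
        by (rule Phi_cmp[OF a(1) c(2) a(6) p1 oi' K'(2) m1 K'(4)[OF i]])
      also have "Cmp (cat v) (\<alpha> u v') \<dots> = Cmp (cat v) (Cmp (cat v) (\<alpha> u v') (PhiM u v' (\<iota> v' i)))
          (PhiM u v' (snd (X i) (u', w)))"
        by (rule V.cmp_assoc[OF p2[OF p1] p2[OF oi'] p2[OF K'(2)] Kv(2) q4 q5 k2(1), symmetric])
      also have "\<dots> = Cmp (cat v) (Cmp (cat v) (\<iota> v i) (snd (X i) (u, v'))) (PhiM u v' (snd (X i)
          (u', w)))"
        using k2(2)[OF i] by simp
      also have "\<dots> = Cmp (cat v) (\<iota> v i) (Cmp (cat v) (snd (X i) (u, v')) (PhiM u v' (snd (X i) (u',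
          w))))"
        by (rule V.cmp_assoc[OF p2[OF p1] p2[OF oi'] oiv Kv(2) q4 m2 Kv(4)[OF i]])
      also have "\<dots> = Cmp (cat v) (\<iota> v i) (Cmp (cat v) (snd (X i) (x, w)) (nu u u' w (fst (X i) w)))"
        using glue_obj_assoc[OF P X[OF i] a] by simp
      also have "\<dots> = Cmp (cat v) (Cmp (cat v) (\<iota> v i) (snd (X i) (x, w))) (nu u u' w (fst (X i) w))"
        by (rule V.cmp_assoc[OF p2[OF p1] p3 oiv Kv(2) ni m3 Kv(4)[OF i], symmetric])
      also have "\<dots> = Cmp (cat v) (Cmp (cat v) (\<alpha> x w) (PhiM x w (\<iota> w i))) (nu u u' w (fst (X i) w))"
        using k3(2)[OF i] by simp
      also have "\<dots> = Cmp (cat v) (\<alpha> x w) (Cmp (cat v) (PhiM x w (\<iota> w i)) (nu u u' w (fst (X i) w)))"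
        by (rule V.cmp_assoc[OF p2[OF p1] p3 p3U Kv(2) ni h3 k3(1)])
      also have "Cmp (cat v) (PhiM x w (\<iota> w i)) (nu u u' w (fst (X i) w)) = Cmp (cat v) (nu u u' w
          (U w)) (PhiM u v' (PhiM u' w (\<iota> w i)))"
        by (rule nu_nat[OF a(1,2) c(1) a(4,8,6) oi K(2) K(4)[OF i], symmetric])
      also have "Cmp (cat v) (\<alpha> x w) \<dots> = Cmp (cat v) (Cmp (cat v) (\<alpha> x w) (nu u u' w (U w))) (PhiM u
          v' (PhiM u' w (\<iota> w i)))"
        by (rule V.cmp_assoc[OF p2[OF p1] p2[OF p1U] p3U Kv(2) q3 nU k3(1), symmetric])
      finally show "Cmp (cat v) (Cmp (cat v) (\<alpha> u v') (PhiM u v' (\<alpha> u' w))) (PhiM u v' (PhiM u' w (\<iota>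
          w i)))
          = Cmp (cat v) (Cmp (cat v) (\<alpha> x w) (nu u u' w (U w))) (PhiM u v' (PhiM u' w (\<iota> w i)))" .
    qed
  qed
  have sU: "snd ?U (u, w) = \<alpha> u w" if "u \<in> carrier W" "w \<in> P" "u \<otimes> w = v" "v \<in> P" for u w v
    using that by (simp add: glue_pairs_def)
  have \<iota>H: "?\<iota> i \<in> Hom ?G (X i) ?U" if i: "i \<in> I" for i
    by (rule glue_homI) (use i B sU \<alpha>(2) in simp_all)
  have \<pi>H: "?\<pi> i \<in> Hom ?G ?U (X i)" if i: "i \<in> I" for i
  proof (rule glue_homI)
    fix u w v assume a: "u \<in> carrier W" "w \<in> P" "u \<otimes> w = v" "v \<in> P"
    have c: "w \<in> carrier W" "v \<in> carrier W" using a P by auto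
    interpret V: preadditive_category "cat v" by (rule preadd) fact
    note K = B[OF a(2) a(2)] and Kv = B[OF a(4) a(4)] and k = \<alpha>[OF a]
    note p = Phi_obj[OF a(1) c(1) a(3)] and h = Phi_hom[OF a(1) c(1) a(3)]
    note mi = glue_obj_map[OF X[OF i] a]
    note oi = oX[OF i a(2)] and oiv = oX[OF i a(4)]
    have "Cmp (cat v) (\<pi> v i) (\<alpha> u w) = Cmp (cat v) (snd (X i) (u, w)) (PhiM u w (\<pi> w i))"
    proof (rule V.coproduct_eqI[OF cop[OF a] oiv])
      show "Cmp (cat v) (\<pi> v i) (\<alpha> u w) \<in> Hom (cat v) (Phi u w (U w)) (fst (X i) v)"
        by (rule V.cmp_hom[OF p[OF K(2)] Kv(2) oiv k(1) Kv(5)[OF i]])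
      show "Cmp (cat v) (snd (X i) (u, w)) (PhiM u w (\<pi> w i)) \<in> Hom (cat v) (Phi u w (U w)) (fst (X
          i) v)"
        by (rule V.cmp_hom[OF p[OF K(2)] p[OF oi] oiv h[OF K(2) oi K(5)[OF i]] mi])
      fix j assume j: "j \<in> I"
      note oj = oX[OF j a(2)] and ojv = oX[OF j a(4)] and mj = glue_obj_map[OF X[OF j] a]
      show "Phi u w (fst (X j) w) \<in> Obj (cat v)" by (rule p[OF oj])
      have "Cmp (cat v) (Cmp (cat v) (\<pi> v i) (\<alpha> u w)) (PhiM u w (\<iota> w j)) = Cmp (cat v) (\<pi> v i) (Cmp
          (cat v) (\<iota> v j) (snd (X j) (u, w)))"
        using V.cmp_assoc[OF p[OF oj] p[OF K(2)] Kv(2) oiv h[OF oj K(2) K(4)[OF j]] k(1) Kv(5)[OF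
            i]] k(2)[OF j] by simp
      also have "\<dots> = Cmp (cat v) (Cmp (cat v) (\<pi> v i) (\<iota> v j)) (snd (X j) (u, w))"
        by (rule V.cmp_assoc[OF p[OF oj] ojv Kv(2) oiv mj Kv(4)[OF j] Kv(5)[OF i], symmetric])
      also have "\<dots> = Cmp (cat v) (snd (X i) (u, w)) (PhiM u w (Cmp (cat w) (\<pi> w i) (\<iota> w j)))"
      proof (cases "i = j")
        case True
        thus ?thesis using K(6)[OF j] Kv(6)[OF j] Phi_ident[OF a(1) c(1) a(3) oj]
            V.cmp_ident_left[OF p[OF oj] ojv mj] V.cmp_ident_right[OF p[OF oj] ojv mj] by simp
      next
        case False
        thus ?thesis using K(7)[OF i j] Kv(7)[OF i j] Phi_zero[OF a(1) c(1) a(3) oj oi]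
            V.cmp_zero_left[OF p[OF oj] ojv oiv mj] V.cmp_zero_right[OF p[OF oj] p[OF oi] oiv mi] by
                simp
      qed
      also have "PhiM u w (Cmp (cat w) (\<pi> w i) (\<iota> w j)) = Cmp (cat v) (PhiM u w (\<pi> w i)) (PhiM u w
          (\<iota> w j))"
        by (rule Phi_cmp[OF a(1) c(1) a(3) oj K(2) oi K(4)[OF j] K(5)[OF i]])
      also have "Cmp (cat v) (snd (X i) (u, w)) \<dots> = Cmp (cat v) (Cmp (cat v) (snd (X i) (u, w))
          (PhiM u w (\<pi> w i))) (PhiM u w (\<iota> w j))"
        by (rule V.cmp_assoc[OF p[OF oj] p[OF K(2)] p[OF oi] oiv h[OF oj K(2) K(4)[OF j]] h[OF K(2)
            oi K(5)[OF i]] mi, symmetric])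
      finally show "Cmp (cat v) (Cmp (cat v) (\<pi> v i) (\<alpha> u w)) (PhiM u w (\<iota> w j))
          = Cmp (cat v) (Cmp (cat v) (snd (X i) (u, w)) (PhiM u w (\<pi> w i))) (PhiM u w (\<iota> w j))" .
    qed
    thus "Cmp (cat v) (?\<pi> i v) (snd ?U (u, w)) = Cmp (cat v) (snd (X i) (u, w)) (PhiM u w (?\<pi> i w))"
      using a sU[OF a] by simp
  qed (use i B in simp_all)
  have "Cmp ?G (?\<pi> i) (?\<iota> j) = (if i = j then Ident ?G (X i) else Zero_hom ?G (X j) (X i))"
    if ij: "i \<in> I" "j \<in> I" for i j
  proof -
    have "(if i = j then Ident ?G (X i) else Zero_hom ?G (X j) (X i)) \<in> Hom ?G (X j) (X i)"
      using G.ident_hom[OF X] X ij by auto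
    from glue_hom_eqI[OF G.cmp_hom[OF X[OF ij(2)] UO X[OF ij(1)] \<iota>H[OF ij(2)] \<pi>H[OF ij(1)]] this]
    show ?thesis using B(6) B(7)[OF _ _ ij] ij by auto
  qed
  moreover have "hom_sum ?G ?U ?U (\<lambda>i. Cmp ?G (?\<iota> i) (?\<pi> i)) I = Ident ?G ?U"
  proof -
    have ip: "Cmp ?G (?\<iota> i) (?\<pi> i) \<in> Hom ?G ?U ?U" if "i \<in> I" for i
      using G.cmp_hom[OF UO X[OF that] UO \<pi>H[OF that] \<iota>H[OF that]] .
    show ?thesis
    proof (rule glue_hom_eqI[OF G.hom_sum_closed[OF UO UO ip] G.ident_hom[OF UO]])
      fix w assume w: "w \<in> P"
      show "hom_sum ?G ?U ?U (\<lambda>i. Cmp ?G (?\<iota> i) (?\<pi> i)) I w = Ident ?G ?U w"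
        using glue_hom_sum_component[OF P UO UO w I, of "\<lambda>i. Cmp ?G (?\<iota> i) (?\<pi> i)", OF ip] B(8)[OF w
            w] w by simp
    qed
  qed
  ultimately have "is_biproduct ?G I X ?U ?\<iota> ?\<pi>" unfolding is_biproduct_def using I UO X \<iota>H \<pi>H by blast
  thus ?thesis by blast
qed

lemma glue_zero_object:
  assumes P: "P \<subseteq> carrier W" shows "\<exists>Z. is_zero_object (glue W D P) Z"
proof -
  interpret G: preadditive_category "glue W D P" by (rule glue_preadditive[OF P])
  obtain U \<iota> \<pi> where b: "is_biproduct (glue W D P) ({} :: nat set) (\<lambda>_. undefined) U \<iota> \<pi>"
    using glue_biproduct[OF P, of "{} :: nat set" "\<lambda>_. undefined"] by auto
  have "is_zero_object (glue W D P) U"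
    by (rule G.zero_objectI) (use G.biproductD(2,8)[OF b] in simp_all)
  thus ?thesis by (rule exI)
qed

end

section \<open>The left adjoint of restriction to a coset\<close>

context coxeter_gluing
begin

lemma jstar_simps:
  "fst (fobj (jstar W D Q) X) = restrict (fst X) Q"
  "snd (fobj (jstar W D Q) X) = restrict (snd X) (glue_pairs W Q)"
  "fmap (jstar W D Q) f = restrict f Q"
  unfolding jstar_def by (simp_all add: case_prod_beta)

lemma glue_obj_expand:
  assumes "X \<in> Obj (glue W D P)"
  shows "X = (restrict (fst X) P, restrict (\<lambda>(u, w). snd X (u, w)) (glue_pairs W P))"
proof -
  obtain A \<alpha> where X: "X = (A, \<alpha>)" by (cases X)
  have "A \<in> (\<Pi>\<^sub>E w\<in>P. Obj (cat w))" "\<alpha> \<in> extensional (glue_pairs W P)"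
    using assms unfolding X glue_simps is_glue_obj_def PiE_def by auto
  thus ?thesis unfolding X by (simp add: PiE_restrict extensional_restrict)
qed

lemma jstar_obj:
  assumes P: "P \<subseteq> carrier W" and Q: "Q \<subseteq> P" and X: "X \<in> Obj (glue W D P)"
  shows "fobj (jstar W D Q) X \<in> Obj (glue W D Q)"
proof -
  have "(restrict (fst X) Q, restrict (\<lambda>(u, w). snd X (u, w)) (glue_pairs W Q)) \<in> Obj (glue W D Q)"
    by (rule glue_objI) (use P Q glue_obj_component[OF X] glue_obj_map[OF X] glue_obj_one[OF X]
        glue_obj_assoc[OF P X] in \<open>auto simp: subset_iff\<close>)
  moreover have "fobj (jstar W D Q) X = (restrict (fst X) Q, restrict (\<lambda>(u, w). snd X (u, w))
      (glue_pairs W Q))"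
    by (rule prod_eqI) (simp_all add: jstar_simps)
  ultimately show ?thesis by simp
qed

lemma jstar_component: "w \<in> Q \<Longrightarrow> fst (fobj (jstar W D Q) X) w = fst X w"
  and jstar_structure: "u \<in> carrier W \<Longrightarrow> w \<in> Q \<Longrightarrow> u \<otimes> w \<in> Q \<Longrightarrow> snd (fobj (jstar W D Q) X) (u, w) = snd
      X (u, w)"
  by (simp_all add: jstar_simps glue_pairs_def)

lemma jstar_hom:
  assumes Q: "Q \<subseteq> P" and f: "f \<in> Hom (glue W D P) X Y"
  shows "restrict f Q \<in> Hom (glue W D Q) (fobj (jstar W D Q) X) (fobj (jstar W D Q) Y)"
  by (rule glue_homI) (use Q glue_hom_component[OF f] glue_hom_natural[OF f] in \<open>auto simp:
      jstar_component jstar_structure subset_iff\<close>)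

lemma jstar_jstar:
  assumes "Q \<subseteq> P" shows "fobj (jstar W D Q) (fobj (jstar W D P) X) = fobj (jstar W D Q) X"
proof -
  have "glue_pairs W Q \<subseteq> glue_pairs W P" using assms by (auto simp: glue_pairs_def)
  thus ?thesis using assms by (intro prod_eqI) (auto simp: jstar_simps fun_eq_iff restrict_def)
qed

end

locale coset_extension = coxeter_gluing W S D
  for W :: "('w, 'z) monoid_scheme" (structure) and S and D :: "('w, 'o, 'm) gluing" +
  fixes K Q P :: "'w set"
  assumes coset: "coset_of K Q" and QP: "Q \<subseteq> P" and P: "P \<subseteq> carrier W"
begin

text \<open>Every \<open>w\<close> factors as \<open>nn w\<close> times its nearest element \<open>pr w\<close> in the coset.\<close>

abbreviation pr where "pr \<equiv> nearest Q"
abbreviation nn where "nn w \<equiv> w \<otimes> inv (nearest Q w)"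

lemma Q_carrier: "y \<in> Q \<Longrightarrow> y \<in> carrier W" using QP P by blast
lemma P_carrier: "y \<in> P \<Longrightarrow> y \<in> carrier W" using P by blast
lemma Q_sub: "Q \<subseteq> carrier W" using QP P by blast
lemma pr_mem: "pr w \<in> Q" by (rule nearest_mem[OF coset])
lemma pr_carrier: "pr w \<in> carrier W" using pr_mem Q_carrier by blast
lemma nn_carrier: "w \<in> carrier W \<Longrightarrow> nn w \<in> carrier W" using pr_carrier by simp
lemma nn_pr: "w \<in> carrier W \<Longrightarrow> nn w \<otimes> pr w = w" using pr_carrier by (simp add: m_assoc)
lemma pr_Q: "w \<in> Q \<Longrightarrow> pr w = w" by (rule nearest_self[OF coset])
lemma nn_Q: "w \<in> Q \<Longrightarrow> nn w = \<one>" using pr_Q Q_carrier by simp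

text \<open>The morphism \<open>\<Phi>\<^sub>g B\<^sub>y \<rightarrow> \<Phi>\<^sub>n B\<^sub>p\<close> for \<open>p\<close> the element of the coset nearest to \<open>g y = n p\<close>: writing
  \<open>g = n z\<close> with lengths adding up, it is \<open>\<Phi>\<^sub>n\<close> of the structure map of \<open>z\<close> after the inverse of \<open>\<nu>\<close>.\<close>

definition transport :: "('w, 'o, 'm) glue_obj \<Rightarrow> 'w \<Rightarrow> 'w \<Rightarrow> 'm" where
  "transport B g y = (let v = g \<otimes> y; z = pr v \<otimes> inv y in
     SOME h. h \<in> Hom (cat v) (Phi g y (fst B y)) (Phi (nn v) (pr v) (fst B (pr v))) \<and>
       Cmp (cat v) h (nu (nn v) z y (fst B y)) = PhiM (nn v) (pr v) (snd B (z, y)))"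

lemma coset_split:
  assumes "y \<in> Q" "g \<in> carrier W" "g \<otimes> y = v"
  shows "v \<in> carrier W" "pr v \<otimes> inv y \<in> carrier W" "pr v \<otimes> inv y \<in> generate W K"
    "pr v \<otimes> inv y \<otimes> y = pr v" "nn v \<otimes> (pr v \<otimes> inv y) = g"
    "len g = len (nn v) + len (pr v \<otimes> inv y)"
proof -
  have y: "y \<in> carrier W" using assms Q_carrier by blast
  show v: "v \<in> carrier W" using assms y by blast
  show "pr v \<otimes> inv y \<in> carrier W" using y pr_carrier by simp
  show K: "pr v \<otimes> inv y \<in> generate W K" by (rule coset_diff[OF coset assms(1) pr_mem])
  show "pr v \<otimes> inv y \<otimes> y = pr v" using y pr_carrier by (simp add: m_assoc)
  show e: "nn v \<otimes> (pr v \<otimes> inv y) = g" using y pr_carrier assms v by (auto simp: m_assoc)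
  show "len g = len (nn v) + len (pr v \<otimes> inv y)" using nearest_len[OF coset v K] e by simp
qed

text \<open>The lengths in \<open>g = n z\<close> add up, so \<open>\<nu>\<close> is invertible here. Identities between morphisms out of
  \<open>\<Phi>\<^sub>g\<close> are therefore tested after composition with this \<open>\<nu>\<close>.\<close>

lemma transport_iso:
  assumes "y \<in> Q" "g \<in> carrier W" "g \<otimes> y = v" "A \<in> Obj (cat y)"
  shows "is_iso (cat v) (Phi (nn v) (pr v) (Phi (pr v \<otimes> inv y) y A)) (Phi g y A) (nu (nn v) (pr v \<otimes>
      inv y) y A)"
  using coset_split[OF assms(1-3)] assms nn_carrier nn_pr Q_carrier
  by (intro nu_is_iso) auto

lemma transport_props:
  assumes B: "B \<in> Obj (glue W D Q)" and a: "y \<in> Q" "g \<in> carrier W" "g \<otimes> y = v"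
  shows "transport B g y \<in> Hom (cat v) (Phi g y (fst B y)) (Phi (nn v) (pr v) (fst B (pr v)))"
    "Cmp (cat v) (transport B g y) (nu (nn v) (pr v \<otimes> inv y) y (fst B y)) = PhiM (nn v) (pr v) (snd
        B (pr v \<otimes> inv y, y))"
proof -
  note s = coset_split[OF a]
  let ?z = "pr v \<otimes> inv y"
  note oB = glue_obj_component[OF B]
  have yc: "y \<in> carrier W" using a Q_carrier by blast
  interpret V: preadditive_category "cat v" by (rule preadd) fact
  obtain h where h: "nu (nn v) ?z y (fst B y) \<in> Hom (cat v) (Phi (nn v) (pr v) (Phi ?z y (fst B y)))
      (Phi g y (fst B y))"
      "h \<in> Hom (cat v) (Phi g y (fst B y)) (Phi (nn v) (pr v) (Phi ?z y (fst B y)))"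
      "Cmp (cat v) h (nu (nn v) ?z y (fst B y)) = Ident (cat v) (Phi (nn v) (pr v) (Phi ?z y (fst B
          y)))"
    using V.is_iso_E[OF transport_iso[OF a oB[OF a(1)]]] by blast
  note m = glue_obj_map[OF B s(2) a(1) s(4) pr_mem]
  note o1 = Phi_obj[OF s(2) yc s(4) oB[OF a(1)]]
  note P = Phi_obj[OF nn_carrier[OF s(1)] pr_carrier nn_pr[OF s(1)]]
  note hm = Phi_hom[OF nn_carrier[OF s(1)] pr_carrier nn_pr[OF s(1)] o1 oB[OF pr_mem] m]
  have o2: "Phi g y (fst B y) \<in> Obj (cat v)" using Phi_obj a yc oB by blast
  let ?h = "Cmp (cat v) (PhiM (nn v) (pr v) (snd B (?z, y))) h"
  have "?h \<in> Hom (cat v) (Phi g y (fst B y)) (Phi (nn v) (pr v) (fst B (pr v)))"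
    by (rule V.cmp_hom[OF o2 P[OF o1] P[OF oB[OF pr_mem]] h(2) hm])
  moreover have "Cmp (cat v) ?h (nu (nn v) ?z y (fst B y)) = PhiM (nn v) (pr v) (snd B (?z, y))"
    using V.cmp_assoc[OF P[OF o1] o2 P[OF o1] P[OF oB[OF pr_mem]] h(1,2) hm] h(3)
      V.cmp_ident_right[OF P[OF o1] P[OF oB[OF pr_mem]] hm] by simp
  ultimately have "\<exists>h. h \<in> Hom (cat v) (Phi g y (fst B y)) (Phi (nn v) (pr v) (fst B (pr v))) \<and>
       Cmp (cat v) h (nu (nn v) ?z y (fst B y)) = PhiM (nn v) (pr v) (snd B (?z, y))" by blast
  from someI_ex[OF this] show "transport B g y \<in> Hom (cat v) (Phi g y (fst B y)) (Phi (nn v) (pr v)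
      (fst B (pr v)))"
    "Cmp (cat v) (transport B g y) (nu (nn v) ?z y (fst B y)) = PhiM (nn v) (pr v) (snd B (?z, y))"
    unfolding transport_def Let_def a(3) by auto
qed

lemma transport_unique:
  assumes B: "B \<in> Obj (glue W D Q)" and a: "y \<in> Q" "g \<in> carrier W" "g \<otimes> y = v"
    and h: "h \<in> Hom (cat v) (Phi g y (fst B y)) (Phi (nn v) (pr v) (fst B (pr v)))"
      "Cmp (cat v) h (nu (nn v) (pr v \<otimes> inv y) y (fst B y)) = PhiM (nn v) (pr v) (snd B (pr v \<otimes> inv
          y, y))"
  shows "transport B g y = h"
proof -
  note s = coset_split[OF a]
  note oB = glue_obj_component[OF B]
  have yc: "y \<in> carrier W" using a Q_carrier by blast
  interpret V: preadditive_category "cat v" by (rule preadd) fact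
  note o1 = Phi_obj[OF s(2) yc s(4) oB[OF a(1)]]
  note P = Phi_obj[OF nn_carrier[OF s(1)] pr_carrier nn_pr[OF s(1)]]
  have o2: "Phi g y (fst B y) \<in> Obj (cat v)" using Phi_obj a yc oB by blast
  show ?thesis
    by (rule V.is_iso_cancel_right[OF P[OF o1] o2 P[OF oB[OF pr_mem]] transport_iso[OF a oB[OF a(1)]]
        transport_props(1)[OF B a] h(1)]) (use transport_props(2)[OF B a] h(2) in simp)
qed

lemma transport_self:
  assumes B: "B \<in> Obj (glue W D Q)" and w: "w \<in> carrier W"
  shows "transport B (nn w) (pr w) = Ident (cat w) (Phi (nn w) (pr w) (fst B (pr w)))"
proof (rule transport_unique[OF B pr_mem nn_carrier[OF w] nn_pr[OF w]])
  interpret C: preadditive_category "cat w" by (rule preadd) fact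
  note oB = glue_obj_component[OF B pr_mem]
  note o = Phi_obj[OF nn_carrier[OF w] pr_carrier nn_pr[OF w] oB]
  show i: "Ident (cat w) (Phi (nn w) (pr w) (fst B (pr w)))
    \<in> Hom (cat w) (Phi (nn w) (pr w) (fst B (pr w))) (Phi (nn w) (pr w) (fst B (pr w)))" by (rule
        C.ident_hom[OF o])
  have e: "pr w \<otimes> inv (pr w) = \<one>" using pr_carrier by simp
  show "Cmp (cat w) (Ident (cat w) (Phi (nn w) (pr w) (fst B (pr w)))) (nu (nn w) (pr w \<otimes> inv (pr
      w)) (pr w) (fst B (pr w))) =
    PhiM (nn w) (pr w) (snd B (pr w \<otimes> inv (pr w), pr w))"
    unfolding e using nu_one_right[OF nn_carrier[OF w] pr_carrier oB] glue_obj_one[OF B pr_mem]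
      Phi_ident[OF nn_carrier[OF w] pr_carrier nn_pr[OF w] oB] C.cmp_ident_left[OF o o i] nn_pr[OF
          w] by simp
qed

lemma transport_Q:
  assumes B: "B \<in> Obj (glue W D Q)" and a: "w \<in> Q" "u \<in> carrier W" "u \<otimes> w \<in> Q"
  shows "transport B u w = snd B (u, w)"
proof (rule transport_unique[OF B a(1,2) HOL.refl])
  let ?v = "u \<otimes> w"
  have c: "w \<in> carrier W" "?v \<in> carrier W" using a Q_carrier by auto
  interpret V: preadditive_category "cat ?v" by (rule preadd) fact
  note oB = glue_obj_component[OF B]
  have e: "pr ?v = ?v" "nn ?v = \<one>" "?v \<otimes> inv w = u" using pr_Q[OF a(3)] nn_Q[OF a(3)] a c by (auto
      simp: m_assoc)
  note m = glue_obj_map[OF B a(2,1) HOL.refl a(3)]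
  note o = Phi_obj[OF a(2) c(1) HOL.refl oB[OF a(1)]]
  show "snd B (u, w) \<in> Hom (cat ?v) (Phi u w (fst B w)) (Phi (nn ?v) (pr ?v) (fst B (pr ?v)))"
    unfolding e(2) unfolding e(1) Phi_one_obj[OF c(2) oB[OF a(3)]] by (rule m)
  show "Cmp (cat ?v) (snd B (u, w)) (nu (nn ?v) (pr ?v \<otimes> inv w) w (fst B w)) =
    PhiM (nn ?v) (pr ?v) (snd B (pr ?v \<otimes> inv w, w))"
    unfolding e(2) unfolding e(1) e(3)
    using nu_one_left[OF a(2) c(1) oB[OF a(1)]] Phi_one_map[OF c(2) o oB[OF a(3)] m]
        V.cmp_ident_right[OF o oB[OF a(3)] m] by simp
qed

text \<open>Moving \<open>z\<close> from \<open>g\<close> to the object changes nothing. After composition with \<open>\<nu>\<close> both sides become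
  \<open>\<Phi>\<^sub>n\<close> of the two sides of the associativity law of the structure maps of \<open>B\<close>.\<close>

lemma transport_balanced:
  assumes B: "B \<in> Obj (glue W D Q)" and y: "y \<in> Q" and z: "z \<in> carrier W" "z \<otimes> y = y'" "y' \<in> Q"
    and g: "g \<in> carrier W" "g \<otimes> y' = v" "g \<otimes> z = g'"
  shows "Cmp (cat v) (transport B g y') (PhiM g y' (snd B (z, y))) = Cmp (cat v) (transport B g' y)
      (nu g z y (fst B y))"
proof -
  let ?p = "pr v" and ?n = "nn v"
  let ?z1 = "?p \<otimes> inv y'" and ?z2 = "?p \<otimes> inv y"
  have yc: "y \<in> carrier W" "y' \<in> carrier W" using y z Q_carrier by auto
  have g'y: "g' \<otimes> y = v" "g' \<in> carrier W" using g z yc by (auto simp: m_assoc)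
  note s = coset_split[OF z(3) g(1,2)] and s' = coset_split[OF y g'y(2,1)]
  have zz: "?z1 \<otimes> z = ?z2"
  proof -
    have "inv y' = inv y \<otimes> inv z" using inv_mult_group[OF z(1) yc(1)] z(2) by simp
    thus ?thesis using z(1) yc pr_carrier by (simp add: m_assoc)
  qed
  interpret V: preadditive_category "cat v" by (rule preadd) fact
  note oB = glue_obj_component[OF B]
  note nc = nn_carrier[OF s(1)] and np = nn_pr[OF s(1)]
  note m = glue_obj_map[OF B z(1) y z(2,3)] and m1 = glue_obj_map[OF B s(2) z(3) s(4) pr_mem]
    and m2 = glue_obj_map[OF B s'(2) y s'(4) pr_mem]
  note o0 = Phi_obj[OF z(1) yc(1) z(2) oB[OF y]]
  note o1 = Phi_obj[OF s(2) yc(2) s(4) o0] and o1' = Phi_obj[OF s(2) yc(2) s(4) oB[OF z(3)]]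
  note o2 = Phi_obj[OF s'(2) yc(1) s'(4) oB[OF y]]
  note Pn = Phi_obj[OF nc pr_carrier np] and Pg = Phi_obj[OF g(1) yc(2) g(2)]
  note o3 = Phi_obj[OF g'y(2) yc(1) g'y(1) oB[OF y]]
  note h1 = Phi_hom[OF s(2) yc(2) s(4) o0 oB[OF z(3)] m]
  note Hn = Phi_hom[OF nc pr_carrier np]
  note hg = Phi_hom[OF g(1) yc(2) g(2) o0 oB[OF z(3)] m]
  note n1 = nu_hom[OF nc s(2) yc(2) s(4,5) np o0] and n1' = nu_hom[OF nc s(2) yc(2) s(4,5) np oB[OF
      z(3)]]
  note n2 = nu_hom[OF s(2) z(1) yc(1) z(2) zz s(4) oB[OF y]]
  note n3 = nu_hom[OF g(1) z(1) yc(1) z(2) g(3) g(2) oB[OF y]]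
  note n4 = nu_hom[OF nc s'(2) yc(1) s'(4,5) np oB[OF y]]
  note t = transport_props[OF B z(3) g(1,2)] and t' = transport_props[OF B y g'y(2,1)]
  show ?thesis
  proof (rule V.is_iso_cancel_right[OF Pn[OF o1] Pg[OF o0] Pn[OF oB[OF pr_mem]] transport_iso[OF
      z(3) g(1,2) o0]])
    show "Cmp (cat v) (transport B g y') (PhiM g y' (snd B (z, y))) \<in> Hom (cat v) (Phi g y' (Phi z y
        (fst B y))) (Phi ?n ?p (fst B ?p))"
      by (rule V.cmp_hom[OF Pg[OF o0] Pg[OF oB[OF z(3)]] Pn[OF oB[OF pr_mem]] hg t(1)])
    show "Cmp (cat v) (transport B g' y) (nu g z y (fst B y)) \<in> Hom (cat v) (Phi g y' (Phi z y (fst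
        B y))) (Phi ?n ?p (fst B ?p))"
      by (rule V.cmp_hom[OF Pg[OF o0] o3 Pn[OF oB[OF pr_mem]] n3 t'(1)])
    let ?N = "nu ?n ?z1 y' (Phi z y (fst B y))"
    have "Cmp (cat v) (Cmp (cat v) (transport B g y') (PhiM g y' (snd B (z, y)))) ?N
        = Cmp (cat v) (transport B g y') (Cmp (cat v) (PhiM g y' (snd B (z, y))) ?N)"
      by (rule V.cmp_assoc[OF Pn[OF o1] Pg[OF o0] Pg[OF oB[OF z(3)]] Pn[OF oB[OF pr_mem]] n1 hg t(1)])
    also have "Cmp (cat v) (PhiM g y' (snd B (z, y))) ?N = Cmp (cat v) (nu ?n ?z1 y' (fst B y'))
        (PhiM ?n ?p (PhiM ?z1 y' (snd B (z, y))))"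
      by (rule nu_nat[OF nc s(2) yc(2) s(4,5) np o0 oB[OF z(3)] m, symmetric])
    also have "Cmp (cat v) (transport B g y') \<dots> = Cmp (cat v) (Cmp (cat v) (transport B g y') (nu ?n
        ?z1 y' (fst B y'))) (PhiM ?n ?p (PhiM ?z1 y' (snd B (z, y))))"
      by (rule V.cmp_assoc[OF Pn[OF o1] Pn[OF o1'] Pg[OF oB[OF z(3)]] Pn[OF oB[OF pr_mem]] Hn[OF o1
          o1' h1] n1' t(1), symmetric])
    also have "\<dots> = Cmp (cat v) (PhiM ?n ?p (snd B (?z1, y'))) (PhiM ?n ?p (PhiM ?z1 y' (snd B (z, y))))"
      using t(2) by simp
    also have "\<dots> = PhiM ?n ?p (Cmp (cat ?p) (snd B (?z1, y')) (PhiM ?z1 y' (snd B (z, y))))"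
      by (rule Phi_cmp[OF nc pr_carrier np o1 o1' oB[OF pr_mem] h1 m1, symmetric])
    also have "Cmp (cat ?p) (snd B (?z1, y')) (PhiM ?z1 y' (snd B (z, y))) = Cmp (cat ?p) (snd B
        (?z2, y)) (nu ?z1 z y (fst B y))"
      by (rule glue_obj_assoc[OF Q_sub B s(2) z(1) y z(2,3) s(4) pr_mem zz])
    also have "PhiM ?n ?p \<dots> = Cmp (cat v) (PhiM ?n ?p (snd B (?z2, y))) (PhiM ?n ?p (nu ?z1 z y (fst
        B y)))"
      by (rule Phi_cmp[OF nc pr_carrier np o1 o2 oB[OF pr_mem] n2 m2])
    also have "\<dots> = Cmp (cat v) (Cmp (cat v) (transport B g' y) (nu ?n ?z2 y (fst B y))) (PhiM ?n ?p
        (nu ?z1 z y (fst B y)))"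
      using t'(2) by simp
    also have "\<dots> = Cmp (cat v) (transport B g' y) (Cmp (cat v) (nu ?n ?z2 y (fst B y)) (PhiM ?n ?p
        (nu ?z1 z y (fst B y))))"
      by (rule V.cmp_assoc[OF Pn[OF o1] Pn[OF o2] o3 Pn[OF oB[OF pr_mem]] Hn[OF o1 o2 n2] n4 t'(1)])
    also have "Cmp (cat v) (nu ?n ?z2 y (fst B y)) (PhiM ?n ?p (nu ?z1 z y (fst B y))) = Cmp (cat v)
        (nu g z y (fst B y)) ?N"
      by (rule nu_associative[OF nc s(2) z(1) yc(1) z(2) s(4) np s(5) zz oB[OF y], symmetric])
    also have "Cmp (cat v) (transport B g' y) \<dots> = Cmp (cat v) (Cmp (cat v) (transport B g' y) (nu g
        z y (fst B y))) ?N"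
      by (rule V.cmp_assoc[OF Pn[OF o1] Pg[OF o0] o3 Pn[OF oB[OF pr_mem]] n1 n3 t'(1), symmetric])
    finally show "Cmp (cat v) (Cmp (cat v) (transport B g y') (PhiM g y' (snd B (z, y)))) ?N
        = Cmp (cat v) (Cmp (cat v) (transport B g' y) (nu g z y (fst B y))) ?N" .
  qed
qed

text \<open>The structure map of the extension of \<open>B\<close>: the composite
  \<open>\<Phi>\<^sub>u \<Phi>\<^sub>n B\<^sub>p \<rightarrow> \<Phi>\<^bsub>un\<^esub> B\<^sub>p \<rightarrow> \<Phi>\<^bsub>n'\<^esub> B\<^bsub>p'\<^esub>\<close> for \<open>w = n p\<close> and \<open>u w = n' p'\<close>.\<close>

definition ext_map :: "('w, 'o, 'm) glue_obj \<Rightarrow> 'w \<Rightarrow> 'w \<Rightarrow> 'm" where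
  "ext_map B u w = Cmp (cat (u \<otimes> w)) (transport B (u \<otimes> nn w) (pr w)) (nu u (nn w) (pr w) (fst B (pr
      w)))"

lemma nn_step:
  assumes "u \<in> carrier W" "w \<in> carrier W" "u \<otimes> w = v" shows "u \<otimes> nn w \<in> carrier W" "u \<otimes> nn w \<otimes> pr w = v"
  using assms pr_carrier nn_carrier by (auto simp: m_assoc)

lemma ext_map_hom:
  assumes B: "B \<in> Obj (glue W D Q)" and a: "u \<in> carrier W" "w \<in> carrier W" "u \<otimes> w = v"
  shows "ext_map B u w \<in> Hom (cat v) (Phi u w (Phi (nn w) (pr w) (fst B (pr w)))) (Phi (nn v) (pr v)
      (fst B (pr v)))"
proof -
  note st = nn_step[OF a] and oB = glue_obj_component[OF B pr_mem]
  have vc: "v \<in> carrier W" using a by auto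
  interpret V: preadditive_category "cat v" by (rule preadd) fact
  show ?thesis unfolding ext_map_def a(3)
    by (rule V.cmp_hom[OF Phi_obj[OF a Phi_obj[OF nn_carrier[OF a(2)] pr_carrier nn_pr[OF a(2)] oB]]
      Phi_obj[OF st(1) pr_carrier st(2) oB] Phi_obj[OF nn_carrier[OF vc] pr_carrier nn_pr[OF vc] oB]
      nu_hom[OF a(1) nn_carrier[OF a(2)] pr_carrier nn_pr[OF a(2)] HOL.refl a(3) oB]
          transport_props(1)[OF B pr_mem st]])
qed

text \<open>This carries the associativity law of the extension: it removes the auxiliary factorization of \<open>g\<close> from the
  composite of two structure maps.\<close>

lemma ext_map_transport:
  assumes B: "B \<in> Obj (glue W D Q)" and y: "y \<in> Q" and g: "g \<in> carrier W" "g \<otimes> y = w"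
    and u: "u \<in> carrier W" "u \<otimes> w = v"
  shows "Cmp (cat v) (ext_map B u w) (PhiM u w (transport B g y)) = Cmp (cat v) (transport B (u \<otimes> g)
      y) (nu u g y (fst B y))"
proof -
  let ?p = "pr w" and ?n = "nn w"
  let ?z = "?p \<otimes> inv y"
  have yc: "y \<in> carrier W" using y Q_carrier by blast
  note s = coset_split[OF y g]
  have vc: "v \<in> carrier W" using u s by auto
  have ug: "u \<otimes> g \<in> carrier W" "u \<otimes> g \<otimes> y = v" using u g yc by (auto simp: m_assoc)
  have uwc: "u \<in> carrier W" "w \<in> carrier W" "u \<otimes> w = v" using u s by auto
  note st = nn_step[OF uwc]
  have unz: "u \<otimes> ?n \<otimes> ?z = u \<otimes> g" using s(5) u s(1,2) nn_carrier by (simp add: m_assoc[of u ?n ?z])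
  interpret V: preadditive_category "cat v" by (rule preadd) fact
  note oB = glue_obj_component[OF B]
  note nc = nn_carrier[OF s(1)] and np = nn_pr[OF s(1)]
  note m = glue_obj_map[OF B s(2) y s(4) pr_mem]
  note o0 = Phi_obj[OF s(2) yc s(4) oB[OF y]]
  note Pn = Phi_obj[OF nc pr_carrier np] and Pu = Phi_obj[OF uwc]
  note og = Phi_obj[OF g(1) yc g(2) oB[OF y]] and oug = Phi_obj[OF ug(1) yc ug(2) oB[OF y]]
  note Pun = Phi_obj[OF st(1) pr_carrier st(2)]
  have E: "Phi (nn v) (pr v) (fst B (pr v)) \<in> Obj (cat v)" by (rule Phi_obj[OF nn_carrier[OF vc]
      pr_carrier nn_pr[OF vc] oB[OF pr_mem]])
  note Hn = Phi_hom[OF nc pr_carrier np] and Hu = Phi_hom[OF uwc] and Hun = Phi_hom[OF st(1)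
      pr_carrier st(2)]
  note t = transport_props[OF B y g] and t2 = transport_props[OF B pr_mem st] and t3 =
      transport_props[OF B y ug]
  note em = ext_map_hom[OF B uwc]
  note nz = nu_hom[OF nc s(2) yc s(4,5) np oB[OF y]]
  note nug = nu_hom[OF uwc(1) g(1) yc g(2) HOL.refl uwc(3) oB[OF y]]
  note nun = nu_hom[OF uwc(1) nc pr_carrier np HOL.refl uwc(3)]
  note nunz = nu_hom[OF st(1) s(2) yc s(4) unz st(2) oB[OF y]]
  note iso = Phi_iso[OF uwc Pn[OF o0] og transport_iso[OF y g oB[OF y]]]
  show ?thesis
  proof (rule V.is_iso_cancel_right[OF Pu[OF Pn[OF o0]] Pu[OF og] E iso])
    show "Cmp (cat v) (ext_map B u w) (PhiM u w (transport B g y)) \<in> Hom (cat v) (Phi u w (Phi g y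
        (fst B y))) (Phi (nn v) (pr v) (fst B (pr v)))"
      by (rule V.cmp_hom[OF Pu[OF og] Pu[OF Pn[OF oB[OF pr_mem]]] E Hu[OF og Pn[OF oB[OF pr_mem]]
          t(1)] em])
    show "Cmp (cat v) (transport B (u \<otimes> g) y) (nu u g y (fst B y)) \<in> Hom (cat v) (Phi u w (Phi g y
        (fst B y))) (Phi (nn v) (pr v) (fst B (pr v)))"
      by (rule V.cmp_hom[OF Pu[OF og] oug E nug t3(1)])
    let ?N = "PhiM u w (nu ?n ?z y (fst B y))"
    note hN = Hu[OF Pn[OF o0] og nz]
    have "Cmp (cat v) (Cmp (cat v) (ext_map B u w) (PhiM u w (transport B g y))) ?N
        = Cmp (cat v) (ext_map B u w) (Cmp (cat v) (PhiM u w (transport B g y)) ?N)"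
      by (rule V.cmp_assoc[OF Pu[OF Pn[OF o0]] Pu[OF og] Pu[OF Pn[OF oB[OF pr_mem]]] E hN Hu[OF og
          Pn[OF oB[OF pr_mem]] t(1)] em])
    also have "Cmp (cat v) (PhiM u w (transport B g y)) ?N = PhiM u w (PhiM ?n ?p (snd B (?z, y)))"
      using Phi_cmp[OF uwc Pn[OF o0] og Pn[OF oB[OF pr_mem]] nz t(1)] t(2) by simp
    also have "Cmp (cat v) (ext_map B u w) (PhiM u w (PhiM ?n ?p (snd B (?z, y))))
        = Cmp (cat v) (transport B (u \<otimes> ?n) ?p) (Cmp (cat v) (nu u ?n ?p (fst B ?p)) (PhiM u w (PhiM
            ?n ?p (snd B (?z, y)))))"
      unfolding ext_map_def uwc(3)
      by (rule V.cmp_assoc[OF Pu[OF Pn[OF o0]] Pu[OF Pn[OF oB[OF pr_mem]]] Pun[OF oB[OF pr_mem]] E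
            Hu[OF Pn[OF o0] Pn[OF oB[OF pr_mem]] Hn[OF o0 oB[OF pr_mem] m]] nun[OF oB[OF pr_mem]]
                t2(1)])
    also have "Cmp (cat v) (nu u ?n ?p (fst B ?p)) (PhiM u w (PhiM ?n ?p (snd B (?z, y))))
        = Cmp (cat v) (PhiM (u \<otimes> ?n) ?p (snd B (?z, y))) (nu u ?n ?p (Phi ?z y (fst B y)))"
      by (rule nu_nat[OF uwc(1) nc pr_carrier np HOL.refl uwc(3) o0 oB[OF pr_mem] m])
    also have "Cmp (cat v) (transport B (u \<otimes> ?n) ?p) \<dots>
        = Cmp (cat v) (Cmp (cat v) (transport B (u \<otimes> ?n) ?p) (PhiM (u \<otimes> ?n) ?p (snd B (?z, y)))) (nu
            u ?n ?p (Phi ?z y (fst B y)))"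
      by (rule V.cmp_assoc[OF Pu[OF Pn[OF o0]] Pun[OF o0] Pun[OF oB[OF pr_mem]] E nun[OF o0] Hun[OF
          o0 oB[OF pr_mem] m] t2(1), symmetric])
    also have "Cmp (cat v) (transport B (u \<otimes> ?n) ?p) (PhiM (u \<otimes> ?n) ?p (snd B (?z, y)))
        = Cmp (cat v) (transport B (u \<otimes> g) y) (nu (u \<otimes> ?n) ?z y (fst B y))"
      by (rule transport_balanced[OF B y s(2,4) pr_mem st unz])
    also have "Cmp (cat v) (Cmp (cat v) (transport B (u \<otimes> g) y) (nu (u \<otimes> ?n) ?z y (fst B y))) (nu u
        ?n ?p (Phi ?z y (fst B y)))
        = Cmp (cat v) (transport B (u \<otimes> g) y) (Cmp (cat v) (nu (u \<otimes> ?n) ?z y (fst B y)) (nu u ?n ?p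
            (Phi ?z y (fst B y))))"
      by (rule V.cmp_assoc[OF Pu[OF Pn[OF o0]] Pun[OF o0] oug E nun[OF o0] nunz t3(1)])
    also have "Cmp (cat v) (nu (u \<otimes> ?n) ?z y (fst B y)) (nu u ?n ?p (Phi ?z y (fst B y))) = Cmp (cat
        v) (nu u g y (fst B y)) ?N"
      by (rule nu_associative[OF uwc(1) nc s(2) yc s(4) np uwc(3) HOL.refl s(5) oB[OF y]])
    also have "Cmp (cat v) (transport B (u \<otimes> g) y) \<dots> = Cmp (cat v) (Cmp (cat v) (transport B (u \<otimes> g)
        y) (nu u g y (fst B y))) ?N"
      by (rule V.cmp_assoc[OF Pu[OF Pn[OF o0]] Pu[OF og] oug E hN nug t3(1), symmetric])
    finally show "Cmp (cat v) (Cmp (cat v) (ext_map B u w) (PhiM u w (transport B g y))) ?N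
        = Cmp (cat v) (Cmp (cat v) (transport B (u \<otimes> g) y) (nu u g y (fst B y))) ?N" .
  qed
qed

definition ext_obj :: "('w, 'o, 'm) glue_obj \<Rightarrow> ('w, 'o, 'm) glue_obj" where
  "ext_obj B = (\<lambda>w\<in>P. Phi (nn w) (pr w) (fst B (pr w)), restrict (\<lambda>(u, w). ext_map B u w)
      (glue_pairs W P))"

lemma ext_obj_component: "w \<in> P \<Longrightarrow> fst (ext_obj B) w = Phi (nn w) (pr w) (fst B (pr w))"
  and ext_obj_structure: "u \<in> carrier W \<Longrightarrow> w \<in> P \<Longrightarrow> u \<otimes> w \<in> P \<Longrightarrow> snd (ext_obj B) (u, w) = ext_map B u w"
  unfolding ext_obj_def by (simp_all add: glue_pairs_def)

lemma ext_obj_closed: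
  assumes B: "B \<in> Obj (glue W D Q)" shows "ext_obj B \<in> Obj (glue W D P)"
  unfolding ext_obj_def
proof (rule glue_objI[OF P])
  note oB = glue_obj_component[OF B pr_mem]
  have comp: "Phi (nn w) (pr w) (fst B (pr w)) \<in> Obj (cat w)" if "w \<in> carrier W" for w
    by (rule Phi_obj[OF nn_carrier[OF that] pr_carrier nn_pr[OF that] oB])
  show "Phi (nn w) (pr w) (fst B (pr w)) \<in> Obj (cat w)" if "w \<in> P" for w using comp P_carrier[OF that] .
  show "ext_map B u w \<in> Hom (cat v) (Phi u w (Phi (nn w) (pr w) (fst B (pr w)))) (Phi (nn v) (pr v)
      (fst B (pr v)))"
    if "u \<in> carrier W" "w \<in> P" "u \<otimes> w = v" "v \<in> P" for u w v
    by (rule ext_map_hom[OF B that(1) P_carrier[OF that(2)] that(3)])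
  show "ext_map B \<one> w = Ident (cat w) (Phi (nn w) (pr w) (fst B (pr w)))" if "w \<in> P" for w
  proof -
    have w: "w \<in> carrier W" using P_carrier[OF that] .
    interpret C: preadditive_category "cat w" by (rule preadd) fact
    have e: "\<one> \<otimes> w = w" "\<one> \<otimes> nn w = nn w" using w nn_carrier[OF w] by auto
    show ?thesis unfolding ext_map_def e
      using transport_self[OF B w] nu_one_left[OF nn_carrier[OF w] pr_carrier oB] nn_pr[OF w]
        C.cmp_ident_left[OF comp[OF w] comp[OF w] C.ident_hom[OF comp[OF w]]] by simp
  qed
  fix u u' w v' v x
  assume a: "u \<in> carrier W" "u' \<in> carrier W" "w \<in> P" "u' \<otimes> w = v'" "v' \<in> P" "u \<otimes> v' = v" "v \<in> P" "u
      \<otimes> u' = x"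
  have c: "w \<in> carrier W" "v' \<in> carrier W" "v \<in> carrier W" "x \<in> carrier W" using a P_carrier by auto
  have xw: "x \<otimes> w = v" using a c by (auto simp: m_assoc)
  interpret V: preadditive_category "cat v" by (rule preadd) fact
  let ?p = "pr w" and ?n = "nn w"
  let ?B = "fst B ?p"
  note nc = nn_carrier[OF c(1)] and np = nn_pr[OF c(1)]
  note st' = nn_step[OF a(2) c(1) a(4)] and st = nn_step[OF c(4) c(1) xw]
  have xe: "u \<otimes> (u' \<otimes> ?n) = x \<otimes> ?n" using a nc by (auto simp: m_assoc)
  note E = comp[OF c(1)] and E' = comp[OF c(2)] and Ev = comp[OF c(3)]
  note pu'n = Phi_obj[OF st'(1) pr_carrier st'(2) oB] and pxn = Phi_obj[OF st(1) pr_carrier st(2) oB]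
  note Pu = Phi_obj[OF a(1) c(2) a(6)] and Hu = Phi_hom[OF a(1) c(2) a(6)]
  note Pu' = Phi_obj[OF a(2) c(1) a(4)] and Px = Phi_obj[OF c(4) c(1) xw]
  note n1 = nu_hom[OF a(2) nc pr_carrier np HOL.refl a(4) oB]
  note n2 = nu_hom[OF a(1) st'(1) pr_carrier st'(2) xe a(6) oB]
  note n3 = nu_hom[OF c(4) nc pr_carrier np HOL.refl xw oB]
  note n4 = nu_hom[OF a(1,2) c(1) a(4,8,6) E]
  note t' = transport_props(1)[OF B pr_mem st'] and t = transport_props(1)[OF B pr_mem st]
  have "Cmp (cat v) (ext_map B u v') (PhiM u v' (ext_map B u' w))
      = Cmp (cat v) (ext_map B u v') (Cmp (cat v) (PhiM u v' (transport B (u' \<otimes> ?n) ?p)) (PhiM u v'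
          (nu u' ?n ?p ?B)))"
    using Phi_cmp[OF a(1) c(2) a(6) Pu'[OF E] pu'n E' n1 t'] unfolding ext_map_def[of B u' w] a(4)
        by simp
  also have "\<dots> = Cmp (cat v) (Cmp (cat v) (ext_map B u v') (PhiM u v' (transport B (u' \<otimes> ?n) ?p)))
      (PhiM u v' (nu u' ?n ?p ?B))"
    by (rule V.cmp_assoc[OF Pu[OF Pu'[OF E]] Pu[OF pu'n] Pu[OF E'] Ev Hu[OF Pu'[OF E] pu'n n1] Hu[OF
        pu'n E' t']
      ext_map_hom[OF B a(1) c(2) a(6)], symmetric])
  also have "Cmp (cat v) (ext_map B u v') (PhiM u v' (transport B (u' \<otimes> ?n) ?p))
      = Cmp (cat v) (transport B (x \<otimes> ?n) ?p) (nu u (u' \<otimes> ?n) ?p ?B)"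
    using ext_map_transport[OF B pr_mem st' a(1,6)] xe by simp
  also have "Cmp (cat v) (Cmp (cat v) (transport B (x \<otimes> ?n) ?p) (nu u (u' \<otimes> ?n) ?p ?B)) (PhiM u v'
      (nu u' ?n ?p ?B))
      = Cmp (cat v) (transport B (x \<otimes> ?n) ?p) (Cmp (cat v) (nu u (u' \<otimes> ?n) ?p ?B) (PhiM u v' (nu u'
          ?n ?p ?B)))"
    by (rule V.cmp_assoc[OF Pu[OF Pu'[OF E]] Pu[OF pu'n] pxn Ev Hu[OF Pu'[OF E] pu'n n1] n2 t])
  also have "Cmp (cat v) (nu u (u' \<otimes> ?n) ?p ?B) (PhiM u v' (nu u' ?n ?p ?B)) = Cmp (cat v) (nu x ?n
      ?p ?B) (nu u u' w (Phi ?n ?p ?B))"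
    by (rule nu_associative[OF a(1,2) nc pr_carrier np a(4,6,8) HOL.refl oB, symmetric])
  also have "Cmp (cat v) (transport B (x \<otimes> ?n) ?p) \<dots> = Cmp (cat v) (ext_map B x w) (nu u u' w (Phi
      ?n ?p ?B))"
    unfolding ext_map_def xw by (rule V.cmp_assoc[OF Pu[OF Pu'[OF E]] Px[OF E] pxn Ev n4 n3 t,
        symmetric])
  finally show "Cmp (cat v) (ext_map B u v') (PhiM u v' (ext_map B u' w)) = Cmp (cat v) (ext_map B x
      w) (nu u u' w (Phi ?n ?p ?B))" .
qed

text \<open>The component at \<open>w\<close> is freely generated by the component at its nearest element.\<close>

lemma ext_map_generates:
  assumes B: "B \<in> Obj (glue W D Q)" and w: "w \<in> carrier W"
  shows "ext_map B (nn w) (pr w) = Ident (cat w) (Phi (nn w) (pr w) (fst B (pr w)))"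
proof -
  note oB = glue_obj_component[OF B pr_mem]
  note nc = nn_carrier[OF w] and np = nn_pr[OF w]
  interpret C: preadditive_category "cat w" by (rule preadd) fact
  note o = Phi_obj[OF nc pr_carrier np oB]
  have e: "pr (pr w) = pr w" "nn (pr w) = \<one>" "nn w \<otimes> \<one> = nn w" using pr_Q[OF pr_mem] nn_Q[OF pr_mem]
      nc by auto
  show ?thesis unfolding ext_map_def e(1) np using e(1,2,3) pr_carrier transport_self[OF B w]
      nu_one_right[OF nc pr_carrier oB]
      C.cmp_ident_left[OF o o C.ident_hom[OF o]] np by simp
qed

lemma ext_obj_restrict:
  assumes B: "B \<in> Obj (glue W D Q)" shows "fobj (jstar W D Q) (ext_obj B) = B"
proof -
  have 1: "fst (ext_obj B) w = fst B w" if "w \<in> Q" for w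
    using ext_obj_component[of w B] that QP pr_Q[OF that] nn_Q[OF that] Phi_one_obj[OF Q_carrier[OF
        that] glue_obj_component[OF B that]]
    by auto
  have 2: "snd (ext_obj B) (u, w) = snd B (u, w)" if a: "u \<in> carrier W" "w \<in> Q" "u \<otimes> w \<in> Q" for u w
  proof -
    have c: "w \<in> carrier W" "u \<otimes> w \<in> carrier W" using a Q_carrier by auto
    interpret V: preadditive_category "cat (u \<otimes> w)" by (rule preadd) fact
    note oB = glue_obj_component[OF B]
    have e: "pr w = w" "nn w = \<one>" "u \<otimes> \<one> = u" using pr_Q nn_Q a by auto
    have "snd (ext_obj B) (u, w) = ext_map B u w" using ext_obj_structure a QP by blast
    also have "\<dots> = Cmp (cat (u \<otimes> w)) (transport B u w) (nu u \<one> w (fst B w))"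
      unfolding ext_map_def e(2) unfolding e(1,3) ..
    also have "\<dots> = snd B (u, w)"
      using transport_Q[OF B a(2,1,3)] nu_one_right[OF a(1) c(1) oB[OF a(2)]]
        V.cmp_ident_right[OF Phi_obj[OF a(1) c(1) HOL.refl oB[OF a(2)]] oB[OF a(3)] glue_obj_map[OF
            B a(1,2) HOL.refl a(3)]] by simp
    finally show ?thesis .
  qed
  have "restrict (snd (ext_obj B)) (glue_pairs W Q) = restrict (\<lambda>(u, w). snd B (u, w)) (glue_pairs W Q)"
    by (rule restrict_ext) (use 2 in \<open>auto simp: glue_pairs_def\<close>)
  moreover have "restrict (fst (ext_obj B)) Q = restrict (fst B) Q" by (rule restrict_ext) (rule 1)
  ultimately show ?thesis by (subst (2) glue_obj_expand[OF B]) (auto intro!: prod_eqI simp: jstar_simps)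
qed

end

context coset_extension
begin

text \<open>The only possible extension of \<open>g\<close>: at \<open>w = n p\<close> the structure map of \<open>n\<close> is the identity of
  \<open>\<Phi>\<^sub>n B\<^sub>p\<close>, which forces the value.\<close>

definition ext_hom :: "('w, 'o, 'm) glue_obj \<Rightarrow> ('w \<Rightarrow> 'm) \<Rightarrow> 'w \<Rightarrow> 'm" where
  "ext_hom X g = (\<lambda>w\<in>P. Cmp (cat w) (snd X (nn w, pr w)) (PhiM (nn w) (pr w) (g (pr w))))"

lemma jstar_homD:
  assumes g: "g \<in> Hom (glue W D Q) B (fobj (jstar W D Q) X)"
  shows "y \<in> Q \<Longrightarrow> g y \<in> Hom (cat y) (fst B y) (fst X y)"
    "u \<in> carrier W \<Longrightarrow> y \<in> Q \<Longrightarrow> u \<otimes> y = v \<Longrightarrow> v \<in> Q \<Longrightarrow>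
     Cmp (cat v) (g v) (snd B (u, y)) = Cmp (cat v) (snd X (u, y)) (PhiM u y (g y))"
  using glue_hom_component[OF g] glue_hom_natural[OF g] by (auto simp: jstar_component jstar_structure)

text \<open>Compatibility of the extended morphism with the structure maps follows from this statement about the
  morphisms from which they are built.\<close>

lemma ext_hom_transport:
  assumes B: "B \<in> Obj (glue W D Q)" and X: "X \<in> Obj (glue W D P)" and g: "g \<in> Hom (glue W D Q) B
      (fobj (jstar W D Q) X)"
    and y: "y \<in> Q" and h: "h \<in> carrier W" "h \<otimes> y = v" and v: "v \<in> P"
  shows "Cmp (cat v) (ext_hom X g v) (transport B h y) = Cmp (cat v) (snd X (h, y)) (PhiM h y (g y))"
proof -
  let ?p = "pr v" and ?n = "nn v"
  let ?z = "?p \<otimes> inv y"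
  have yc: "y \<in> carrier W" and yP: "y \<in> P" and pP: "?p \<in> P" using y Q_carrier QP pr_mem by auto
  note s = coset_split[OF y h]
  interpret V: preadditive_category "cat v" by (rule preadd) fact
  note oB = glue_obj_component[OF B] and oX = glue_obj_component[OF X]
  note gd = jstar_homD[OF g]
  note nc = nn_carrier[OF s(1)] and np = nn_pr[OF s(1)]
  note m = glue_obj_map[OF B s(2) y s(4) pr_mem] and mX = glue_obj_map[OF X s(2) yP s(4) pP]
    and mn = glue_obj_map[OF X nc pP np v] and mh = glue_obj_map[OF X h(1) yP h(2) v]
  note o0 = Phi_obj[OF s(2) yc s(4) oB[OF y]] and oX0 = Phi_obj[OF s(2) yc s(4) oX[OF yP]]
  note Pn = Phi_obj[OF nc pr_carrier np] and Ph = Phi_obj[OF h(1) yc h(2)]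
  note Hn = Phi_hom[OF nc pr_carrier np] and hg = Phi_hom[OF h(1) yc h(2) oB[OF y] oX[OF yP]
      gd(1)[OF y]]
  note hz = Phi_hom[OF s(2) yc s(4) oB[OF y] oX[OF yP] gd(1)[OF y]]
  note t = transport_props[OF B y h]
  note gp = gd(1)[OF pr_mem]
  note hgp = Hn[OF oB[OF pr_mem] oX[OF pP] gp]
  note nB = nu_hom[OF nc s(2) yc s(4,5) np oB[OF y]] and nX = nu_hom[OF nc s(2) yc s(4,5) np oX[OF yP]]
  have E: "ext_hom X g v = Cmp (cat v) (snd X (?n, ?p)) (PhiM ?n ?p (g ?p))" unfolding ext_hom_def
      using v by simp
  have eh: "ext_hom X g v \<in> Hom (cat v) (Phi ?n ?p (fst B ?p)) (fst X v)"
    unfolding E by (rule V.cmp_hom[OF Pn[OF oB[OF pr_mem]] Pn[OF oX[OF pP]] oX[OF v] hgp mn])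
  show ?thesis
  proof (rule V.is_iso_cancel_right[OF Pn[OF o0] Ph[OF oB[OF y]] oX[OF v] transport_iso[OF y h oB[OF
      y]]])
    show "Cmp (cat v) (ext_hom X g v) (transport B h y) \<in> Hom (cat v) (Phi h y (fst B y)) (fst X v)"
      by (rule V.cmp_hom[OF Ph[OF oB[OF y]] Pn[OF oB[OF pr_mem]] oX[OF v] t(1) eh])
    show "Cmp (cat v) (snd X (h, y)) (PhiM h y (g y)) \<in> Hom (cat v) (Phi h y (fst B y)) (fst X v)"
      by (rule V.cmp_hom[OF Ph[OF oB[OF y]] Ph[OF oX[OF yP]] oX[OF v] hg mh])
    let ?N = "nu ?n ?z y (fst B y)"
    have "Cmp (cat v) (Cmp (cat v) (ext_hom X g v) (transport B h y)) ?N = Cmp (cat v) (ext_hom X g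
        v) (PhiM ?n ?p (snd B (?z, y)))"
      using V.cmp_assoc[OF Pn[OF o0] Ph[OF oB[OF y]] Pn[OF oB[OF pr_mem]] oX[OF v] nB t(1) eh] t(2)
          by simp
    also have "\<dots> = Cmp (cat v) (snd X (?n, ?p)) (Cmp (cat v) (PhiM ?n ?p (g ?p)) (PhiM ?n ?p (snd B
        (?z, y))))"
      unfolding E by (rule V.cmp_assoc[OF Pn[OF o0] Pn[OF oB[OF pr_mem]] Pn[OF oX[OF pP]] oX[OF v]
          Hn[OF o0 oB[OF pr_mem] m] hgp mn])
    also have "Cmp (cat v) (PhiM ?n ?p (g ?p)) (PhiM ?n ?p (snd B (?z, y))) = PhiM ?n ?p (Cmp (cat
        ?p) (snd X (?z, y)) (PhiM ?z y (g y)))"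
      using Phi_cmp[OF nc pr_carrier np o0 oB[OF pr_mem] oX[OF pP] m gp] gd(2)[OF s(2) y s(4)
          pr_mem] by simp
    also have "\<dots> = Cmp (cat v) (PhiM ?n ?p (snd X (?z, y))) (PhiM ?n ?p (PhiM ?z y (g y)))"
      by (rule Phi_cmp[OF nc pr_carrier np o0 oX0 oX[OF pP] hz mX])
    also have "Cmp (cat v) (snd X (?n, ?p)) \<dots> = Cmp (cat v) (Cmp (cat v) (snd X (?n, ?p)) (PhiM ?n
        ?p (snd X (?z, y)))) (PhiM ?n ?p (PhiM ?z y (g y)))"
      by (rule V.cmp_assoc[OF Pn[OF o0] Pn[OF oX0] Pn[OF oX[OF pP]] oX[OF v] Hn[OF o0 oX0 hz] Hn[OF
          oX0 oX[OF pP] mX] mn, symmetric])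
    also have "Cmp (cat v) (snd X (?n, ?p)) (PhiM ?n ?p (snd X (?z, y))) = Cmp (cat v) (snd X (h,
        y)) (nu ?n ?z y (fst X y))"
      by (rule glue_obj_assoc[OF P X nc s(2) yP s(4) pP np v s(5)])
    also have "Cmp (cat v) (Cmp (cat v) (snd X (h, y)) (nu ?n ?z y (fst X y))) (PhiM ?n ?p (PhiM ?z
        y (g y)))
        = Cmp (cat v) (snd X (h, y)) (Cmp (cat v) (nu ?n ?z y (fst X y)) (PhiM ?n ?p (PhiM ?z y (g
            y))))"
      by (rule V.cmp_assoc[OF Pn[OF o0] Pn[OF oX0] Ph[OF oX[OF yP]] oX[OF v] Hn[OF o0 oX0 hz] nX mh])
    also have "Cmp (cat v) (nu ?n ?z y (fst X y)) (PhiM ?n ?p (PhiM ?z y (g y))) = Cmp (cat v) (PhiM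
        h y (g y)) ?N"
      by (rule nu_nat[OF nc s(2) yc s(4,5) np oB[OF y] oX[OF yP] gd(1)[OF y]])
    also have "Cmp (cat v) (snd X (h, y)) \<dots> = Cmp (cat v) (Cmp (cat v) (snd X (h, y)) (PhiM h y (g
        y))) ?N"
      by (rule V.cmp_assoc[OF Pn[OF o0] Ph[OF oB[OF y]] Ph[OF oX[OF yP]] oX[OF v] nB hg mh, symmetric])
    finally show "Cmp (cat v) (Cmp (cat v) (ext_hom X g v) (transport B h y)) ?N
        = Cmp (cat v) (Cmp (cat v) (snd X (h, y)) (PhiM h y (g y))) ?N" .
  qed
qed

lemma ext_hom_closed:
  assumes B: "B \<in> Obj (glue W D Q)" and X: "X \<in> Obj (glue W D P)" and g: "g \<in> Hom (glue W D Q) B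
      (fobj (jstar W D Q) X)"
  shows "ext_hom X g \<in> Hom (glue W D P) (ext_obj B) X"
proof (rule glue_homI)
  show "ext_hom X g \<in> extensional P" unfolding ext_hom_def by simp
  note oB = glue_obj_component[OF B pr_mem] and oX = glue_obj_component[OF X]
  have pP: "pr w \<in> P" for w using pr_mem QP by blast
  have comp: "ext_hom X g w \<in> Hom (cat w) (Phi (nn w) (pr w) (fst B (pr w))) (fst X w)" if w: "w \<in>
      P" for w
  proof -
    have wc: "w \<in> carrier W" using P_carrier[OF w] .
    interpret C: preadditive_category "cat w" by (rule preadd) fact
    note Pn = Phi_obj[OF nn_carrier[OF wc] pr_carrier nn_pr[OF wc]]
    show ?thesis unfolding ext_hom_def using w
        C.cmp_hom[OF Pn[OF oB] Pn[OF oX[OF pP]] oX[OF w] Phi_hom[OF nn_carrier[OF wc] pr_carrier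
            nn_pr[OF wc] oB oX[OF pP] jstar_homD(1)[OF g pr_mem]]
          glue_obj_map[OF X nn_carrier[OF wc] pP nn_pr[OF wc] w]] by simp
  qed
  show "ext_hom X g w \<in> Hom (cat w) (fst (ext_obj B) w) (fst X w)" if "w \<in> P" for w
    using comp[OF that] that by (simp add: ext_obj_component)
  fix u w v assume a: "u \<in> carrier W" "w \<in> P" "u \<otimes> w = v" "v \<in> P"
  have c: "w \<in> carrier W" "v \<in> carrier W" using a P_carrier by auto
  interpret V: preadditive_category "cat v" by (rule preadd) fact
  interpret C: preadditive_category "cat w" by (rule preadd) fact
  let ?p = "pr w" and ?n = "nn w"
  note nc = nn_carrier[OF c(1)] and np = nn_pr[OF c(1)] and st = nn_step[OF a(1) c(1) a(3)]
  note Pn = Phi_obj[OF nc pr_carrier np] and Hn = Phi_hom[OF nc pr_carrier np]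
  note Pu = Phi_obj[OF a(1) c(1) a(3)] and Hu = Phi_hom[OF a(1) c(1) a(3)]
  note Pun = Phi_obj[OF st(1) pr_carrier st(2)] and Hun = Phi_hom[OF st(1) pr_carrier st(2)]
  have Ev: "Phi (nn v) (pr v) (fst B (pr v)) \<in> Obj (cat v)" by (rule Phi_obj[OF nn_carrier[OF c(2)]
      pr_carrier nn_pr[OF c(2)] oB])
  note gp = jstar_homD(1)[OF g pr_mem]
  note nB = nu_hom[OF a(1) nc pr_carrier np HOL.refl a(3) oB] and nX = nu_hom[OF a(1) nc pr_carrier
      np HOL.refl a(3) oX[OF pP]]
  note t = transport_props(1)[OF B pr_mem st]
  note mun = glue_obj_map[OF X st(1) pP st(2) a(4)] and mn = glue_obj_map[OF X nc pP np a(2)] and mu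
      = glue_obj_map[OF X a]
  note hgp = Hn[OF oB oX[OF pP] gp]
  have "Cmp (cat v) (ext_hom X g v) (ext_map B u w)
      = Cmp (cat v) (Cmp (cat v) (ext_hom X g v) (transport B (u \<otimes> ?n) ?p)) (nu u ?n ?p (fst B ?p))"
    unfolding ext_map_def a(3) by (rule V.cmp_assoc[OF Pu[OF Pn[OF oB]] Pun[OF oB] Ev oX[OF a(4)] nB
        t comp[OF a(4)], symmetric])
  also have "\<dots> = Cmp (cat v) (Cmp (cat v) (snd X (u \<otimes> ?n, ?p)) (PhiM (u \<otimes> ?n) ?p (g ?p))) (nu u ?n
      ?p (fst B ?p))"
    using ext_hom_transport[OF B X g pr_mem st a(4)] by simp
  also have "\<dots> = Cmp (cat v) (snd X (u \<otimes> ?n, ?p)) (Cmp (cat v) (PhiM (u \<otimes> ?n) ?p (g ?p)) (nu u ?n ?p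
      (fst B ?p)))"
    by (rule V.cmp_assoc[OF Pu[OF Pn[OF oB]] Pun[OF oB] Pun[OF oX[OF pP]] oX[OF a(4)] nB Hun[OF oB
        oX[OF pP] gp] mun])
  also have "Cmp (cat v) (PhiM (u \<otimes> ?n) ?p (g ?p)) (nu u ?n ?p (fst B ?p)) = Cmp (cat v) (nu u ?n ?p
      (fst X ?p)) (PhiM u w (PhiM ?n ?p (g ?p)))"
    by (rule nu_nat[OF a(1) nc pr_carrier np HOL.refl a(3) oB oX[OF pP] gp, symmetric])
  also have "Cmp (cat v) (snd X (u \<otimes> ?n, ?p)) \<dots> = Cmp (cat v) (Cmp (cat v) (snd X (u \<otimes> ?n, ?p)) (nu
      u ?n ?p (fst X ?p))) (PhiM u w (PhiM ?n ?p (g ?p)))"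
    by (rule V.cmp_assoc[OF Pu[OF Pn[OF oB]] Pu[OF Pn[OF oX[OF pP]]] Pun[OF oX[OF pP]] oX[OF a(4)]
        Hu[OF Pn[OF oB] Pn[OF oX[OF pP]] hgp] nX mun, symmetric])
  also have "Cmp (cat v) (snd X (u \<otimes> ?n, ?p)) (nu u ?n ?p (fst X ?p)) = Cmp (cat v) (snd X (u, w))
      (PhiM u w (snd X (?n, ?p)))"
    by (rule glue_obj_assoc[OF P X a(1) nc pP np a(2,3,4) HOL.refl, symmetric])
  also have "Cmp (cat v) (Cmp (cat v) (snd X (u, w)) (PhiM u w (snd X (?n, ?p)))) (PhiM u w (PhiM ?n
      ?p (g ?p)))
      = Cmp (cat v) (snd X (u, w)) (Cmp (cat v) (PhiM u w (snd X (?n, ?p))) (PhiM u w (PhiM ?n ?p (g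
          ?p))))"
    by (rule V.cmp_assoc[OF Pu[OF Pn[OF oB]] Pu[OF Pn[OF oX[OF pP]]] Pu[OF oX[OF a(2)]] oX[OF a(4)]
        Hu[OF Pn[OF oB] Pn[OF oX[OF pP]] hgp]
      Hu[OF Pn[OF oX[OF pP]] oX[OF a(2)] mn] mu])
  also have "Cmp (cat v) (PhiM u w (snd X (?n, ?p))) (PhiM u w (PhiM ?n ?p (g ?p))) = PhiM u w
      (ext_hom X g w)"
    unfolding ext_hom_def using Phi_cmp[OF a(1) c(1) a(3) Pn[OF oB] Pn[OF oX[OF pP]] oX[OF a(2)] hgp
        mn] a(2) by simp
  finally show "Cmp (cat v) (ext_hom X g v) (snd (ext_obj B) (u, w)) = Cmp (cat v) (snd X (u, w))
      (PhiM u w (ext_hom X g w))"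
    using ext_obj_structure[of u w B] a by simp
qed

lemma ext_hom_restrict:
  assumes B: "B \<in> Obj (glue W D Q)" and X: "X \<in> Obj (glue W D P)" and g: "g \<in> Hom (glue W D Q) B
      (fobj (jstar W D Q) X)"
  shows "restrict (ext_hom X g) Q = g"
proof (rule extensionalityI[of _ Q])
  show "g \<in> extensional Q" by (rule glue_hom_ext[OF g])
  fix w assume w: "w \<in> Q"
  hence wP: "w \<in> P" and wc: "w \<in> carrier W" using QP Q_carrier by auto
  interpret C: preadditive_category "cat w" by (rule preadd) fact
  note oB = glue_obj_component[OF B w] and oX = glue_obj_component[OF X wP] and gw =
      jstar_homD(1)[OF g w]
  show "restrict (ext_hom X g) Q w = g w"
    unfolding ext_hom_def using w wP nn_Q[OF w] pr_Q[OF w] Phi_one_map[OF wc oB oX gw]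
        glue_obj_one[OF X wP] C.cmp_ident_left[OF oB oX gw]
    by simp
qed simp

lemma ext_hom_unique:
  assumes B: "B \<in> Obj (glue W D Q)" and X: "X \<in> Obj (glue W D P)" and f: "f \<in> Hom (glue W D P)
      (ext_obj B) X"
  shows "f = ext_hom X (restrict f Q)"
proof (rule extensionalityI[of _ P])
  show "f \<in> extensional P" by (rule glue_hom_ext[OF f])
  show "ext_hom X (restrict f Q) \<in> extensional P" unfolding ext_hom_def by simp
  fix w assume w: "w \<in> P"
  hence wc: "w \<in> carrier W" using P_carrier by blast
  have pP: "pr w \<in> P" using pr_mem QP by blast
  interpret C: preadditive_category "cat w" by (rule preadd) fact
  note oB = glue_obj_component[OF B pr_mem] and oX = glue_obj_component[OF X]
  note Pn = Phi_obj[OF nn_carrier[OF wc] pr_carrier nn_pr[OF wc] oB]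
  have fw: "f w \<in> Hom (cat w) (Phi (nn w) (pr w) (fst B (pr w))) (fst X w)"
    using glue_hom_component[OF f w] w by (simp add: ext_obj_component)
  have "f w = Cmp (cat w) (f w) (snd (ext_obj B) (nn w, pr w))"
    using ext_obj_structure[OF nn_carrier[OF wc] pP] nn_pr[OF wc] w ext_map_generates[OF B wc]
        C.cmp_ident_right[OF Pn oX[OF w] fw] by simp
  also have "\<dots> = Cmp (cat w) (snd X (nn w, pr w)) (PhiM (nn w) (pr w) (f (pr w)))"
    by (rule glue_hom_natural[OF f nn_carrier[OF wc] pP nn_pr[OF wc] w])
  finally show "f w = ext_hom X (restrict f Q) w" unfolding ext_hom_def using w pr_mem by simp
qed

text \<open>The unit of the explicit extension is the identity, because restricting the extension of \<open>B\<close>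
  gives back \<open>B\<close>.\<close>

lemma ext_universal:
  assumes B: "B \<in> Obj (glue W D Q)" and X: "X \<in> Obj (glue W D P)" and g: "g \<in> Hom (glue W D Q) B
      (fobj (jstar W D Q) X)"
  shows "\<exists>!f. f \<in> Hom (glue W D P) (ext_obj B) X \<and> Cmp (glue W D Q) (fmap (jstar W D Q) f) (Ident
      (glue W D Q) B) = g"
proof -
  interpret G: preadditive_category "glue W D Q" by (rule glue_preadditive[OF Q_sub])
  have r: "Cmp (glue W D Q) (fmap (jstar W D Q) f) (Ident (glue W D Q) B) = restrict f Q"
    if f: "f \<in> Hom (glue W D P) (ext_obj B) X" for f
    using G.cmp_ident_right[OF B jstar_obj[OF P QP X], of "restrict f Q"] jstar_hom[OF QP f]
        ext_obj_restrict[OF B]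
    by (simp add: jstar_simps)
  show ?thesis
  proof (rule ex1I[of _ "ext_hom X g"])
    show "ext_hom X g \<in> Hom (glue W D P) (ext_obj B) X \<and> Cmp (glue W D Q) (fmap (jstar W D Q)
        (ext_hom X g)) (Ident (glue W D Q) B) = g"
      using ext_hom_closed[OF B X g] r[OF ext_hom_closed[OF B X g]] ext_hom_restrict[OF B X g] by simp
    fix f assume f: "f \<in> Hom (glue W D P) (ext_obj B) X \<and> Cmp (glue W D Q) (fmap (jstar W D Q) f)
        (Ident (glue W D Q) B) = g"
    thus "f = ext_hom X g" using ext_hom_unique[OF B X, of f] r[of f] by simp
  qed
qed

text \<open>As hom sets of different pairs of objects may overlap, the action on a morphism has to be given by a formula
  that does not mention its source and target.\<close>

definition ext_functor :: "(('w, 'o, 'm) glue_obj, 'w \<Rightarrow> 'm, ('w, 'o, 'm) glue_obj, 'w \<Rightarrow> 'm) funct" where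
  "ext_functor = \<lparr>fobj = ext_obj, fmap = (\<lambda>f. \<lambda>w\<in>P. PhiM (nn w) (pr w) (f (pr w)))\<rparr>"

lemma ext_left_adjoint:
  "is_left_adjoint (glue W D P) (glue W D Q) (jstar W D Q) ext_functor (Ident (glue W D Q))"
proof -
  interpret G: preadditive_category "glue W D Q" by (rule glue_preadditive[OF Q_sub])
  interpret GP: preadditive_category "glue W D P" by (rule glue_preadditive[OF P])
  have s: "fobj ext_functor = ext_obj" "fmap ext_functor f = (\<lambda>w\<in>P. PhiM (nn w) (pr w) (f (pr w)))"
      for f
    unfolding ext_functor_def by simp_all
  have hom: "fmap ext_functor f \<in> Hom (glue W D P) (ext_obj a) (ext_obj b)"
    if a: "a \<in> Obj (glue W D Q)" and b: "b \<in> Obj (glue W D Q)" and f: "f \<in> Hom (glue W D Q) a b" for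
        a b f
  proof -
    have f': "f \<in> Hom (glue W D Q) a (fobj (jstar W D Q) (ext_obj b))" using f ext_obj_restrict[OF
        b] by simp
    have "fmap ext_functor f = ext_hom (ext_obj b) f"
    proof (rule extensionalityI[of _ P])
      fix w assume w: "w \<in> P"
      hence wc: "w \<in> carrier W" using P_carrier by blast
      have pP: "pr w \<in> P" using pr_mem QP by blast
      interpret C: preadditive_category "cat w" by (rule preadd) fact
      note o = glue_obj_component[OF a pr_mem] glue_obj_component[OF b pr_mem]
      note Pn = Phi_obj[OF nn_carrier[OF wc] pr_carrier nn_pr[OF wc]]
      show "fmap ext_functor f w = ext_hom (ext_obj b) f w"
        unfolding s ext_hom_def using w ext_obj_structure[OF nn_carrier[OF wc] pP] nn_pr[OF wc]
            ext_map_generates[OF b wc]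
          C.cmp_ident_left[OF Pn[OF o(1)] Pn[OF o(2)] Phi_hom[OF nn_carrier[OF wc] pr_carrier
              nn_pr[OF wc] o glue_hom_component[OF f pr_mem]]]
        by simp
    qed (simp_all add: s ext_hom_def)
    thus ?thesis using ext_hom_closed[OF a ext_obj_closed[OF b] f'] by simp
  qed
  have comp: "fst (ext_obj B) w = Phi (nn w) (pr w) (fst B (pr w))" if "w \<in> P" for B w using
      ext_obj_component[OF that] .
  have "is_functor (glue W D Q) (glue W D P) ext_functor"
    unfolding is_functor_def s(1)
  proof (intro conjI ballI)
    show "ext_obj a \<in> Obj (glue W D P)" if "a \<in> Obj (glue W D Q)" for a by (rule ext_obj_closed[OF
        that])
    show "fmap ext_functor f \<in> Hom (glue W D P) (ext_obj a) (ext_obj b)"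
      if "a \<in> Obj (glue W D Q)" "b \<in> Obj (glue W D Q)" "f \<in> Hom (glue W D Q) a b" for a b f using
          hom[OF that] .
    show "fmap ext_functor (Ident (glue W D Q) a) = Ident (glue W D P) (ext_obj a)" if a: "a \<in> Obj
        (glue W D Q)" for a
    proof (rule glue_hom_eqI[OF hom[OF a a G.ident_hom[OF a]] GP.ident_hom[OF ext_obj_closed[OF a]]])
      fix w assume w: "w \<in> P"
      hence wc: "w \<in> carrier W" using P_carrier by blast
      show "fmap ext_functor (Ident (glue W D Q) a) w = Ident (glue W D P) (ext_obj a) w"
        unfolding s using w comp[OF w] pr_mem[of w] Phi_ident[OF nn_carrier[OF wc] pr_carrier
            nn_pr[OF wc] glue_obj_component[OF a pr_mem]] by simp
    qed
    fix a b c f g assume o: "a \<in> Obj (glue W D Q)" "b \<in> Obj (glue W D Q)" "c \<in> Obj (glue W D Q)"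
      and f: "f \<in> Hom (glue W D Q) a b" and g: "g \<in> Hom (glue W D Q) b c"
    show "fmap ext_functor (Cmp (glue W D Q) g f) = Cmp (glue W D P) (fmap ext_functor g) (fmap
        ext_functor f)"
    proof (rule glue_hom_eqI[OF hom[OF o(1,3) G.cmp_hom[OF o f g]]
          GP.cmp_hom[OF ext_obj_closed[OF o(1)] ext_obj_closed[OF o(2)] ext_obj_closed[OF o(3)]
              hom[OF o(1,2) f] hom[OF o(2,3) g]]])
      fix w assume w: "w \<in> P"
      hence wc: "w \<in> carrier W" using P_carrier by blast
      show "fmap ext_functor (Cmp (glue W D Q) g f) w = Cmp (glue W D P) (fmap ext_functor g) (fmap
          ext_functor f) w"
        unfolding s using w pr_mem[of w] Phi_cmp[OF nn_carrier[OF wc] pr_carrier nn_pr[OF wc]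
            glue_obj_component[OF o(1) pr_mem]
          glue_obj_component[OF o(2) pr_mem] glue_obj_component[OF o(3) pr_mem]
              glue_hom_component[OF f pr_mem] glue_hom_component[OF g pr_mem]]
        by simp
    qed
  qed
  moreover have "is_nat_trans (glue W D Q) (glue W D Q) funct_id (funct_comp (jstar W D Q)
      ext_functor) (Ident (glue W D Q))"
    unfolding is_nat_trans_def funct_id_def funct_comp_def funct.simps s(1)
  proof (intro conjI ballI)
    show "Ident (glue W D Q) a \<in> Hom (glue W D Q) a (fobj (jstar W D Q) (ext_obj a))" if "a \<in> Obj
        (glue W D Q)" for a
      using G.ident_hom[OF that] ext_obj_restrict[OF that] by simp
    fix a b f assume o: "a \<in> Obj (glue W D Q)" "b \<in> Obj (glue W D Q)" and f: "f \<in> Hom (glue W D Q) a b"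
    have "fmap (jstar W D Q) (fmap ext_functor f) = f"
    proof (rule extensionalityI[of _ Q])
      fix w assume w: "w \<in> Q"
      thus "fmap (jstar W D Q) (fmap ext_functor f) w = f w" unfolding s jstar_simps
        using QP nn_Q[OF w] pr_Q[OF w] Phi_one_map[OF Q_carrier[OF w] glue_obj_component[OF o(1) w]
            glue_obj_component[OF o(2) w] glue_hom_component[OF f w]]
        by auto
    qed (use glue_hom_ext[OF f] in \<open>simp_all add: jstar_simps\<close>)
    thus "Cmp (glue W D Q) (Ident (glue W D Q) b) f = Cmp (glue W D Q) (fmap (jstar W D Q) (fmap
        ext_functor f)) (Ident (glue W D Q) a)"
      using G.cmp_ident_left[OF o f] G.cmp_ident_right[OF o f] by simp
  qed
  ultimately show ?thesis unfolding is_left_adjoint_def s(1) using ext_universal by blast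
qed

lemma jshriek_left_adjoint:
  "is_left_adjoint (glue W D P) (glue W D Q) (jstar W D Q) (jshriek W D Q P) (junit W D Q P)"
proof -
  have "\<exists>p. case p of (L, \<eta>) \<Rightarrow> is_left_adjoint (glue W D P) (glue W D Q) (jstar W D Q) L \<eta>"
    using ext_left_adjoint by auto
  hence "case jshriek_adj W D Q P of (L, \<eta>) \<Rightarrow> is_left_adjoint (glue W D P) (glue W D Q) (jstar W D
      Q) L \<eta>"
    unfolding jshriek_adj_def by (rule someI_ex)
  thus ?thesis unfolding jshriek_def junit_def by (simp add: case_prod_beta)
qed

lemma jj_props:
  assumes A: "A \<in> Obj (glue W D P)"
  shows "jj W D Q P A \<in> Obj (glue W D P)"
    "junit W D Q P (fobj (jstar W D Q) A) \<in> Hom (glue W D Q) (fobj (jstar W D Q) A) (fobj (jstar W D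
        Q) (jj W D Q P A))"
    "X \<in> Obj (glue W D P) \<Longrightarrow> g \<in> Hom (glue W D Q) (fobj (jstar W D Q) A) (fobj (jstar W D Q) X) \<Longrightarrow>
      \<exists>!f. f \<in> Hom (glue W D P) (jj W D Q P A) X \<and> Cmp (glue W D Q) (restrict f Q) (junit W D Q P
          (fobj (jstar W D Q) A)) = g"
  using jshriek_left_adjoint jstar_obj[OF P QP A]
  unfolding is_left_adjoint_def is_functor_def is_nat_trans_def jj_def funct_id_def funct_comp_def
  by (simp_all add: jstar_simps)

text \<open>Whatever left adjoint was chosen, its value is generated freely by the components on the coset:
  the \<open>w\<close>-component is \<open>\<Phi>\<^sub>n A\<^sub>p\<close>, through the unit at \<open>p\<close> and the structure map of \<open>n\<close>.\<close>

lemma jj_generated: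
  assumes A: "A \<in> Obj (glue W D P)" and w: "w \<in> P"
  shows "is_iso (cat w) (Phi (nn w) (pr w) (fst A (pr w))) (fst (jj W D Q P A) w)
     (Cmp (cat w) (snd (jj W D Q P A) (nn w, pr w)) (PhiM (nn w) (pr w) (junit W D Q P (fobj (jstar
         W D Q) A) (pr w))))"
proof -
  let ?B = "fobj (jstar W D Q) A" and ?X = "jj W D Q P A"
  let ?E = "ext_obj ?B" and ?\<eta> = "junit W D Q P ?B"
  interpret G: preadditive_category "glue W D Q" by (rule glue_preadditive[OF Q_sub])
  interpret GP: preadditive_category "glue W D P" by (rule glue_preadditive[OF P])
  interpret C: preadditive_category "cat w" by (rule preadd) (use P_carrier w in blast)
  note X = jj_props[OF A] and B = jstar_obj[OF P QP A]
  note E = ext_obj_closed[OF B] and jE = ext_obj_restrict[OF B] and jX = jstar_obj[OF P QP X(1)]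
  let ?i = "ext_hom ?X ?\<eta>"
  have i: "?i \<in> Hom (glue W D P) ?E ?X" and ir: "restrict ?i Q = ?\<eta>"
    using ext_hom_closed[OF B X(1,2)] ext_hom_restrict[OF B X(1,2)] by auto
  have "Ident (glue W D Q) ?B \<in> Hom (glue W D Q) ?B (fobj (jstar W D Q) ?E)" using G.ident_hom[OF B]
      jE by simp
  then obtain j where j: "j \<in> Hom (glue W D P) ?X ?E" "Cmp (glue W D Q) (restrict j Q) ?\<eta> = Ident
      (glue W D Q) ?B"
    using X(3)[OF E] by blast
  have rc: "restrict (Cmp (glue W D P) g f) Q = Cmp (glue W D Q) (restrict g Q) (restrict f Q)" for f g
    unfolding glue_simps using QP by (auto simp: fun_eq_iff restrict_def)
  have ri: "restrict (Ident (glue W D P) Y) Q = Ident (glue W D Q) (fobj (jstar W D Q) Y)" for Y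
    unfolding glue_simps using QP by (auto simp: fun_eq_iff restrict_def jstar_simps)
  \<comment> \<open>the two universal arrows yield mutually inverse morphisms \<open>?i\<close> and \<open>j\<close>\<close>
  have ji: "Cmp (glue W D P) j ?i = Ident (glue W D P) ?E"
  proof -
    have "Cmp (glue W D P) j ?i \<in> Hom (glue W D P) ?E ?E" by (rule GP.cmp_hom[OF E X(1) E i j(1)])
    moreover have "restrict (Cmp (glue W D P) j ?i) Q = restrict (Ident (glue W D P) ?E) Q"
      unfolding rc ri ir jE by (rule j(2))
    ultimately show ?thesis using ext_hom_unique[OF B E] GP.ident_hom[OF E] by metis
  qed
  have ij: "Cmp (glue W D P) ?i j = Ident (glue W D P) ?X"
  proof -
    have jr: "restrict j Q \<in> Hom (glue W D Q) (fobj (jstar W D Q) ?X) ?B" using jstar_hom[OF QP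
        j(1)] jE by simp
    have 1: "Cmp (glue W D Q) (restrict (Cmp (glue W D P) ?i j) Q) ?\<eta> = ?\<eta>"
      unfolding rc ir using G.cmp_assoc[OF B jX B jX X(2) jr X(2)] j(2) G.cmp_ident_right[OF B jX
          X(2)] by simp
    have 2: "Cmp (glue W D Q) (restrict (Ident (glue W D P) ?X) Q) ?\<eta> = ?\<eta>"
      unfolding ri by (rule G.cmp_ident_left[OF B jX X(2)])
    show ?thesis using ex1_eq[OF X(3)[OF X(1,2)], of "Cmp (glue W D P) ?i j" "Ident (glue W D P) ?X"]
        1 2 GP.cmp_hom[OF X(1) E X(1) j(1) i] GP.ident_hom[OF X(1)] by blast
  qed
  have "is_iso (cat w) (fst ?E w) (fst ?X w) (?i w)"
  proof (rule C.is_isoI[where g = "j w"])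
    show "?i w \<in> Hom (cat w) (fst ?E w) (fst ?X w)" "j w \<in> Hom (cat w) (fst ?X w) (fst ?E w)"
      using glue_hom_component[OF i w] glue_hom_component[OF j(1) w] by auto
    show "Cmp (cat w) (j w) (?i w) = Ident (cat w) (fst ?E w)" "Cmp (cat w) (?i w) (j w) = Ident
        (cat w) (fst ?X w)"
      using arg_cong[OF ji, of "\<lambda>h. h w"] arg_cong[OF ij, of "\<lambda>h. h w"] w by auto
  qed
  moreover have "fst ?E w = Phi (nn w) (pr w) (fst A (pr w))" using ext_obj_component[OF w]
      jstar_component[OF pr_mem] by simp
  moreover have "?i w = Cmp (cat w) (snd ?X (nn w, pr w)) (PhiM (nn w) (pr w) (?\<eta> (pr w)))"
    unfolding ext_hom_def using w by simp
  ultimately show ?thesis by simp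
qed

end

section \<open>Canonical morphisms between extensions\<close>

context coxeter_gluing
begin

abbreviation unit_at where
  "unit_at P A Q \<equiv> junit W D Q P (fobj (jstar W D Q) A)"

definition in_cosets :: "'w set \<Rightarrow> 'w set \<Rightarrow> bool" where
  "in_cosets P Q \<longleftrightarrow> (\<exists>K. coset_of K Q) \<and> Q \<subseteq> P"

lemma in_cosetsE:
  assumes "in_cosets P Q" "P \<subseteq> carrier W" obtains K where "coset_extension W S D K Q P" "coset_of K
      Q" "Q \<subseteq> P"
  using assms unfolding in_cosets_def
  by (meson coset_extension.intro coset_extension_axioms.intro coxeter_gluing_axioms)

lemma jj_facts:
  assumes P: "P \<subseteq> carrier W" and Q: "in_cosets P Q" and A: "A \<in> Obj (glue W D P)"
  shows jj_obj: "jj W D Q P A \<in> Obj (glue W D P)"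
    and unit_hom: "unit_at P A Q \<in> Hom (glue W D Q) (fobj (jstar W D Q) A) (fobj (jstar W D Q) (jj W
        D Q P A))"
    and jj_universal: "X \<in> Obj (glue W D P) \<Longrightarrow> g \<in> Hom (glue W D Q) (fobj (jstar W D Q) A) (fobj
        (jstar W D Q) X) \<Longrightarrow>
      \<exists>!f. f \<in> Hom (glue W D P) (jj W D Q P A) X \<and> Cmp (glue W D Q) (restrict f Q) (unit_at P A Q) = g"
    and jj_iso: "w \<in> P \<Longrightarrow> is_iso (cat w) (Phi (w \<otimes> inv nearest Q w) (nearest Q w) (fst A (nearest Q
        w))) (fst (jj W D Q P A) w)
     (Cmp (cat w) (snd (jj W D Q P A) (w \<otimes> inv nearest Q w, nearest Q w)) (PhiM (w \<otimes> inv nearest Q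
         w) (nearest Q w) (unit_at P A Q (nearest Q w))))"
proof -
  obtain K where "coset_extension W S D K Q P" using in_cosetsE[OF Q P] by blast
  then interpret coset_extension W S D K Q P .
  show "jj W D Q P A \<in> Obj (glue W D P)"
    "unit_at P A Q \<in> Hom (glue W D Q) (fobj (jstar W D Q) A) (fobj (jstar W D Q) (jj W D Q P A))"
    using jj_props(1,2)[OF A] .
  show "X \<in> Obj (glue W D P) \<Longrightarrow> g \<in> Hom (glue W D Q) (fobj (jstar W D Q) A) (fobj (jstar W D Q) X) \<Longrightarrow>
      \<exists>!f. f \<in> Hom (glue W D P) (jj W D Q P A) X \<and> Cmp (glue W D Q) (restrict f Q) (unit_at P A Q) = g"
    using jj_props(3)[OF A] .
  show "w \<in> P \<Longrightarrow> is_iso (cat w) (Phi (w \<otimes> inv nearest Q w) (nearest Q w) (fst A (nearest Q w))) (fst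
      (jj W D Q P A) w)
     (Cmp (cat w) (snd (jj W D Q P A) (w \<otimes> inv nearest Q w, nearest Q w)) (PhiM (w \<otimes> inv nearest Q
         w) (nearest Q w) (unit_at P A Q (nearest Q w))))"
    using jj_generated[OF A] .
qed

lemma jj_hom_eqI:
  assumes P: "P \<subseteq> carrier W" and Q: "in_cosets P Q" and A: "A \<in> Obj (glue W D P)"
    and X: "X \<in> Obj (glue W D P)" and f: "f \<in> Hom (glue W D P) (jj W D Q P A) X" and g: "g \<in> Hom
        (glue W D P) (jj W D Q P A) X"
    and e: "\<And>y. y \<in> Q \<Longrightarrow> Cmp (cat y) (f y) (unit_at P A Q y) = Cmp (cat y) (g y) (unit_at P A Q y)"
  shows "f = g"
proof -
  have QP: "Q \<subseteq> P" using Q unfolding in_cosets_def by blast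
  interpret G: preadditive_category "glue W D Q" by (rule glue_preadditive) (use P QP in blast)
  note u = unit_hom[OF P Q A]
  have h: "Cmp (glue W D Q) (restrict g Q) (unit_at P A Q) \<in> Hom (glue W D Q) (fobj (jstar W D Q) A)
      (fobj (jstar W D Q) X)"
    by (rule G.cmp_hom[OF jstar_obj[OF P QP A] jstar_obj[OF P QP jj_obj[OF P Q A]] jstar_obj[OF P QP
        X] u jstar_hom[OF QP g]])
  have "Cmp (glue W D Q) (restrict f Q) (unit_at P A Q) = Cmp (glue W D Q) (restrict g Q) (unit_at P
      A Q)"
    unfolding glue_simps using e by (auto simp: fun_eq_iff restrict_def)
  thus ?thesis using ex1_eq[OF jj_universal[OF P Q A X h], of f g] f g by simp
qed

lemma jj_map_props:
  assumes P: "P \<subseteq> carrier W" and Q: "in_cosets P Q" and Q': "in_cosets P Q'" and sub: "Q \<subseteq> Q'" and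
      A: "A \<in> Obj (glue W D P)"
  shows "jj_map W D P A Q Q' \<in> Hom (glue W D P) (jj W D Q P A) (jj W D Q' P A)"
    "y \<in> Q \<Longrightarrow> Cmp (cat y) (jj_map W D P A Q Q' y) (unit_at P A Q y) = unit_at P A Q' y"
proof -
  have QP: "Q \<subseteq> P" "Q' \<subseteq> P" using Q Q' unfolding in_cosets_def by auto
  have g: "restrict (unit_at P A Q') Q \<in> Hom (glue W D Q) (fobj (jstar W D Q) A) (fobj (jstar W D Q)
      (jj W D Q' P A))"
    using jstar_hom[OF sub unit_hom[OF P Q' A]] by (simp add: jstar_jstar[OF sub])
  have "jj_map W D P A Q Q' \<in> Hom (glue W D P) (jj W D Q P A) (jj W D Q' P A) \<and>
      Cmp (glue W D Q) (restrict (jj_map W D P A Q Q') Q) (unit_at P A Q) = restrict (unit_at P A Q') Q"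
    unfolding jj_map_def jstar_simps by (rule theI'[OF jj_universal[OF P Q A jj_obj[OF P Q' A] g]])
  note h = this
  show "jj_map W D P A Q Q' \<in> Hom (glue W D P) (jj W D Q P A) (jj W D Q' P A)" using h by blast
  show "y \<in> Q \<Longrightarrow> Cmp (cat y) (jj_map W D P A Q Q' y) (unit_at P A Q y) = unit_at P A Q' y"
    using arg_cong[OF conjunct2[OF h], of "\<lambda>f. f y"] by simp
qed

lemma unit_component:
  assumes P: "P \<subseteq> carrier W" and Q: "in_cosets P Q" and A: "A \<in> Obj (glue W D P)" and y: "y \<in> Q"
  shows "unit_at P A Q y \<in> Hom (cat y) (fst A y) (fst (jj W D Q P A) y)"
  using glue_hom_component[OF unit_hom[OF P Q A] y] by (simp add: jstar_component y)

text \<open>Both sides restrict to the same morphism along the unit.\<close>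

lemma jj_map_compose:
  assumes P: "P \<subseteq> carrier W" and Q: "in_cosets P Q" and Q': "in_cosets P Q'" and Q'': "in_cosets P Q''"
    and sub: "Q \<subseteq> Q'" "Q' \<subseteq> Q''" and A: "A \<in> Obj (glue W D P)"
  shows "Cmp (glue W D P) (jj_map W D P A Q' Q'') (jj_map W D P A Q Q') = jj_map W D P A Q Q''"
proof -
  interpret G: preadditive_category "glue W D P" by (rule glue_preadditive[OF P])
  note o = jj_obj[OF P Q A] jj_obj[OF P Q' A] jj_obj[OF P Q'' A]
  note m = jj_map_props[OF P Q Q' sub(1) A] and m' = jj_map_props[OF P Q' Q'' sub(2) A]
    and m'' = jj_map_props[OF P Q Q'' subset_trans[OF sub] A]
  have QP: "Q \<subseteq> P" using Q unfolding in_cosets_def by blast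
  show ?thesis
  proof (rule jj_hom_eqI[OF P Q A o(3) G.cmp_hom[OF o m(1) m'(1)] m''(1)])
    fix y assume y: "y \<in> Q"
    hence yP: "y \<in> P" and yc: "y \<in> carrier W" and yQ': "y \<in> Q'" using QP P sub by auto
    interpret C: preadditive_category "cat y" by (rule preadd) fact
    note oc = glue_obj_component[OF _ yP]
    show "Cmp (cat y) (Cmp (glue W D P) (jj_map W D P A Q' Q'') (jj_map W D P A Q Q') y) (unit_at P
        A Q y) =
        Cmp (cat y) (jj_map W D P A Q Q'' y) (unit_at P A Q y)"
      using C.cmp_assoc[OF oc[OF A] oc[OF o(1)] oc[OF o(2)] oc[OF o(3)] unit_component[OF P Q A y]
          glue_hom_component[OF m(1) yP] glue_hom_component[OF m'(1) yP]] m(2)[OF y] m'(2)[OF yQ']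
              m''(2)[OF y] yP by simp
  qed
qed

definition counit :: "'w set \<Rightarrow> ('w, 'o, 'm) glue_obj \<Rightarrow> 'w set \<Rightarrow> 'w \<Rightarrow> 'm" where
  "counit P A Q = (THE f. f \<in> Hom (glue W D P) (jj W D Q P A) A \<and>
     Cmp (glue W D Q) (restrict f Q) (unit_at P A Q) = Ident (glue W D Q) (fobj (jstar W D Q) A))"

lemma counit_props:
  assumes P: "P \<subseteq> carrier W" and Q: "in_cosets P Q" and A: "A \<in> Obj (glue W D P)"
  shows "counit P A Q \<in> Hom (glue W D P) (jj W D Q P A) A"
    "y \<in> Q \<Longrightarrow> Cmp (cat y) (counit P A Q y) (unit_at P A Q y) = Ident (cat y) (fst A y)"
proof -
  have QP: "Q \<subseteq> P" using Q unfolding in_cosets_def by auto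
  interpret G: preadditive_category "glue W D Q" by (rule glue_preadditive) (use P QP in blast)
  have h: "counit P A Q \<in> Hom (glue W D P) (jj W D Q P A) A \<and>
     Cmp (glue W D Q) (restrict (counit P A Q) Q) (unit_at P A Q) = Ident (glue W D Q) (fobj (jstar
         W D Q) A)"
    unfolding counit_def by (rule theI'[OF jj_universal[OF P Q A A G.ident_hom[OF jstar_obj[OF P QP
        A]]]])
  show "counit P A Q \<in> Hom (glue W D P) (jj W D Q P A) A" using h by blast
  show "y \<in> Q \<Longrightarrow> Cmp (cat y) (counit P A Q y) (unit_at P A Q y) = Ident (cat y) (fst A y)"
    using arg_cong[OF conjunct2[OF h], of "\<lambda>f. f y"] by (simp add: jstar_component)
qed

lemma counit_jj_map:
  assumes P: "P \<subseteq> carrier W" and Q: "in_cosets P Q" and Q': "in_cosets P Q'"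
    and sub: "Q \<subseteq> Q'" and A: "A \<in> Obj (glue W D P)"
  shows "Cmp (glue W D P) (counit P A Q') (jj_map W D P A Q Q') = counit P A Q"
proof -
  interpret G: preadditive_category "glue W D P" by (rule glue_preadditive[OF P])
  note o = jj_obj[OF P Q A] jj_obj[OF P Q' A]
  note m = jj_map_props[OF P Q Q' sub A] and e = counit_props[OF P Q A] and e' = counit_props[OF P Q' A]
  have QP: "Q \<subseteq> P" using Q unfolding in_cosets_def by blast
  show ?thesis
  proof (rule jj_hom_eqI[OF P Q A A G.cmp_hom[OF o A m(1) e'(1)] e(1)])
    fix y assume y: "y \<in> Q"
    hence yP: "y \<in> P" and yc: "y \<in> carrier W" and yQ': "y \<in> Q'" using QP P sub by auto
    interpret C: preadditive_category "cat y" by (rule preadd) fact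
    note oc = glue_obj_component[OF _ yP]
    show "Cmp (cat y) (Cmp (glue W D P) (counit P A Q') (jj_map W D P A Q Q') y) (unit_at P A Q y) =
        Cmp (cat y) (counit P A Q y) (unit_at P A Q y)"
      using C.cmp_assoc[OF oc[OF A] oc[OF o(1)] oc[OF o(2)] oc[OF A] unit_component[OF P Q A y]
          glue_hom_component[OF m(1) yP] glue_hom_component[OF e'(1) yP]] m(2)[OF y] e(2)[OF y]
              e'(2)[OF yQ'] yP by simp
  qed
qed

text \<open>A morphism out of an extension is computed at \<open>w\<close> from its value at the nearest element of the coset.\<close>

lemma jj_hom_component:
  assumes P: "P \<subseteq> carrier W" and Q: "in_cosets P Q" and A: "A \<in> Obj (glue W D P)"
    and X: "X \<in> Obj (glue W D P)" and f: "f \<in> Hom (glue W D P) (jj W D Q P A) X" and w: "w \<in> P"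
    and p: "p = nearest Q w" and n: "n = w \<otimes> inv p"
  shows "Cmp (cat w) (f w) (Cmp (cat w) (snd (jj W D Q P A) (n, p)) (PhiM n p (unit_at P A Q p)))
    = Cmp (cat w) (snd X (n, p)) (PhiM n p (Cmp (cat p) (f p) (unit_at P A Q p)))"
proof -
  obtain K where K: "coset_of K Q" "Q \<subseteq> P" using Q unfolding in_cosets_def by blast
  have pQ: "p \<in> Q" unfolding p by (rule nearest_mem[OF K(1)])
  have pP: "p \<in> P" and c: "p \<in> carrier W" "w \<in> carrier W" using pQ K P w by auto
  have nc: "n \<in> carrier W" "n \<otimes> p = w" unfolding n using c by (auto simp: m_assoc)
  interpret C: preadditive_category "cat w" by (rule preadd) fact
  interpret Cp: preadditive_category "cat p" by (rule preadd) fact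
  let ?Y = "jj W D Q P A"
  note Y = jj_obj[OF P Q A]
  note oA = glue_obj_component[OF A pP] and oY = glue_obj_component[OF Y] and oX =
      glue_obj_component[OF X]
  note Pn = Phi_obj[OF nc(1) c(1) nc(2)] and Hn = Phi_hom[OF nc(1) c(1) nc(2)]
  note u = unit_component[OF P Q A pQ] and fw = glue_hom_component[OF f]
  note mY = glue_obj_map[OF Y nc(1) pP nc(2) w] and mX = glue_obj_map[OF X nc(1) pP nc(2) w]
  have "Cmp (cat w) (f w) (Cmp (cat w) (snd ?Y (n, p)) (PhiM n p (unit_at P A Q p)))
      = Cmp (cat w) (Cmp (cat w) (f w) (snd ?Y (n, p))) (PhiM n p (unit_at P A Q p))"
    by (rule C.cmp_assoc[OF Pn[OF oA] Pn[OF oY[OF pP]] oY[OF w] oX[OF w] Hn[OF oA oY[OF pP] u] mY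
        fw[OF w], symmetric])
  also have "\<dots> = Cmp (cat w) (Cmp (cat w) (snd X (n, p)) (PhiM n p (f p))) (PhiM n p (unit_at P A Q p))"
    using glue_hom_natural[OF f nc(1) pP nc(2) w] by simp
  also have "\<dots> = Cmp (cat w) (snd X (n, p)) (Cmp (cat w) (PhiM n p (f p)) (PhiM n p (unit_at P A Q p)))"
    by (rule C.cmp_assoc[OF Pn[OF oA] Pn[OF oY[OF pP]] Pn[OF oX[OF pP]] oX[OF w] Hn[OF oA oY[OF pP]
        u] Hn[OF oY[OF pP] oX[OF pP] fw[OF pP]] mX])
  also have "Cmp (cat w) (PhiM n p (f p)) (PhiM n p (unit_at P A Q p)) = PhiM n p (Cmp (cat p) (f p)
      (unit_at P A Q p))"
    by (rule Phi_cmp[OF nc(1) c(1) nc(2) oA oY[OF pP] oX[OF pP] u fw[OF pP], symmetric])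
  finally show ?thesis .
qed

text \<open>Both \<open>w\<close>-components are identified with \<open>\<Phi>\<^sub>n A\<^sub>p\<close> for the common nearest element \<open>p\<close>, and the
  canonical morphism respects these identifications.\<close>

lemma jj_map_iso:
  assumes P: "P \<subseteq> carrier W" and Q: "in_cosets P Q" and Q': "in_cosets P Q'" and sub: "Q \<subseteq> Q'" and
      A: "A \<in> Obj (glue W D P)"
    and w: "w \<in> P" and near: "nearest Q w = nearest Q' w"
  shows "is_iso (cat w) (fst (jj W D Q P A) w) (fst (jj W D Q' P A) w) (jj_map W D P A Q Q' w)"
proof -
  obtain K where K: "coset_of K Q" "Q \<subseteq> P" using Q unfolding in_cosets_def by blast
  let ?p = "nearest Q w"
  have pQ: "?p \<in> Q" by (rule nearest_mem[OF K(1)])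
  have pP: "?p \<in> P" and c: "?p \<in> carrier W" "w \<in> carrier W" using pQ K P w by auto
  interpret C: preadditive_category "cat w" by (rule preadd) fact
  note m = jj_map_props[OF P Q Q' sub A]
  note i = jj_iso[OF P Q A w] and i' = jj_iso[OF P Q' A w, folded near]
  have n: "w \<otimes> inv ?p \<in> carrier W" "w \<otimes> inv ?p \<otimes> ?p = w" using c by (auto simp: m_assoc)
  show ?thesis
  proof (rule C.is_iso_factor[OF Phi_obj[OF n(1) c(1) n(2) glue_obj_component[OF A pP]]
        glue_obj_component[OF jj_obj[OF P Q A] w] glue_obj_component[OF jj_obj[OF P Q' A] w] i i'
            glue_hom_component[OF m(1) w]])
    show "Cmp (cat w) (jj_map W D P A Q Q' w) (Cmp (cat w) (snd (jj W D Q P A) (w \<otimes> inv ?p, ?p))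
        (PhiM (w \<otimes> inv ?p) ?p (unit_at P A Q ?p)))
        = Cmp (cat w) (snd (jj W D Q' P A) (w \<otimes> inv ?p, ?p)) (PhiM (w \<otimes> inv ?p) ?p (unit_at P A Q' ?p))"
      using jj_hom_component[OF P Q A jj_obj[OF P Q' A] m(1) w HOL.refl HOL.refl] m(2)[OF pQ] by simp
  qed
qed

lemma counit_iso:
  assumes P: "P \<subseteq> carrier W" and Q: "in_cosets P Q" and A: "A \<in> Obj (glue W D P)" and w: "w \<in> Q"
  shows "is_iso (cat w) (fst (jj W D Q P A) w) (fst A w) (counit P A Q w)"
proof -
  obtain K where K: "coset_of K Q" "Q \<subseteq> P" using Q unfolding in_cosets_def by blast
  have wP: "w \<in> P" and wc: "w \<in> carrier W" using w K P by auto
  interpret C: preadditive_category "cat w" by (rule preadd) fact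
  have p: "nearest Q w = w" "w \<otimes> inv w = \<one>" using nearest_self[OF K(1) w] wc by auto
  note e = counit_props[OF P Q A] and oA = glue_obj_component[OF A wP]
  have Ae: "Phi \<one> w (fst A w) = fst A w" by (rule Phi_one_obj[OF wc oA])
  note i = jj_iso[OF P Q A wP, unfolded p, unfolded p Ae]
  show ?thesis
  proof (rule C.is_iso_factor[OF oA glue_obj_component[OF jj_obj[OF P Q A] wP] oA i
      C.is_iso_ident[OF oA] glue_hom_component[OF e(1) wP]])
    show "Cmp (cat w) (counit P A Q w) (Cmp (cat w) (snd (jj W D Q P A) (\<one>, w)) (PhiM \<one> w (unit_at P
        A Q w))) = Ident (cat w) (fst A w)"
      using jj_hom_component[OF P Q A A e(1) wP p(1)[symmetric] p(2)[symmetric]] e(2)[OF w]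
          glue_obj_one[OF A wP]
        Phi_one_map[OF wc oA oA C.ident_hom[OF oA]] C.cmp_ident_left[OF oA oA C.ident_hom[OF oA]] by
            simp
  qed
qed

section \<open>Componentwise split sequences\<close>

lemma glue_split_epi:
  assumes P: "P \<subseteq> carrier W" and o: "X \<in> Obj (glue W D P)" "K \<in> Obj (glue W D P)" "Y \<in> Obj (glue W D P)"
    and f: "f \<in> Hom (glue W D P) X K"
    and split: "\<And>w. w \<in> P \<Longrightarrow> \<exists>g. g \<in> Hom (cat w) (fst K w) (fst X w) \<and> Cmp (cat w) (f w) g = Ident
        (cat w) (fst K w)"
    and x: "x \<in> Hom (glue W D P) K Y" and y: "y \<in> Hom (glue W D P) K Y" and e: "Cmp (glue W D P) x f
        = Cmp (glue W D P) y f"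
  shows "x = y"
proof (rule glue_hom_eqI[OF x y])
  fix w assume w: "w \<in> P"
  interpret C: preadditive_category "cat w" by (rule preadd) (use P w in blast)
  obtain g where g: "g \<in> Hom (cat w) (fst K w) (fst X w)" "Cmp (cat w) (f w) g = Ident (cat w) (fst
      K w)" using split[OF w] by blast
  note oc = glue_obj_component[OF _ w] and hc = glue_hom_component[OF _ w]
  have "z w = Cmp (cat w) (Cmp (cat w) (z w) (f w)) g" if z: "z \<in> Hom (glue W D P) K Y" for z
    using C.cmp_assoc[OF oc[OF o(2)] oc[OF o(1)] oc[OF o(2)] oc[OF o(3)] g(1) hc[OF f] hc[OF z]] g(2)
      C.cmp_ident_right[OF oc[OF o(2)] oc[OF o(3)] hc[OF z]] by simp
  moreover have "Cmp (cat w) (x w) (f w) = Cmp (cat w) (y w) (f w)" using arg_cong[OF e, of "\<lambda>h. h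
      w"] w by simp
  ultimately show "x w = y w" using x y by metis
qed

text \<open>If \<open>x d = 0\<close> then at each component \<open>x = (x \<sigma>) e\<close> for a section \<open>\<sigma>\<close> of \<open>e\<close>, since
  \<open>e (1 - \<sigma> e) = 0\<close> and hence \<open>1 - \<sigma> e\<close> factors through \<open>d\<close>. The sections need not be compatible with the
  structure maps, but the factorization is: \<open>\<Phi>\<^sub>u e\<close> is again a split epimorphism and can be cancelled.\<close>

lemma glue_split_cokernel:
  assumes P: "P \<subseteq> carrier W" and o: "X \<in> Obj (glue W D P)" "Y \<in> Obj (glue W D P)" "A \<in> Obj (glue W D P)"
    and d: "d \<in> Hom (glue W D P) X Y" and e: "e \<in> Hom (glue W D P) Y A" and ed: "Cmp (glue W D P) e
        d = Zero_hom (glue W D P) X A"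
    and split: "\<And>w. w \<in> P \<Longrightarrow> \<exists>g. g \<in> Hom (cat w) (fst A w) (fst Y w) \<and> Cmp (cat w) (e w) g = Ident
        (cat w) (fst A w)"
    and exact: "\<And>w Z f. w \<in> P \<Longrightarrow> Z \<in> Obj (cat w) \<Longrightarrow> f \<in> Hom (cat w) Z (fst Y w) \<Longrightarrow>
      Cmp (cat w) (e w) f = Zero_hom (cat w) Z (fst A w) \<Longrightarrow> \<exists>g. g \<in> Hom (cat w) Z (fst X w) \<and> Cmp
          (cat w) (d w) g = f"
  shows "is_cokernel (glue W D P) X Y d A e"
proof -
  let ?G = "glue W D P"
  interpret G: preadditive_category ?G by (rule glue_preadditive[OF P])
  note oX = glue_obj_component[OF o(1)] and oY = glue_obj_component[OF o(2)] and oA =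
      glue_obj_component[OF o(3)]
  note ec = glue_hom_component[OF e] and dc = glue_hom_component[OF d]
  obtain \<sigma> where \<sigma>: "\<And>w. w \<in> P \<Longrightarrow> \<sigma> w \<in> Hom (cat w) (fst A w) (fst Y w)"
    "\<And>w. w \<in> P \<Longrightarrow> Cmp (cat w) (e w) (\<sigma> w) = Ident (cat w) (fst A w)" using split by metis
  have "\<exists>!h. h \<in> Hom ?G A T \<and> Cmp ?G h e = x"
    if T: "T \<in> Obj ?G" and x: "x \<in> Hom ?G Y T" and xd: "Cmp ?G x d = Zero_hom ?G X T" for T x
  proof -
    note oT = glue_obj_component[OF T] and xc = glue_hom_component[OF x]
    let ?h = "\<lambda>w\<in>P. Cmp (cat w) (x w) (\<sigma> w)"
    have hc: "?h w \<in> Hom (cat w) (fst A w) (fst T w)" if w: "w \<in> P" for w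
      using preadditive_category.cmp_hom[OF preadd[OF subsetD[OF P w]] oA[OF w] oY[OF w] oT[OF w]
          \<sigma>(1)[OF w] xc[OF w]] w by simp
    have he: "Cmp (cat w) (?h w) (e w) = x w" if w: "w \<in> P" for w
    proof -
      interpret C: preadditive_category "cat w" by (rule preadd) (use P w in blast)
      let ?se = "Cmp (cat w) (\<sigma> w) (e w)" and ?I = "Ident (cat w) (fst Y w)"
      have se: "?se \<in> Hom (cat w) (fst Y w) (fst Y w)" by (rule C.cmp_hom[OF oY[OF w] oA[OF w] oY[OF
          w] ec[OF w] \<sigma>(1)[OF w]])
      have I: "?I \<in> Hom (cat w) (fst Y w) (fst Y w)" by (rule C.ident_hom[OF oY[OF w]])
      let ?f = "Plus_hom (cat w) ?I (hom_neg (cat w) (fst Y w) (fst Y w) ?se)"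
      have f: "?f \<in> Hom (cat w) (fst Y w) (fst Y w)"
        by (rule C.plus_closed[OF oY[OF w] oY[OF w] I C.neg_closed[OF oY[OF w] oY[OF w] se]])
      have "Cmp (cat w) (e w) ?se = Cmp (cat w) (Cmp (cat w) (e w) (\<sigma> w)) (e w)"
        by (rule C.cmp_assoc[OF oY[OF w] oA[OF w] oY[OF w] oA[OF w] ec[OF w] \<sigma>(1)[OF w] ec[OF w],
            symmetric])
      hence ese: "Cmp (cat w) (e w) ?se = e w" using \<sigma>(2)[OF w] C.cmp_ident_left[OF oY[OF w] oA[OF
          w] ec[OF w]] by simp
      have "Cmp (cat w) (e w) ?f = Zero_hom (cat w) (fst Y w) (fst A w)"
        using C.minus_cmp_right[OF oY[OF w] oY[OF w] oA[OF w] I se ec[OF w]] ese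
          C.cmp_ident_right[OF oY[OF w] oA[OF w] ec[OF w]] C.plus_neg(1)[OF oY[OF w] oA[OF w] ec[OF
              w]] by simp
      then obtain g where g: "g \<in> Hom (cat w) (fst Y w) (fst X w)" "Cmp (cat w) (d w) g = ?f"
        using exact[OF w oY[OF w] f] by blast
      have "Cmp (cat w) (x w) ?f = Cmp (cat w) (Cmp (cat w) (x w) (d w)) g"
        using C.cmp_assoc[OF oY[OF w] oX[OF w] oY[OF w] oT[OF w] g(1) dc[OF w] xc[OF w]] g(2) by simp
      also have "Cmp (cat w) (x w) (d w) = Zero_hom (cat w) (fst X w) (fst T w)"
        using arg_cong[OF xd, of "\<lambda>h. h w"] w by simp
      also have "Cmp (cat w) \<dots> g = Zero_hom (cat w) (fst Y w) (fst T w)" by (rule C.cmp_zero_left[OF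
          oY[OF w] oX[OF w] oT[OF w] g(1)])
      finally have z: "Cmp (cat w) (x w) ?f = Zero_hom (cat w) (fst Y w) (fst T w)" .
      have xse: "Cmp (cat w) (x w) ?se \<in> Hom (cat w) (fst Y w) (fst T w)" by (rule C.cmp_hom[OF
          oY[OF w] oY[OF w] oT[OF w] se xc[OF w]])
      have "x w = Cmp (cat w) (x w) ?se"
        by (rule C.minus_eq_zero[OF oY[OF w] oT[OF w] xc[OF w] xse])
          (use z C.minus_cmp_right[OF oY[OF w] oY[OF w] oT[OF w] I se xc[OF w]] C.cmp_ident_right[OF
              oY[OF w] oT[OF w] xc[OF w]] in simp)
      thus ?thesis using C.cmp_assoc[OF oY[OF w] oA[OF w] oY[OF w] oT[OF w] ec[OF w] \<sigma>(1)[OF w]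
          xc[OF w]] w by simp
    qed
    have h: "?h \<in> Hom ?G A T"
    proof (rule glue_homI)
      fix u w v assume a: "u \<in> carrier W" "w \<in> P" "u \<otimes> w = v" "v \<in> P"
      have c: "w \<in> carrier W" "v \<in> carrier W" using a P by auto
      interpret V: preadditive_category "cat v" by (rule preadd) fact
      note Pu = Phi_obj[OF a(1) c(1) a(3)] and Hu = Phi_hom[OF a(1) c(1) a(3)]
      note oY = oY[OF a(2)] oY[OF a(4)] and oA = oA[OF a(2)] oA[OF a(4)] and oT = oT[OF a(2)] oT[OF
          a(4)]
      note mY = glue_obj_map[OF o(2) a] and mA = glue_obj_map[OF o(3) a] and mT = glue_obj_map[OF T a]
      note he' = Hu[OF oY(1) oA(1) ec[OF a(2)]] and hs' = Hu[OF oA(1) oY(1) \<sigma>(1)[OF a(2)]] and hh' =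
          Hu[OF oA(1) oT(1) hc[OF a(2)]]
      let ?L = "Cmp (cat v) (?h v) (snd A (u, w))" and ?R = "Cmp (cat v) (snd T (u, w)) (PhiM u w
          (?h w))"
      have L: "?L \<in> Hom (cat v) (Phi u w (fst A w)) (fst T v)" by (rule V.cmp_hom[OF Pu[OF oA(1)]
          oA(2) oT(2) mA hc[OF a(4)]])
      have R: "?R \<in> Hom (cat v) (Phi u w (fst A w)) (fst T v)" by (rule V.cmp_hom[OF Pu[OF oA(1)]
          Pu[OF oT(1)] oT(2) hh' mT])
      have "Cmp (cat v) ?L (PhiM u w (e w)) = Cmp (cat v) (?h v) (Cmp (cat v) (snd A (u, w)) (PhiM u
          w (e w)))"
        by (rule V.cmp_assoc[OF Pu[OF oY(1)] Pu[OF oA(1)] oA(2) oT(2) he' mA hc[OF a(4)]])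
      also have "Cmp (cat v) (snd A (u, w)) (PhiM u w (e w)) = Cmp (cat v) (e v) (snd Y (u, w))"
        by (rule glue_hom_natural[OF e a, symmetric])
      also have "Cmp (cat v) (?h v) \<dots> = Cmp (cat v) (Cmp (cat v) (?h v) (e v)) (snd Y (u, w))"
        by (rule V.cmp_assoc[OF Pu[OF oY(1)] oY(2) oA(2) oT(2) mY ec[OF a(4)] hc[OF a(4)], symmetric])
      also have "\<dots> = Cmp (cat v) (snd T (u, w)) (PhiM u w (x w))" using he[OF a(4)]
          glue_hom_natural[OF x a] by simp
      also have "PhiM u w (x w) = Cmp (cat v) (PhiM u w (?h w)) (PhiM u w (e w))"
        using Phi_cmp[OF a(1) c(1) a(3) oY(1) oA(1) oT(1) ec[OF a(2)] hc[OF a(2)]] he[OF a(2)] by simp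
      also have "Cmp (cat v) (snd T (u, w)) \<dots> = Cmp (cat v) ?R (PhiM u w (e w))"
        by (rule V.cmp_assoc[OF Pu[OF oY(1)] Pu[OF oA(1)] Pu[OF oT(1)] oT(2) he' hh' mT, symmetric])
      finally have LR: "Cmp (cat v) ?L (PhiM u w (e w)) = Cmp (cat v) ?R (PhiM u w (e w))" .
      have es: "Cmp (cat v) (PhiM u w (e w)) (PhiM u w (\<sigma> w)) = Ident (cat v) (Phi u w (fst A w))"
        using Phi_cmp[OF a(1) c(1) a(3) oA(1) oY(1) oA(1) \<sigma>(1)[OF a(2)] ec[OF a(2)]] \<sigma>(2)[OF a(2)]
            Phi_ident[OF a(1) c(1) a(3) oA(1)] by simp
      have "M = Cmp (cat v) (Cmp (cat v) M (PhiM u w (e w))) (PhiM u w (\<sigma> w))" if M: "M \<in> Hom (cat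
          v) (Phi u w (fst A w)) (fst T v)" for M
        using V.cmp_assoc[OF Pu[OF oA(1)] Pu[OF oY(1)] Pu[OF oA(1)] oT(2) hs' he' M] es
            V.cmp_ident_right[OF Pu[OF oA(1)] oT(2) M] by simp
      from this[OF L] this[OF R] show "?L = ?R" using LR by metis
    qed (use hc in simp_all)
    show ?thesis
    proof (rule ex1I[of _ ?h])
      show "?h \<in> Hom ?G A T \<and> Cmp ?G ?h e = x"
        using h he by (intro conjI glue_hom_eqI[OF G.cmp_hom[OF o(2,3) T e h] x]) simp_all
      fix h' assume h': "h' \<in> Hom ?G A T \<and> Cmp ?G h' e = x"
      have "Cmp ?G ?h e = x" using h he by (intro glue_hom_eqI[OF G.cmp_hom[OF o(2,3) T e h] x])
          simp_all
      thus "h' = ?h" using glue_split_epi[OF P o(2,3) T e split, of h' ?h] h h' by simp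
    qed
  qed
  thus ?thesis unfolding is_cokernel_def using o e ed by blast
qed

end

section \<open>Signs and faces\<close>

context preadditive_category
begin

lemma signed_closed:
  assumes "a \<in> Obj C" "b \<in> Obj C" "f \<in> Hom C a b" shows "signed_hom C a b k f \<in> Hom C a b"
  using assms neg_closed by (simp add: signed_hom_def)

lemma cmp_signed_right:
  assumes "a \<in> Obj C" "b \<in> Obj C" "c \<in> Obj C" "f \<in> Hom C a b" "g \<in> Hom C b c"
  shows "Cmp C g (signed_hom C a b k f) = signed_hom C a c k (Cmp C g f)"
  using assms cmp_neg_right by (simp add: signed_hom_def)

lemma cmp_signed_left:
  assumes "a \<in> Obj C" "b \<in> Obj C" "c \<in> Obj C" "f \<in> Hom C a b" "g \<in> Hom C b c"
  shows "Cmp C (signed_hom C b c k g) f = signed_hom C a c k (Cmp C g f)"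
  using assms cmp_neg_left by (simp add: signed_hom_def)

lemma signed_signed:
  assumes "a \<in> Obj C" "b \<in> Obj C" "f \<in> Hom C a b"
  shows "signed_hom C a b k (signed_hom C a b l f) = signed_hom C a b (k + l) f"
  using assms neg_neg by (simp add: signed_hom_def)

lemma signed_cancel:
  assumes "a \<in> Obj C" "b \<in> Obj C" "f \<in> Hom C a b" "odd (k + l)"
  shows "Plus_hom C (signed_hom C a b k f) (signed_hom C a b l f) = Zero_hom C a b"
  using assms plus_neg by (auto simp: signed_hom_def)

lemma signed_zero:
  assumes "a \<in> Obj C" "b \<in> Obj C" shows "signed_hom C a b k (Zero_hom C a b) = Zero_hom C a b"
proof -
  have "hom_neg C a b (Zero_hom C a b) = Zero_hom C a b"
    using plus_eq_zero_neg[of a b "Zero_hom C a b" "Zero_hom C a b"] plus_zero[of a b "Zero_hom C a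
        b"] assms by simp
  thus ?thesis by (simp add: signed_hom_def)
qed

lemma signed_iso:
  assumes "a \<in> Obj C" "b \<in> Obj C" "is_iso C a b f" shows "is_iso C a b (signed_hom C a b k f)"
  using assms is_iso_neg by (simp add: signed_hom_def)

end

text \<open>Removing the smaller of two vertices lowers the position of the larger one by one; removing the larger does
  not affect the smaller.\<close>

lemma face_sign_parity:
  fixes j k :: nat
  assumes J: "finite J" "j \<in> J" "k \<in> J" "j \<noteq> k"
  shows "odd ((card {i \<in> J. i < j} + card {i \<in> J - {j}. i < k}) + (card {i \<in> J. i < k} + card {i \<in> J
      - {k}. i < j}))"
proof -
  have *: "odd ((card {i \<in> J. i < j} + card {i \<in> J - {j}. i < k}) + (card {i \<in> J. i < k} + card {i \<in>
      J - {k}. i < j}))"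
    if "j \<in> J" "k \<in> J" "j < k" for j k :: nat
  proof -
    have 1: "{i \<in> J - {k}. i < j} = {i \<in> J. i < j}" using that by auto
    have 2: "{i \<in> J. i < k} = insert j {i \<in> J - {j}. i < k}" using that by auto
    have "card {i \<in> J. i < k} = card {i \<in> J - {j}. i < k} + 1" unfolding 2 using J(1) by (subst
        card_insert_disjoint) auto
    thus ?thesis unfolding 1 by auto
  qed
  show ?thesis using *[of j k] *[of k j] J by (cases "j < k") (auto simp: add.commute)
qed

lemma faces_diff:
  assumes "J \<in> faces V m" "j \<in> J" "J - {j} \<noteq> {}" "finite V" shows "J - {j} \<in> faces V (m - 1)"
proof -
  have "finite J" using assms finite_subset unfolding faces_def by blast
  hence "card (J - {j}) = card J - 1" "card J > 0" using assms(2) by (auto simp: card_gt_0_iff)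
  thus ?thesis using assms unfolding faces_def by auto
qed

lemma finite_faces: "finite V \<Longrightarrow> finite (faces V m)"
  unfolding faces_def by (rule finite_subset[of _ "Pow V"]) auto

section \<open>The complex of cosets\<close>

locale coset_chain = coxeter_gluing W "s ` {1..n}" D
  for W :: "('w, 'z) monoid_scheme" (structure) and s :: "nat \<Rightarrow> 'w" and n :: nat and D :: "('w, 'o,
      'm) gluing" +
  fixes i :: nat and P :: "'w set" and A :: "('w, 'o, 'm) glue_obj"
  assumes s_inj: "inj_on s {1..n}" and finite_W: "finite (carrier W)" and i: "i \<in> {1..n}"
    and P_def: "P = ascent_set W (s ` {1..n}) (s i)" and A: "A \<in> Obj (glue W D P)"
begin

abbreviation V where "V \<equiv> {1..n}"
abbreviation gens where "gens J \<equiv> s ` ({1..n} - J)"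
abbreviation par where "par \<equiv> parab W s n"
abbreviation G where "G \<equiv> glue W D P"
abbreviation X where "X c \<equiv> jj W D c P A"
abbreviation CI where "CI \<equiv> coset_index W s n P"
abbreviation r where "r \<equiv> jj_map W D P A"

lemma P_sub: "P \<subseteq> carrier W" unfolding P_def ascent_set_def by blast

lemma P_iff: "w \<in> P \<longleftrightarrow> w \<in> carrier W \<and> \<not> is_inversion w (s i)"
  unfolding P_def ascent_set_def using inversion_iff_len(2)[of w "s i"] i by auto

lemma G_preadditive: "preadditive_category G" by (rule glue_preadditive[OF P_sub])

sublocale G: preadditive_category "glue W D P" by (rule G_preadditive)

lemma gens_sub: "gens J \<subseteq> s ` {1..n}" by blast

lemma par_generate: "par J = generate W (gens J)" unfolding parab_def ..

lemma par_mono: "J \<subseteq> J' \<Longrightarrow> par J' \<subseteq> par J"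
  unfolding parab_def by (rule mono_generate) blast

lemma par_coset: "x \<in> carrier W \<Longrightarrow> coset_of (gens J) (par J #> x)"
  unfolding coset_of_def par_generate by blast

lemma par_self: "x \<in> carrier W \<Longrightarrow> x \<in> par J #> x"
  unfolding par_generate r_coset_def using generate.one[of W "gens J"] l_one by force

text \<open>Any element of a coset may serve as its representative, also in the condition on the maximal cosets.\<close>

lemma CI_D:
  assumes "c \<in> CI J" "y \<in> c"
  shows "y \<in> carrier W" "c = par J #> y" "\<And>j. j \<in> J \<Longrightarrow> par {j} #> y \<subseteq> P"
proof -
  obtain x where x: "x \<in> carrier W" "c = par J #> x" "\<And>j. j \<in> J \<Longrightarrow> par {j} #> x \<subseteq> P"
    using assms(1) unfolding coset_index_def by blast
  note co = par_coset[OF x(1), of J]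
  show "y \<in> carrier W" using coset_mem_carrier[OF co] assms(2) x(2) by blast
  show "c = par J #> y" using coset_eq[OF co, of y] assms(2) unfolding x(2) par_generate by blast
  fix j assume j: "j \<in> J"
  have "y \<in> par {j} #> x" using assms(2) par_mono[of "{j}" J] j unfolding x(2) r_coset_def by blast
  hence "par {j} #> x = par {j} #> y" using coset_eq[OF par_coset[OF x(1), of "{j}"]] unfolding
      par_generate by blast
  thus "par {j} #> y \<subseteq> P" using x(3)[OF j] by simp
qed

lemma CI_I: "y \<in> carrier W \<Longrightarrow> (\<And>j. j \<in> J \<Longrightarrow> par {j} #> y \<subseteq> P) \<Longrightarrow> par J #> y \<in> CI J"
  unfolding coset_index_def by blast

lemma CI_coset: assumes "c \<in> CI J" shows "coset_of (gens J) c"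
  using assms par_coset unfolding coset_index_def by blast

lemma CI_nonempty: "c \<in> CI J \<Longrightarrow> \<exists>y. y \<in> c"
  using coset_nonempty[OF CI_coset] by blast

lemma par_coset_mono: "J \<subseteq> J' \<Longrightarrow> par J' #> y \<subseteq> par J #> y"
  using par_mono unfolding r_coset_def by blast

lemma CI_in_cosets:
  assumes "c \<in> CI J" "J \<noteq> {}" shows "in_cosets P c"
proof -
  obtain y j where y: "y \<in> c" and j: "j \<in> J" using CI_nonempty assms by blast
  note d = CI_D[OF assms(1) y]
  have "c \<subseteq> P" using par_coset_mono[of "{j}" J y] j d(3)[OF j] unfolding d(2)[symmetric] by blast
  thus ?thesis unfolding in_cosets_def using CI_coset[OF assms(1)] by blast
qed

lemma face_coset:
  assumes "J \<subseteq> J'" "c \<in> CI J'" "y \<in> c" shows "par J <#> c = par J #> y"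
proof
  note d = CI_D[OF assms(2,3)]
  have sg: "subgroup (par J) W" unfolding par_generate by (rule parabolic_subgroup[OF gens_sub])
  show "par J <#> c \<subseteq> par J #> y"
  proof
    fix x assume "x \<in> par J <#> c"
    then obtain h k where h: "h \<in> par J" "k \<in> c" "x = h \<otimes> k" unfolding set_mult_def by blast
    obtain z where z: "z \<in> par J'" "k = z \<otimes> y" using h(2) unfolding d(2) r_coset_def by blast
    have z': "z \<in> par J" using z par_mono[OF assms(1)] by blast
    have "x = (h \<otimes> z) \<otimes> y" using h z z' d(1) subgroup.mem_carrier[OF sg] by (simp add: m_assoc)
    moreover have "h \<otimes> z \<in> par J" using h z' subgroup.m_closed[OF sg] by blast
    ultimately show "x \<in> par J #> y" unfolding r_coset_def by blast
  qed
  show "par J #> y \<subseteq> par J <#> c" using assms(3) unfolding r_coset_def set_mult_def by blast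
qed

lemma face_CI:
  assumes "J \<subseteq> J'" "c \<in> CI J'" shows "par J <#> c \<in> CI J"
proof -
  obtain y where y: "y \<in> c" using CI_nonempty assms by blast
  show ?thesis unfolding face_coset[OF assms y] using CI_D[OF assms(2) y] assms(1) by (intro CI_I) auto
qed

lemma face_sub:
  assumes "J \<subseteq> J'" "c \<in> CI J'" shows "c \<subseteq> par J <#> c"
proof
  fix y assume y: "y \<in> c"
  show "y \<in> par J <#> c" unfolding face_coset[OF assms y] using par_self CI_D(1)[OF assms(2) y] .
qed

lemma face_face:
  assumes "J \<subseteq> J'" "J' \<subseteq> J''" "c \<in> CI J''" shows "par J <#> (par J' <#> c) = par J <#> c"
proof -
  obtain y where y: "y \<in> c" using CI_nonempty assms by blast
  have "y \<in> par J' <#> c" using face_sub[OF assms(2,3)] y by blast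
  thus ?thesis using face_coset[OF assms(1) face_CI[OF assms(2,3)]] face_coset[OF subset_trans[OF
      assms(1,2)] assms(3) y] by simp
qed

lemma finite_CI: "finite (CI J)"
  by (rule finite_subset[of _ "Pow (carrier W)"]) (use finite_W CI_coset coset_subset in blast)+

lemma X_obj: "c \<in> CI J \<Longrightarrow> J \<noteq> {} \<Longrightarrow> X c \<in> Obj G"
  using jj_obj[OF P_sub CI_in_cosets A] by blast

lemma r_hom: "c \<in> CI J' \<Longrightarrow> J \<subseteq> J' \<Longrightarrow> J \<noteq> {} \<Longrightarrow> r c (par J <#> c) \<in> Hom G (X c) (X (par J <#> c))"
  using jj_map_props(1)[OF P_sub CI_in_cosets CI_in_cosets[OF face_CI] face_sub A] by blast

lemma glue_dsum:
  assumes "finite I" "\<And>k. k \<in> I \<Longrightarrow> Y k \<in> Obj G"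
  shows "is_coproduct G I Y (dsum_obj G I Y) (dsum_inj G I Y)"
proof -
  obtain U \<iota> \<pi> where "is_biproduct G I Y U \<iota> \<pi>" using glue_biproduct[OF P_sub assms(1), of Y]
      assms(2) by blast
  hence "is_coproduct G I Y U \<iota>" by (rule G.biproduct_coproduct)
  thus ?thesis by (intro G.dsum_coproduct) blast
qed

abbreviation F where "F \<equiv> coeff_obj W s n D P A"
abbreviation Ch where "Ch \<equiv> simplex_obj G V F"
abbreviation df where "df \<equiv> simplex_diff G V F (coeff_map W s n D P A)"

text \<open>The degree \<open>m\<close> part of the complex is the sum over \<open>J\<close> of sums over cosets, thus a single sum over
  the pairs \<open>(J, c)\<close>, the cells of degree \<open>m\<close>.\<close>

definition cells :: "int \<Rightarrow> (nat set \<times> 'w set) set" where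
  "cells m = Sigma (faces V m) CI"

definition cell_inj :: "int \<Rightarrow> nat set \<times> 'w set \<Rightarrow> 'w \<Rightarrow> 'm" where
  "cell_inj m \<sigma> = Cmp G (dsum_inj G (faces V m) F (fst \<sigma>)) (dsum_inj G (CI (fst \<sigma>)) X (snd \<sigma>))"

lemma F_coproduct: "J \<noteq> {} \<Longrightarrow> is_coproduct G (CI J) X (F J) (dsum_inj G (CI J) X)"
  unfolding coeff_obj_def by (rule glue_dsum[OF finite_CI]) (rule X_obj)

lemma F_obj: "J \<noteq> {} \<Longrightarrow> F J \<in> Obj G" using G.coproductD(1)[OF F_coproduct] .

lemma faces_nonempty: "J \<in> faces V m \<Longrightarrow> J \<noteq> {}" unfolding faces_def by blast

lemma Ch_coproduct: "is_coproduct G (faces V m) F (Ch m) (dsum_inj G (faces V m) F)"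
  unfolding simplex_obj_def by (rule glue_dsum) (auto simp: finite_faces F_obj faces_nonempty)

lemma Ch_obj: "Ch m \<in> Obj G" using G.coproductD(1)[OF Ch_coproduct] .

lemma cellD: assumes "\<sigma> \<in> cells m"
  shows "fst \<sigma> \<in> faces V m" "fst \<sigma> \<noteq> {}" "finite (fst \<sigma>)" "fst \<sigma> \<subseteq> V" "snd \<sigma> \<in> CI (fst \<sigma>)" "X (snd
      \<sigma>) \<in> Obj G"
    "in_cosets P (snd \<sigma>)"
proof -
  show f: "fst \<sigma> \<in> faces V m" and c: "snd \<sigma> \<in> CI (fst \<sigma>)" using assms unfolding cells_def by auto
  show ne: "fst \<sigma> \<noteq> {}" and s: "fst \<sigma> \<subseteq> V" using f unfolding faces_def by auto
  show "finite (fst \<sigma>)" using s finite_subset by blast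
  show "X (snd \<sigma>) \<in> Obj G" by (rule X_obj[OF c ne])
  show "in_cosets P (snd \<sigma>)" by (rule CI_in_cosets[OF c ne])
qed

lemma cells_coproduct: "is_coproduct G (cells m) (\<lambda>\<sigma>. X (snd \<sigma>)) (Ch m) (cell_inj m)"
proof -
  have "is_coproduct G (Sigma (faces V m) CI) (\<lambda>(J, c). X c) (Ch m)
      (\<lambda>(J, c). Cmp G (dsum_inj G (faces V m) F J) (dsum_inj G (CI J) X c))"
    by (rule G.coproduct_Sigma[OF Ch_coproduct F_coproduct[OF faces_nonempty] X_obj[OF _
        faces_nonempty]])
  thus ?thesis unfolding cells_def cell_inj_def[abs_def] by (simp add: split_beta')
qed

lemma finite_cells: "finite (cells m)"
  unfolding cells_def using finite_faces finite_CI by blast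

definition cell_proj :: "int \<Rightarrow> nat set \<times> 'w set \<Rightarrow> 'w \<Rightarrow> 'm" where
  "cell_proj m = (SOME \<pi>. is_biproduct G (cells m) (\<lambda>\<sigma>. X (snd \<sigma>)) (Ch m) (cell_inj m) \<pi>)"

lemma cells_biproduct: "is_biproduct G (cells m) (\<lambda>\<sigma>. X (snd \<sigma>)) (Ch m) (cell_inj m) (cell_proj m)"
  unfolding cell_proj_def
  by (rule someI_ex[OF G.coproduct_biproduct[OF cells_coproduct finite_cells cellD(6)]])

lemmas cellB = G.biproductD[OF cells_biproduct]

lemma coeff_map_props:
  assumes J: "J \<subseteq> J'" "J \<noteq> {}"
  shows "coeff_map W s n D P A J' J \<in> Hom G (F J') (F J)"
    "c \<in> CI J' \<Longrightarrow> Cmp G (coeff_map W s n D P A J' J) (dsum_inj G (CI J') X c)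
        = Cmp G (dsum_inj G (CI J) X (par J <#> c)) (r c (par J <#> c))"
proof -
  have J': "J' \<noteq> {}" using J by blast
  have h: "Cmp G (dsum_inj G (CI J) X (par J <#> c)) (r c (par J <#> c)) \<in> Hom G (X c) (F J)" if c:
      "c \<in> CI J'" for c
    by (rule G.cmp_hom[OF X_obj[OF c J'] X_obj[OF face_CI[OF J(1) c] J(2)] F_obj[OF J(2)] r_hom[OF c
        J] G.coproductD(2)[OF F_coproduct[OF J(2)] face_CI[OF J(1) c]]])
  note p = G.copair_props[OF F_coproduct[OF J', unfolded coeff_obj_def] F_obj[OF J(2)],
      of "\<lambda>c. Cmp G (dsum_inj G (CI J) X (par J <#> c)) (r c (par J <#> c))", OF h]
  show "coeff_map W s n D P A J' J \<in> Hom G (F J') (F J)"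
    using p(1) unfolding coeff_map_def coeff_obj_def[of W s n D P A J'] .
  show "c \<in> CI J' \<Longrightarrow> Cmp G (coeff_map W s n D P A J' J) (dsum_inj G (CI J') X c)
        = Cmp G (dsum_inj G (CI J) X (par J <#> c)) (r c (par J <#> c))"
    using p(2) unfolding coeff_map_def .
qed

definition face_of :: "nat set \<times> 'w set \<Rightarrow> nat \<Rightarrow> nat set \<times> 'w set" where
  "face_of \<sigma> j = (fst \<sigma> - {j}, par (fst \<sigma> - {j}) <#> snd \<sigma>)"

abbreviation proper where "proper \<sigma> \<equiv> {j \<in> fst \<sigma>. fst \<sigma> - {j} \<noteq> {}}"
abbreviation fsign where "fsign \<sigma> j \<equiv> card {k \<in> fst \<sigma>. k < j}"
abbreviation rf where "rf \<sigma> j \<equiv> r (snd \<sigma>) (snd (face_of \<sigma> j))"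

lemma face_cell: "\<sigma> \<in> cells m \<Longrightarrow> j \<in> proper \<sigma> \<Longrightarrow> face_of \<sigma> j \<in> cells (m - 1)"
  using faces_diff[of "fst \<sigma>" V m j] face_CI[of "fst \<sigma> - {j}" "fst \<sigma>" "snd \<sigma>"] cellD[of \<sigma> m]
  unfolding face_of_def cells_def by auto

lemma rf_hom: "\<sigma> \<in> cells m \<Longrightarrow> j \<in> proper \<sigma> \<Longrightarrow> rf \<sigma> j \<in> Hom G (X (snd \<sigma>)) (X (snd (face_of \<sigma> j)))"
  using r_hom[of "snd \<sigma>" "fst \<sigma>" "fst \<sigma> - {j}"] cellD[of \<sigma> m] unfolding face_of_def by auto

lemma df_hom: "df m \<in> Hom G (Ch m) (Ch (m - 1))"
  and df_cell: "\<sigma> \<in> cells m \<Longrightarrow> Cmp G (df m) (cell_inj m \<sigma>) =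
    hom_sum G (X (snd \<sigma>)) (Ch (m - 1)) (\<lambda>j. signed_hom G (X (snd \<sigma>)) (Ch (m - 1)) (fsign \<sigma> j)
      (Cmp G (cell_inj (m - 1) (face_of \<sigma> j)) (rf \<sigma> j))) (proper \<sigma>)"
proof -
  let ?t = "\<lambda>J j. Cmp G (dsum_inj G (faces V (m - 1)) F (J - {j})) (coeff_map W s n D P A J (J - {j}))"
  let ?s = "\<lambda>J j. signed_hom G (F J) (Ch (m - 1)) (card {i \<in> J. i < j}) (?t J j)"
  let ?S = "\<lambda>J. hom_sum G (F J) (Ch (m - 1)) (?s J) {j \<in> J. J - {j} \<noteq> {}}"
  have inj: "dsum_inj G (faces V k) F J \<in> Hom G (F J) (Ch k)" if "J \<in> faces V k" for J k
    using G.coproductD(2)[OF Ch_coproduct that] .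
  have t: "?t J j \<in> Hom G (F J) (Ch (m - 1))" if J: "J \<in> faces V m" "j \<in> J" "J - {j} \<noteq> {}" for J j
  proof -
    have "J - {j} \<in> faces V (m - 1)" using faces_diff[OF J] by simp
    thus ?thesis using G.cmp_hom[OF F_obj[OF faces_nonempty[OF J(1)]] F_obj[OF J(3)] Ch_obj
        coeff_map_props(1)[OF Diff_subset J(3)] inj] by blast
  qed
  have sc: "?s J j \<in> Hom G (F J) (Ch (m - 1))" if J: "J \<in> faces V m" "j \<in> J" "J - {j} \<noteq> {}" for J j
    by (rule G.signed_closed[OF F_obj[OF faces_nonempty[OF J(1)]] Ch_obj t[OF J]])
  have S: "?S J \<in> Hom G (F J) (Ch (m - 1))" if J: "J \<in> faces V m" for J
    by (rule G.hom_sum_closed[OF F_obj[OF faces_nonempty[OF J]] Ch_obj]) (use sc J in auto)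
  note p = G.copair_props[OF Ch_coproduct[of m, unfolded simplex_obj_def] Ch_obj, of ?S, OF S]
  show h: "df m \<in> Hom G (Ch m) (Ch (m - 1))" unfolding simplex_diff_def simplex_obj_def[of G V F m]
      by (rule p(1))
  show "Cmp G (df m) (cell_inj m \<sigma>) =
    hom_sum G (X (snd \<sigma>)) (Ch (m - 1)) (\<lambda>j. signed_hom G (X (snd \<sigma>)) (Ch (m - 1)) (fsign \<sigma> j)
      (Cmp G (cell_inj (m - 1) (face_of \<sigma> j)) (rf \<sigma> j))) (proper \<sigma>)" if \<sigma>: "\<sigma> \<in> cells m"
  proof -
    let ?J = "fst \<sigma>" and ?c = "snd \<sigma>"
    note c = cellD[OF \<sigma>]
    have FJ: "F ?J \<in> Obj G" by (rule F_obj[OF c(2)])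
    have ic: "dsum_inj G (CI ?J) X ?c \<in> Hom G (X ?c) (F ?J)" by (rule G.coproductD(2)[OF
        F_coproduct[OF c(2)] c(5)])
    have "Cmp G (df m) (cell_inj m \<sigma>) = Cmp G (Cmp G (df m) (dsum_inj G (faces V m) F ?J)) (dsum_inj
        G (CI ?J) X ?c)"
      unfolding cell_inj_def by (rule G.cmp_assoc[OF c(6) FJ Ch_obj Ch_obj ic inj[OF c(1)] h,
          symmetric])
    also have "Cmp G (df m) (dsum_inj G (faces V m) F ?J) = ?S ?J" unfolding simplex_diff_def by
        (rule p(2)[OF _ c(1)])
    also have "Cmp G (?S ?J) (dsum_inj G (CI ?J) X ?c) = hom_sum G (X ?c) (Ch (m - 1)) (\<lambda>j. Cmp G
        (?s ?J j) (dsum_inj G (CI ?J) X ?c)) (proper \<sigma>)"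
      by (rule G.cmp_hom_sum_left[OF c(6) FJ Ch_obj ic]) (use c sc in auto)
    also have "\<dots> = hom_sum G (X ?c) (Ch (m - 1)) (\<lambda>j. signed_hom G (X ?c) (Ch (m - 1)) (fsign \<sigma> j)
      (Cmp G (cell_inj (m - 1) (face_of \<sigma> j)) (rf \<sigma> j))) (proper \<sigma>)"
    proof (rule G.hom_sum_cong[OF c(6) Ch_obj HOL.refl])
      fix j assume jp: "j \<in> proper \<sigma>"
      hence j: "j \<in> ?J" "?J - {j} \<noteq> {}" by auto
      note fc = cellD[OF face_cell[OF \<sigma> jp]] and rh = rf_hom[OF \<sigma> jp]
      note ih = cellB(4)[OF face_cell[OF \<sigma> jp]]
      show "signed_hom G (X ?c) (Ch (m - 1)) (fsign \<sigma> j) (Cmp G (cell_inj (m - 1) (face_of \<sigma> j)) (rf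
          \<sigma> j)) \<in> Hom G (X ?c) (Ch (m - 1))"
        by (rule G.signed_closed[OF c(6) Ch_obj G.cmp_hom[OF c(6) fc(6) Ch_obj rh ih]])
      have f: "?J - {j} \<in> faces V (m - 1)" using faces_diff[OF c(1) j] by simp
      have FJj: "F (?J - {j}) \<in> Obj G" by (rule F_obj[OF j(2)])
      note cm = coeff_map_props[OF Diff_subset j(2)]
      have fe: "face_of \<sigma> j = (?J - {j}, par (?J - {j}) <#> ?c)" unfolding face_of_def ..
      have ifc: "dsum_inj G (CI (?J - {j})) X (par (?J - {j}) <#> ?c) \<in> Hom G (X (par (?J - {j}) <#>
          ?c)) (F (?J - {j}))"
        using G.coproductD(2)[OF F_coproduct[OF j(2)]] fc(5) unfolding fe by simp
      have "Cmp G (?t ?J j) (dsum_inj G (CI ?J) X ?c)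
          = Cmp G (dsum_inj G (faces V (m - 1)) F (?J - {j})) (Cmp G (coeff_map W s n D P A ?J (?J -
              {j})) (dsum_inj G (CI ?J) X ?c))"
        by (rule G.cmp_assoc[OF c(6) FJ FJj Ch_obj ic cm(1) inj[OF f]])
      also have "\<dots> = Cmp G (dsum_inj G (faces V (m - 1)) F (?J - {j})) (Cmp G (dsum_inj G (CI (?J -
          {j})) X (par (?J - {j}) <#> ?c)) (rf \<sigma> j))"
        using cm(2)[OF c(5)] unfolding fe by simp
      also have "\<dots> = Cmp G (cell_inj (m - 1) (face_of \<sigma> j)) (rf \<sigma> j)"
        unfolding cell_inj_def using G.cmp_assoc[OF c(6) fc(6) FJj Ch_obj rh, of "dsum_inj G (CI (?J
            - {j})) X (par (?J - {j}) <#> ?c)"] ifc inj[OF f]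
        unfolding fe by simp
      finally show "Cmp G (?s ?J j) (dsum_inj G (CI ?J) X ?c) = signed_hom G (X ?c) (Ch (m - 1))
          (fsign \<sigma> j)
          (Cmp G (cell_inj (m - 1) (face_of \<sigma> j)) (rf \<sigma> j))"
        using G.cmp_signed_left[OF c(6) FJ Ch_obj ic t[OF c(1) j]] by simp
    qed
    finally show ?thesis .
  qed
qed

lemma face_of_face:
  assumes "\<sigma> \<in> cells m" "j \<in> proper \<sigma>" "k \<in> proper (face_of \<sigma> j)"
  shows "face_of (face_of \<sigma> j) k = (fst \<sigma> - {j} - {k}, par (fst \<sigma> - {j} - {k}) <#> snd \<sigma>)"
    "Cmp G (rf (face_of \<sigma> j) k) (rf \<sigma> j) = r (snd \<sigma>) (par (fst \<sigma> - {j} - {k}) <#> snd \<sigma>)"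
proof -
  note c = cellD[OF assms(1)] and f = face_cell[OF assms(1,2)]
  show e: "face_of (face_of \<sigma> j) k = (fst \<sigma> - {j} - {k}, par (fst \<sigma> - {j} - {k}) <#> snd \<sigma>)"
    unfolding face_of_def using face_face[of "fst \<sigma> - {j} - {k}" "fst \<sigma> - {j}" "fst \<sigma>" "snd \<sigma>"] c(5)
        by auto
  have s1: "snd \<sigma> \<subseteq> snd (face_of \<sigma> j)" using face_sub[of "fst \<sigma> - {j}" "fst \<sigma>" "snd \<sigma>"] c(5)
      unfolding face_of_def by auto
  have s2: "snd (face_of \<sigma> j) \<subseteq> snd (face_of (face_of \<sigma> j) k)"
    using face_sub[of "fst (face_of \<sigma> j) - {k}" "fst (face_of \<sigma> j)" "snd (face_of \<sigma> j)"] cellD(5)[OF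
        f] unfolding face_of_def by auto
  show "Cmp G (rf (face_of \<sigma> j) k) (rf \<sigma> j) = r (snd \<sigma>) (par (fst \<sigma> - {j} - {k}) <#> snd \<sigma>)"
    using jj_map_compose[OF P_sub c(7) cellD(7)[OF f] cellD(7)[OF face_cell[OF f assms(3)]] s1 s2 A]
        e by simp
qed

text \<open>By functoriality of the canonical morphisms, removing two vertices in either order gives the same morphism,
  with opposite signs.\<close>

lemma df_df: "Cmp G (df (m - 1)) (df m) = Zero_hom G (Ch m) (Ch (m - 1 - 1))"
proof (rule G.coproduct_eqI[OF cells_coproduct Ch_obj])
  show "Cmp G (df (m - 1)) (df m) \<in> Hom G (Ch m) (Ch (m - 1 - 1))" by (rule G.cmp_hom[OF Ch_obj
      Ch_obj Ch_obj df_hom df_hom])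
  show "Zero_hom G (Ch m) (Ch (m - 1 - 1)) \<in> Hom G (Ch m) (Ch (m - 1 - 1))" using Ch_obj by blast
  fix \<sigma> assume \<sigma>: "\<sigma> \<in> cells m"
  note c = cellD[OF \<sigma>]
  let ?J = "fst \<sigma>" and ?X = "X (snd \<sigma>)" and ?C = "Ch (m - 1 - 1)"
  show "X (snd \<sigma>) \<in> Obj G" by (rule c(6))
  let ?T = "\<lambda>j k. Cmp G (cell_inj (m - 1 - 1) (?J - {j} - {k}, par (?J - {j} - {k}) <#> snd \<sigma>)) (r
      (snd \<sigma>) (par (?J - {j} - {k}) <#> snd \<sigma>))"
  let ?t = "\<lambda>j k. signed_hom G ?X ?C (fsign \<sigma> j + fsign (face_of \<sigma> j) k) (?T j k)"
  have Th: "?T j k \<in> Hom G ?X ?C" if j: "j \<in> proper \<sigma>" and k: "k \<in> proper (face_of \<sigma> j)" for j k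
  proof -
    note f = face_cell[OF \<sigma> j] and rj = rf_hom[OF \<sigma> j]
    note f2 = face_cell[OF f k] and rk = rf_hom[OF f k]
    show ?thesis using G.cmp_hom[OF c(6) cellD(6)[OF f2] Ch_obj
      G.cmp_hom[OF c(6) cellD(6)[OF f] cellD(6)[OF f2] rj rk] cellB(4)[OF f2]] face_of_face[OF \<sigma> j
          k] by simp
  qed
  have step: "Cmp G (df (m - 1)) (signed_hom G ?X (Ch (m - 1)) (fsign \<sigma> j) (Cmp G (cell_inj (m - 1)
      (face_of \<sigma> j)) (rf \<sigma> j)))
      = hom_sum G ?X ?C (?t j) (proper (face_of \<sigma> j))" if j: "j \<in> proper \<sigma>" for j
  proof -
    note f = face_cell[OF \<sigma> j] and rj = rf_hom[OF \<sigma> j]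
    note fo = cellD(6)[OF f]
    let ?s = "\<lambda>k. Cmp G (cell_inj (m - 1 - 1) (face_of (face_of \<sigma> j) k)) (rf (face_of \<sigma> j) k)"
    have sk: "?s k \<in> Hom G (X (snd (face_of \<sigma> j))) ?C" if k: "k \<in> proper (face_of \<sigma> j)" for k
      by (rule G.cmp_hom[OF fo cellD(6)[OF face_cell[OF f k]] Ch_obj rf_hom[OF f k] cellB(4)[OF
          face_cell[OF f k]]])
    have fin: "finite (proper (face_of \<sigma> j))" using cellD(3)[OF f] by simp
    have q: "Cmp G (cell_inj (m - 1) (face_of \<sigma> j)) (rf \<sigma> j) \<in> Hom G ?X (Ch (m - 1))"
      by (rule G.cmp_hom[OF c(6) fo Ch_obj rj cellB(4)[OF f]])
    have "Cmp G (df (m - 1)) (Cmp G (cell_inj (m - 1) (face_of \<sigma> j)) (rf \<sigma> j))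
        = Cmp G (hom_sum G (X (snd (face_of \<sigma> j))) ?C (\<lambda>k. signed_hom G (X (snd (face_of \<sigma> j))) ?C
            (fsign (face_of \<sigma> j) k) (?s k)) (proper (face_of \<sigma> j))) (rf \<sigma> j)"
      using G.cmp_assoc[OF c(6) fo Ch_obj Ch_obj rj cellB(4)[OF f] df_hom] df_cell[OF f] by simp
    also have "\<dots> = hom_sum G ?X ?C (\<lambda>k. Cmp G (signed_hom G (X (snd (face_of \<sigma> j))) ?C (fsign
        (face_of \<sigma> j) k) (?s k)) (rf \<sigma> j)) (proper (face_of \<sigma> j))"
      by (rule G.cmp_hom_sum_left[OF c(6) fo Ch_obj rj fin G.signed_closed[OF fo Ch_obj sk]])
    also have "\<dots> = hom_sum G ?X ?C (\<lambda>k. signed_hom G ?X ?C (fsign (face_of \<sigma> j) k) (?T j k)) (proper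
        (face_of \<sigma> j))"
    proof (rule G.hom_sum_cong[OF c(6) Ch_obj HOL.refl G.signed_closed[OF c(6) Ch_obj Th[OF j]]])
      fix k assume k: "k \<in> proper (face_of \<sigma> j)"
      have "Cmp G (?s k) (rf \<sigma> j) = ?T j k"
        using G.cmp_assoc[OF c(6) fo cellD(6)[OF face_cell[OF f k]] Ch_obj rj rf_hom[OF f k]
            cellB(4)[OF face_cell[OF f k]]] face_of_face[OF \<sigma> j k] by simp
      thus "Cmp G (signed_hom G (X (snd (face_of \<sigma> j))) ?C (fsign (face_of \<sigma> j) k) (?s k)) (rf \<sigma> j)
          = signed_hom G ?X ?C (fsign (face_of \<sigma> j) k) (?T j k)"
        using G.cmp_signed_left[OF c(6) fo Ch_obj rj sk[OF k]] by simp
    qed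
    finally have e: "Cmp G (df (m - 1)) (Cmp G (cell_inj (m - 1) (face_of \<sigma> j)) (rf \<sigma> j)) = \<dots>" .
    let ?H = "hom_sum G ?X ?C (\<lambda>k. signed_hom G ?X ?C (fsign (face_of \<sigma> j) k) (?T j k)) (proper
        (face_of \<sigma> j))"
    have H: "?H \<in> Hom G ?X ?C"
      by (rule G.hom_sum_closed[OF c(6) Ch_obj]) (rule G.signed_closed[OF c(6) Ch_obj Th[OF j]])
    have "Cmp G (df (m - 1)) (signed_hom G ?X (Ch (m - 1)) (fsign \<sigma> j) (Cmp G (cell_inj (m - 1)
        (face_of \<sigma> j)) (rf \<sigma> j)))
        = signed_hom G ?X ?C (fsign \<sigma> j) (hom_sum G ?X ?C (\<lambda>k. signed_hom G ?X ?C (fsign (face_of \<sigma>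
            j) k) (?T j k)) (proper (face_of \<sigma> j)))"
      using G.cmp_signed_right[OF c(6) Ch_obj Ch_obj q df_hom] e by simp
    also have "\<dots> = Cmp G (signed_hom G ?C ?C (fsign \<sigma> j) (Ident G ?C)) (hom_sum G ?X ?C (\<lambda>k.
        signed_hom G ?X ?C (fsign (face_of \<sigma> j) k) (?T j k)) (proper (face_of \<sigma> j)))"
      using G.cmp_signed_left[OF c(6) Ch_obj Ch_obj H G.ident_hom[OF Ch_obj], of "fsign \<sigma> j"]
          G.cmp_ident_left[OF c(6) Ch_obj H] by simp
    also have "\<dots> = hom_sum G ?X ?C (\<lambda>k. Cmp G (signed_hom G ?C ?C (fsign \<sigma> j) (Ident G ?C))
        (signed_hom G ?X ?C (fsign (face_of \<sigma> j) k) (?T j k))) (proper (face_of \<sigma> j))"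
      by (rule G.cmp_hom_sum_right[OF c(6) Ch_obj Ch_obj G.signed_closed[OF Ch_obj Ch_obj
          G.ident_hom[OF Ch_obj]] fin G.signed_closed[OF c(6) Ch_obj Th[OF j]]])
    also have "\<dots> = hom_sum G ?X ?C (?t j) (proper (face_of \<sigma> j))"
    proof (rule G.hom_sum_cong[OF c(6) Ch_obj HOL.refl G.signed_closed[OF c(6) Ch_obj Th[OF j]]])
      fix k assume k: "k \<in> proper (face_of \<sigma> j)"
      note sT = G.signed_closed[OF c(6) Ch_obj Th[OF j k]]
      show "Cmp G (signed_hom G ?C ?C (fsign \<sigma> j) (Ident G ?C)) (signed_hom G ?X ?C (fsign (face_of
          \<sigma> j) k) (?T j k)) = ?t j k"
        using G.cmp_signed_left[OF c(6) Ch_obj Ch_obj sT G.ident_hom[OF Ch_obj]] G.cmp_ident_left[OF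
            c(6) Ch_obj sT]
          G.signed_signed[OF c(6) Ch_obj Th[OF j k]] by simp
    qed
    finally show ?thesis .
  qed
  have q: "signed_hom G ?X (Ch (m - 1)) (fsign \<sigma> j) (Cmp G (cell_inj (m - 1) (face_of \<sigma> j)) (rf \<sigma>
      j)) \<in> Hom G ?X (Ch (m - 1))"
    if j: "j \<in> proper \<sigma>" for j
    by (rule G.signed_closed[OF c(6) Ch_obj G.cmp_hom[OF c(6) cellD(6)[OF face_cell[OF \<sigma> j]] Ch_obj
        rf_hom[OF \<sigma> j] cellB(4)[OF face_cell[OF \<sigma> j]]]])
  have fin: "finite (proper \<sigma>)" using c(3) by simp
  have th: "?t j k \<in> Hom G ?X ?C" if "j \<in> proper \<sigma>" "k \<in> proper (face_of \<sigma> j)" for j k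
    by (rule G.signed_closed[OF c(6) Ch_obj Th[OF that]])
  have "Cmp G (Cmp G (df (m - 1)) (df m)) (cell_inj m \<sigma>) = Cmp G (df (m - 1)) (Cmp G (df m)
      (cell_inj m \<sigma>))"
    by (rule G.cmp_assoc[OF c(6) Ch_obj Ch_obj Ch_obj cellB(4)[OF \<sigma>] df_hom df_hom])
  also have "\<dots> = hom_sum G ?X ?C (\<lambda>j. Cmp G (df (m - 1)) (signed_hom G ?X (Ch (m - 1)) (fsign \<sigma> j)
      (Cmp G (cell_inj (m - 1) (face_of \<sigma> j)) (rf \<sigma> j)))) (proper \<sigma>)"
    unfolding df_cell[OF \<sigma>] by (rule G.cmp_hom_sum_right[OF c(6) Ch_obj Ch_obj df_hom fin q])
  also have "\<dots> = hom_sum G ?X ?C (\<lambda>j. hom_sum G ?X ?C (?t j) (proper (face_of \<sigma> j))) (proper \<sigma>)"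
    by (rule G.hom_sum_cong[OF c(6) Ch_obj HOL.refl G.hom_sum_closed[OF c(6) Ch_obj th] step])
  also have "\<dots> = Zero_hom G ?X ?C"
  \<comment> \<open>with at least three vertices all faces involved are nonempty; with fewer there is nothing to sum\<close>
  proof (cases "card ?J \<ge> 3")
    case True
    have big: "?J - {j} - {k} \<noteq> {}" for j k
    proof
      assume "?J - {j} - {k} = {}"
      hence "?J \<subseteq> {j, k}" by blast
      hence "card ?J \<le> card {j, k}" by (intro card_mono) auto
      also have "\<dots> \<le> 2" by (simp add: card_insert_if)
      finally show False using True by simp
    qed
    have p1: "proper \<sigma> = ?J" using big by blast
    have p2: "proper (face_of \<sigma> j) = ?J - {j}" for j using big unfolding face_of_def by auto
    have cm: "?T j k = ?T k j" for j k by (simp add: Diff_insert2[symmetric] insert_commute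
        Diff_insert[symmetric])
    show ?thesis unfolding p1 p2
    proof (rule G.hom_sum_antisym[OF c(6) Ch_obj c(3)])
      fix j k assume jk: "j \<in> ?J" "k \<in> ?J" "j \<noteq> k"
      have mem: "j \<in> proper \<sigma>" "k \<in> proper (face_of \<sigma> j)" unfolding p1 p2 using jk by auto
      show "?t j k \<in> Hom G ?X ?C" by (rule th[OF mem])
      have "odd ((fsign \<sigma> j + fsign (face_of \<sigma> j) k) + (fsign \<sigma> k + fsign (face_of \<sigma> k) j))"
        using face_sign_parity[OF c(3) jk] unfolding face_of_def by simp
      thus "Plus_hom G (?t j k) (?t k j) = Zero_hom G ?X ?C" unfolding cm[of k j]
        by (rule G.signed_cancel[OF c(6) Ch_obj Th[OF mem]])
    qed
  next
    case False
    have "proper (face_of \<sigma> j) = {}" if "j \<in> proper \<sigma>" for j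
    proof -
      have "card (?J - {j}) \<le> 1" using False that c(3) by simp
      hence "k \<in> ?J - {j} \<Longrightarrow> ?J - {j} = {k}" for k using c(3) by (auto simp: card_le_Suc0_iff_eq)
      thus ?thesis unfolding face_of_def by auto
    qed
    thus ?thesis using c(6) Ch_obj by (intro G.hom_sum_zero) auto
  qed
  also have "\<dots> = Cmp G (Zero_hom G (Ch m) ?C) (cell_inj m \<sigma>)"
    by (rule G.cmp_zero_left[OF c(6) Ch_obj Ch_obj cellB(4)[OF \<sigma>], symmetric])
  finally show "Cmp G (Cmp G (df (m - 1)) (df m)) (cell_inj m \<sigma>) = Cmp G (Zero_hom G (Ch m) ?C)
      (cell_inj m \<sigma>)" .
qed

end

lemma (in preadditive_category) biproduct_singleton:
  assumes a: "a \<in> Obj C"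
  shows "is_biproduct C {()} (\<lambda>_. a) a (\<lambda>_. Ident C a) (\<lambda>_. Ident C a)"
proof -
  note i = ident_hom[OF a]
  have "hom_sum C a a (\<lambda>_. Cmp C (Ident C a) (Ident C a)) {()} = Cmp C (Ident C a) (Ident C a)"
    using hom_sum_single[OF a a, of "{()}" "()" "\<lambda>_. Cmp C (Ident C a) (Ident C a)"] cmp_hom[OF a a
        a i i] by simp
  thus ?thesis unfolding is_biproduct_def using a i cmp_ident_left[OF a a i] by simp
qed

context coset_chain
begin

subsection \<open>Matrix coefficients of the differential\<close>

lemma df_coeff:
  assumes \<sigma>: "\<sigma> \<in> cells m" and \<tau>: "\<tau> \<in> cells (m - 1)"
  shows "Cmp G (cell_proj (m - 1) \<tau>) (Cmp G (df m) (cell_inj m \<sigma>)) =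
    hom_sum G (X (snd \<sigma>)) (X (snd \<tau>)) (\<lambda>j. signed_hom G (X (snd \<sigma>)) (X (snd \<tau>)) (fsign \<sigma> j)
      (if face_of \<sigma> j = \<tau> then rf \<sigma> j else Zero_hom G (X (snd \<sigma>)) (X (snd \<tau>)))) (proper \<sigma>)"
proof -
  note c = cellD[OF \<sigma>] and t = cellD[OF \<tau>] and pt = cellB(5)[OF \<tau>]
  have fin: "finite (proper \<sigma>)" using c(3) by simp
  let ?q = "\<lambda>j. Cmp G (cell_inj (m - 1) (face_of \<sigma> j)) (rf \<sigma> j)"
  have q: "?q j \<in> Hom G (X (snd \<sigma>)) (Ch (m - 1))" if j: "j \<in> proper \<sigma>" for j
    by (rule G.cmp_hom[OF c(6) cellD(6)[OF face_cell[OF \<sigma> j]] Ch_obj rf_hom[OF \<sigma> j] cellB(4)[OF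
        face_cell[OF \<sigma> j]]])
  have "Cmp G (cell_proj (m - 1) \<tau>) (Cmp G (df m) (cell_inj m \<sigma>)) =
    hom_sum G (X (snd \<sigma>)) (X (snd \<tau>)) (\<lambda>j. Cmp G (cell_proj (m - 1) \<tau>) (signed_hom G (X (snd \<sigma>)) (Ch
        (m - 1)) (fsign \<sigma> j) (?q j))) (proper \<sigma>)"
    unfolding df_cell[OF \<sigma>] by (rule G.cmp_hom_sum_right[OF c(6) Ch_obj t(6) pt fin
        G.signed_closed[OF c(6) Ch_obj q]])
  also have "\<dots> = hom_sum G (X (snd \<sigma>)) (X (snd \<tau>)) (\<lambda>j. signed_hom G (X (snd \<sigma>)) (X (snd \<tau>)) (fsign \<sigma> j)
      (if face_of \<sigma> j = \<tau> then rf \<sigma> j else Zero_hom G (X (snd \<sigma>)) (X (snd \<tau>)))) (proper \<sigma>)"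
  proof (rule G.hom_sum_cong[OF c(6) t(6) HOL.refl])
    fix j assume j: "j \<in> proper \<sigma>"
    note f = face_cell[OF \<sigma> j] and rj = rf_hom[OF \<sigma> j]
    show "signed_hom G (X (snd \<sigma>)) (X (snd \<tau>)) (fsign \<sigma> j) (if face_of \<sigma> j = \<tau> then rf \<sigma> j else
        Zero_hom G (X (snd \<sigma>)) (X (snd \<tau>)))
        \<in> Hom G (X (snd \<sigma>)) (X (snd \<tau>))"
      using G.signed_closed[OF c(6) t(6)] rj G.zero_closed[OF c(6) t(6)] by auto
    have "Cmp G (cell_proj (m - 1) \<tau>) (?q j) = Cmp G (Cmp G (cell_proj (m - 1) \<tau>) (cell_inj (m - 1)
        (face_of \<sigma> j))) (rf \<sigma> j)"
      by (rule G.cmp_assoc[OF c(6) cellD(6)[OF f] Ch_obj t(6) rj cellB(4)[OF f] pt, symmetric])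
    also have "\<dots> = (if face_of \<sigma> j = \<tau> then rf \<sigma> j else Zero_hom G (X (snd \<sigma>)) (X (snd \<tau>)))"
    proof (cases "face_of \<sigma> j = \<tau>")
      case True
      thus ?thesis using cellB(6)[OF \<tau>] G.cmp_ident_left[OF c(6) t(6), of "rf \<sigma> j"] rj by auto
    next
      case False
      thus ?thesis using cellB(7)[OF \<tau> f] G.cmp_zero_left[OF c(6) cellD(6)[OF f] t(6) rj] by auto
    qed
    finally show "Cmp G (cell_proj (m - 1) \<tau>) (signed_hom G (X (snd \<sigma>)) (Ch (m - 1)) (fsign \<sigma> j) (?q
        j)) =
       signed_hom G (X (snd \<sigma>)) (X (snd \<tau>)) (fsign \<sigma> j) (if face_of \<sigma> j = \<tau> then rf \<sigma> j else
           Zero_hom G (X (snd \<sigma>)) (X (snd \<tau>)))"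
      using G.cmp_signed_right[OF c(6) Ch_obj t(6) q[OF j] pt] by simp
  qed
  finally show ?thesis .
qed

lemma df_coeff_zero:
  assumes \<sigma>: "\<sigma> \<in> cells m" and \<tau>: "\<tau> \<in> cells (m - 1)" and "\<And>j. j \<in> proper \<sigma> \<Longrightarrow> face_of \<sigma> j \<noteq> \<tau>"
  shows "Cmp G (cell_proj (m - 1) \<tau>) (Cmp G (df m) (cell_inj m \<sigma>)) = Zero_hom G (X (snd \<sigma>)) (X (snd \<tau>))"
  unfolding df_coeff[OF \<sigma> \<tau>]
  by (rule G.hom_sum_zero[OF cellD(6)[OF \<sigma>] cellD(6)[OF \<tau>]])
    (use assms(3) G.signed_zero[OF cellD(6)[OF \<sigma>] cellD(6)[OF \<tau>]] in auto)

lemma df_coeff_face: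
  assumes \<sigma>: "\<sigma> \<in> cells m" and j: "j \<in> proper \<sigma>"
  shows "Cmp G (cell_proj (m - 1) (face_of \<sigma> j)) (Cmp G (df m) (cell_inj m \<sigma>))
    = signed_hom G (X (snd \<sigma>)) (X (snd (face_of \<sigma> j))) (fsign \<sigma> j) (rf \<sigma> j)"
proof -
  note c = cellD[OF \<sigma>] and f = face_cell[OF \<sigma> j]
  let ?f = "\<lambda>k. signed_hom G (X (snd \<sigma>)) (X (snd (face_of \<sigma> j))) (fsign \<sigma> k)
      (if face_of \<sigma> k = face_of \<sigma> j then rf \<sigma> k else Zero_hom G (X (snd \<sigma>)) (X (snd (face_of \<sigma> j))))"
  have "hom_sum G (X (snd \<sigma>)) (X (snd (face_of \<sigma> j))) ?f (proper \<sigma>) = ?f j"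
  proof (rule G.hom_sum_single[OF c(6) cellD(6)[OF f] _ j])
    show "finite (proper \<sigma>)" using c(3) by simp
    show "?f j \<in> Hom G (X (snd \<sigma>)) (X (snd (face_of \<sigma> j)))" using G.signed_closed[OF c(6)
        cellD(6)[OF f] rf_hom[OF \<sigma> j]] by simp
    fix k assume k: "k \<in> proper \<sigma>" "k \<noteq> j"
    have "face_of \<sigma> k \<noteq> face_of \<sigma> j" using k j unfolding face_of_def by auto
    thus "?f k = Zero_hom G (X (snd \<sigma>)) (X (snd (face_of \<sigma> j)))" using G.signed_zero[OF c(6)
        cellD(6)[OF f]] by simp
  qed
  thus ?thesis unfolding df_coeff[OF \<sigma> f] by simp
qed

lemma signed_component:
  assumes "Y \<in> Obj G" "Z \<in> Obj G" "w \<in> P" "f \<in> Hom G Y Z"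
  shows "signed_hom G Y Z k f w = signed_hom (cat w) (fst Y w) (fst Z w) k (f w)"
  using glue_neg_component[OF P_sub assms(1,2,3,4)] by (simp add: signed_hom_def)

lemma cells_biproduct_at:
  "w \<in> P \<Longrightarrow> is_biproduct (cat w) (cells m) (\<lambda>\<sigma>. fst (X (snd \<sigma>)) w) (fst (Ch m) w) (\<lambda>\<sigma>. cell_inj m \<sigma>
      w) (\<lambda>\<sigma>. cell_proj m \<sigma> w)"
  by (rule glue_biproduct_component[OF P_sub _ cellD(6) cells_biproduct])

lemma coeff_zero_at:
  assumes w: "w \<in> P" and \<sigma>: "\<sigma> \<in> cells m" and \<tau>: "\<tau> \<in> cells (m - 1)" and "\<And>j. j \<in> proper \<sigma> \<Longrightarrow> face_of
      \<sigma> j \<noteq> \<tau>"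
  shows "Cmp (cat w) (cell_proj (m - 1) \<tau> w) (Cmp (cat w) (df m w) (cell_inj m \<sigma> w)) = Zero_hom (cat
      w) (fst (X (snd \<sigma>)) w) (fst (X (snd \<tau>)) w)"
  using arg_cong[OF df_coeff_zero[OF \<sigma> \<tau> assms(4)], of "\<lambda>h. h w"] w by simp

lemma coeff_iso_at:
  assumes w: "w \<in> P" and \<sigma>: "\<sigma> \<in> cells m" and j: "j \<in> proper \<sigma>" and near: "nearest (snd \<sigma>) w =
      nearest (snd (face_of \<sigma> j)) w"
  shows "is_iso (cat w) (fst (X (snd \<sigma>)) w) (fst (X (snd (face_of \<sigma> j))) w)
    (Cmp (cat w) (cell_proj (m - 1) (face_of \<sigma> j) w) (Cmp (cat w) (df m w) (cell_inj m \<sigma> w)))"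
proof -
  interpret C: preadditive_category "cat w" by (rule preadd) (use w P_sub in blast)
  note c = cellD[OF \<sigma>] and f = cellD[OF face_cell[OF \<sigma> j]]
  have sub: "snd \<sigma> \<subseteq> snd (face_of \<sigma> j)" using face_sub[of "fst \<sigma> - {j}" "fst \<sigma>" "snd \<sigma>"] c(5)
      unfolding face_of_def by auto
  have "is_iso (cat w) (fst (X (snd \<sigma>)) w) (fst (X (snd (face_of \<sigma> j))) w)
     (signed_hom (cat w) (fst (X (snd \<sigma>)) w) (fst (X (snd (face_of \<sigma> j))) w) (fsign \<sigma> j) (rf \<sigma> j w))"
    by (rule C.signed_iso[OF glue_obj_component[OF c(6) w] glue_obj_component[OF f(6) w]
        jj_map_iso[OF P_sub c(7) f(7) sub A w near]])
  thus ?thesis using arg_cong[OF df_coeff_face[OF \<sigma> j], of "\<lambda>h. h w"] signed_component[OF c(6) f(6)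
      w rf_hom[OF \<sigma> j]] w by simp
qed

subsection \<open>The matching of cells at a component\<close>

text \<open>The vertex that is added to or removed from all cells with nearest element \<open>y\<close>.\<close>

definition free_vertex :: "'w \<Rightarrow> 'w \<Rightarrow> nat" where
  "free_vertex w y = (SOME j. j \<in> V \<and> par {j} #> y \<subseteq> P \<and> \<not> is_inversion (w \<otimes> inv y) (s j))"

lemma free_vertex_props:
  assumes w: "w \<in> P" and y: "y \<in> P"
  shows "free_vertex w y \<in> V" "par {free_vertex w y} #> y \<subseteq> P" "\<not> is_inversion (w \<otimes> inv y) (s
      (free_vertex w y))"
proof -
  have c: "w \<in> carrier W" "\<not> is_inversion w (s i)" "y \<in> carrier W" "\<not> is_inversion y (s i)" using w
      y P_iff by auto
  have si: "s i \<in> s ` V" using i by blast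
  obtain a where a: "a \<in> s ` V" "\<And>x. x \<in> generate W (s ` V - {a}) #> y \<Longrightarrow> \<not> is_inversion x (s i)" "\<not>
      is_inversion (w \<otimes> inv y) a"
    using ascent_coset_ex[OF si c(3,4,1,2)] by blast
  obtain j where j: "j \<in> V" "a = s j" using a(1) by blast
  have "s ` V - {a} = gens {j}" using inj_on_image_set_diff[OF s_inj, of V "{j}"] j by blast
  hence "\<not> is_inversion x (s i)" if "x \<in> par {j} #> y" for x using a(2)[of x] that unfolding
      par_generate by simp
  hence "par {j} #> y \<subseteq> P" using P_iff coset_mem_carrier[OF par_coset[OF c(3), of "{j}"]] by blast
  hence "\<exists>j. j \<in> V \<and> par {j} #> y \<subseteq> P \<and> \<not> is_inversion (w \<otimes> inv y) (s j)" using j a(3) by blast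
  from someI_ex[OF this] show "free_vertex w y \<in> V" "par {free_vertex w y} #> y \<subseteq> P"
    "\<not> is_inversion (w \<otimes> inv y) (s (free_vertex w y))" unfolding free_vertex_def by auto
qed

text \<open>A cell \<open>(J, c)\<close> is lower if its free vertex is missing from \<open>J\<close>; it is then matched with its coface,
  otherwise with its face opposite to the free vertex. The rank is the length from the nearest element to
  \<open>w\<close>; it cannot grow under the passage to a larger coset, and stays the same only if the nearest element
  does.\<close>

abbreviation near where "near w \<sigma> \<equiv> nearest (snd \<sigma>) w"
abbreviation vertex where "vertex w \<sigma> \<equiv> free_vertex w (near w \<sigma>)"
abbreviation lower where "lower w \<equiv> {\<sigma>. vertex w \<sigma> \<notin> fst \<sigma>}"
abbreviation rank where "rank w \<sigma> \<equiv> len (w \<otimes> inv (near w \<sigma>))"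
definition coface where "coface w \<sigma> = (insert (vertex w \<sigma>) (fst \<sigma>), par (insert (vertex w \<sigma>) (fst
    \<sigma>)) #> near w \<sigma>)"

lemma near_mem:
  assumes "\<sigma> \<in> cells m" shows "near w \<sigma> \<in> snd \<sigma>" "near w \<sigma> \<in> P" "near w \<sigma> \<in> carrier W"
proof -
  note c = cellD[OF assms]
  show n: "near w \<sigma> \<in> snd \<sigma>" by (rule nearest_mem[OF CI_coset[OF c(5)]])
  show p: "near w \<sigma> \<in> P" using n c(7) unfolding in_cosets_def by blast
  show "near w \<sigma> \<in> carrier W" using p P_sub by blast
qed

lemma vertex_props:
  assumes w: "w \<in> P" and \<sigma>: "\<sigma> \<in> cells m"
  shows "vertex w \<sigma> \<in> V" "par {vertex w \<sigma>} #> near w \<sigma> \<subseteq> P" "\<not> is_inversion (w \<otimes> inv (near w \<sigma>)) (s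
      (vertex w \<sigma>))"
  using free_vertex_props[OF w near_mem(2)[OF \<sigma>]] .

lemma face_rank:
  assumes w: "w \<in> P" and \<sigma>: "\<sigma> \<in> cells m" and j: "j \<in> proper \<sigma>"
  shows "rank w (face_of \<sigma> j) \<le> rank w \<sigma>" "rank w \<sigma> \<le> rank w (face_of \<sigma> j) \<Longrightarrow> near w (face_of \<sigma> j) =
      near w \<sigma>"
proof -
  have wc: "w \<in> carrier W" using w P_sub by blast
  note c = cellD[OF \<sigma>] and f = cellD[OF face_cell[OF \<sigma> j]]
  have sub: "snd \<sigma> \<subseteq> snd (face_of \<sigma> j)" using face_sub[of "fst \<sigma> - {j}" "fst \<sigma>" "snd \<sigma>"] c(5)
      unfolding face_of_def by auto
  note co = CI_coset[OF c(5)] CI_coset[OF f(5)]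
  show "rank w (face_of \<sigma> j) \<le> rank w \<sigma>" by (rule nearest_mono[OF co sub wc])
  show "near w (face_of \<sigma> j) = near w \<sigma>" if "rank w \<sigma> \<le> rank w (face_of \<sigma> j)"
    using nearest_unique[OF co(2) wc _ that] near_mem(1)[OF \<sigma>, of w] sub by blast
qed

text \<open>The nearest element of a coset remains nearest in every smaller coset that contains it, so the coface has the
  same free vertex and lies over the original cell.\<close>

lemma coface_props:
  assumes w: "w \<in> P" and \<sigma>: "\<sigma> \<in> cells m" "\<sigma> \<in> lower w"
  shows "coface w \<sigma> \<in> cells (m + 1)" "vertex w \<sigma> \<in> proper (coface w \<sigma>)" "face_of (coface w \<sigma>)
      (vertex w \<sigma>) = \<sigma>"
    "near w (coface w \<sigma>) = near w \<sigma>"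
proof -
  have wc: "w \<in> carrier W" using w P_sub by blast
  let ?j = "vertex w \<sigma>" and ?J = "fst \<sigma>" and ?y = "near w \<sigma>"
  let ?J' = "insert ?j ?J"
  note c = cellD[OF \<sigma>(1)] and v = vertex_props[OF w \<sigma>(1)] and y = near_mem[OF \<sigma>(1), of w]
  have jJ: "?j \<notin> ?J" using \<sigma>(2) by blast
  note d = CI_D[OF c(5) y(1)]
  have c': "par ?J' #> ?y \<in> CI ?J'" using d v(2) by (intro CI_I) auto
  have "?J' \<in> faces V (m + 1)" using c(1,3) v(1) jJ unfolding faces_def by auto
  thus m: "coface w \<sigma> \<in> cells (m + 1)" unfolding coface_def cells_def using c' by auto
  have dJ: "?J' - {?j} = ?J" using jJ by blast
  show "?j \<in> proper (coface w \<sigma>)" unfolding coface_def fst_conv mem_Collect_eq dJ using c(2) by blast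
  have "par ?J <#> (par ?J' #> ?y) = snd \<sigma>" using face_coset[OF subset_insertI c' par_self[OF y(3)]]
      d(2) by simp
  thus "face_of (coface w \<sigma>) ?j = \<sigma>" unfolding face_of_def coface_def using dJ by simp
  have sub: "par ?J' #> ?y \<subseteq> snd \<sigma>" using par_coset_mono[of ?J ?J' ?y] d(2) by auto
  show "near w (coface w \<sigma>) = ?y" unfolding coface_def
    using nearest_subset[OF CI_coset[OF c'] CI_coset[OF c(5)] sub wc par_self[OF y(3)]] by simp
qed

lemma no_descent_near:
  assumes w: "w \<in> P" and \<sigma>: "\<sigma> \<in> cells m" and a: "a \<in> gens (fst \<sigma>)"
  shows "\<not> is_inversion (w \<otimes> inv (near w \<sigma>)) a"
proof -
  have wc: "w \<in> carrier W" using w P_sub by blast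
  note c = cellD[OF \<sigma>] and y = near_mem[OF \<sigma>, of w]
  have aS: "a \<in> s ` V" using a by blast
  have "len (w \<otimes> inv (near w \<sigma>) \<otimes> a) = len (w \<otimes> inv (near w \<sigma>)) + len a"
    by (rule nearest_len[OF CI_coset[OF c(5)] wc]) (use a in \<open>rule generate.incl\<close>)
  thus ?thesis using inversion_iff_len(1)[of "w \<otimes> inv (near w \<sigma>)" a] aS wc y by simp
qed

text \<open>The free vertex is not a descent. Hence \<open>w y\<^sup>-\<^sup>1\<close> has no descents among the generators of the larger
  parabolic subgroup, and \<open>y\<close> remains nearest. In nonzero degree some other vertex is left.\<close>

lemma upper_face:
  assumes w: "w \<in> P" and \<sigma>: "\<sigma> \<in> cells m" "\<sigma> \<notin> lower w" and m: "m \<noteq> 0"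
  shows "vertex w \<sigma> \<in> proper \<sigma>" "near w (face_of \<sigma> (vertex w \<sigma>)) = near w \<sigma>"
proof -
  have wc: "w \<in> carrier W" using w P_sub by blast
  let ?j = "vertex w \<sigma>"
  note c = cellD[OF \<sigma>(1)] and v = vertex_props[OF w \<sigma>(1)] and y = near_mem[OF \<sigma>(1), of w]
  have j: "?j \<in> fst \<sigma>" using \<sigma>(2) by blast
  have "fst \<sigma> \<noteq> {?j}"
  proof
    assume e: "fst \<sigma> = {?j}"
    have "int (card (fst \<sigma>)) = m + 1" using c(1) unfolding faces_def by simp
    thus False using m unfolding e by simp
  qed
  thus p: "?j \<in> proper \<sigma>" using j by blast
  note f = cellD[OF face_cell[OF \<sigma>(1) p]]
  have sub: "snd \<sigma> \<subseteq> snd (face_of \<sigma> ?j)" using face_sub[of "fst \<sigma> - {?j}" "fst \<sigma>" "snd \<sigma>"] c(5)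
      unfolding face_of_def by auto
  show "near w (face_of \<sigma> ?j) = near w \<sigma>"
  proof (rule nearest_no_descent[OF CI_coset[OF f(5)] wc])
    show "near w \<sigma> \<in> snd (face_of \<sigma> ?j)" using sub y(1) by blast
    fix a assume "a \<in> gens (fst (face_of \<sigma> ?j))"
    then obtain k where k: "k \<in> V" "a = s k" "k \<notin> fst \<sigma> \<or> k = ?j" unfolding face_of_def fst_conv by
        blast
    thus "\<not> is_inversion (w \<otimes> inv (near w \<sigma>)) a" using no_descent_near[OF w \<sigma>(1), of a] v(3) by blast
  qed
qed

text \<open>If the free vertex is the only vertex, \<open>w y\<^sup>-\<^sup>1\<close> has no descents at all and is therefore \<open>1\<close>. So there is
  exactly one upper cell of degree zero.\<close>

lemma upper_vertex:
  assumes w: "w \<in> P" and \<sigma>: "\<sigma> \<in> cells 0" "\<sigma> \<notin> lower w"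
  shows "near w \<sigma> = w" "\<sigma> = ({free_vertex w w}, par {free_vertex w w} #> w)"
proof -
  have wc: "w \<in> carrier W" using w P_sub by blast
  let ?j = "vertex w \<sigma>" and ?v = "w \<otimes> inv (near w \<sigma>)"
  note c = cellD[OF \<sigma>(1)] and v = vertex_props[OF w \<sigma>(1)] and y = near_mem[OF \<sigma>(1), of w]
  have j: "?j \<in> fst \<sigma>" using \<sigma>(2) by blast
  have "card (fst \<sigma>) = 1" using c(1) unfolding faces_def by simp
  hence J: "fst \<sigma> = {?j}" using j by (auto simp: card_1_singleton_iff)
  have nd: "\<not> is_inversion ?v a" if aV: "a \<in> s ` V" for a
  proof -
    obtain k where k: "k \<in> V" "a = s k" using aV by blast
    show ?thesis using no_descent_near[OF w \<sigma>(1), of a] v(3) k J by (cases "k = ?j") auto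
  qed
  have "?v \<in> generate W (s ` V)" using wc y cox unfolding coxeter_system_def by simp
  hence "?v = \<one>" using parabolic_descent_ex[of "s ` V" ?v] nd by blast
  thus n: "near w \<sigma> = w" using wc y by (metis inv_inv inv_equality inv_closed)
  have "snd \<sigma> = par (fst \<sigma>) #> w" using CI_D(2)[OF c(5) y(1)] n by simp
  thus "\<sigma> = ({free_vertex w w}, par {free_vertex w w} #> w)" using J n by (intro prod_eqI) simp_all
qed

text \<open>A lower face of the coface of \<open>\<tau>\<close> of the same rank has the same nearest element, hence the same free vertex;
  only the removal of that vertex makes it lower, and the result is \<open>\<tau>\<close>.\<close>

lemma lower_rank:
  assumes w: "w \<in> P" and \<sigma>: "\<sigma> \<in> cells m" "\<sigma> \<in> lower w" and \<tau>: "\<tau> \<in> cells m" "\<tau> \<in> lower w" and ne: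
      "\<sigma> \<noteq> \<tau>"
    and rank: "\<not> rank w \<sigma> < rank w \<tau>" and j: "j \<in> proper (coface w \<tau>)"
  shows "face_of (coface w \<tau>) j \<noteq> \<sigma>"
proof
  assume e: "face_of (coface w \<tau>) j = \<sigma>"
  note m = coface_props[OF w \<tau>]
  have le: "rank w (coface w \<tau>) \<le> rank w (face_of (coface w \<tau>) j)" using rank unfolding e m(4) by simp
  have n: "near w \<sigma> = near w \<tau>" using face_rank(2)[OF w m(1) j le] unfolding e m(4) .
  have "vertex w \<tau> \<notin> fst \<sigma>" using \<sigma>(2) n by simp
  hence "j = vertex w \<tau>" unfolding e[symmetric] face_of_def coface_def by auto
  thus False using m(3) e ne by simp
qed

text \<open>A cell of the same rank with the same face has the same nearest element, hence the same free vertex, which is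
  missing from the face and so is the vertex removed from both.\<close>

lemma upper_rank:
  assumes w: "w \<in> P" and \<sigma>: "\<sigma> \<in> cells m" "\<sigma> \<notin> lower w" and \<tau>: "\<tau> \<in> cells m" "\<tau> \<notin> lower w" and ne:
      "\<sigma> \<noteq> \<tau>"
    and m: "m \<noteq> 0" and rank: "\<not> rank w \<sigma> < rank w \<tau>" and j: "j \<in> proper \<tau>"
  shows "face_of \<tau> j \<noteq> face_of \<sigma> (vertex w \<sigma>)"
proof
  assume e: "face_of \<tau> j = face_of \<sigma> (vertex w \<sigma>)"
  note u = upper_face[OF w \<sigma> m]
  have le: "rank w \<tau> \<le> rank w (face_of \<tau> j)" using rank unfolding e u(2) by simp
  have n: "near w \<sigma> = near w \<tau>" using face_rank(2)[OF w \<tau>(1) j le] unfolding e u(2) .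
  have J: "fst \<tau> - {j} = fst \<sigma> - {vertex w \<sigma>}" using e unfolding face_of_def by simp
  have vt: "vertex w \<sigma> \<in> fst \<tau>" using \<tau>(2) n by simp
  have vs: "vertex w \<sigma> \<in> fst \<sigma>" using \<sigma>(2) by simp
  have jv: "j = vertex w \<sigma>" using J vt by blast
  have jt: "j \<in> fst \<tau>" using j by blast
  have 1: "fst \<sigma> = fst \<tau>" using J vt vs jv by blast
  have "snd \<sigma> = snd \<tau>"
    using CI_D(2)[OF cellD(5)[OF \<sigma>(1)] near_mem(1)[OF \<sigma>(1), of w]] CI_D(2)[OF cellD(5)[OF \<tau>(1)]
        near_mem(1)[OF \<tau>(1), of w]] n 1 by simp
  thus False using 1 ne by (simp add: prod_eq_iff)
qed

lemma boundary_matching_up: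
  assumes w: "w \<in> P" and l: "\<sigma> \<in> cells m \<inter> lower w"
  shows "coface w \<sigma> \<in> cells (m + 1) \<and> is_iso (cat w) (fst (X (snd (coface w \<sigma>))) w) (fst (X (snd \<sigma>)) w)
     (Cmp (cat w) (cell_proj m \<sigma> w) (Cmp (cat w) (df (m + 1) w) (cell_inj (m + 1) (coface w \<sigma>) w)))"
proof -
  note p = coface_props[OF w IntD1[OF l] IntD2[OF l]]
  show ?thesis using coeff_iso_at[OF w p(1,2)] p(1,3,4) by simp
qed

lemma boundary_matching_up_rank:
  assumes w: "w \<in> P" and l: "\<sigma> \<in> cells m \<inter> lower w" and l': "\<tau> \<in> cells m \<inter> lower w" and ne: "\<sigma> \<noteq> \<tau>"
    and rank: "\<not> rank w \<sigma> < rank w \<tau>"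
  shows "Cmp (cat w) (cell_proj m \<sigma> w) (Cmp (cat w) (df (m + 1) w) (cell_inj (m + 1) (coface w \<tau>) w))
    = Zero_hom (cat w) (fst (X (snd (coface w \<tau>))) w) (fst (X (snd \<sigma>)) w)"
  using coeff_zero_at[OF w coface_props(1)[OF w IntD1[OF l'] IntD2[OF l']], of \<sigma>] l
    lower_rank[OF w IntD1[OF l] IntD2[OF l] IntD1[OF l'] IntD2[OF l'] ne rank] by simp

lemma df_hom_at: "w \<in> P \<Longrightarrow> df m w \<in> Hom (cat w) (fst (Ch m) w) (fst (Ch (m - 1)) w)"
  by (rule glue_hom_component[OF df_hom])

lemma df_hom_at': "w \<in> P \<Longrightarrow> df (m + 1) w \<in> Hom (cat w) (fst (Ch (m + 1)) w) (fst (Ch m) w)"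
  using df_hom_at[of w "m + 1"] by simp

lemma df_df': "Cmp G (df m) (df (m + 1)) = Zero_hom G (Ch (m + 1)) (Ch (m - 1))"
  using df_df[of "m + 1"] by simp

lemma exact_at:
  assumes w: "w \<in> P" and m: "m \<noteq> 0" and Z: "Z \<in> Obj (cat w)"
    and f: "f \<in> Hom (cat w) Z (fst (Ch m) w)" "Cmp (cat w) (df m w) f = Zero_hom (cat w) Z (fst (Ch
        (m - 1)) w)"
  shows "\<exists>g. g \<in> Hom (cat w) Z (fst (Ch (m + 1)) w) \<and> Cmp (cat w) (df (m + 1) w) g = f"
proof -
  interpret C: preadditive_category "cat w" by (rule preadd) (use w P_sub in blast)
  have dd: "Cmp (cat w) (df m w) (df (m + 1) w) = Zero_hom (cat w) (fst (Ch (m + 1)) w) (fst (Ch (m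
      - 1)) w)"
    using arg_cong[OF df_df'[of m], of "\<lambda>h. h w"] w by simp
  show ?thesis
  proof (rule C.acyclic_matching_exact[OF cells_biproduct_at[OF w] cells_biproduct_at[OF w]
      cells_biproduct_at[OF w]
        df_hom_at[OF w] df_hom_at'[OF w] dd, where L = "lower w" and \<delta> = "\<lambda>\<sigma>. face_of \<sigma> (vertex w
            \<sigma>)" and \<mu> = "coface w" and \<rho> = "rank w"])
    fix \<sigma> assume "\<sigma> \<in> cells m - lower w"
    hence s: "\<sigma> \<in> cells m" "\<sigma> \<notin> lower w" by auto
    note u = upper_face[OF w s m]
    show "face_of \<sigma> (vertex w \<sigma>) \<in> cells (m - 1) \<and>
      is_iso (cat w) (fst (X (snd \<sigma>)) w) (fst (X (snd (face_of \<sigma> (vertex w \<sigma>)))) w)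
       (Cmp (cat w) (cell_proj (m - 1) (face_of \<sigma> (vertex w \<sigma>)) w) (Cmp (cat w) (df m w) (cell_inj m
           \<sigma> w)))"
      using face_cell[OF s(1) u(1)] coeff_iso_at[OF w s(1) u(1) u(2)[symmetric]] by blast
  next
    fix \<sigma> \<tau> assume "\<sigma> \<in> cells m - lower w" "\<tau> \<in> cells m - lower w" and ne: "\<sigma> \<noteq> \<tau>" "\<not> rank w \<sigma> <
        rank w \<tau>"
    hence s: "\<sigma> \<in> cells m" "\<sigma> \<notin> lower w" and t: "\<tau> \<in> cells m" "\<tau> \<notin> lower w" by auto
    note u = upper_face[OF w s m]
    show "Cmp (cat w) (cell_proj (m - 1) (face_of \<sigma> (vertex w \<sigma>)) w) (Cmp (cat w) (df m w) (cell_inj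
        m \<tau> w))
       = Zero_hom (cat w) (fst (X (snd \<tau>)) w) (fst (X (snd (face_of \<sigma> (vertex w \<sigma>)))) w)"
      by (rule coeff_zero_at[OF w t(1) face_cell[OF s(1) u(1)] upper_rank[OF w s t ne(1) m ne(2)]])
  qed (use boundary_matching_up[OF w] boundary_matching_up_rank[OF w] Z f in blast)+
qed

subsection \<open>The augmentation\<close>

definition aug :: "'w \<Rightarrow> 'm" where
  "aug = (SOME h. h \<in> Hom G (Ch 0) A \<and> (\<forall>\<sigma>\<in>cells 0. Cmp G h (cell_inj 0 \<sigma>) = counit P A (snd \<sigma>)))"

lemma aug_props: "aug \<in> Hom G (Ch 0) A" "\<sigma> \<in> cells 0 \<Longrightarrow> Cmp G aug (cell_inj 0 \<sigma>) = counit P A (snd \<sigma>)"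
proof -
  have "\<exists>h. h \<in> Hom G (Ch 0) A \<and> (\<forall>\<sigma>\<in>cells 0. Cmp G h (cell_inj 0 \<sigma>) = counit P A (snd \<sigma>))"
    by (rule G.coproduct_ex[OF cells_coproduct A]) (rule counit_props(1)[OF P_sub cellD(7) A])
  from someI_ex[OF this] show "aug \<in> Hom G (Ch 0) A" "\<sigma> \<in> cells 0 \<Longrightarrow> Cmp G aug (cell_inj 0 \<sigma>) =
      counit P A (snd \<sigma>)"
    unfolding aug_def by auto
qed

lemma aug_df: "Cmp G aug (df 1) = Zero_hom G (Ch 1) A"
proof (rule G.coproduct_eqI[OF cells_coproduct A])
  have d: "df 1 \<in> Hom G (Ch 1) (Ch 0)" using df_hom[of 1] by simp
  show "Cmp G aug (df 1) \<in> Hom G (Ch 1) A" by (rule G.cmp_hom[OF Ch_obj Ch_obj A d aug_props(1)])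
  show "Zero_hom G (Ch 1) A \<in> Hom G (Ch 1) A" by (rule G.zero_closed[OF Ch_obj A])
  fix \<sigma> assume \<sigma>: "\<sigma> \<in> cells 1"
  note c = cellD[OF \<sigma>]
  show "X (snd \<sigma>) \<in> Obj G" by (rule c(6))
  note e = counit_props(1)[OF P_sub c(7) A]
  have "card (fst \<sigma>) = 2" using c(1) unfolding faces_def by simp
  then obtain x y where xy: "fst \<sigma> = {x, y}" "x \<noteq> y" by (auto simp: card_2_iff)
  then obtain a b where ab: "fst \<sigma> = {a, b}" "a < b" by (metis insert_commute linorder_neqE_nat)
  have pr: "proper \<sigma> = {a, b}" using ab by auto
  have fs: "fsign \<sigma> a = 0" "fsign \<sigma> b = 1"
  proof -
    have "{k \<in> {a, b}. k < a} = {}" "{k \<in> {a, b}. k < b} = {a}" using ab by auto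
    thus "fsign \<sigma> a = 0" "fsign \<sigma> b = 1" unfolding ab by simp_all
  qed
  let ?q = "\<lambda>j. Cmp G (cell_inj (1 - 1) (face_of \<sigma> j)) (rf \<sigma> j)"
  have q: "?q j \<in> Hom G (X (snd \<sigma>)) (Ch (1 - 1))" if j: "j \<in> proper \<sigma>" for j
    by (rule G.cmp_hom[OF c(6) cellD(6)[OF face_cell[OF \<sigma> j]] Ch_obj rf_hom[OF \<sigma> j] cellB(4)[OF
        face_cell[OF \<sigma> j]]])
  have aq: "Cmp G aug (?q j) = counit P A (snd \<sigma>)" if j: "j \<in> proper \<sigma>" for j
  proof -
    have f: "face_of \<sigma> j \<in> cells 0" using face_cell[OF \<sigma> j] by simp
    have sub: "snd \<sigma> \<subseteq> snd (face_of \<sigma> j)" using face_sub[of "fst \<sigma> - {j}" "fst \<sigma>" "snd \<sigma>"] c(5)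
        unfolding face_of_def by auto
    show ?thesis using G.cmp_assoc[OF c(6) cellD(6)[OF f] Ch_obj A rf_hom[OF \<sigma> j] cellB(4)[OF f]
        aug_props(1)] aug_props(2)[OF f]
        counit_jj_map[OF P_sub c(7) cellD(7)[OF f] sub A] by simp
  qed
  let ?s = "\<lambda>j. signed_hom G (X (snd \<sigma>)) A (fsign \<sigma> j) (counit P A (snd \<sigma>))"
  have sc: "?s j \<in> Hom G (X (snd \<sigma>)) A" for j by (rule G.signed_closed[OF c(6) A e])
  have aug': "aug \<in> Hom G (Ch (1 - 1)) A" using aug_props(1) by simp
  have "Cmp G (Cmp G aug (df 1)) (cell_inj 1 \<sigma>) = Cmp G aug (Cmp G (df 1) (cell_inj 1 \<sigma>))"
    by (rule G.cmp_assoc[OF c(6) Ch_obj Ch_obj A cellB(4)[OF \<sigma>] d aug_props(1)])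
  also have "\<dots> = hom_sum G (X (snd \<sigma>)) A (\<lambda>j. Cmp G aug (signed_hom G (X (snd \<sigma>)) (Ch (1 - 1))
      (fsign \<sigma> j) (?q j))) (proper \<sigma>)"
    unfolding df_cell[OF \<sigma>] by (rule G.cmp_hom_sum_right[OF c(6) Ch_obj A aug' _ G.signed_closed[OF
        c(6) Ch_obj q]]) (use c(3) in auto)
  also have "\<dots> = hom_sum G (X (snd \<sigma>)) A ?s {a, b}" unfolding pr[symmetric]
    by (rule G.hom_sum_cong[OF c(6) A HOL.refl sc]) (simp only: G.cmp_signed_right[OF c(6) Ch_obj A
        q aug'] aq)
  also have "\<dots> = Plus_hom G (?s a) (hom_sum G (X (snd \<sigma>)) A ?s {b})"
    by (rule G.hom_sum_insert[OF c(6) A _ _ sc sc]) (use ab in auto)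
  also have "hom_sum G (X (snd \<sigma>)) A ?s {b} = ?s b" by (rule G.hom_sum_single[OF c(6) A, where j = b
      and I = "{b}"]) (use sc in auto)
  also have "Plus_hom G (?s a) (?s b) = Zero_hom G (X (snd \<sigma>)) A" by (rule G.signed_cancel[OF c(6) A
      e]) (simp only: fs, simp)
  also have "\<dots> = Cmp G (Zero_hom G (Ch 1) A) (cell_inj 1 \<sigma>)" by (rule G.cmp_zero_left[OF c(6) Ch_obj
      A cellB(4)[OF \<sigma>], symmetric])
  finally show "Cmp G (Cmp G aug (df 1)) (cell_inj 1 \<sigma>) = Cmp G (Zero_hom G (Ch 1) A) (cell_inj 1 \<sigma>)" .
qed

lemma aug_cell_at: "w \<in> P \<Longrightarrow> \<sigma> \<in> cells 0 \<Longrightarrow> Cmp (cat w) (aug w) (cell_inj 0 \<sigma> w) = counit P A (snd \<sigma>) w"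
  using arg_cong[OF aug_props(2), of \<sigma> "\<lambda>h. h w"] by simp

lemma upper_counit_iso:
  assumes w: "w \<in> P" and \<sigma>: "\<sigma> \<in> cells 0" "\<sigma> \<notin> lower w"
  shows "is_iso (cat w) (fst (X (snd \<sigma>)) w) (fst A w) (Cmp (cat w) (aug w) (cell_inj 0 \<sigma> w))"
  unfolding aug_cell_at[OF w \<sigma>(1)]
  using counit_iso[OF P_sub cellD(7)[OF \<sigma>(1)] A] near_mem(1)[OF \<sigma>(1), of w] upper_vertex(1)[OF w \<sigma>]
      by simp

text \<open>In degree zero the single upper cell is matched with the target of the augmentation.\<close>

lemma exact_at_zero:
  assumes w: "w \<in> P" and Z: "Z \<in> Obj (cat w)"
    and f: "f \<in> Hom (cat w) Z (fst (Ch 0) w)" "Cmp (cat w) (aug w) f = Zero_hom (cat w) Z (fst A w)"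
  shows "\<exists>g. g \<in> Hom (cat w) Z (fst (Ch 1) w) \<and> Cmp (cat w) (df 1 w) g = f"
proof -
  interpret C: preadditive_category "cat w" by (rule preadd) (use w P_sub in blast)
  note oA = glue_obj_component[OF A w] and aw = glue_hom_component[OF aug_props(1) w]
  have dd: "Cmp (cat w) (aug w) (df 1 w) = Zero_hom (cat w) (fst (Ch 1) w) (fst A w)"
    using arg_cong[OF aug_df, of "\<lambda>h. h w"] w by simp
  have d: "df 1 w \<in> Hom (cat w) (fst (Ch 1) w) (fst (Ch 0) w)" using df_hom_at[OF w, of 1] by simp
  show ?thesis
  proof (rule C.acyclic_matching_exact[OF cells_biproduct_at[OF w] cells_biproduct_at[OF w]
      C.biproduct_singleton[OF oA]
        aw d dd, where L = "lower w" and \<delta> = "\<lambda>\<sigma>. ()" and \<mu> = "coface w" and \<rho> = "rank w"])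
    fix \<sigma> assume "\<sigma> \<in> cells 0 - lower w"
    hence s: "\<sigma> \<in> cells 0" "\<sigma> \<notin> lower w" by auto
    have "is_iso (cat w) (fst (X (snd \<sigma>)) w) (fst A w) (Cmp (cat w) (aug w) (cell_inj 0 \<sigma> w))"
      by (rule upper_counit_iso[OF w s])
    moreover have "Cmp (cat w) (aug w) (cell_inj 0 \<sigma> w) \<in> Hom (cat w) (fst (X (snd \<sigma>)) w) (fst A w)"
      using calculation C.is_iso_E by blast
    ultimately show "() \<in> {()} \<and> is_iso (cat w) (fst (X (snd \<sigma>)) w) (fst A w)
        (Cmp (cat w) (Ident (cat w) (fst A w)) (Cmp (cat w) (aug w) (cell_inj 0 \<sigma> w)))"
      using C.cmp_ident_left[OF glue_obj_component[OF cellD(6)[OF s(1)] w] oA] by simp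
  next
    fix \<sigma> \<tau> assume "\<sigma> \<in> cells 0 - lower w" "\<tau> \<in> cells 0 - lower w" and ne: "\<sigma> \<noteq> \<tau>"
    hence s: "\<sigma> \<in> cells 0" "\<sigma> \<notin> lower w" and t: "\<tau> \<in> cells 0" "\<tau> \<notin> lower w" by auto
    have "\<sigma> = \<tau>" by (rule HOL.trans[OF upper_vertex(2)[OF w s] upper_vertex(2)[OF w t, symmetric]])
    thus "Cmp (cat w) (Ident (cat w) (fst A w)) (Cmp (cat w) (aug w) (cell_inj 0 \<tau> w)) = Zero_hom
        (cat w) (fst (X (snd \<tau>)) w) (fst A w)"
      using ne by blast
  next
    show "\<And>\<sigma>. \<sigma> \<in> cells 0 \<inter> lower w \<Longrightarrow> coface w \<sigma> \<in> cells 1 \<and> is_iso (cat w) (fst (X (snd (coface w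
        \<sigma>))) w) (fst (X (snd \<sigma>)) w)
     (Cmp (cat w) (cell_proj 0 \<sigma> w) (Cmp (cat w) (df 1 w) (cell_inj 1 (coface w \<sigma>) w)))"
      using boundary_matching_up[OF w, of _ 0] by simp
    show "\<And>\<sigma> \<tau>. \<sigma> \<in> cells 0 \<inter> lower w \<Longrightarrow> \<tau> \<in> cells 0 \<inter> lower w \<Longrightarrow> \<sigma> \<noteq> \<tau> \<Longrightarrow> \<not> rank w \<sigma> < rank w \<tau> \<Longrightarrow>
      Cmp (cat w) (cell_proj 0 \<sigma> w) (Cmp (cat w) (df 1 w) (cell_inj 1 (coface w \<tau>) w))
    = Zero_hom (cat w) (fst (X (snd (coface w \<tau>))) w) (fst (X (snd \<sigma>)) w)"
      using boundary_matching_up_rank[OF w, of _ 0] by simp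
  qed (use Z f in auto)
qed

lemma aug_split:
  assumes w: "w \<in> P"
  shows "\<exists>g. g \<in> Hom (cat w) (fst A w) (fst (Ch 0) w) \<and> Cmp (cat w) (aug w) g = Ident (cat w) (fst A w)"
proof -
  have wc: "w \<in> carrier W" using w P_sub by blast
  interpret C: preadditive_category "cat w" by (rule preadd) fact
  let ?j = "free_vertex w w"
  let ?c = "par {?j} #> w"
  note v = free_vertex_props[OF w w]
  have ci: "?c \<in> CI {?j}" using v(2) by (intro CI_I[OF wc]) auto
  have \<sigma>: "({?j}, ?c) \<in> cells 0" using ci v(1) unfolding cells_def faces_def by auto
  note oc = glue_obj_component[OF cellD(6)[OF \<sigma>] w, simplified] and oA = glue_obj_component[OF A w]
      and oC = glue_obj_component[OF Ch_obj w]
  have "is_iso (cat w) (fst (X ?c) w) (fst A w) (counit P A ?c w)"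
    using counit_iso[OF P_sub CI_in_cosets[OF ci] A par_self[OF wc]] by simp
  then obtain g where g: "g \<in> Hom (cat w) (fst A w) (fst (X ?c) w)" "Cmp (cat w) (counit P A ?c w) g
      = Ident (cat w) (fst A w)"
    using C.is_iso_E by blast
  have i: "cell_inj 0 ({?j}, ?c) w \<in> Hom (cat w) (fst (X ?c) w) (fst (Ch 0) w)"
    using glue_hom_component[OF cellB(4)[OF \<sigma>] w] by simp
  show ?thesis
  proof (intro exI conjI)
    show "Cmp (cat w) (cell_inj 0 ({?j}, ?c) w) g \<in> Hom (cat w) (fst A w) (fst (Ch 0) w)"
      by (rule C.cmp_hom[OF oA oc oC g(1) i])
    show "Cmp (cat w) (aug w) (Cmp (cat w) (cell_inj 0 ({?j}, ?c) w) g) = Ident (cat w) (fst A w)"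
      using C.cmp_assoc[OF oA oc oC oA g(1) i glue_hom_component[OF aug_props(1) w]] aug_cell_at[OF
          w \<sigma>] g(2) by simp
  qed
qed

subsection \<open>Homology of the complex\<close>

lemma Ch_minus_one: "is_zero_object G (Ch (- 1))"
proof -
  have "J \<notin> faces V (- 1)" for J
  proof
    assume J: "J \<in> faces V (- 1)"
    hence "finite J" "J \<noteq> {}" "card J = 0" unfolding faces_def using finite_subset[of J V] by auto
    thus False by simp
  qed
  hence "faces V (- 1) = {}" by blast
  hence e: "cells (- 1) = {}" unfolding cells_def by simp
  have "Zero_hom G (Ch (- 1)) (Ch (- 1)) = Ident G (Ch (- 1))"
    using cellB(8)[of "- 1"] unfolding e G.hom_sum_empty[OF Ch_obj Ch_obj] .
  thus ?thesis by (intro G.zero_objectI[OF Ch_obj]) (rule HOL.sym)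
qed

lemma homology_zero_degree: "is_homology G (Ch 1) (Ch 0) (Ch (- 1)) (df 1) (df 0) A"
proof -
  have d0: "df 0 = Zero_hom G (Ch 0) (Ch (- 1))"
    using G.zero_objectD(2)[OF Ch_minus_one Ch_obj] df_hom[of 0] by simp
  have d1: "df 1 \<in> Hom G (Ch 1) (Ch 0)" using df_hom[of 1] by simp
  note I = G.ident_hom[OF Ch_obj[of 0]]
  have "is_kernel G (Ch 0) (Ch (- 1)) (df 0) (Ch 0) (Ident G (Ch 0))"
    unfolding is_kernel_def
  proof (intro conjI ballI impI)
    show "Cmp G (df 0) (Ident G (Ch 0)) = Zero_hom G (Ch 0) (Ch (- 1))"
      unfolding d0 by (rule G.cmp_zero_left[OF Ch_obj Ch_obj Ch_obj I])
    fix Z g assume Z: "Z \<in> Obj G" and g: "g \<in> Hom G Z (Ch 0)"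
    show "\<exists>!h. h \<in> Hom G Z (Ch 0) \<and> Cmp G (Ident G (Ch 0)) h = g"
      by (rule ex1I[of _ g]) (use g G.cmp_ident_left[OF Z Ch_obj] in auto)
  qed (use Ch_obj I in auto)
  moreover have "Cmp G (Ident G (Ch 0)) (df 1) = df 1" by (rule G.cmp_ident_left[OF Ch_obj Ch_obj d1])
  moreover have "is_cokernel G (Ch 1) (Ch 0) (df 1) A aug"
    by (rule glue_split_cokernel[OF P_sub Ch_obj Ch_obj A d1 aug_props(1) aug_df aug_split
        exact_at_zero])
  ultimately show ?thesis unfolding is_homology_def using d1 by blast
qed

text \<open>Lifting the inclusion of the kernel at \<open>w\<close> through the differential splits the induced morphism onto the kernel
  at \<open>w\<close>; so this morphism is an epimorphism.\<close>

lemma homology_other_degree: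
  assumes m: "m \<noteq> 0" and z: "is_zero_object G Z"
  shows "is_homology G (Ch (m + 1)) (Ch m) (Ch (m - 1)) (df (m + 1)) (df m) Z"
proof -
  have d: "df (m + 1) \<in> Hom G (Ch (m + 1)) (Ch m)" using df_hom[of "m + 1"] by simp
  obtain K k where K: "is_kernel G (Ch m) (Ch (m - 1)) (df m) K k"
    and Kw: "\<And>w. w \<in> P \<Longrightarrow> is_kernel (cat w) (fst (Ch m) w) (fst (Ch (m - 1)) w) (df m w) (fst K w) (k w)"
    using glue_kernel[OF P_sub Ch_obj Ch_obj df_hom] by blast
  note KD = G.kernelD[OF K]
  obtain f where f: "f \<in> Hom G (Ch (m + 1)) K" "Cmp G k f = df (m + 1)"
    using G.kernel_factor[OF K Ch_obj d df_df'] by blast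
  have split: "\<exists>g. g \<in> Hom (cat w) (fst K w) (fst (Ch (m + 1)) w) \<and> Cmp (cat w) (f w) g = Ident (cat
      w) (fst K w)" if w: "w \<in> P" for w
  proof -
    interpret C: preadditive_category "cat w" by (rule preadd) (use w P_sub in blast)
    note D = C.kernelD[OF Kw[OF w]]
    note o = glue_obj_component[OF Ch_obj w]
    note fw = glue_hom_component[OF f(1) w]
    obtain g where g: "g \<in> Hom (cat w) (fst K w) (fst (Ch (m + 1)) w)" "Cmp (cat w) (df (m + 1) w) g
        = k w"
      using exact_at[OF w m D] by blast
    have fg: "Cmp (cat w) (f w) g \<in> Hom (cat w) (fst K w) (fst K w)" by (rule C.cmp_hom[OF D(1) o
        D(1) g(1) fw])
    have "Cmp (cat w) (k w) (Cmp (cat w) (f w) g) = Cmp (cat w) (Cmp (cat w) (k w) (f w)) g"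
      by (rule C.cmp_assoc[OF D(1) o D(1) o g(1) fw D(2), symmetric])
    also have "\<dots> = Cmp (cat w) (k w) (Ident (cat w) (fst K w))"
      using arg_cong[OF f(2), of "\<lambda>h. h w"] g(2) w C.cmp_ident_right[OF D(1) o D(2)] by simp
    finally have "Cmp (cat w) (f w) g = Ident (cat w) (fst K w)"
      by (rule C.kernel_cancel[OF Kw[OF w] o o D(1) df_hom_at[OF w] fg C.ident_hom[OF D(1)]])
    thus ?thesis using g(1) by blast
  qed
  show ?thesis
    by (rule G.homology_zero_if_epi[OF Ch_obj K f glue_split_epi[OF P_sub Ch_obj KD(1) _ f(1) split] z])
qed

theorem coset_complex_homology:
  "isomorphic G (homology G (coset_complex W s n D P A) 0) A"
  "m \<noteq> 0 \<Longrightarrow> is_zero_object G (homology G (coset_complex W s n D P A) m)"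
proof -
  have H: "isomorphic G (homology G (coset_complex W s n D P A) m) H"
    if h: "is_homology G (Ch (m + 1)) (Ch m) (Ch (m - 1)) (df (m + 1)) (df m) H" for m H
  proof -
    have "is_homology G (Ch (m + 1)) (Ch m) (Ch (m - 1)) (df (m + 1)) (df m) (homology G
        (coset_complex W s n D P A) m)"
      unfolding homology_def coset_complex_def simplex_complex_def complex_data.simps
      by (rule someI[of "is_homology G (Ch (m + 1)) (Ch m) (Ch (m - 1)) (df (m + 1)) (df m)", OF h])
    moreover have "df (m + 1) \<in> Hom G (Ch (m + 1)) (Ch m)" using df_hom[of "m + 1"] by simp
    ultimately show ?thesis using G.homology_unique[OF Ch_obj Ch_obj Ch_obj _ df_hom _ h] by blast
  qed
  show "isomorphic G (homology G (coset_complex W s n D P A) 0) A" by (rule H) (use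
      homology_zero_degree in simp)
  obtain Z where Z: "is_zero_object G Z" using glue_zero_object[OF P_sub] by blast
  show "is_zero_object G (homology G (coset_complex W s n D P A) m)" if "m \<noteq> 0"
    by (rule G.zero_object_isomorphic[OF H[OF homology_other_degree[OF that Z]] Z])
qed

end

theorem theorem7p3p1:
  fixes W :: "('w, 'z) monoid_scheme"
    and s :: "nat \<Rightarrow> 'w" and n i :: nat and P :: "'w set"
    and \<Phi> :: "('w, 'o, 'm) gluing"
    and A :: "('w, 'o, 'm) glue_obj"
  assumes "coxeter_system W (s ` {1..n})" and "finite (carrier W)" and "inj_on s {1..n}"
    and "\<And>w. w \<in> carrier W \<Longrightarrow> abelian_category (GCat \<Phi> w)"
    and "gluing_data W (s ` {1..n}) \<Phi>"
    and "i \<in> {1..n}"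
    and "P = ascent_set W (s ` {1..n}) (s i)"
    and "A \<in> Obj (glue W \<Phi> P)"
  shows "isomorphic (glue W \<Phi> P) (homology (glue W \<Phi> P) (coset_complex W s n \<Phi> P A) 0) A \<and>
    (\<forall>j. j \<noteq> 0 \<longrightarrow>
       is_zero_object (glue W \<Phi> P) (homology (glue W \<Phi> P) (coset_complex W s n \<Phi> P A) j))"
proof -
  interpret coset_chain W s n \<Phi> i P A
    by (intro coset_chain.intro coxeter_gluing.intro coxeter.intro coxeter_gluing_axioms.intro
        coset_chain_axioms.intro)
      (use assms in auto)
  show ?thesis using coset_complex_homology by blast
qed

end
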